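(* Let $H\in(0,1)$ and $\mathbf c=(c_+,c_-)\in\mathbb R^2\setminus\{(0,0)\}$. If $a\in\mathbb R$ and $T\in(0,\infty)$, or $a>0$ and $T=\infty$, then $$m^{\mathbf c}_H(T,a)=\frac{c_+-c_-}{\sqrt{V^{\mathbf c}_H}}\,\mathcal J_H(T,a)-a\,\mathcal E_{1/2}(T,a),$$ and $$m_H(T,a)=m^{(1,-1)}_H(T,a)=\frac{\mathcal J_H(T,a)}{C_H\sin\big(\frac{\pi(H+1/2)}{2}\big)}-a\,\mathcal E_{1/2}(T,a),$$ where $C_H>0$ is given by $C_H^2=\frac{\Gamma(\frac12+H)\Gamma(2-2H)}{2H\,\Gamma(\frac32-H)}$.
   Context: Let $\{B(t):t\in\mathbb R\}$ be a standard two-sided Brownian motion. For $(H,t)\in(0,1)\times[0,\infty)$ put $$X^+_H(t)=\int_{-\infty}^0[(t-s)^{H-\frac12}-(-s)^{H-\frac12}]\,dB(s)+\int_0^t(t-s)^{H-\frac12}dB(s),$$ $$X^-_H(t)=-\int_0^ts^{H-\frac12}dB(s)-\int_t^\infty[s^{H-\frac12}-(s-t)^{H-\frac12}]\,dB(s),$$ and let $\tilde X^{\pm}_H(t)$ be the continuous modifications of these fields (jointly continuous in $(H,t)$). For $\mathbf c=(c_+,c_-)\in\mathbb R^2\setminus\{(0,0)\}$ let $X^{\mathbf c}_H=c_+X^+_H+c_-X^-_H$, $\tilde X^{\mathbf c}_H=c_+\tilde X^+_H+c_-\tilde X^-_H$ and $V^{\mathbf c}_H=\mathrm{Var}(X^{\mathbf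 c}_H(1))$; it is known that $$V^{\mathbf c}_H=C_H^2\Big[\big((c_++c_-)\cos\tfrac{\pi(H+1/2)}{2}\big)^2+\big((c_+-c_-)\sin\tfrac{\pi(H+1/2)}{2}\big)^2\Big].$$ Put $\tilde B^{\mathbf c}_H(t)=\tilde X^{\mathbf c}_H(t)/\sqrt{V^{\mathbf c}_H}$, a fractional Brownian motion with Hurst index $H$. Let $\tau_{1/2}(T,a):=\arg\max_{t\in[0,T]}\{B(t)-at\}$ (over $[0,\infty)$ if $T=\infty$), $\mathcal E_{1/2}(T,a):=\mathbb E(\tau_{1/2}(T,a))$, $\mathcal J_H(T,a):=\mathbb E\big(\tilde X^+_H(\tau_{1/2}(T,a))\big)$, and $$m^{\mathbf c}_H(T,a):=\mathbb E\big(\tilde B^{\mathbf c}_H(\tau_{1/2}(T,a))-a\,\tau_{1/2}(T,a)\big),\qquad m_H(T,a):=\sup_{\mathbf c\in\mathbb R^2\setminus\{(0,0)\}}m^{\mathbf c}_H(T,a).$$ *)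

theory Defs
  imports "HOL-Probability.Probability"
begin

locale two_sided_brownian_motion = prob_space M
  for M :: "'w measure" and B :: "real \<Rightarrow> 'w \<Rightarrow> real" +
  assumes B_measurable: "B t \<in> borel_measurable M"
    and B_zero: "\<omega> \<in> space M \<Longrightarrow> B 0 \<omega> = 0"
    and B_continuous: "\<omega> \<in> space M \<Longrightarrow> continuous_on UNIV (\<lambda>t. B t \<omega>)"
    and B_increment_normal: "s < t \<Longrightarrow>
      distributed M lborel (\<lambda>\<omega>. B t \<omega> - B s \<omega>) (normal_density 0 (sqrt (t - s)))"
    and B_increments_indep: "strict_mono (u :: nat \<Rightarrow> real) \<Longrightarrow>
      indep_vars (\<lambda>_. borel) (\<lambda>i \<omega>. B (u (Suc i)) \<omega> - B (u i) \<omega>) UNIV"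

text \<open>
  A list of triples \<open>(c, u, v)\<close> represents the step function
  \<open>\<Sum> c * indicator {u<..v}\<close>, whose integral against \<open>B\<close> is \<open>\<Sum> c * (B v - B u)\<close>.
  The Wiener integral is the extension of this isometry to square-integrable functions:
  \<open>X\<close> is a Wiener integral of \<open>f\<close> if there are step functions that converge to \<open>f\<close> in
  \<open>L\<^sup>2(lborel)\<close> and whose integrals converge to \<open>X\<close> in \<open>L\<^sup>2(M)\<close>. This determines \<open>X\<close>
  up to almost sure equality.
\<close>

definition step_function :: "(real \<times> real \<times> real) list \<Rightarrow> real \<Rightarrow> real" where
  "step_function l s = (\<Sum>(c, u, v)\<leftarrow>l. c * indicator {u<..v} s)"

definition step_integral ::
  "(real \<Rightarrow> 'w \<Rightarrow> real) \<Rightarrow> (real \<times> real \<times> real) list \<Rightarrow> 'w \<Rightarrow> real" where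
  "step_integral B l \<omega> = (\<Sum>(c, u, v)\<leftarrow>l. c * (B v \<omega> - B u \<omega>))"

definition has_wiener_integral ::
  "'w measure \<Rightarrow> (real \<Rightarrow> 'w \<Rightarrow> real) \<Rightarrow> (real \<Rightarrow> real) \<Rightarrow> ('w \<Rightarrow> real) \<Rightarrow> bool" where
  "has_wiener_integral M B f X \<longleftrightarrow>
     f \<in> borel_measurable lborel \<and> X \<in> borel_measurable M \<and>
     (\<exists>l :: nat \<Rightarrow> (real \<times> real \<times> real) list.
        (\<forall>n. \<forall>(c, u, v) \<in> set (l n). u \<le> v) \<and>
        (\<lambda>n. \<integral>\<^sup>+ s. ennreal ((f s - step_function (l n) s)\<^sup>2) \<partial>lborel) \<longlonglongrightarrow> 0 \<and>
        (\<lambda>n. \<integral>\<^sup>+ \<omega>. ennreal ((X \<omega> - step_integral B (l n) \<omega>)\<^sup>2) \<partial>M) \<longlonglongrightarrow> 0)"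

text \<open>An arbitrary version of the integral of \<open>f\<close> over \<open>A\<close> with respect to \<open>B\<close>.\<close>

definition wiener_integral ::
  "'w measure \<Rightarrow> (real \<Rightarrow> 'w \<Rightarrow> real) \<Rightarrow> real set \<Rightarrow> (real \<Rightarrow> real) \<Rightarrow> 'w \<Rightarrow> real" where
  "wiener_integral M B A f =
     (SOME X. has_wiener_integral M B (\<lambda>s. indicator A s * f s) X)"

definition X_plus ::
  "'w measure \<Rightarrow> (real \<Rightarrow> 'w \<Rightarrow> real) \<Rightarrow> real \<Rightarrow> real \<Rightarrow> 'w \<Rightarrow> real" where
  "X_plus M B H t \<omega> =
     wiener_integral M B {..<0} (\<lambda>s. (t - s) powr (H - 1/2) - (- s) powr (H - 1/2)) \<omega>
     + wiener_integral M B {0<..<t} (\<lambda>s. (t - s) powr (H - 1/2)) \<omega>"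

definition X_minus ::
  "'w measure \<Rightarrow> (real \<Rightarrow> 'w \<Rightarrow> real) \<Rightarrow> real \<Rightarrow> real \<Rightarrow> 'w \<Rightarrow> real" where
  "X_minus M B H t \<omega> =
     - wiener_integral M B {0<..<t} (\<lambda>s. s powr (H - 1/2)) \<omega>
     - wiener_integral M B {t<..} (\<lambda>s. s powr (H - 1/2) - (s - t) powr (H - 1/2)) \<omega>"

definition continuous_modification ::
  "'w measure \<Rightarrow> (real \<Rightarrow> real \<Rightarrow> 'w \<Rightarrow> real) \<Rightarrow> (real \<Rightarrow> real \<Rightarrow> 'w \<Rightarrow> real) \<Rightarrow> bool" where
  "continuous_modification M X Y \<longleftrightarrow>
     (\<forall>H\<in>{0<..<1}. \<forall>t\<ge>0. Y H t \<in> borel_measurable M \<and> (AE \<omega> in M. Y H t \<omega> = X H t \<omega>)) \<and>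
     (\<forall>\<omega>\<in>space M. continuous_on ({0<..<1} \<times> {0..}) (\<lambda>(H, t). Y H t \<omega>))"

definition linear_comb ::
  "real \<times> real \<Rightarrow> (real \<Rightarrow> real \<Rightarrow> 'w \<Rightarrow> real) \<Rightarrow> (real \<Rightarrow> real \<Rightarrow> 'w \<Rightarrow> real)
    \<Rightarrow> real \<Rightarrow> real \<Rightarrow> 'w \<Rightarrow> real" where
  "linear_comb c Y Z H t \<omega> = fst c * Y H t \<omega> + snd c * Z H t \<omega>"

definition V :: "'w measure \<Rightarrow> (real \<Rightarrow> 'w \<Rightarrow> real) \<Rightarrow> real \<times> real \<Rightarrow> real \<Rightarrow> real" where
  "V M B c H =
     (let X = linear_comb c (X_plus M B) (X_minus M B) H 1
      in \<integral>\<omega>. (X \<omega> - (\<integral>\<omega>'. X \<omega>' \<partial>M))\<^sup>2 \<partial>M)"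

text \<open>
  In the remaining definitions \<open>Xp\<close> and \<open>Xm\<close> are the continuous modifications of \<open>X_plus\<close>
  and \<open>X_minus\<close>. The only degenerate case is \<open>H = 1/2\<close>, \<open>fst c = snd c\<close>, where \<open>V = 0\<close>;
  there \<open>fbm\<close> is \<open>0\<close> because \<open>x / 0 = 0\<close>.
\<close>

definition fbm ::
  "'w measure \<Rightarrow> (real \<Rightarrow> 'w \<Rightarrow> real) \<Rightarrow> (real \<Rightarrow> real \<Rightarrow> 'w \<Rightarrow> real)
    \<Rightarrow> (real \<Rightarrow> real \<Rightarrow> 'w \<Rightarrow> real) \<Rightarrow> real \<times> real \<Rightarrow> real \<Rightarrow> real \<Rightarrow> 'w \<Rightarrow> real" where
  "fbm M B Xp Xm c H t \<omega> = linear_comb c Xp Xm H t \<omega> / sqrt (V M B c H)"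

text \<open>
  The maximizer almost surely exists and is unique. Taking the leftmost one, and \<open>0\<close> if there
  is none, makes \<open>\<tau>\<close> nonnegative and measurable also on the exceptional null set, which
  matters as \<open>M\<close> need not be complete.
\<close>

definition horizon :: "ereal \<Rightarrow> real set" where
  "horizon T = {t. 0 \<le> t \<and> ereal t \<le> T}"

definition \<tau> :: "(real \<Rightarrow> 'w \<Rightarrow> real) \<Rightarrow> ereal \<Rightarrow> real \<Rightarrow> 'w \<Rightarrow> real" where
  "\<tau> B T a \<omega> =
     (let A = {t \<in> horizon T. \<forall>s\<in>horizon T. B s \<omega> - a * s \<le> B t \<omega> - a * t}
      in if A = {} then 0 else Inf A)"

definition \<E> :: "'w measure \<Rightarrow> (real \<Rightarrow> 'w \<Rightarrow> real) \<Rightarrow> ereal \<Rightarrow> real \<Rightarrow> real" where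
  "\<E> M B T a = (\<integral>\<omega>. \<tau> B T a \<omega> \<partial>M)"

definition \<J> ::
  "'w measure \<Rightarrow> (real \<Rightarrow> 'w \<Rightarrow> real) \<Rightarrow> (real \<Rightarrow> real \<Rightarrow> 'w \<Rightarrow> real)
    \<Rightarrow> real \<Rightarrow> ereal \<Rightarrow> real \<Rightarrow> real" where
  "\<J> M B Xp H T a = (\<integral>\<omega>. Xp H (\<tau> B T a \<omega>) \<omega> \<partial>M)"

definition m ::
  "'w measure \<Rightarrow> (real \<Rightarrow> 'w \<Rightarrow> real) \<Rightarrow> (real \<Rightarrow> real \<Rightarrow> 'w \<Rightarrow> real)
    \<Rightarrow> (real \<Rightarrow> real \<Rightarrow> 'w \<Rightarrow> real) \<Rightarrow> real \<times> real \<Rightarrow> real \<Rightarrow> ereal \<Rightarrow> real \<Rightarrow> real" where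
  "m M B Xp Xm c H T a =
     (\<integral>\<omega>. fbm M B Xp Xm c H (\<tau> B T a \<omega>) \<omega> - a * \<tau> B T a \<omega> \<partial>M)"

text \<open>The supremum is taken in \<open>ereal\<close>, so that its finiteness is part of any claim about it.\<close>

definition m_sup ::
  "'w measure \<Rightarrow> (real \<Rightarrow> 'w \<Rightarrow> real) \<Rightarrow> (real \<Rightarrow> real \<Rightarrow> 'w \<Rightarrow> real)
    \<Rightarrow> (real \<Rightarrow> real \<Rightarrow> 'w \<Rightarrow> real) \<Rightarrow> real \<Rightarrow> ereal \<Rightarrow> real \<Rightarrow> ereal" where
  "m_sup M B Xp Xm H T a = (SUP c \<in> UNIV - {(0, 0)}. ereal (m M B Xp Xm c H T a))"

definition C :: "real \<Rightarrow> real" where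
  "C H = sqrt (Gamma (1/2 + H) * Gamma (2 - 2 * H) / (2 * H * Gamma (3/2 - H)))"

end

theory Submission
  imports Defs "HOL-Real_Asymp.Real_Asymp"
begin

text \<open>
  The sum \<open>Y = X\<^sup>+ + X\<^sup>-\<close> has an antisymmetric cross-covariance with \<open>B\<close>, so \<open>B + \<epsilon>Y\<close> and \<open>B - \<epsilon>Y\<close>
  have the same law. As the maximum is convex, the expected maximum of \<open>B(t) - at + \<epsilon>Y(t)\<close> is minimal
  at \<open>\<epsilon> = 0\<close>; its derivative there is \<open>E Y(\<tau>)\<close>, because the maximizer is almost surely unique. Hence
  \<open>E X\<^sup>-(\<tau>) = - E X\<^sup>+(\<tau>)\<close>. For \<open>X\<^sup>+\<close> itself, the symmetrized covariance with \<open>B\<close> is that of a fractional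
  Brownian motion with Hurst index \<open>(H + 1/2) / 2\<close>, so for \<open>\<epsilon> > 0\<close> the process \<open>B + \<epsilon>X\<^sup>+\<close> has the law
  of \<open>B\<close> plus independent centred noise. By the same argument \<open>E X\<^sup>+(\<tau>) \<ge> 0\<close>, and the supremum over \<open>c\<close>
  reduces to maximizing \<open>(c\<^sub>+ - c\<^sub>-) / \<surd>V\<close>, where \<open>V = C\<^sup>2 (c\<^sub>+\<^sup>2 + c\<^sub>-\<^sup>2 - 2 c\<^sub>+ c\<^sub>- sin (\<pi>H))\<close>. An infinite
  horizon is exhausted by finite ones.
\<close>

text \<open>Comparisons of laws are made for finite vectors, the values on dyadic grids. There only
  variances of linear combinations matter, and for Wiener integrals these are inner products of
  kernels in \<open>L2\<close>, so every probabilistic claim becomes an identity between integrals.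
  The index (H + 1/2) / 2 is forced by scaling: the cross-covariance of \<open>B\<close> with a
  process of index H is homogeneous of degree H + 1/2, and this must be twice the index of the
  comparison process. Differentiating the expected maximum needs two facts. The maximizer is unique
  because the difference of the maxima over two disjoint intervals contains the increment of
  \<open>B\<close> over the gap, which is independent of the rest. Dominated convergence needs
  moments of suprema; a dyadic chaining bound gives them with an explicit power of T, which also
  controls late maximizers on an infinite horizon. The sign of E X+ at the maximizer matters only
  for the supremum: c = (1, -1) maximizes the factor in front of it. As \<open>V\<close> is defined
  as a variance, its closed form and the constant \<open>C H\<close> have to be computed from the
  kernels.\<close>

subsection \<open>Centred Gaussian variables\<close>

text \<open>Stated through the characteristic function, this notion passes to L2 limits, is additive
  over product spaces and includes the degenerate case of variance 0, which a density would exclude.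
  The sign of \<open>v\<close> is not encoded, so facts on moments ask for
  \<open>0 \<le> v\<close>.\<close>

definition gauss :: "'a measure \<Rightarrow> ('a \<Rightarrow> real) \<Rightarrow> real \<Rightarrow> bool" where
  "gauss M X v \<longleftrightarrow> X \<in> borel_measurable M \<and>
     (\<forall>t. char (distr M borel X) t = complex_of_real (exp (- (v * t\<^sup>2) / 2)))"

context prob_space
begin

lemma char_distr_eq:
  assumes [measurable]: "X \<in> borel_measurable M"
  shows "char (distr M borel X) t = (CLINT \<omega>|M. iexp (t * X \<omega>))"
  by (simp add: char_def integral_distr)

lemma gauss_iff:
  "gauss M X v \<longleftrightarrow> X \<in> borel_measurable M \<and>
     (\<forall>t. (CLINT \<omega>|M. iexp (t * X \<omega>)) = complex_of_real (exp (- (v * t\<^sup>2) / 2)))"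
  by (auto simp: gauss_def char_distr_eq)

lemma integrable_iexp:
  assumes [measurable]: "X \<in> borel_measurable M"
  shows "integrable M (\<lambda>\<omega>. iexp (X \<omega>))"
  by (rule integrable_const_bound[where B = 1]) auto

lemma gauss_cos_sin:
  assumes "gauss M X v"
  shows "(\<integral>\<omega>. cos (X \<omega>) \<partial>M) = exp (- v / 2)" "(\<integral>\<omega>. sin (X \<omega>) \<partial>M) = 0"
proof -
  have [measurable]: "X \<in> borel_measurable M" using assms by (simp add: gauss_def)
  have i: "integrable M (\<lambda>\<omega>. iexp (X \<omega>))" by (rule integrable_iexp) simp
  have e: "(CLINT \<omega>|M. iexp (X \<omega>)) = complex_of_real (exp (- v / 2))"
    using assms[unfolded gauss_iff, THEN conjunct2, THEN spec, of 1] by simp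
  have "(\<integral>\<omega>. cos (X \<omega>) \<partial>M) = (\<integral>\<omega>. Re (iexp (X \<omega>)) \<partial>M)" by (simp add: Re_exp)
  also have "\<dots> = exp (- v / 2)" by (simp only: integral_Re[OF i] e) simp
  finally show "(\<integral>\<omega>. cos (X \<omega>) \<partial>M) = exp (- v / 2)" .
  have "(\<integral>\<omega>. sin (X \<omega>) \<partial>M) = (\<integral>\<omega>. Im (iexp (X \<omega>)) \<partial>M)" by (simp add: Im_exp)
  also have "\<dots> = 0" by (simp only: integral_Im[OF i] e) simp
  finally show "(\<integral>\<omega>. sin (X \<omega>) \<partial>M) = 0" .
qed

lemma gauss_scale:
  assumes "gauss M X v"
  shows "gauss M (\<lambda>\<omega>. c * X \<omega>) (c\<^sup>2 * v)"
proof -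
  have [measurable]: "X \<in> borel_measurable M" using assms by (simp add: gauss_def)
  have "(CLINT \<omega>|M. iexp (t * (c * X \<omega>))) = complex_of_real (exp (- (c\<^sup>2 * v * t\<^sup>2) / 2))" for t
  proof -
    have "(CLINT \<omega>|M. iexp ((t * c) * X \<omega>)) = complex_of_real (exp (- (v * (t * c)\<^sup>2) / 2))"
      using assms unfolding gauss_iff by blast
    then show ?thesis by (simp add: power_mult_distrib mult_ac)
  qed
  then show ?thesis unfolding gauss_iff by simp
qed

text \<open>x -> exp (i t x) is Lipschitz, so convergence in L2 forces convergence of characteristic
  functions; their limit is read off from the convergent variances.\<close>

lemma gauss_limit:
  assumes g: "\<And>n. gauss M (X n) (v n)" and [measurable]: "Y \<in> borel_measurable M"
    and lim: "(\<lambda>n. \<integral>\<^sup>+ \<omega>. ennreal ((Y \<omega> - X n \<omega>)\<^sup>2) \<partial>M) \<longlonglongrightarrow> 0" and v: "v \<longlonglongrightarrow> w"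
  shows "gauss M Y w"
proof -
  have [measurable]: "X n \<in> borel_measurable M" for n using g by (simp add: gauss_def)
  have "(CLINT \<omega>|M. iexp (t * Y \<omega>)) = complex_of_real (exp (- (w * t\<^sup>2) / 2))" for t
  proof (rule LIMSEQ_unique)
    show "(\<lambda>n. CLINT \<omega>|M. iexp (t * X n \<omega>)) \<longlonglongrightarrow> complex_of_real (exp (- (w * t\<^sup>2) / 2))"
    proof -
      have "(\<lambda>n. CLINT \<omega>|M. iexp (t * X n \<omega>)) = (\<lambda>n. complex_of_real (exp (- (v n * t\<^sup>2) / 2)))"
        using g unfolding gauss_iff by simp
      then show ?thesis by (simp only:, intro tendsto_intros v) simp
    qed
    show "(\<lambda>n. CLINT \<omega>|M. iexp (t * X n \<omega>)) \<longlonglongrightarrow> (CLINT \<omega>|M. iexp (t * Y \<omega>))"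
    proof (rule LIMSEQ_I)
      fix e :: real assume e: "e > 0"
      \<comment> \<open>\<open>|exp (i x) - exp (i y)| \<le> |x - y| \<le> e/2 + (x - y)\<^sup>2 / (2 e)\<close>\<close>
      define d where "d = ennreal (e\<^sup>2 / (t\<^sup>2 + 1))"
      have d: "d > 0" unfolding d_def using e by (simp add: add_nonneg_pos)
      have "eventually (\<lambda>n. (\<integral>\<^sup>+ \<omega>. ennreal ((Y \<omega> - X n \<omega>)\<^sup>2) \<partial>M) < d) sequentially"
        using lim d by (rule order_tendstoD)
      then obtain N where N: "\<And>n. n \<ge> N \<Longrightarrow> (\<integral>\<^sup>+ \<omega>. ennreal ((Y \<omega> - X n \<omega>)\<^sup>2) \<partial>M) < d"
        by (auto simp: eventually_sequentially)
      have "norm ((CLINT \<omega>|M. iexp (t * X n \<omega>)) - (CLINT \<omega>|M. iexp (t * Y \<omega>))) < e" if n: "n \<ge> N" for n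
      proof -
        have fin: "(\<integral>\<^sup>+ \<omega>. ennreal ((Y \<omega> - X n \<omega>)\<^sup>2) \<partial>M) < \<infinity>"
          using N[OF n] by (metis d_def ennreal_less_top less_trans infinity_ennreal_def)
        have int: "integrable M (\<lambda>\<omega>. (Y \<omega> - X n \<omega>)\<^sup>2)"
          by (rule integrableI_bounded) (use fin in auto)
        have "ennreal (\<integral>\<omega>. (Y \<omega> - X n \<omega>)\<^sup>2 \<partial>M) < d"
          using N[OF n] nn_integral_eq_integral[OF int] by simp
        then have sq: "(\<integral>\<omega>. (Y \<omega> - X n \<omega>)\<^sup>2 \<partial>M) < e\<^sup>2 / (t\<^sup>2 + 1)"
          unfolding d_def by (simp add: ennreal_less_iff)
        have i1: "integrable M (\<lambda>\<omega>. iexp (t * X n \<omega>) - iexp (t * Y \<omega>))"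
          by (intro Bochner_Integration.integrable_diff integrable_iexp) auto
        have pt: "norm (iexp (t * X n \<omega>) - iexp (t * Y \<omega>)) \<le> e/2 + t\<^sup>2 / (2*e) * (Y \<omega> - X n \<omega>)\<^sup>2" for \<omega>
        proof -
          define z where "z = \<bar>t * X n \<omega> - t * Y \<omega>\<bar>"
          have "norm (iexp (t * X n \<omega>) - iexp (t * Y \<omega>))
              = norm (iexp (t * Y \<omega>) * (iexp (t * X n \<omega> - t * Y \<omega>) - 1))"
            by (simp add: algebra_simps flip: exp_add)
          also have "\<dots> = norm (iexp (t * X n \<omega> - t * Y \<omega>) - 1)" by (simp add: norm_mult)
          also have "\<dots> \<le> z"
            unfolding z_def using iexp_approx1[of "t * X n \<omega> - t * Y \<omega>" 0] by simp
          also have "z \<le> e/2 + z\<^sup>2 / (2*e)"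
          proof -
            have "0 \<le> (z - e)\<^sup>2" by simp
            then show ?thesis using e by (simp add: field_simps power2_eq_square)
          qed
          also have "z\<^sup>2 = t\<^sup>2 * (Y \<omega> - X n \<omega>)\<^sup>2" unfolding z_def
            by (simp add: power2_eq_square algebra_simps)
          finally show ?thesis by simp
        qed
        have "norm ((CLINT \<omega>|M. iexp (t * X n \<omega>)) - (CLINT \<omega>|M. iexp (t * Y \<omega>)))
            = norm (CLINT \<omega>|M. iexp (t * X n \<omega>) - iexp (t * Y \<omega>))"
          by (rule arg_cong[where f = norm], rule Bochner_Integration.integral_diff[symmetric])
            (rule integrable_iexp, simp)+
        also have "\<dots> \<le> (\<integral>\<omega>. norm (iexp (t * X n \<omega>) - iexp (t * Y \<omega>)) \<partial>M)"
          by (rule integral_norm_bound)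
        also have "\<dots> \<le> (\<integral>\<omega>. e/2 + t\<^sup>2 / (2*e) * (Y \<omega> - X n \<omega>)\<^sup>2 \<partial>M)"
          by (intro integral_mono integrable_norm i1 pt) (use int in auto)
        also have "\<dots> = e/2 + t\<^sup>2 / (2*e) * (\<integral>\<omega>. (Y \<omega> - X n \<omega>)\<^sup>2 \<partial>M)"
          using int by (simp add: prob_space)
        also have "\<dots> < e"
        proof -
          have "t\<^sup>2 / (2*e) * (\<integral>\<omega>. (Y \<omega> - X n \<omega>)\<^sup>2 \<partial>M) \<le> t\<^sup>2 / (2*e) * (e\<^sup>2 / (t\<^sup>2 + 1))"
            using sq e by (intro mult_left_mono) auto
          also have "\<dots> = e / 2 * (t\<^sup>2 / (t\<^sup>2 + 1))" using e by (simp add: power2_eq_square)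
          also have "\<dots> < e / 2 * 1" using e by (intro mult_strict_left_mono) (auto simp: add_nonneg_pos)
          finally show ?thesis by simp
        qed
        finally show ?thesis .
      qed
      then show "\<exists>N. \<forall>n\<ge>N. norm ((CLINT \<omega>|M. iexp (t * X n \<omega>)) - (CLINT \<omega>|M. iexp (t * Y \<omega>))) < e"
        by blast
    qed
  qed
  then show ?thesis unfolding gauss_iff by simp
qed

text \<open>Levy's uniqueness theorem. Scaling the standard normal law by \<open>sqrt v\<close> also
  covers \<open>v = 0\<close>, where both sides are the point mass at 0.\<close>

lemma gauss_distr:
  assumes "gauss M X v" "0 \<le> v"
  shows "distr M borel X = distr std_normal_distribution borel (\<lambda>x. sqrt v * x)"
proof (rule Levy_uniqueness)
  have [measurable]: "X \<in> borel_measurable M" using assms by (simp add: gauss_def)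
  interpret N: real_distribution std_normal_distribution by (rule real_dist_normal_dist)
  show "real_distribution (distr M borel X)" by (rule real_distribution_distr) simp
  show "real_distribution (distr std_normal_distribution borel (\<lambda>x. sqrt v * x))"
    by (rule N.real_distribution_distr) simp
  show "char (distr M borel X) = char (distr std_normal_distribution borel (\<lambda>x. sqrt v * x))"
  proof
    fix t
    have "char (distr std_normal_distribution borel (\<lambda>x. sqrt v * x)) t
       = char std_normal_distribution (t * sqrt v)"
      by (subst N.char_distr_eq) (auto simp: char_def mult_ac)
    also have "\<dots> = complex_of_real (exp (- (v * t\<^sup>2) / 2))"
      using assms by (simp add: char_std_normal_distribution power_mult_distrib mult_ac)
    finally show "char (distr M borel X) t = char (distr std_normal_distribution borel (\<lambda>x. sqrt v * x)) t"
      using assms by (simp add: gauss_def)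
  qed
qed

lemma gauss_transfer:
  fixes g :: "real \<Rightarrow> real"
  assumes "gauss M X v" "0 \<le> v" and [measurable]: "g \<in> borel_measurable borel"
  shows "integrable M (\<lambda>\<omega>. g (X \<omega>)) \<longleftrightarrow> integrable std_normal_distribution (\<lambda>x. g (sqrt v * x))"
    "(\<integral>\<omega>. g (X \<omega>) \<partial>M) = (\<integral>x. g (sqrt v * x) \<partial>std_normal_distribution)"
proof -
  have [measurable]: "X \<in> borel_measurable M" using assms by (simp add: gauss_def)
  note d = gauss_distr[OF assms(1,2)]
  have "integrable M (\<lambda>\<omega>. g (X \<omega>)) \<longleftrightarrow> integrable (distr M borel X) g"
    by (subst integrable_distr_eq) auto
  also have "\<dots> \<longleftrightarrow> integrable std_normal_distribution (\<lambda>x. g (sqrt v * x))"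
    unfolding d by (subst integrable_distr_eq) auto
  finally show "integrable M (\<lambda>\<omega>. g (X \<omega>)) \<longleftrightarrow> integrable std_normal_distribution (\<lambda>x. g (sqrt v * x))" .
  have "(\<integral>\<omega>. g (X \<omega>) \<partial>M) = integral\<^sup>L (distr M borel X) g"
    by (subst integral_distr) auto
  also have "\<dots> = (\<integral>x. g (sqrt v * x) \<partial>std_normal_distribution)"
    unfolding d by (subst integral_distr) auto
  finally show "(\<integral>\<omega>. g (X \<omega>) \<partial>M) = (\<integral>x. g (sqrt v * x) \<partial>std_normal_distribution)" .
qed

lemma gauss_moment:
  assumes "gauss M X v" "0 \<le> v"
  shows "integrable M (\<lambda>\<omega>. X \<omega> ^ (2 * k))"
    "(\<integral>\<omega>. X \<omega> ^ (2 * k) \<partial>M) = v ^ k * (fact (2 * k) / (2 ^ k * fact k))"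
proof -
  have e: "(sqrt v * x) ^ (2 * k) = v ^ k * x ^ (2 * k)" for x
    using assms by (simp add: power_mult_distrib power_mult)
  show "integrable M (\<lambda>\<omega>. X \<omega> ^ (2 * k))"
    by (subst gauss_transfer[OF assms])
      (auto simp: e intro!: integrable_mult_right std_normal_distribution_even_moments)
  show "(\<integral>\<omega>. X \<omega> ^ (2 * k) \<partial>M) = v ^ k * (fact (2 * k) / (2 ^ k * fact k))"
    by (subst gauss_transfer(2)[OF assms]) (simp_all add: e std_normal_distribution_even_moments)
qed

lemma gauss_mean:
  assumes "gauss M X v" "0 \<le> v"
  shows "integrable M X" "(\<integral>\<omega>. X \<omega> \<partial>M) = 0"
proof -
  show "integrable M X"
    using gauss_transfer(1)[OF assms, of "\<lambda>x. x"] integrable_std_normal_distribution_moment[of 1]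
    by simp
  show "(\<integral>\<omega>. X \<omega> \<partial>M) = 0"
    using gauss_transfer(2)[OF assms, of "\<lambda>x. x"] integral_std_normal_distribution_moment_odd[of 1]
    by simp
qed

lemma gauss_variance:
  assumes "gauss M X v" "0 \<le> v"
  shows "integrable M (\<lambda>\<omega>. (X \<omega>)\<^sup>2)" "(\<integral>\<omega>. (X \<omega>)\<^sup>2 \<partial>M) = v"
  using gauss_moment[OF assms, of 1] by (simp_all add: fact_numeral)

lemma gauss_zero:
  assumes "gauss M X 0"
  shows "AE \<omega> in M. X \<omega> = 0"
proof -
  have "AE \<omega> in M. (X \<omega>)\<^sup>2 = 0"
    using gauss_variance[OF assms] by (subst integral_nonneg_eq_0_iff_AE[symmetric]) auto
  then show ?thesis by simp
qed

text \<open>The standard normal density is at most 1, so the length of the interval is a bound.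
  Uniformity in the shift \<open>r\<close> later permits \<open>r\<close> to be an independent
  random quantity.\<close>

lemma gauss_small_ball:
  assumes "gauss M X v" "0 < v" "0 < d"
  shows "prob {\<omega> \<in> space M. \<bar>X \<omega> + r\<bar> \<le> d} \<le> 2 * d / sqrt v"
proof -
  have [measurable]: "X \<in> borel_measurable M" using assms by (simp add: gauss_def)
  have "prob {\<omega> \<in> space M. \<bar>X \<omega> + r\<bar> \<le> d} = (\<integral>\<omega>. indicator {x. \<bar>x + r\<bar> \<le> d} (X \<omega>) \<partial>M)"
  proof -
    let ?S = "{\<omega> \<in> space M. \<bar>X \<omega> + r\<bar> \<le> d}"
    have "prob ?S = (\<integral>\<omega>. indicator ?S \<omega> \<partial>M)"
      by (simp add: Int_absorb2 subset_eq)
    also have "\<dots> = (\<integral>\<omega>. indicator {x. \<bar>x + r\<bar> \<le> d} (X \<omega>) \<partial>M)"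
      by (rule Bochner_Integration.integral_cong) (auto simp: indicator_def)
    finally show ?thesis .
  qed
  also have "\<dots> = (\<integral>x. indicator {x. \<bar>x + r\<bar> \<le> d} (sqrt v * x) \<partial>std_normal_distribution)"
    using assms by (intro gauss_transfer) auto
  also have "\<dots> = (\<integral>x. std_normal_density x * indicator {x. \<bar>x + r\<bar> \<le> d} (sqrt v * x) \<partial>lborel)"
    by (subst integral_density) (auto simp: normal_density_nonneg)
  also have "\<dots> \<le> (\<integral>x. indicator {(- d - r) / sqrt v .. (d - r) / sqrt v} x \<partial>lborel)"
  proof (rule integral_mono')
    show "integrable lborel (indicat_real {(- d - r) / sqrt v..(d - r) / sqrt v})"
      by (rule integrable_real_indicator) (auto simp: emeasure_lborel_Icc_eq)
    fix x
    have "std_normal_density x \<le> 1"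
    proof -
      have "exp (- x\<^sup>2 / 2) \<le> 1" by simp
      moreover have "1 / sqrt (2 * pi) \<le> 1" using pi_ge_two by (simp add: real_le_rsqrt)
      ultimately show ?thesis unfolding std_normal_density_def
        by (metis mult_le_one exp_ge_zero)
    qed
    moreover have "indicat_real {x. \<bar>x + r\<bar> \<le> d} (sqrt v * x) = indicator {(- d - r) / sqrt v .. (d - r) / sqrt v} x"
      using assms by (auto simp: indicator_def field_simps abs_le_iff)
    ultimately show "std_normal_density x * indicator {x. \<bar>x + r\<bar> \<le> d} (sqrt v * x)
        \<le> indicator {(- d - r) / sqrt v .. (d - r) / sqrt v} x"
      by (simp add: indicator_def)
  qed simp
  also have "\<dots> = 2 * d / sqrt v"
    using assms by (simp add: field_simps)
  finally show ?thesis .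
qed

end

text \<open>Independence is realised by separate coordinates of a product space, where the
  characteristic function factors by Fubini.\<close>

lemma gauss_pair:
  assumes "prob_space M1" "prob_space M2" "gauss M1 X v" "gauss M2 Y w"
  shows "gauss (M1 \<Otimes>\<^sub>M M2) (\<lambda>z. X (fst z) + Y (snd z)) (v + w)"
proof -
  interpret M1: prob_space M1 by fact
  interpret M2: prob_space M2 by fact
  interpret P: pair_prob_space M1 M2 ..
  have [measurable]: "X \<in> borel_measurable M1" "Y \<in> borel_measurable M2"
    using assms by (auto simp: gauss_def)
  have "(CLINT z|M1 \<Otimes>\<^sub>M M2. iexp (t * (X (fst z) + Y (snd z))))
      = complex_of_real (exp (- ((v + w) * t\<^sup>2) / 2))" for t
  proof -
    have i: "integrable (M1 \<Otimes>\<^sub>M M2) (\<lambda>(x, y). iexp (t * X x) * iexp (t * Y y))"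
      by (rule P.integrable_const_bound[where B = 1]) (auto simp: norm_mult)
    have "(CLINT z|M1 \<Otimes>\<^sub>M M2. iexp (t * (X (fst z) + Y (snd z))))
        = (CLINT z|M1 \<Otimes>\<^sub>M M2. (\<lambda>(x, y). iexp (t * X x) * iexp (t * Y y)) z)"
      by (intro Bochner_Integration.integral_cong)
        (auto simp: exp_add[symmetric] algebra_simps split: prod.split)
    also have "\<dots> = (CLINT x|M1. CLINT y|M2. iexp (t * X x) * iexp (t * Y y))"
      using P.integral_fst'[OF i] by simp
    also have "\<dots> = (CLINT x|M1. iexp (t * X x)) * (CLINT y|M2. iexp (t * Y y))"
      by (simp add: mult.commute)
    also have "\<dots> = complex_of_real (exp (- ((v + w) * t\<^sup>2) / 2))"
      using assms(3,4) unfolding M1.gauss_iff M2.gauss_iff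
      by (simp add: exp_add[symmetric] of_real_exp add_divide_distrib diff_divide_distrib algebra_simps flip: of_real_mult)
    finally show ?thesis .
  qed
  then show ?thesis unfolding P.gauss_iff by simp
qed

subsection \<open>Finite Gaussian vectors are determined by their variances\<close>

text \<open>Real trigonometric polynomials in the first \<open>n\<close> coordinates, with arbitrary
  real frequencies. Characteristic functions of linear combinations determine their expectations,
  and they form an algebra, as Stone-Weierstrass requires.\<close>

inductive trig :: "nat \<Rightarrow> ((nat \<Rightarrow> real) \<Rightarrow> real) \<Rightarrow> bool" for n where
  trig_cos: "trig n (\<lambda>x. cos (\<Sum>i<n. u i * x i))"
| trig_sin: "trig n (\<lambda>x. sin (\<Sum>i<n. u i * x i))"
| trig_add: "trig n f \<Longrightarrow> trig n g \<Longrightarrow> trig n (\<lambda>x. f x + g x)"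
| trig_scale: "trig n f \<Longrightarrow> trig n (\<lambda>x. c * f x)"

lemma trig_const: "trig n (\<lambda>x. c)"
  using trig_scale[OF trig_cos[of n "\<lambda>_. 0"], of c] by simp

lemma trig_diff: "trig n f \<Longrightarrow> trig n g \<Longrightarrow> trig n (\<lambda>x. f x - g x)"
  using trig_add[OF _ trig_scale[of n g "-1"]] by simp

text \<open>The product-to-sum formulas settle pairs of generators. Linearity then extends this
  first in the right factor, with a generator on the left, and finally in the left factor.\<close>

lemma trig_mult:
  assumes "trig n f" "trig n g"
  shows "trig n (\<lambda>x. f x * g x)"
proof -
  have L: "(\<Sum>i<n. u i * x i) + (\<Sum>i<n. w i * x i) = (\<Sum>i<n. (u i + w i) * x i)"
    "(\<Sum>i<n. u i * x i) - (\<Sum>i<n. w i * x i) = (\<Sum>i<n. (u i - w i) * x i)" for u w x :: "nat \<Rightarrow> real"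
    by (simp_all add: sum.distrib sum_subtractf algebra_simps)
  have cc: "trig n (\<lambda>x. cos (\<Sum>i<n. u i * x i) * cos (\<Sum>i<n. w i * x i))" for u w
    using trig_scale[OF trig_add[OF trig_cos[of n "\<lambda>i. u i - w i"] trig_cos[of n "\<lambda>i. u i + w i"]], of "1/2"]
    by (simp add: cos_times_cos L)
  have ss: "trig n (\<lambda>x. sin (\<Sum>i<n. u i * x i) * sin (\<Sum>i<n. w i * x i))" for u w
    using trig_scale[OF trig_diff[OF trig_cos[of n "\<lambda>i. u i - w i"] trig_cos[of n "\<lambda>i. u i + w i"]], of "1/2"]
    by (simp add: sin_times_sin L)
  have sc: "trig n (\<lambda>x. sin (\<Sum>i<n. u i * x i) * cos (\<Sum>i<n. w i * x i))" for u w
    using trig_scale[OF trig_add[OF trig_sin[of n "\<lambda>i. u i + w i"] trig_sin[of n "\<lambda>i. u i - w i"]], of "1/2"]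
    by (simp add: sin_times_cos L)
  have cs: "trig n (\<lambda>x. cos (\<Sum>i<n. u i * x i) * sin (\<Sum>i<n. w i * x i))" for u w
    using sc[of w u] by (simp add: mult.commute)
  have c1: "trig n (\<lambda>x. cos (\<Sum>i<n. u i * x i) * g x)" for u
    using assms(2)
  proof induction
    case (trig_add f g)
    then show ?case using trig.trig_add[OF trig_add.IH] by (simp add: algebra_simps)
  next
    case (trig_scale f c)
    then show ?case using trig.trig_scale[OF trig_scale.IH, of c] by (simp add: algebra_simps)
  qed (auto intro: cc cs)
  have s1: "trig n (\<lambda>x. sin (\<Sum>i<n. u i * x i) * g x)" for u
    using assms(2)
  proof induction
    case (trig_add f g)
    then show ?case using trig.trig_add[OF trig_add.IH] by (simp add: algebra_simps)
  next
    case (trig_scale f c)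
    then show ?case using trig.trig_scale[OF trig_scale.IH, of c] by (simp add: algebra_simps)
  qed (auto intro: sc ss)
  show ?thesis
    using assms(1)
  proof induction
    case (trig_add f g)
    then show ?case using trig.trig_add[OF trig_add.IH] by (simp add: algebra_simps)
  next
    case (trig_scale f c)
    then show ?case using trig.trig_scale[OF trig_scale.IH, of c] by (simp add: algebra_simps)
  qed (auto intro: c1 s1)
qed

lemma trig_continuous:
  assumes "trig n f"
  shows "continuous_on UNIV f"
proof -
  have "continuous_on UNIV (\<lambda>x. \<Sum>i<n. u i * x i :: real)" for u
    by (intro continuous_on_sum continuous_on_mult continuous_on_const continuous_on_product_coordinates)
  with assms show ?thesis
    by induction (auto intro: continuous_on_cos continuous_on_sin continuous_on_add continuous_on_mult)
qed

lemma trig_measurable_bounded: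
  assumes "trig n f" and [measurable]: "\<And>i. i < n \<Longrightarrow> (\<lambda>\<omega>. X \<omega> i) \<in> borel_measurable M"
  shows "(\<lambda>\<omega>. f (X \<omega>)) \<in> borel_measurable M \<and> (\<exists>b. \<forall>x. \<bar>f x\<bar> \<le> b)"
  using assms(1)
proof induction
  case (trig_add f g)
  then obtain b b' where "\<forall>x. \<bar>f x\<bar> \<le> b" "\<forall>x. \<bar>g x\<bar> \<le> b'" by auto
  then have "\<forall>x. \<bar>f x + g x\<bar> \<le> b + b'" by (meson abs_triangle_ineq add_mono order_trans)
  with trig_add show ?case by (auto intro!: borel_measurable_add)
next
  case (trig_scale f c)
  then obtain b where "\<forall>x. \<bar>f x\<bar> \<le> b" by auto
  then have "\<forall>x. \<bar>c * f x\<bar> \<le> \<bar>c\<bar> * b" by (auto simp: abs_mult intro: mult_left_mono)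
  with trig_scale show ?case by (auto intro!: borel_measurable_times)
qed (auto intro!: exI[of _ 1])

text \<open>For a centred Gaussian variable of variance v the expectations of cosine and sine are
  exp (- v / 2) and 0, hence equal under both laws; sums and multiples follow by linearity.\<close>

lemma trig_expectation_eq:
  assumes P: "prob_space M1" "prob_space M2"
    and mX: "\<And>i. i < n \<Longrightarrow> (\<lambda>\<omega>. X \<omega> i) \<in> borel_measurable M1"
    and mY: "\<And>i. i < n \<Longrightarrow> (\<lambda>\<omega>. Y \<omega> i) \<in> borel_measurable M2"
    and eq: "\<And>u. \<exists>v. gauss M1 (\<lambda>\<omega>. \<Sum>i<n. u i * X \<omega> i) v \<and> gauss M2 (\<lambda>\<omega>. \<Sum>i<n. u i * Y \<omega> i) v"
    and "trig n f"
  shows "(\<integral>\<omega>. f (X \<omega>) \<partial>M1) = (\<integral>\<omega>. f (Y \<omega>) \<partial>M2)"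
proof -
  interpret M1: prob_space M1 by fact
  interpret M2: prob_space M2 by fact
  have i1: "integrable M1 (\<lambda>\<omega>. g (X \<omega>))" if "trig n g" for g
    using trig_measurable_bounded[OF that, of X M1] mX M1.integrable_const_bound[of "\<lambda>\<omega>. g (X \<omega>)"] by auto
  have i2: "integrable M2 (\<lambda>\<omega>. g (Y \<omega>))" if "trig n g" for g
    using trig_measurable_bounded[OF that, of Y M2] mY M2.integrable_const_bound[of "\<lambda>\<omega>. g (Y \<omega>)"] by auto
  show ?thesis
    using assms(6)
  proof induction
    case (trig_cos u)
    obtain v where "gauss M1 (\<lambda>\<omega>. \<Sum>i<n. u i * X \<omega> i) v" "gauss M2 (\<lambda>\<omega>. \<Sum>i<n. u i * Y \<omega> i) v"
      using eq by blast
    then show ?case by (simp only: M1.gauss_cos_sin M2.gauss_cos_sin)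
  next
    case (trig_sin u)
    obtain v where "gauss M1 (\<lambda>\<omega>. \<Sum>i<n. u i * X \<omega> i) v" "gauss M2 (\<lambda>\<omega>. \<Sum>i<n. u i * Y \<omega> i) v"
      using eq by blast
    then show ?case by (simp only: M1.gauss_cos_sin M2.gauss_cos_sin)
  next
    case (trig_add f g)
    then show ?case by (simp add: i1 i2)
  next
    case (trig_scale f c)
    then show ?case by simp
  qed
qed

text \<open>Coordinates from \<open>n\<close> on are pinned to 0. This makes the set compact in the
  product topology, and functions of the first \<open>n\<close> coordinates can separate its
  points.\<close>

lemma compact_cube:
  fixes L :: real
  shows "compact {x :: nat \<Rightarrow> real. \<forall>i. x i \<in> (if i < n then {-L..L} else {0})}"
proof -
  have "compactin (product_topology (\<lambda>i. euclidean) UNIV) (PiE UNIV (\<lambda>i. if i < n then {-L..L::real} else {0}))"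
    by (subst compactin_PiE) auto
  then have "compact (PiE UNIV (\<lambda>i::nat. if i < n then {-L..L::real} else {0}))"
    by (simp add: euclidean_product_topology)
  also have "PiE UNIV (\<lambda>i. if i < n then {-L..L::real} else {0}) = {x. \<forall>i. x i \<in> (if i < n then {-L..L} else {0})}"
    by (auto simp: PiE_def Pi_def extensional_def)
  finally show ?thesis .
qed

text \<open>
  The reflected point \<open>r x\<close> lies in the cube and satisfies \<open>sin (pi x / 2 L) = sin (pi (r x) / 2 L)\<close>.
  Polynomials in these sines therefore keep, on the whole space, the bounds that they have on the cube.
\<close>

lemma trig_approx:
  fixes f :: "(nat \<Rightarrow> real) \<Rightarrow> real"
  assumes f: "continuous_on UNIV f" and b: "\<And>x. \<bar>f x\<bar> \<le> b" and L: "0 < L" and e: "0 < e"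
  obtains g where "trig n g" "\<And>x. \<bar>g x\<bar> \<le> b + e"
    "\<And>x. (\<And>i. i < n \<Longrightarrow> \<bar>x i\<bar> \<le> L) \<Longrightarrow> (\<And>i. i \<ge> n \<Longrightarrow> x i = 0) \<Longrightarrow> \<bar>f x - g x\<bar> \<le> e"
proof -
  let ?K = "{x :: nat \<Rightarrow> real. \<forall>i. x i \<in> (if i < n then {-L..L} else {0})}"
  define r where "r x = (\<lambda>i. if i < n then (2 * L / pi) * arcsin (sin (pi * x i / (2 * L))) else 0)"
    for x :: "nat \<Rightarrow> real"
  have rK: "r x \<in> ?K" for x
  proof -
    have "\<bar>(2 * L / pi) * arcsin (sin y)\<bar> \<le> (2 * L / pi) * (pi / 2)" for y
    proof -
      have "\<bar>arcsin (sin y)\<bar> \<le> pi / 2" using arcsin_bounded[of "sin y"] by (auto simp: abs_le_iff)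
      then have "\<bar>2 * L / pi\<bar> * \<bar>arcsin (sin y)\<bar> \<le> (2 * L / pi) * (pi / 2)"
        using L by (intro mult_mono) auto
      then show ?thesis by (simp only: abs_mult)
    qed
    then have "\<bar>(2 * L / pi) * arcsin (sin y)\<bar> \<le> L" for y by simp
    then show ?thesis unfolding r_def abs_le_iff by (auto simp: minus_le_iff)
  qed
  have rs: "sin (pi * r x i / (2 * L)) = sin (pi * x i / (2 * L))" if "i < n" for x i
    using that L by (simp add: r_def)
  \<comment> \<open>The algebra consists of all trigonometric polynomials invariant under
    \<open>r\<close>; the sines serve only to show that it separates the points of the cube.\<close>
  let ?R = "{g. trig n g \<and> (\<forall>x. g (r x) = g x)}"
  interpret function_ring_on ?R ?K
  proof
    show "compact ?K" by (rule compact_cube)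
    show "continuous_on ?K g" if "g \<in> ?R" for g
      using that trig_continuous continuous_on_subset by blast
    fix x y assume x: "x \<in> ?K" and y: "y \<in> ?K" and ne: "x \<noteq> y"
    obtain i where i: "x i \<noteq> y i" using ne by (metis ext)
    then have "i < n" using x y by (metis (mono_tags, lifting) mem_Collect_eq singletonD)
    then have xi: "x i \<in> {-L..L}" "y i \<in> {-L..L}" using x y by (auto split: if_splits dest: spec[of _ i])
    let ?g = "\<lambda>x. sin (pi * x i / (2 * L))"
    have "?g = (\<lambda>x. sin (\<Sum>j<n. (if j = i then pi / (2 * L) else 0) * x j))"
      using \<open>i < n\<close> by (auto simp: if_distrib[of "\<lambda>c. c * _"] sum.delta cong: if_cong)
    then have "trig n ?g" using trig_sin[of n "\<lambda>j. if j = i then pi / (2 * L) else 0"] by simp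
    then have "?g \<in> ?R" using rs[OF \<open>i < n\<close>] by auto
    moreover have "?g x \<noteq> ?g y"
    proof
      assume "?g x = ?g y"
      moreover have "\<bar>pi * z / (2 * L)\<bar> \<le> pi / 2" if "z \<in> {-L..L}" for z
      proof -
        have "pi * \<bar>z\<bar> \<le> pi * L" using that by (intro mult_left_mono) auto
        then show ?thesis using L by (simp add: abs_mult field_simps)
      qed
      ultimately have "pi * x i / (2 * L) = pi * y i / (2 * L)"
        using sin_inj_pi[of "pi * x i / (2 * L)" "pi * y i / (2 * L)"] xi
        by (metis abs_le_iff minus_le_iff minus_divide_left)
      then show False using i L by simp
    qed
    ultimately show "\<exists>f\<in>?R. f x \<noteq> f y" by (intro bexI[of _ ?g])
  qed (auto intro: trig_add trig_mult trig_const)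
  obtain g where g: "g \<in> ?R" "\<forall>x\<in>?K. \<bar>f x - g x\<bar> < e"
    using Stone_Weierstrass_basic[OF continuous_on_subset[OF f] e] by auto
  show ?thesis
  proof
    show "trig n g" using g by simp
    show "\<bar>g x\<bar> \<le> b + e" for x
    proof -
      have "g x = g (r x)" using g by simp
      moreover have "\<bar>f (r x) - g (r x)\<bar> < e" using g rK by blast
      ultimately show ?thesis using b[of "r x"] by linarith
    qed
    fix x :: "nat \<Rightarrow> real" assume x: "\<And>i. i < n \<Longrightarrow> \<bar>x i\<bar> \<le> L" "\<And>i. i \<ge> n \<Longrightarrow> x i = 0"
    have "x \<in> ?K"
    proof safe
      fix i show "x i \<in> (if i < n then {-L..L} else {0})"
        using x(1)[of i] x(2)[of i] by (auto simp: abs_le_iff)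
    qed
    then show "\<bar>f x - g x\<bar> \<le> e" using g by (simp add: less_imp_le)
  qed
qed

lemma measurable_vector:
  fixes X :: "'a \<Rightarrow> nat \<Rightarrow> real"
  assumes "\<And>i. i < n \<Longrightarrow> (\<lambda>\<omega>. X \<omega> i) \<in> borel_measurable M" "\<And>\<omega> i. n \<le> i \<Longrightarrow> X \<omega> i = (0::real)"
  shows "X \<in> borel_measurable M"
proof (rule measurable_coordinatewise_then_product)
  fix i
  show "(\<lambda>\<omega>. X \<omega> i) \<in> borel_measurable M"
    using assms by (cases "i < n") auto
qed

text \<open>On a large cube \<open>f\<close> is within e of a trigonometric polynomial that is
  bounded by b + e everywhere and has the same expectation under both laws. Off the cube the error
  is at most 2 b + e, and that event has small probability.\<close>

lemma law_eq_bounded: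
  fixes X :: "'a \<Rightarrow> nat \<Rightarrow> real" and Y :: "'b \<Rightarrow> nat \<Rightarrow> real" and f :: "(nat \<Rightarrow> real) \<Rightarrow> real"
  assumes P: "prob_space M1" "prob_space M2"
    and mX: "\<And>i. i < n \<Longrightarrow> (\<lambda>\<omega>. X \<omega> i) \<in> borel_measurable M1" "\<And>\<omega> i. n \<le> i \<Longrightarrow> X \<omega> i = 0"
    and mY: "\<And>i. i < n \<Longrightarrow> (\<lambda>\<omega>. Y \<omega> i) \<in> borel_measurable M2" "\<And>\<omega> i. n \<le> i \<Longrightarrow> Y \<omega> i = 0"
    and eq: "\<And>u. \<exists>v. gauss M1 (\<lambda>\<omega>. \<Sum>i<n. u i * X \<omega> i) v \<and> gauss M2 (\<lambda>\<omega>. \<Sum>i<n. u i * Y \<omega> i) v"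
    and f: "continuous_on UNIV f" and b: "\<And>x. \<bar>f x\<bar> \<le> b"
  shows "(\<integral>\<omega>. f (X \<omega>) \<partial>M1) = (\<integral>\<omega>. f (Y \<omega>) \<partial>M2)"
proof -
  have fb: "f \<in> borel_measurable borel" using f by (rule borel_measurable_continuous_onI)
  have b0: "0 \<le> b" using b[of "\<lambda>_. 0"] by linarith
  \<comment> \<open>the error outside the cube is controlled by tightness\<close>
  have key: "\<exists>L>0. \<forall>g L'. L \<le> L' \<longrightarrow> trig n g \<longrightarrow> (\<forall>x. \<bar>g x\<bar> \<le> b + e) \<longrightarrow>
      (\<forall>x. (\<forall>i<n. \<bar>x i\<bar> \<le> L') \<longrightarrow> (\<forall>i\<ge>n. x i = 0) \<longrightarrow> \<bar>f x - g x\<bar> \<le> e) \<longrightarrow>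
      \<bar>(\<integral>\<omega>. f (Z \<omega>) \<partial>N) - (\<integral>\<omega>. g (Z \<omega>) \<partial>N)\<bar> \<le> e + (2 * b + e) * e"
    if "prob_space N" and mZ: "\<And>i. i < n \<Longrightarrow> (\<lambda>\<omega>. Z \<omega> i) \<in> borel_measurable N"
      "\<And>\<omega> i. n \<le> i \<Longrightarrow> Z \<omega> i = 0" and e: "e > 0"
    for Z :: "'c \<Rightarrow> nat \<Rightarrow> real" and N e
  proof -
    interpret N: prob_space N by fact
    have mZ': "Z \<in> borel_measurable N" by (rule measurable_vector[OF mZ])
    define S where "S \<omega> = (\<Sum>i<n. \<bar>Z \<omega> i\<bar>)" for \<omega>
    have [measurable]: "S \<in> borel_measurable N" unfolding S_def
      by (intro borel_measurable_sum borel_measurable_abs mZ) auto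
    define A where "A k = {\<omega> \<in> space N. S \<omega> \<le> real k}" for k
    have mA [measurable]: "A k \<in> sets N" for k unfolding A_def by measurable
    have "incseq A" by (auto simp: A_def incseq_def)
    then have "(\<lambda>k. N.prob (A k)) \<longlonglongrightarrow> N.prob (\<Union>k. A k)"
      by (intro N.finite_Lim_measure_incseq) auto
    also have "(\<Union>k. A k) = space N" by (auto simp: A_def real_arch_simple)
    finally have "eventually (\<lambda>k. 1 - e < N.prob (A k)) sequentially"
      using e by (intro order_tendstoD) (auto simp: N.prob_space)
    then obtain k where k: "1 - e < N.prob (A (Suc k))"
      by (metis (no_types, lifting) eventually_sequentially le_add1 le_SucI le_refl)
    show ?thesis
    proof (intro exI[of _ "real (Suc k)"] conjI allI impI)
      fix g L' assume L': "real (Suc k) \<le> L'" and g: "trig n g" and gb: "\<forall>x. \<bar>g x\<bar> \<le> b + e"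
        and fg: "\<forall>x. (\<forall>i<n. \<bar>x i\<bar> \<le> L') \<longrightarrow> (\<forall>i\<ge>n. x i = 0) \<longrightarrow> \<bar>f x - g x\<bar> \<le> e"
      let ?h = "\<lambda>\<omega>. f (Z \<omega>) - g (Z \<omega>)"
      have m1 [measurable]: "(\<lambda>\<omega>. f (Z \<omega>)) \<in> borel_measurable N" using mZ' fb by simp
      have m2 [measurable]: "(\<lambda>\<omega>. g (Z \<omega>)) \<in> borel_measurable N"
        using trig_measurable_bounded[OF g, of Z N] mZ by auto
      have i1: "integrable N (\<lambda>\<omega>. f (Z \<omega>))" by (rule N.integrable_const_bound[of _ b]) (use b in auto)
      have i2: "integrable N (\<lambda>\<omega>. g (Z \<omega>))" by (rule N.integrable_const_bound[of _ "b + e"]) (use gb in auto)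
      have iS: "integrable N (indicator (space N - A (Suc k)) :: 'c \<Rightarrow> real)"
        by (rule integrable_real_indicator) (auto simp: N.emeasure_eq_measure)
      have pt: "\<bar>?h \<omega>\<bar> \<le> e + (2 * b + e) * indicator (space N - A (Suc k)) \<omega>" if "\<omega> \<in> space N" for \<omega>
      proof (cases "\<omega> \<in> A (Suc k)")
        case True
        have "\<bar>Z \<omega> i\<bar> \<le> L'" if "i < n" for i
        proof -
          have "\<bar>Z \<omega> i\<bar> \<le> S \<omega>" unfolding S_def using that by (intro member_le_sum) auto
          then show ?thesis using True L' by (auto simp: A_def)
        qed
        then have "\<bar>?h \<omega>\<bar> \<le> e" using fg mZ(2) by auto
        then show ?thesis using True by (simp add: indicator_def)
      next
        case False
        have "\<bar>?h \<omega>\<bar> \<le> 2 * b + e" using b[of "Z \<omega>"] gb[rule_format, of "Z \<omega>"] by linarith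
        then show ?thesis using False that e by (simp add: indicator_def)
      qed
      have "\<bar>(\<integral>\<omega>. f (Z \<omega>) \<partial>N) - (\<integral>\<omega>. g (Z \<omega>) \<partial>N)\<bar> = \<bar>\<integral>\<omega>. ?h \<omega> \<partial>N\<bar>" using i1 i2 by simp
      also have "\<dots> \<le> (\<integral>\<omega>. \<bar>?h \<omega>\<bar> \<partial>N)" by (rule integral_abs_bound)
      also have "\<dots> \<le> (\<integral>\<omega>. e + (2 * b + e) * indicator (space N - A (Suc k)) \<omega> \<partial>N)"
        using i1 i2 iS pt by (intro integral_mono) auto
      also have "\<dots> = e + (2 * b + e) * N.prob (space N - A (Suc k))"
        using iS by (simp add: N.prob_space Int_absorb2)
      also have "\<dots> \<le> e + (2 * b + e) * e"
        using k e b0 N.prob_compl[OF mA[of "Suc k"]] by (intro add_left_mono mult_left_mono) auto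
      finally show "\<bar>(\<integral>\<omega>. f (Z \<omega>) \<partial>N) - (\<integral>\<omega>. g (Z \<omega>) \<partial>N)\<bar> \<le> e + (2 * b + e) * e" .
    qed simp
  qed
  have main: "\<bar>(\<integral>\<omega>. f (X \<omega>) \<partial>M1) - (\<integral>\<omega>. f (Y \<omega>) \<partial>M2)\<bar> \<le> 2 * (e + (2 * b + e) * e)" if e: "e > 0" for e
  proof -
    obtain L1 where L1: "L1 > 0" "\<forall>g L'. L1 \<le> L' \<longrightarrow> trig n g \<longrightarrow> (\<forall>x. \<bar>g x\<bar> \<le> b + e) \<longrightarrow>
      (\<forall>x. (\<forall>i<n. \<bar>x i\<bar> \<le> L') \<longrightarrow> (\<forall>i\<ge>n. x i = 0) \<longrightarrow> \<bar>f x - g x\<bar> \<le> e) \<longrightarrow>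
      \<bar>(\<integral>\<omega>. f (X \<omega>) \<partial>M1) - (\<integral>\<omega>. g (X \<omega>) \<partial>M1)\<bar> \<le> e + (2 * b + e) * e"
      using key[of M1 X, OF P(1) mX e] by blast
    obtain L2 where L2: "L2 > 0" "\<forall>g L'. L2 \<le> L' \<longrightarrow> trig n g \<longrightarrow> (\<forall>x. \<bar>g x\<bar> \<le> b + e) \<longrightarrow>
      (\<forall>x. (\<forall>i<n. \<bar>x i\<bar> \<le> L') \<longrightarrow> (\<forall>i\<ge>n. x i = 0) \<longrightarrow> \<bar>f x - g x\<bar> \<le> e) \<longrightarrow>
      \<bar>(\<integral>\<omega>. f (Y \<omega>) \<partial>M2) - (\<integral>\<omega>. g (Y \<omega>) \<partial>M2)\<bar> \<le> e + (2 * b + e) * e"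
      using key[of M2 Y, OF P(2) mY e] by blast
    \<comment> \<open>One cube, and hence one approximating polynomial, serves both laws, because
      \<open>key\<close> admits every larger side length.\<close>
    have "max L1 L2 > 0" using L1(1) by simp
    then have "\<exists>g. trig n g \<and> (\<forall>x. \<bar>g x\<bar> \<le> b + e) \<and>
      (\<forall>x. (\<forall>i<n. \<bar>x i\<bar> \<le> max L1 L2) \<longrightarrow> (\<forall>i\<ge>n. x i = 0) \<longrightarrow> \<bar>f x - g x\<bar> \<le> e)"
      by (rule trig_approx[OF f b _ e, of _ n]) blast
    then obtain g where g: "trig n g" "\<forall>x. \<bar>g x\<bar> \<le> b + e"
      "\<forall>x. (\<forall>i<n. \<bar>x i\<bar> \<le> max L1 L2) \<longrightarrow> (\<forall>i\<ge>n. x i = 0) \<longrightarrow> \<bar>f x - g x\<bar> \<le> e"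
      by blast
    have aux: "\<bar>p - q\<bar> \<le> c \<Longrightarrow> \<bar>r - s\<bar> \<le> c \<Longrightarrow> q = s \<Longrightarrow> \<bar>p - r\<bar> \<le> 2 * c" for p q r s c :: real
      by linarith
    have "\<bar>(\<integral>\<omega>. f (X \<omega>) \<partial>M1) - (\<integral>\<omega>. g (X \<omega>) \<partial>M1)\<bar> \<le> e + (2 * b + e) * e"
      using L1(2)[rule_format, of "max L1 L2" g] g by auto
    moreover have "\<bar>(\<integral>\<omega>. f (Y \<omega>) \<partial>M2) - (\<integral>\<omega>. g (Y \<omega>) \<partial>M2)\<bar> \<le> e + (2 * b + e) * e"
      using L2(2)[rule_format, of "max L1 L2" g] g by auto
    moreover have "(\<integral>\<omega>. g (X \<omega>) \<partial>M1) = (\<integral>\<omega>. g (Y \<omega>) \<partial>M2)"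
      by (rule trig_expectation_eq[OF P mX(1) mY(1) eq g(1)])
    ultimately show ?thesis by (rule aux)
  qed
  have "((\<lambda>e. 2 * (e + (2 * b + e) * e)) \<longlongrightarrow> 2 * (0 + (2 * b + 0) * 0)) (at_right 0)"
    by (intro tendsto_intros)
  then have "\<bar>(\<integral>\<omega>. f (X \<omega>) \<partial>M1) - (\<integral>\<omega>. f (Y \<omega>) \<partial>M2)\<bar> \<le> 2 * (0 + (2 * b + 0) * 0)"
    by (rule tendsto_lowerbound) (rule eventually_at_rightI[of 0 1], rule main, simp_all)
  then show ?thesis by simp
qed

text \<open>Clipping \<open>f\<close> at -k and k keeps it continuous, so the bounded case applies;
  dominated convergence with bound \<open>\<bar>f\<bar>\<close> removes the clipping.\<close>

lemma law_eq:
  fixes X :: "'a \<Rightarrow> nat \<Rightarrow> real" and Y :: "'b \<Rightarrow> nat \<Rightarrow> real" and f :: "(nat \<Rightarrow> real) \<Rightarrow> real"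
  assumes P: "prob_space M1" "prob_space M2"
    and mX: "\<And>i. i < n \<Longrightarrow> (\<lambda>\<omega>. X \<omega> i) \<in> borel_measurable M1" "\<And>\<omega> i. n \<le> i \<Longrightarrow> X \<omega> i = 0"
    and mY: "\<And>i. i < n \<Longrightarrow> (\<lambda>\<omega>. Y \<omega> i) \<in> borel_measurable M2" "\<And>\<omega> i. n \<le> i \<Longrightarrow> Y \<omega> i = 0"
    and eq: "\<And>u. \<exists>v. gauss M1 (\<lambda>\<omega>. \<Sum>i<n. u i * X \<omega> i) v \<and> gauss M2 (\<lambda>\<omega>. \<Sum>i<n. u i * Y \<omega> i) v"
    and f: "continuous_on UNIV f"
    and i: "integrable M1 (\<lambda>\<omega>. f (X \<omega>))" "integrable M2 (\<lambda>\<omega>. f (Y \<omega>))"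
  shows "(\<integral>\<omega>. f (X \<omega>) \<partial>M1) = (\<integral>\<omega>. f (Y \<omega>) \<partial>M2)"
proof -
  define g where "g k x = max (- real k) (min (real k) (f x))" for k x
  have lim: "(\<lambda>k. g k x) \<longlonglongrightarrow> f x" for x
  proof (rule tendsto_eventually)
    obtain k where "\<bar>f x\<bar> \<le> real k" using real_arch_simple by blast
    then have "\<forall>m\<ge>k. g m x = f x" by (auto simp: g_def max_def min_def)
    then show "eventually (\<lambda>m. g m x = f x) sequentially" by (auto simp: eventually_sequentially)
  qed
  have [measurable]: "(\<lambda>\<omega>. f (X \<omega>)) \<in> borel_measurable M1" "(\<lambda>\<omega>. f (Y \<omega>)) \<in> borel_measurable M2"
    using i by auto
  have bd: "\<bar>g k x\<bar> \<le> \<bar>f x\<bar>" for k x by (auto simp: g_def max_def min_def)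
  have m1: "(\<lambda>\<omega>. g k (X \<omega>)) \<in> borel_measurable M1" for k unfolding g_def by measurable
  have m2: "(\<lambda>\<omega>. g k (Y \<omega>)) \<in> borel_measurable M2" for k unfolding g_def by measurable
  have "(\<lambda>k. \<integral>\<omega>. g k (X \<omega>) \<partial>M1) \<longlonglongrightarrow> (\<integral>\<omega>. f (X \<omega>) \<partial>M1)"
    by (rule integral_dominated_convergence[where w = "\<lambda>\<omega>. \<bar>f (X \<omega>)\<bar>"]) (use i lim bd m1 in auto)
  moreover have "(\<lambda>k. \<integral>\<omega>. g k (Y \<omega>) \<partial>M2) \<longlonglongrightarrow> (\<integral>\<omega>. f (Y \<omega>) \<partial>M2)"
    by (rule integral_dominated_convergence[where w = "\<lambda>\<omega>. \<bar>f (Y \<omega>)\<bar>"]) (use i lim bd m2 in auto)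
  moreover have "(\<integral>\<omega>. g k (X \<omega>) \<partial>M1) = (\<integral>\<omega>. g k (Y \<omega>) \<partial>M2)" for k
  proof (rule law_eq_bounded[OF P mX mY eq, where b = "real k"])
    show "continuous_on UNIV (g k)" unfolding g_def by (intro continuous_intros f)
  qed (auto simp: g_def)
  ultimately show ?thesis by (auto intro: LIMSEQ_unique)
qed

subsection \<open>Square-integrable functions\<close>

definition L2 :: "(real \<Rightarrow> real) set" where
  "L2 = {f \<in> borel_measurable lborel. integrable lborel (\<lambda>s. (f s)\<^sup>2)}"

definition ip :: "(real \<Rightarrow> real) \<Rightarrow> (real \<Rightarrow> real) \<Rightarrow> real" where
  "ip f g = (\<integral>s. f s * g s \<partial>lborel)"

lemma L2_square_integrable: "f \<in> L2 \<Longrightarrow> integrable lborel (\<lambda>s. (f s)\<^sup>2)"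
  by (simp add: L2_def)

lemma L2_iff_nn_integral:
  "f \<in> L2 \<longleftrightarrow> f \<in> borel_measurable lborel \<and> (\<integral>\<^sup>+ s. ennreal ((f s)\<^sup>2) \<partial>lborel) < \<infinity>"
  by (auto simp: L2_def integrable_iff_bounded)

lemma L2_mult_integrable:
  assumes "f \<in> L2" "g \<in> L2"
  shows "integrable lborel (\<lambda>s. f s * g s)"
proof (rule Bochner_Integration.integrable_bound)
  have [measurable]: "f \<in> borel_measurable borel" "g \<in> borel_measurable borel"
    using assms by (auto simp: L2_def)
  show "integrable lborel (\<lambda>s. (f s)\<^sup>2 + (g s)\<^sup>2)"
    using assms by (auto simp: L2_def)
  show "(\<lambda>s. f s * g s) \<in> borel_measurable lborel" by measurable
  have "\<bar>x * y\<bar> \<le> x\<^sup>2 + y\<^sup>2" for x y :: real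
    using sum_squares_bound[of "\<bar>x\<bar>" "\<bar>y\<bar>"] abs_ge_zero[of "x * y"] unfolding abs_mult power2_abs by linarith
  then show "AE s in lborel. norm (f s * g s) \<le> norm ((f s)\<^sup>2 + (g s)\<^sup>2)" by simp
qed

lemma L2_add:
  assumes "f \<in> L2" "g \<in> L2" shows "(\<lambda>s. f s + g s) \<in> L2"
proof -
  have [measurable]: "f \<in> borel_measurable borel" "g \<in> borel_measurable borel"
    using assms by (auto simp: L2_def)
  have "integrable lborel (\<lambda>s. (f s)\<^sup>2 + (g s)\<^sup>2 + 2 * (f s * g s))"
    using assms L2_mult_integrable[OF assms] by (auto simp: L2_def)
  then show ?thesis by (simp add: L2_def power2_sum mult.assoc)
qed

lemma L2_scale: "f \<in> L2 \<Longrightarrow> (\<lambda>s. c * f s) \<in> L2"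
  by (auto simp: L2_def power_mult_distrib)

lemma L2_diff: "f \<in> L2 \<Longrightarrow> g \<in> L2 \<Longrightarrow> (\<lambda>s. f s - g s) \<in> L2"
  using L2_add[OF _ L2_scale[of g "-1"]] by simp

lemma L2_zero: "(\<lambda>s. 0) \<in> L2" by (simp add: L2_def)

lemma L2_sum: "(\<And>i. i \<in> I \<Longrightarrow> f i \<in> L2) \<Longrightarrow> (\<lambda>s. \<Sum>i\<in>I. f i s) \<in> L2"
  by (induction I rule: infinite_finite_induct) (auto intro: L2_zero L2_add)

lemma L2_indicator:
  "A \<in> sets lborel \<Longrightarrow> emeasure lborel A < \<infinity> \<Longrightarrow> indicator A \<in> L2"
proof -
  assume A: "A \<in> sets lborel" "emeasure lborel A < \<infinity>"
  have "ennreal ((indicator A s)\<^sup>2) = indicator A s" for s :: real by (simp add: indicator_def)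
  then show ?thesis using A unfolding L2_iff_nn_integral by simp
qed

lemma L2_indicator_Ioc: "indicator {u<..v} \<in> L2"
  by (cases "u \<le> v") (auto intro!: L2_indicator L2_zero)

lemma ip_commute: "ip f g = ip g f" by (simp add: ip_def mult.commute)

lemma ip_self: "ip f f = (\<integral>s. (f s)\<^sup>2 \<partial>lborel)" by (simp add: ip_def power2_eq_square)

lemma ip_self_nonneg: "0 \<le> ip f f" by (simp add: ip_self)

lemma nn_integral_eq_ip: "f \<in> L2 \<Longrightarrow> (\<integral>\<^sup>+ s. ennreal ((f s)\<^sup>2) \<partial>lborel) = ennreal (ip f f)"
  by (simp add: ip_self nn_integral_eq_integral L2_square_integrable)

lemma ip_add_left: "f \<in> L2 \<Longrightarrow> g \<in> L2 \<Longrightarrow> h \<in> L2 \<Longrightarrow> ip (\<lambda>s. f s + g s) h = ip f h + ip g h"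
  by (simp add: ip_def L2_mult_integrable distrib_right)

lemma ip_scale_left: "ip (\<lambda>s. c * f s) h = c * ip f h"
  by (simp add: ip_def mult.assoc)

lemma ip_add_right: "f \<in> L2 \<Longrightarrow> g \<in> L2 \<Longrightarrow> h \<in> L2 \<Longrightarrow> ip h (\<lambda>s. f s + g s) = ip h f + ip h g"
  by (simp add: ip_commute[of h] ip_add_left)

lemma ip_scale_right: "ip h (\<lambda>s. c * f s) = c * ip h f"
  by (simp add: ip_commute[of h] ip_scale_left)

lemma ip_diff_left: "f \<in> L2 \<Longrightarrow> g \<in> L2 \<Longrightarrow> h \<in> L2 \<Longrightarrow> ip (\<lambda>s. f s - g s) h = ip f h - ip g h"
  by (simp add: ip_def L2_mult_integrable left_diff_distrib)

lemma ip_diff_right: "f \<in> L2 \<Longrightarrow> g \<in> L2 \<Longrightarrow> h \<in> L2 \<Longrightarrow> ip h (\<lambda>s. f s - g s) = ip h f - ip h g"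
  by (simp add: ip_commute[of h] ip_diff_left)

lemma ip_sum_left: "(\<And>i. i \<in> I \<Longrightarrow> f i \<in> L2) \<Longrightarrow> h \<in> L2 \<Longrightarrow> ip (\<lambda>s. \<Sum>i\<in>I. f i s) h = (\<Sum>i\<in>I. ip (f i) h)"
  by (simp add: ip_def L2_mult_integrable sum_distrib_right)

lemma ip_sum_sum:
  assumes "\<And>i. i < n \<Longrightarrow> f i \<in> L2"
  shows "ip (\<lambda>s. \<Sum>i<n. u i * f i s) (\<lambda>s. \<Sum>i<n. u i * f i s)
    = (\<Sum>i<n. \<Sum>j<n. u i * u j * ip (f i) (f j))"
proof -
  have S: "(\<lambda>s. \<Sum>j<n. u j * f j s) \<in> L2" using assms by (intro L2_sum L2_scale) auto
  have "ip (\<lambda>s. \<Sum>i<n. u i * f i s) (\<lambda>s. \<Sum>i<n. u i * f i s)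
      = (\<Sum>i<n. ip (\<lambda>s. u i * f i s) (\<lambda>s. \<Sum>j<n. u j * f j s))"
    using assms by (intro ip_sum_left L2_scale S) auto
  also have "\<dots> = (\<Sum>i<n. \<Sum>j<n. u i * u j * ip (f i) (f j))"
  proof (rule sum.cong[OF refl])
    fix i assume "i \<in> {..<n}"
    then have "ip (f i) (\<lambda>s. \<Sum>j<n. u j * f j s) = (\<Sum>j<n. u j * ip (f i) (f j))"
      using assms ip_sum_left[of "{..<n}" "\<lambda>j s. u j * f j s" "f i"]
      by (simp add: ip_commute[of "f i"] ip_scale_left L2_scale)
    then show "ip (\<lambda>s. u i * f i s) (\<lambda>s. \<Sum>j<n. u j * f j s) = (\<Sum>j<n. u i * u j * ip (f i) (f j))"
      by (simp add: ip_scale_left sum_distrib_left mult.assoc)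
  qed
  finally show ?thesis .
qed

lemma ip_Cauchy_Schwarz:
  assumes "f \<in> L2" "g \<in> L2"
  shows "(ip f g)\<^sup>2 \<le> ip f f * ip g g"
proof -
  have q: "0 \<le> ip f f + 2 * t * ip f g + t\<^sup>2 * ip g g" for t
  proof -
    have "0 \<le> ip (\<lambda>s. f s + t * g s) (\<lambda>s. f s + t * g s)" by (rule ip_self_nonneg)
    then show ?thesis using assms
      by (simp add: ip_add_left ip_add_right L2_add L2_scale ip_scale_left ip_scale_right
          ip_commute[of g f] power2_eq_square algebra_simps)
  qed
  show ?thesis
  proof (cases "ip g g = 0")
    case True
    have "ip f g = 0"
    proof (rule ccontr)
      assume "ip f g \<noteq> 0"
      \<comment> \<open>As \<open>ip g g = 0\<close>, the quadratic is affine in t; this choice of t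
        gives it the value -1.\<close>
      then show False using q[of "- (ip f f + 1) / (2 * ip f g)"] True by (simp add: field_simps)
    qed
    then show ?thesis using True by simp
  next
    case False
    then have pos: "ip g g > 0" using ip_self_nonneg[of g] by simp
    have "0 \<le> ip f f - (ip f g)\<^sup>2 / ip g g"
      using q[of "- ip f g / ip g g"] pos by (simp add: power2_eq_square field_simps)
    then show ?thesis using pos by (simp add: field_simps)
  qed
qed

subsection \<open>Step functions\<close>

text \<open>An instance of (x + y)^2 <= 2 x^2 + 2 y^2. The measure is arbitrary since the bound
  serves kernels over \<open>lborel\<close> as well as random variables over
  \<open>M\<close>.\<close>

lemma nn_integral_square_comb:
  fixes p q p' q' :: "'c \<Rightarrow> real"
  assumes [measurable]: "p \<in> borel_measurable N" "q \<in> borel_measurable N" "p' \<in> borel_measurable N" "q' \<in> borel_measurable N"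
  shows "(\<integral>\<^sup>+ s. ennreal ((a * p s + b * q s - (a * p' s + b * q' s))\<^sup>2) \<partial>N)
    \<le> ennreal (2 * a\<^sup>2) * (\<integral>\<^sup>+ s. ennreal ((p s - p' s)\<^sup>2) \<partial>N) + ennreal (2 * b\<^sup>2) * (\<integral>\<^sup>+ s. ennreal ((q s - q' s)\<^sup>2) \<partial>N)"
proof -
  have pt: "(a * x + b * y - (a * x' + b * y'))\<^sup>2 \<le> 2 * a\<^sup>2 * (x - x')\<^sup>2 + 2 * b\<^sup>2 * (y - y')\<^sup>2" for x y x' y' :: real
    using zero_le_power2[of "a * (x - x') - b * (y - y')"] by (simp add: power2_eq_square algebra_simps)
  have "(\<integral>\<^sup>+ s. ennreal ((a * p s + b * q s - (a * p' s + b * q' s))\<^sup>2) \<partial>N)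
      \<le> (\<integral>\<^sup>+ s. ennreal (2 * a\<^sup>2) * ennreal ((p s - p' s)\<^sup>2) + ennreal (2 * b\<^sup>2) * ennreal ((q s - q' s)\<^sup>2) \<partial>N)"
    by (intro nn_integral_mono) (simp add: pt flip: ennreal_mult ennreal_plus)
  then show ?thesis by (subst (asm) nn_integral_add) (auto simp: nn_integral_cmult)
qed

abbreviation ordered :: "(real \<times> real \<times> real) list \<Rightarrow> bool" where
  "ordered l \<equiv> \<forall>(c, u, v) \<in> set l. u \<le> v"

definition scale_steps :: "real \<Rightarrow> (real \<times> real \<times> real) list \<Rightarrow> (real \<times> real \<times> real) list" where
  "scale_steps a l = map (\<lambda>(c, u, v). (a * c, u, v)) l"

lemma ordered_comb: "ordered l \<Longrightarrow> ordered l' \<Longrightarrow> ordered (scale_steps a l @ scale_steps b l')"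
  by (auto simp: scale_steps_def)

lemma step_function_comb:
  "step_function (scale_steps a l @ scale_steps b l') s = a * step_function l s + b * step_function l' s"
proof -
  have "step_function (scale_steps a l) s = a * step_function l s" for a l
    by (induction l) (auto simp: step_function_def scale_steps_def algebra_simps)
  then show ?thesis by (simp add: step_function_def)
qed

lemma step_integral_comb:
  "step_integral B (scale_steps a l @ scale_steps b l') \<omega> = a * step_integral B l \<omega> + b * step_integral B l' \<omega>"
proof -
  have "step_integral B (scale_steps a l) \<omega> = a * step_integral B l \<omega>" for a l
    by (induction l) (auto simp: step_integral_def scale_steps_def algebra_simps)
  then show ?thesis by (simp add: step_integral_def)
qed

lemma step_function_L2: "step_function l \<in> L2"
proof (induction l)
  case Nil
  then show ?case by (simp add: step_function_def[abs_def] L2_zero)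
next
  case (Cons a l)
  obtain c u v where a: "a = (c, u, v)" by (cases a)
  have "step_function (a # l) = (\<lambda>s. c * indicator {u<..v} s + step_function l s)"
    by (simp add: a step_function_def[abs_def])
  then show ?case using L2_add[OF L2_scale[OF L2_indicator_Ioc] Cons] by simp
qed

text \<open>Independence of increments is assumed along infinite strictly increasing sequences, so a
  finite set of endpoints has to be continued beyond its largest element.\<close>

lemma finite_subset_strict_mono:
  fixes P :: "real set"
  assumes "finite P"
  obtains u :: "nat \<Rightarrow> real" and n where "strict_mono u" "P \<subseteq> u ` {..n}"
proof -
  \<comment> \<open>Inserting 0 keeps the list nonempty, so that \<open>last xs\<close> is
    meaningful also for empty \<open>P\<close>.\<close>
  define xs where "xs = sorted_list_of_set (insert 0 P)"
  have xs: "set xs = insert 0 P" "sorted_wrt (<) xs"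
    using assms unfolding xs_def by (simp_all only: set_sorted_list_of_set finite_insert strict_sorted_list_of_set)
  then have ne: "xs \<noteq> []" by auto
  define u where "u i = (if i < length xs then xs ! i else last xs + 1 + real i)" for i
  have last: "x \<le> last xs" if "x \<in> set xs" for x
  proof -
    obtain i where i: "i < length xs" "xs ! i = x" using \<open>x \<in> set xs\<close> by (auto simp: in_set_conv_nth)
    show ?thesis
    proof (cases "i = length xs - 1")
      case True
      then show ?thesis using i ne by (simp add: last_conv_nth)
    next
      case False
      then have "xs ! i < xs ! (length xs - 1)" using i by (intro sorted_wrt_nth_less[OF xs(2)]) auto
      then show ?thesis using i ne by (simp add: last_conv_nth)
    qed
  qed
  have "strict_mono u"
  proof (rule strict_monoI)
    fix i j :: nat assume "i < j"
    show "u i < u j"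
    proof (cases "j < length xs")
      case True
      then show ?thesis using \<open>i < j\<close> xs(2) by (simp add: u_def sorted_wrt_nth_less)
    next
      case False
      show ?thesis
      proof (cases "i < length xs")
        case True
        then have "xs ! i \<le> last xs" by (intro last) auto
        then show ?thesis using True False by (simp add: u_def)
      next
        case False' : False
        then show ?thesis using False \<open>i < j\<close> by (simp add: u_def)
      qed
    qed
  qed
  moreover have "P \<subseteq> u ` {..length xs}"
  proof
    fix x assume "x \<in> P"
    then have "x \<in> set xs" using xs by simp
    then obtain i where "i < length xs" "xs ! i = x" by (auto simp: in_set_conv_nth)
    then show "x \<in> u ` {..length xs}" by (auto simp: u_def intro!: image_eqI[of _ _ i])
  qed
  ultimately show ?thesis by (rule that)
qed

text \<open>
  Both the step function at a point and the step integral are sums \<open>\<Sum> c * (\<phi> v - \<phi> u)\<close>,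
  so they can be refined to a common partition simultaneously.
\<close>

lemma step_refine:
  assumes "strict_mono (w :: nat \<Rightarrow> real)" "ordered l" "\<And>c u v. (c, u, v) \<in> set l \<Longrightarrow> u \<in> w ` {..n} \<and> v \<in> w ` {..n}"
  shows "\<exists>d. \<forall>\<phi> :: real \<Rightarrow> real. (\<Sum>(c, u, v)\<leftarrow>l. c * (\<phi> v - \<phi> u)) = (\<Sum>i<n. d i * (\<phi> (w (Suc i)) - \<phi> (w i)))"
  using assms(2,3)
proof (induction l)
  case Nil
  show ?case by (rule exI[of _ "\<lambda>_. 0"]) simp
next
  case (Cons a l)
  obtain c u v where a: "a = (c, u, v)" by (cases a)
  obtain j k where jk: "u = w j" "v = w k" "j \<le> n" "k \<le> n" using Cons.prems(2)[of c u v] a by auto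
  have "j \<le> k" using Cons.prems(1) a jk assms(1) by (auto simp: strict_mono_less_eq)
  obtain d where d: "\<forall>\<phi> :: real \<Rightarrow> real. (\<Sum>(c, u, v)\<leftarrow>l. c * (\<phi> v - \<phi> u)) = (\<Sum>i<n. d i * (\<phi> (w (Suc i)) - \<phi> (w i)))"
  proof -
    have "ordered l" using Cons.prems(1) by simp
    moreover have "u \<in> w ` {..n} \<and> v \<in> w ` {..n}" if "(c, u, v) \<in> set l" for c u v
      using Cons.prems(2)[of c u v] that by simp
    ultimately show ?thesis using Cons.IH that by blast
  qed
  show ?case
  proof (intro exI[of _ "\<lambda>i. (if j \<le> i \<and> i < k then c else 0) + d i"] allI)
    fix \<phi> :: "real \<Rightarrow> real"
    have "(\<Sum>i<n. (if j \<le> i \<and> i < k then c else 0) * (\<phi> (w (Suc i)) - \<phi> (w i)))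
        = (\<Sum>i\<in>{j..<k}. c * (\<phi> (w (Suc i)) - \<phi> (w i)))"
      using jk by (intro sum.mono_neutral_cong_right) auto
    also have "\<dots> = c * (\<phi> v - \<phi> u)"
      using sum_Suc_diff'[OF \<open>j \<le> k\<close>, of "\<lambda>i. \<phi> (w i)"] jk by (simp add: sum_distrib_left[symmetric])
    finally show "(\<Sum>(c, u, v)\<leftarrow>a # l. c * (\<phi> v - \<phi> u)) =
        (\<Sum>i<n. ((if j \<le> i \<and> i < k then c else 0) + d i) * (\<phi> (w (Suc i)) - \<phi> (w i)))"
      using d by (simp add: a distrib_right sum.distrib)
  qed
qed

lemma step_partition:
  assumes "ordered l"
  obtains w :: "nat \<Rightarrow> real" and d n where "strict_mono w"
    "\<And>B :: real \<Rightarrow> 'w \<Rightarrow> real. \<And>\<omega>. step_integral B l \<omega> = (\<Sum>i<n. d i * (B (w (Suc i)) \<omega> - B (w i) \<omega>))"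
    "\<And>s. step_function l s = (\<Sum>i<n. d i * indicator {w i<..w (Suc i)} s)"
proof -
  have "finite ((\<lambda>(c, u, v). u) ` set l \<union> (\<lambda>(c, u, v). v) ` set l)" by simp
  then obtain w :: "nat \<Rightarrow> real" and n where w: "strict_mono w"
    "(\<lambda>(c, u, v). u) ` set l \<union> (\<lambda>(c, u, v). v) ` set l \<subseteq> w ` {..n}"
    by (rule finite_subset_strict_mono)
  have "\<exists>d. \<forall>\<phi> :: real \<Rightarrow> real. (\<Sum>(c, u, v)\<leftarrow>l. c * (\<phi> v - \<phi> u)) = (\<Sum>i<n. d i * (\<phi> (w (Suc i)) - \<phi> (w i)))"
    using w by (intro step_refine assms) force+
  then obtain d where d: "\<And>\<phi> :: real \<Rightarrow> real. (\<Sum>(c, u, v)\<leftarrow>l. c * (\<phi> v - \<phi> u)) = (\<Sum>i<n. d i * (\<phi> (w (Suc i)) - \<phi> (w i)))"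
    by blast
  show ?thesis
  proof
    show "strict_mono w" by fact
    show "step_integral B l \<omega> = (\<Sum>i<n. d i * (B (w (Suc i)) \<omega> - B (w i) \<omega>))"
      for B :: "real \<Rightarrow> 'w \<Rightarrow> real" and \<omega>
      unfolding step_integral_def using d[of "\<lambda>x. B x \<omega>"] by simp
    fix s
    \<comment> \<open>For this unit step at s the difference \<phi> v - \<phi> u is the indicator of
      {u<..v} at s. The order of the endpoints matters: for v < s and s <= u the difference would be
      -1.\<close>
    define \<phi> :: "real \<Rightarrow> real" where "\<phi> x = (if s \<le> x then 1 else 0)" for x
    have ind: "indicator {u<..v} s = \<phi> v - \<phi> u" if "u \<le> v" for u v
      using that by (auto simp: \<phi>_def indicator_def)
    have "step_function l s = (\<Sum>(c, u, v)\<leftarrow>l. c * (\<phi> v - \<phi> u))"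
      unfolding step_function_def using assms by (intro arg_cong[of _ _ sum_list] map_cong) (auto simp: ind)
    also have "\<dots> = (\<Sum>i<n. d i * indicator {w i<..w (Suc i)} s)"
      using w(1) by (subst d) (auto intro!: sum.cong simp: ind strict_mono_less_eq)
    finally show "step_function l s = (\<Sum>i<n. d i * indicator {w i<..w (Suc i)} s)" .
  qed
qed

lemma ip_partition:
  assumes "strict_mono (w :: nat \<Rightarrow> real)"
  shows "ip (\<lambda>s. \<Sum>i<n. d i * indicator {w i<..w (Suc i)} s) (\<lambda>s. \<Sum>i<n. d i * indicator {w i<..w (Suc i)} s)
    = (\<Sum>i<n. (d i)\<^sup>2 * (w (Suc i) - w i))"
proof -
  have lt: "w i < w (Suc i)" for i using assms by (simp add: strict_mono_less)
  have ii: "ip (indicator {w i<..w (Suc i)}) (indicator {w i<..w (Suc i)}) = w (Suc i) - w i" for i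
    using lt[of i] by (simp add: ip_def flip: indicator_inter_arith)
  have ij: "ip (indicator {w i<..w (Suc i)}) (indicator {w j<..w (Suc j)}) = 0" if "i \<noteq> j" for i j
  proof -
    have "{w i<..w (Suc i)} \<inter> {w j<..w (Suc j)} = {}"
    proof (cases "i < j")
      case True
      then have "w (Suc i) \<le> w j" using assms by (simp add: strict_mono_less_eq)
      then show ?thesis by auto
    next
      case False
      then have "w (Suc j) \<le> w i" using assms that by (simp add: strict_mono_less_eq)
      then show ?thesis by auto
    qed
    then have "(\<lambda>s. indicator {w i<..w (Suc i)} s * indicator {w j<..w (Suc j)} s) = (\<lambda>s. 0 :: real)"
      unfolding indicator_inter_arith[symmetric] by (simp only: indicator_def empty_iff if_False of_bool_eq)
    then show ?thesis by (simp add: ip_def)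
  qed
  have "(\<Sum>j<n. d i * d j * ip (indicator {w i<..w (Suc i)}) (indicator {w j<..w (Suc j)}))
      = (d i)\<^sup>2 * (w (Suc i) - w i)" if "i < n" for i
    using that ij by (subst sum.remove[of _ i]) (auto simp: ii power2_eq_square)
  then show ?thesis by (subst ip_sum_sum) (auto intro!: L2_indicator_Ioc sum.cong)
qed

section \<open>Gaussian law, isometry and linearity of the Wiener integral\<close>

context two_sided_brownian_motion
begin

declare B_measurable [measurable]

lemma gauss_increment: "s < t \<Longrightarrow> gauss M (\<lambda>\<omega>. B t \<omega> - B s \<omega>) (t - s)"
proof -
  assume st: "s < t"
  define \<sigma> where "\<sigma> = sqrt (t - s)"
  have s: "\<sigma> > 0" "\<sigma>\<^sup>2 = t - s" using st by (auto simp: \<sigma>_def)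
  have "distributed M lborel (\<lambda>\<omega>. B t \<omega> - B s \<omega>) (normal_density 0 \<sigma>)"
    using B_increment_normal[OF st] unfolding \<sigma>_def .
  then have "distributed M lborel (\<lambda>\<omega>. (B t \<omega> - B s \<omega> - 0) / \<sigma>) std_normal_density"
    by (simp only: normal_standard_normal_convert[OF s(1)])
  then have "distr M lborel (\<lambda>\<omega>. (B t \<omega> - B s \<omega>) / \<sigma>) = std_normal_distribution"
    by (simp add: distributed_def)
  moreover have "distr M lborel (\<lambda>\<omega>. (B t \<omega> - B s \<omega>) / \<sigma>) = distr M borel (\<lambda>\<omega>. (B t \<omega> - B s \<omega>) / \<sigma>)"
    by (rule distr_cong) auto
  ultimately have "gauss M (\<lambda>\<omega>. (B t \<omega> - B s \<omega>) / \<sigma>) 1"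
    by (simp add: gauss_def char_std_normal_distribution)
  from gauss_scale[OF this, of \<sigma>] show ?thesis using s by simp
qed

text \<open>Independence of the increments enters here, and only here: the characteristic function
  of the sum is the product of those of its terms.\<close>

lemma gauss_partition:
  assumes "strict_mono (w :: nat \<Rightarrow> real)"
  shows "gauss M (\<lambda>\<omega>. \<Sum>i<n. d i * (B (w (Suc i)) \<omega> - B (w i) \<omega>)) (\<Sum>i<n. (d i)\<^sup>2 * (w (Suc i) - w i))"
proof -
  have g: "gauss M (\<lambda>\<omega>. d i * (B (w (Suc i)) \<omega> - B (w i) \<omega>)) ((d i)\<^sup>2 * (w (Suc i) - w i))" for i
    using assms by (intro gauss_scale gauss_increment) (simp add: strict_mono_less)
  have "indep_vars (\<lambda>_. borel) (\<lambda>i \<omega>. d i * (B (w (Suc i)) \<omega> - B (w i) \<omega>)) {..<n}"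
  proof -
    have "indep_vars (\<lambda>_. borel) (\<lambda>i \<omega>. B (w (Suc i)) \<omega> - B (w i) \<omega>) {..<n}"
      using B_increments_indep[OF assms] by (rule indep_vars_subset) simp
    from indep_vars_compose2[OF this, of "\<lambda>i x. d i * x" "\<lambda>_. borel"] show ?thesis by simp
  qed
  note char = char_distr_sum[OF this]
  have "char (distr M borel (\<lambda>\<omega>. \<Sum>i<n. d i * (B (w (Suc i)) \<omega> - B (w i) \<omega>))) t
    = complex_of_real (exp (- ((\<Sum>i<n. (d i)\<^sup>2 * (w (Suc i) - w i)) * t\<^sup>2) / 2))" for t
  proof -
    have "(\<Prod>i<n. exp (- ((d i)\<^sup>2 * (w (Suc i) - w i) * t\<^sup>2) / 2))
        = exp (- ((\<Sum>i<n. (d i)\<^sup>2 * (w (Suc i) - w i)) * t\<^sup>2) / 2)"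
      by (subst exp_sum[symmetric]) (auto simp: sum_negf sum_divide_distrib sum_distrib_right)
    moreover have "char (distr M borel (\<lambda>\<omega>. d i * (B (w (Suc i)) \<omega> - B (w i) \<omega>))) t
        = complex_of_real (exp (- ((d i)\<^sup>2 * (w (Suc i) - w i) * t\<^sup>2) / 2))" for i
      using g unfolding gauss_def by blast
    ultimately show ?thesis unfolding char
      by (simp only: flip: of_real_prod)
  qed
  then show ?thesis unfolding gauss_def by simp
qed

lemma gauss_step_integral:
  assumes "ordered l"
  shows "gauss M (step_integral B l) (ip (step_function l) (step_function l))"
proof -
  obtain w :: "nat \<Rightarrow> real" and d n where w: "strict_mono w"
    "\<And>B :: real \<Rightarrow> 'w \<Rightarrow> real. \<And>\<omega>. step_integral B l \<omega> = (\<Sum>i<n. d i * (B (w (Suc i)) \<omega> - B (w i) \<omega>))"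
    "\<And>s. step_function l s = (\<Sum>i<n. d i * indicator {w i<..w (Suc i)} s)"
    by (rule step_partition[OF assms, where 'w = 'w]) (rule that)
  have "step_integral B l = (\<lambda>\<omega>. \<Sum>i<n. d i * (B (w (Suc i)) \<omega> - B (w i) \<omega>))"
    by (intro ext w(2))
  moreover have "step_function l = (\<lambda>s. \<Sum>i<n. d i * indicator {w i<..w (Suc i)} s)"
    by (intro ext w(3))
  ultimately show ?thesis using gauss_partition[OF w(1)] ip_partition[OF w(1)] by simp
qed

text \<open>The difference of two step integrals is again one, of a concatenated list, and its
  second moment is its Gaussian variance.\<close>

lemma step_integral_isometry:
  assumes "ordered l" "ordered l'"
  shows "(\<integral>\<^sup>+ \<omega>. ennreal ((step_integral B l \<omega> - step_integral B l' \<omega>)\<^sup>2) \<partial>M)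
    = (\<integral>\<^sup>+ s. ennreal ((step_function l s - step_function l' s)\<^sup>2) \<partial>lborel)"
proof -
  let ?l = "scale_steps 1 l @ scale_steps (-1) l'"
  have o: "ordered ?l" using assms by (rule ordered_comb)
  have g: "gauss M (step_integral B ?l) (ip (step_function ?l) (step_function ?l))"
    by (rule gauss_step_integral[OF o])
  have "(\<integral>\<^sup>+ \<omega>. ennreal ((step_integral B ?l \<omega>)\<^sup>2) \<partial>M) = ennreal (ip (step_function ?l) (step_function ?l))"
    using gauss_variance[OF g ip_self_nonneg] by (simp add: nn_integral_eq_integral)
  also have "\<dots> = (\<integral>\<^sup>+ s. ennreal ((step_function ?l s)\<^sup>2) \<partial>lborel)"
    by (rule nn_integral_eq_ip[symmetric, OF step_function_L2])
  finally show ?thesis by (simp add: step_integral_comb step_function_comb)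
qed

text \<open>The approximating step integrals are Gaussian with variance equal to the squared norm of
  the step function. With error e this is |f|^2 - 2 <f, e> + |e|^2, which tends to |f|^2 by
  Cauchy-Schwarz.\<close>

lemma has_wiener_integral_gauss:
  assumes "has_wiener_integral M B f X"
  shows "f \<in> L2" "gauss M X (ip f f)"
proof -
  obtain l where l: "\<And>n. ordered (l n)"
    "(\<lambda>n. \<integral>\<^sup>+ s. ennreal ((f s - step_function (l n) s)\<^sup>2) \<partial>lborel) \<longlonglongrightarrow> 0"
    "(\<lambda>n. \<integral>\<^sup>+ \<omega>. ennreal ((X \<omega> - step_integral B (l n) \<omega>)\<^sup>2) \<partial>M) \<longlonglongrightarrow> 0"
    and [measurable]: "f \<in> borel_measurable borel" "X \<in> borel_measurable M"
    using assms unfolding has_wiener_integral_def by auto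
  have [measurable]: "step_function l \<in> borel_measurable borel" for l
    using step_function_L2[of l] by (simp add: L2_def)
  \<comment> \<open>A sequence in \<open>ennreal\<close> that tends to 0 is finite from some index
    on; one such index shows that \<open>f\<close> differs from a step function by an element of
    \<open>L2\<close>.\<close>
  have ev: "eventually (\<lambda>n. (\<lambda>s. f s - step_function (l n) s) \<in> L2) sequentially"
    using order_tendstoD(2)[OF l(2), of \<infinity>] by (auto simp: L2_iff_nn_integral elim!: eventually_mono)
  then obtain n where "(\<lambda>s. f s - step_function (l n) s) \<in> L2"
    by (auto simp: eventually_sequentially)
  from L2_add[OF this step_function_L2[of "l n"]] show f: "f \<in> L2" by simp
  let ?e = "\<lambda>n s. f s - step_function (l n) s"
  have e: "?e n \<in> L2" for n by (intro L2_diff f step_function_L2)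
  have e0: "(\<lambda>n. ip (?e n) (?e n)) \<longlonglongrightarrow> 0"
    using l(2) unfolding nn_integral_eq_ip[OF e] by (simp add: ip_self_nonneg flip: ennreal_0)
  have fe: "(\<lambda>n. ip f (?e n)) \<longlonglongrightarrow> 0"
  proof (rule tendsto_sandwich)
    have b: "\<bar>ip f (?e n)\<bar> \<le> sqrt (ip f f * ip (?e n) (?e n))" for n
      using ip_Cauchy_Schwarz[OF f e[of n]] by (rule real_le_rsqrt[of "\<bar>_\<bar>", unfolded power2_abs])
    show "eventually (\<lambda>n. - sqrt (ip f f * ip (?e n) (?e n)) \<le> ip f (?e n)) sequentially"
      using b by (auto simp: abs_le_iff intro!: always_eventually) (metis minus_le_iff)
    show "eventually (\<lambda>n. ip f (?e n) \<le> sqrt (ip f f * ip (?e n) (?e n))) sequentially"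
      using b by (auto simp: abs_le_iff intro!: always_eventually)
    have "(\<lambda>n. sqrt (ip f f * ip (?e n) (?e n))) \<longlonglongrightarrow> sqrt (ip f f * 0)" by (intro tendsto_intros e0)
    then show "(\<lambda>n. sqrt (ip f f * ip (?e n) (?e n))) \<longlonglongrightarrow> 0" by simp
    then show "(\<lambda>n. - sqrt (ip f f * ip (?e n) (?e n))) \<longlonglongrightarrow> 0" using tendsto_minus by fastforce
  qed
  have "ip (step_function (l n)) (step_function (l n)) = ip f f - 2 * ip f (?e n) + ip (?e n) (?e n)" for n
    using f step_function_L2[of "l n"]
    by (simp add: ip_diff_left ip_diff_right L2_diff ip_commute[of "step_function (l n)" f])
  moreover have "(\<lambda>n. ip f f - 2 * ip f (?e n) + ip (?e n) (?e n)) \<longlonglongrightarrow> ip f f - 2 * 0 + 0"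
    by (intro tendsto_intros fe e0)
  ultimately have lim: "(\<lambda>n. ip (step_function (l n)) (step_function (l n))) \<longlonglongrightarrow> ip f f" by simp
  show "gauss M X (ip f f)"
    by (rule gauss_limit[OF gauss_step_integral[OF l(1)] _ l(3) lim]) simp
qed

lemma has_wiener_integral_comb:
  assumes "has_wiener_integral M B f X" "has_wiener_integral M B g Y"
  shows "has_wiener_integral M B (\<lambda>s. a * f s + b * g s) (\<lambda>\<omega>. a * X \<omega> + b * Y \<omega>)"
proof -
  obtain l where l: "\<And>n. ordered (l n)"
    "(\<lambda>n. \<integral>\<^sup>+ s. ennreal ((f s - step_function (l n) s)\<^sup>2) \<partial>lborel) \<longlonglongrightarrow> 0"
    "(\<lambda>n. \<integral>\<^sup>+ \<omega>. ennreal ((X \<omega> - step_integral B (l n) \<omega>)\<^sup>2) \<partial>M) \<longlonglongrightarrow> 0"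
    and [measurable]: "f \<in> borel_measurable borel" "X \<in> borel_measurable M"
    using assms(1) unfolding has_wiener_integral_def by auto
  obtain l' where l': "\<And>n. ordered (l' n)"
    "(\<lambda>n. \<integral>\<^sup>+ s. ennreal ((g s - step_function (l' n) s)\<^sup>2) \<partial>lborel) \<longlonglongrightarrow> 0"
    "(\<lambda>n. \<integral>\<^sup>+ \<omega>. ennreal ((Y \<omega> - step_integral B (l' n) \<omega>)\<^sup>2) \<partial>M) \<longlonglongrightarrow> 0"
    and [measurable]: "g \<in> borel_measurable borel" "Y \<in> borel_measurable M"
    using assms(2) unfolding has_wiener_integral_def by auto
  have [measurable]: "step_function l \<in> borel_measurable borel" for l
    using step_function_L2[of l] by (simp add: L2_def)
  have [measurable]: "step_integral B (l n) \<in> borel_measurable M" "step_integral B (l' n) \<in> borel_measurable M" for n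
    using gauss_step_integral l(1) l'(1) by (auto simp: gauss_def)
  have aux: "(\<lambda>n. \<integral>\<^sup>+ s. ennreal ((a * p s + b * q s - (a * p' n s + b * q' n s))\<^sup>2) \<partial>N) \<longlonglongrightarrow> 0"
    if [measurable]: "p \<in> borel_measurable N" "q \<in> borel_measurable N" "\<And>n. p' n \<in> borel_measurable N" "\<And>n. q' n \<in> borel_measurable N"
      and lim: "(\<lambda>n. \<integral>\<^sup>+ s. ennreal ((p s - p' n s)\<^sup>2) \<partial>N) \<longlonglongrightarrow> 0" "(\<lambda>n. \<integral>\<^sup>+ s. ennreal ((q s - q' n s)\<^sup>2) \<partial>N) \<longlonglongrightarrow> 0"
    for p q :: "'c \<Rightarrow> real" and p' q' N
  proof (rule tendsto_sandwich[OF _ _ tendsto_const])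
    let ?I = "\<lambda>n. ennreal (2 * a\<^sup>2) * (\<integral>\<^sup>+ s. ennreal ((p s - p' n s)\<^sup>2) \<partial>N) + ennreal (2 * b\<^sup>2) * (\<integral>\<^sup>+ s. ennreal ((q s - q' n s)\<^sup>2) \<partial>N)"
    have "(\<integral>\<^sup>+ s. ennreal ((a * p s + b * q s - (a * p' n s + b * q' n s))\<^sup>2) \<partial>N) \<le> ?I n" for n
      by (rule nn_integral_square_comb) measurable
    then show "eventually (\<lambda>n. (\<integral>\<^sup>+ s. ennreal ((a * p s + b * q s - (a * p' n s + b * q' n s))\<^sup>2) \<partial>N) \<le> ?I n) sequentially"
      by simp
    have "?I \<longlonglongrightarrow> ennreal (2 * a\<^sup>2) * 0 + ennreal (2 * b\<^sup>2) * 0"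
      by (intro tendsto_add ennreal_tendsto_cmult lim) auto
    then show "?I \<longlonglongrightarrow> 0" by simp
  qed simp
  show ?thesis unfolding has_wiener_integral_def
  proof (intro conjI exI[of _ "\<lambda>n. scale_steps a (l n) @ scale_steps b (l' n)"] allI)
    show "ordered (scale_steps a (l n) @ scale_steps b (l' n))" for n
      using l(1) l'(1) by (rule ordered_comb)
    show "(\<lambda>n. \<integral>\<^sup>+ s. ennreal ((a * f s + b * g s - step_function (scale_steps a (l n) @ scale_steps b (l' n)) s)\<^sup>2) \<partial>lborel) \<longlonglongrightarrow> 0"
      unfolding step_function_comb by (rule aux) (auto intro: l l')
    show "(\<lambda>n. \<integral>\<^sup>+ \<omega>. ennreal ((a * X \<omega> + b * Y \<omega> - step_integral B (scale_steps a (l n) @ scale_steps b (l' n)) \<omega>)\<^sup>2) \<partial>M) \<longlonglongrightarrow> 0"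
      unfolding step_integral_comb by (rule aux) (auto intro: l l')
  qed auto
qed

lemma has_wiener_integral_zero: "has_wiener_integral M B (\<lambda>s. 0) (\<lambda>\<omega>. 0)"
  unfolding has_wiener_integral_def
  by (auto intro!: exI[of _ "\<lambda>_. []"] simp: step_function_def step_integral_def)

lemma has_wiener_integral_add:
  "has_wiener_integral M B f X \<Longrightarrow> has_wiener_integral M B g Y \<Longrightarrow>
    has_wiener_integral M B (\<lambda>s. f s + g s) (\<lambda>\<omega>. X \<omega> + Y \<omega>)"
  using has_wiener_integral_comb[of f X g Y 1 1] by simp

lemma has_wiener_integral_scale:
  "has_wiener_integral M B f X \<Longrightarrow> has_wiener_integral M B (\<lambda>s. c * f s) (\<lambda>\<omega>. c * X \<omega>)"
  using has_wiener_integral_comb[of f X "\<lambda>s. 0" "\<lambda>\<omega>. 0" c 1] has_wiener_integral_zero by simp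

lemma has_wiener_integral_sum:
  "(\<And>i. i \<in> I \<Longrightarrow> has_wiener_integral M B (f i) (X i)) \<Longrightarrow>
    has_wiener_integral M B (\<lambda>s. \<Sum>i\<in>I. f i s) (\<lambda>\<omega>. \<Sum>i\<in>I. X i \<omega>)"
  by (induction I rule: infinite_finite_induct)
    (auto intro: has_wiener_integral_zero has_wiener_integral_add)

lemma has_wiener_integral_increment:
  assumes "s \<le> t"
  shows "has_wiener_integral M B (indicator {s<..t}) (\<lambda>\<omega>. B t \<omega> - B s \<omega>)"
  unfolding has_wiener_integral_def using assms
  by (auto intro!: exI[of _ "\<lambda>_. [(1, s, t)]"] simp: step_function_def step_integral_def)

lemma has_wiener_integral_cong:
  assumes X: "has_wiener_integral M B f X" and f: "AE s in lborel. f s = g s" and g [measurable]: "g \<in> borel_measurable borel"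
    and XY: "AE \<omega> in M. X \<omega> = Y \<omega>" and Y [measurable]: "Y \<in> borel_measurable M"
  shows "has_wiener_integral M B g Y"
proof -
  have 1: "(\<integral>\<^sup>+ s. ennreal ((f s - step_function l s)\<^sup>2) \<partial>lborel) = (\<integral>\<^sup>+ s. ennreal ((g s - step_function l s)\<^sup>2) \<partial>lborel)" for l
    using f by (intro nn_integral_cong_AE) auto
  have 2: "(\<integral>\<^sup>+ \<omega>. ennreal ((X \<omega> - step_integral B l \<omega>)\<^sup>2) \<partial>M) = (\<integral>\<^sup>+ \<omega>. ennreal ((Y \<omega> - step_integral B l \<omega>)\<^sup>2) \<partial>M)" for l
    using XY by (intro nn_integral_cong_AE) auto
  show ?thesis using X unfolding has_wiener_integral_def 1 2 by auto
qed

end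

subsection \<open>Existence of the Wiener integral\<close>

text \<open>Being an \<open>ennreal\<close>, it makes sense before membership in \<open>L2\<close>
  is known. As it is a squared distance, its triangle inequality carries a factor 2.\<close>

definition sqdist :: "(real \<Rightarrow> real) \<Rightarrow> (real \<Rightarrow> real) \<Rightarrow> ennreal" where
  "sqdist f g = (\<integral>\<^sup>+ s. ennreal ((f s - g s)\<^sup>2) \<partial>lborel)"

lemma ennreal_double: "0 \<le> x \<Longrightarrow> 2 * ennreal x = ennreal (2 * x)"
  by (subst ennreal_mult) auto

lemma sqdist_triangle:
  assumes [measurable]: "f \<in> borel_measurable borel" "g \<in> borel_measurable borel" "h \<in> borel_measurable borel"
  shows "sqdist f h \<le> 2 * sqdist f g + 2 * sqdist g h"
  using nn_integral_square_comb[of f lborel g g h 1 1] by (simp add: sqdist_def)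

text \<open>The L2 closure of the step functions, which turns out to contain all of
  \<open>L2\<close>.\<close>

definition steppable :: "(real \<Rightarrow> real) \<Rightarrow> bool" where
  "steppable f \<longleftrightarrow> f \<in> borel_measurable borel \<and> (\<forall>e>0. \<exists>l. ordered l \<and> sqdist f (step_function l) < ennreal e)"

lemma step_function_measurable [measurable]: "step_function l \<in> borel_measurable borel"
  using step_function_L2[of l] by (simp add: L2_def)

lemma steppable_step_function: "ordered l \<Longrightarrow> steppable (step_function l)"
  by (auto simp: steppable_def sqdist_def)

lemma steppable_limit:
  assumes [measurable]: "f \<in> borel_measurable borel" and g: "\<And>n :: nat. steppable (g n)"
    and lim: "(\<lambda>n. sqdist f (g n)) \<longlonglongrightarrow> 0"
  shows "steppable f"
  unfolding steppable_def
proof (intro conjI allI impI)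
  fix e :: real assume e: "e > 0"
  have [measurable]: "g n \<in> borel_measurable borel" for n using g by (simp add: steppable_def)
  obtain n where n: "sqdist f (g n) < ennreal (e / 4)"
    using order_tendstoD(2)[OF lim, of "ennreal (e / 4)"] e by (auto simp: eventually_sequentially)
  obtain l where l: "ordered l" "sqdist (g n) (step_function l) < ennreal (e / 4)"
    using g[of n] e unfolding steppable_def by (meson divide_pos_pos zero_less_numeral)
  have "sqdist f (step_function l) \<le> 2 * sqdist f (g n) + 2 * sqdist (g n) (step_function l)"
    by (rule sqdist_triangle) auto
  also have "\<dots> < 2 * ennreal (e / 4) + 2 * ennreal (e / 4)"
    using n l(2) by (intro add_strict_mono ennreal_mult_strict_left_mono) auto
  also have "\<dots> = ennreal (2 * (e / 4) + 2 * (e / 4))" using e by (simp add: ennreal_double flip: ennreal_plus)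
  also have "\<dots> = ennreal e" by simp
  finally show "\<exists>l. ordered l \<and> sqdist f (step_function l) < ennreal e" using l(1) by blast
qed simp

lemma steppable_comb:
  assumes "steppable f" "steppable g"
  shows "steppable (\<lambda>s. a * f s + b * g s)"
proof -
  have [measurable]: "f \<in> borel_measurable borel" "g \<in> borel_measurable borel"
    using assms by (auto simp: steppable_def)
  have "\<exists>l. ordered l \<and> sqdist f (step_function l) < ennreal (1 / real (Suc n))" for n
    using assms(1) unfolding steppable_def by simp
  then obtain l where l: "\<And>n. ordered (l n)" "\<And>n. sqdist f (step_function (l n)) < ennreal (1 / real (Suc n))"
    by metis
  have "\<exists>l. ordered l \<and> sqdist g (step_function l) < ennreal (1 / real (Suc n))" for n
    using assms(2) unfolding steppable_def by simp
  then obtain l' where l': "\<And>n. ordered (l' n)" "\<And>n. sqdist g (step_function (l' n)) < ennreal (1 / real (Suc n))"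
    by metis
  let ?c = "2 * a\<^sup>2 + 2 * b\<^sup>2"
  show ?thesis
  proof (rule steppable_limit)
    show "steppable (step_function (scale_steps a (l n) @ scale_steps b (l' n)))" for n
      by (intro steppable_step_function ordered_comb l l')
    show "(\<lambda>n. sqdist (\<lambda>s. a * f s + b * g s) (step_function (scale_steps a (l n) @ scale_steps b (l' n)))) \<longlonglongrightarrow> 0"
    proof (rule tendsto_sandwich[OF _ _ tendsto_const])
      have "sqdist (\<lambda>s. a * f s + b * g s) (step_function (scale_steps a (l n) @ scale_steps b (l' n)))
          \<le> ennreal ?c * ennreal (1 / real (Suc n))" for n
      proof -
        have "sqdist (\<lambda>s. a * f s + b * g s) (step_function (scale_steps a (l n) @ scale_steps b (l' n)))
            \<le> ennreal (2 * a\<^sup>2) * sqdist f (step_function (l n)) + ennreal (2 * b\<^sup>2) * sqdist g (step_function (l' n))"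
          unfolding sqdist_def step_function_comb by (rule nn_integral_square_comb) auto
        also have "\<dots> \<le> ennreal (2 * a\<^sup>2) * ennreal (1 / real (Suc n)) + ennreal (2 * b\<^sup>2) * ennreal (1 / real (Suc n))"
          by (intro add_mono mult_left_mono) (use l l' in \<open>auto intro: less_imp_le\<close>)
        also have "\<dots> = ennreal ?c * ennreal (1 / real (Suc n))" by (simp add: distrib_right)
        finally show ?thesis .
      qed
      then show "eventually (\<lambda>n. sqdist (\<lambda>s. a * f s + b * g s) (step_function (scale_steps a (l n) @ scale_steps b (l' n)))
          \<le> ennreal ?c * ennreal (1 / real (Suc n))) sequentially" by simp
      have "(\<lambda>n. ennreal (1 / real (Suc n))) \<longlonglongrightarrow> ennreal 0"
        using LIMSEQ_inverse_real_of_nat by (intro tendsto_ennrealI) (simp add: inverse_eq_divide)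
      then have "(\<lambda>n. ennreal ?c * ennreal (1 / real (Suc n))) \<longlonglongrightarrow> ennreal ?c * ennreal 0"
        by (intro ennreal_tendsto_cmult) auto
      then show "(\<lambda>n. ennreal ?c * ennreal (1 / real (Suc n))) \<longlonglongrightarrow> 0" by simp
    qed simp
  qed simp
qed

lemma steppable_zero: "steppable (\<lambda>s. 0)"
  using steppable_step_function[of "[]"] by (simp add: step_function_def[abs_def])

lemma steppable_scale: "steppable f \<Longrightarrow> steppable (\<lambda>s. c * f s)"
  using steppable_comb[OF _ steppable_zero, of f c 0] by simp

lemma steppable_sum: "(\<And>i. i \<in> I \<Longrightarrow> steppable (f i)) \<Longrightarrow> steppable (\<lambda>s. \<Sum>i\<in>I. f i s)"
proof (induction I rule: infinite_finite_induct)
  case (insert x F)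
  then show ?case using steppable_comb[of "f x" "\<lambda>s. \<Sum>i\<in>F. f i s" 1 1] by simp
qed (auto intro: steppable_zero)

lemma steppable_Ioc: "u \<le> v \<Longrightarrow> steppable (indicator {u<..v})"
  using steppable_step_function[of "[(1, u, v)]"] by (simp add: step_function_def[abs_def])

text \<open>Induction over the Dynkin system generated by the half-lines. Cutting at N makes
  complements differences of approximable indicators and supplies the finite measure needed for
  continuity from above.\<close>

lemma steppable_indicator:
  assumes "A \<in> sets borel"
  shows "steppable (indicator (A \<inter> {- real N<..real N}))"
proof -
  let ?J = "{- real N<..real N}"
  have "A \<in> sigma_sets UNIV (range (\<lambda>a. {..a :: real}))"
    using assms by (simp add: borel_eq_atMost)
  have "Int_stable (range (\<lambda>a. {..a :: real}))" by (auto simp: Int_stable_def)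
  moreover have "range (\<lambda>a. {..a :: real}) \<subseteq> Pow UNIV" by simp
  moreover note \<open>A \<in> sigma_sets _ _\<close>
  ultimately show ?thesis
  proof (induction rule: sigma_sets_induct_disjoint)
    case (basic A)
    then obtain a where a: "A = {..a}" by auto
    show ?case
    proof (cases "- real N \<le> min a (real N)")
      case True
      have "A \<inter> ?J = {- real N<..min a (real N)}" unfolding a by auto
      then show ?thesis using steppable_Ioc[OF True] by simp
    next
      case False
      then have "A \<inter> ?J = {}" unfolding a by auto
      then show ?thesis using steppable_zero by simp
    qed
  next
    case empty
    then show ?case using steppable_zero by simp
  next
    case (compl A)
    have "indicator ((UNIV - A) \<inter> ?J) = (\<lambda>s. 1 * indicator ?J s + (-1) * indicator (A \<inter> ?J) s :: real)"
      by (auto simp: indicator_def)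
    then show ?case using steppable_comb[OF steppable_Ioc[of "- real N" "real N"] compl(2), of 1 "-1"] by simp
  next
    case (union A)
    have mA: "A i \<in> sets borel" for i
    proof -
      have "A i \<in> sigma_sets UNIV (range (\<lambda>a. {..a :: real}))" using union(2) by blast
      then show ?thesis by (simp add: borel_eq_atMost)
    qed
    then have [measurable]: "(\<Union>i. A i) \<in> sets borel" by blast
    \<comment> \<open>What the first n sets leave uncovered. Its measure is the squared distance to
      the n-th partial sum, and these remainders decrease to the empty set.\<close>
    let ?D = "\<lambda>n. ((\<Union>i. A i) - (\<Union>i<n. A i)) \<inter> ?J"
    show ?case
    proof (rule steppable_limit)
      show "steppable (\<lambda>s. \<Sum>i<n. indicator (A i \<inter> ?J) s)" for n
        by (intro steppable_sum union(3))
      have e: "sqdist (indicator (\<Union> (range A) \<inter> ?J)) (\<lambda>s. \<Sum>i<n. indicator (A i \<inter> ?J) s) = emeasure lborel (?D n)" for n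
      proof -
        have "ennreal ((indicator (\<Union> (range A) \<inter> ?J) s - (\<Sum>i<n. indicator (A i \<inter> ?J) s))\<^sup>2) = indicator (?D n) s" for s
        proof -
          have "disjoint_family_on (\<lambda>i. A i \<inter> ?J) {..<n}"
            using union(1) by (auto simp: disjoint_family_on_def)
          then have "(\<Sum>i<n. indicator (A i \<inter> ?J) s :: real) = indicator (\<Union>i<n. A i \<inter> ?J) s"
            by (subst indicator_UN_disjoint) auto
          then show ?thesis by (auto simp: indicator_def)
        qed
        then show ?thesis unfolding sqdist_def using mA
          by (simp add: sets.finite_UN sets.Diff sets.Int)
      qed
      have "(\<lambda>n. emeasure lborel (?D n)) \<longlonglongrightarrow> emeasure lborel (\<Inter>n. ?D n)"
      proof (rule Lim_emeasure_decseq)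
        show "range ?D \<subseteq> sets lborel" using mA by auto
        show "decseq ?D" by (force simp: decseq_def)
        fix n
        have "emeasure lborel (?D n) \<le> emeasure lborel ?J" by (rule emeasure_mono) auto
        also have "\<dots> < \<infinity>" by simp
        finally show "emeasure lborel (?D n) \<noteq> \<infinity>" by simp
      qed
      also have "(\<Inter>n. ?D n) = {}" by auto
      finally show "(\<lambda>n. sqdist (indicator (\<Union> (range A) \<inter> ?J)) (\<lambda>s. \<Sum>i<n. indicator (A i \<inter> ?J) s)) \<longlonglongrightarrow> 0"
        unfolding e by simp
    qed simp
  qed
qed

text \<open>Simple functions converging pointwise with absolute value at most 2 |f|, cut to the
  interval (-i, i], differ from f by at most 3 |f|; hence the dominating function 9 f^2.\<close>

lemma L2_steppable:
  assumes f: "f \<in> L2"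
  shows "steppable f"
proof -
  have fm [measurable]: "f \<in> borel_measurable borel" using f by (simp add: L2_def)
  have "f \<in> borel_measurable lborel" by simp
  from borel_measurable_implies_sequence_metric[OF this, of 0] obtain F where
    F: "\<And>i. simple_function lborel (F i)" "\<And>x. (\<lambda>i. F i x) \<longlonglongrightarrow> f x" "\<And>i x. dist (F i x) 0 \<le> 2 * dist (f x) 0"
    by auto
  have Fm [measurable]: "F i \<in> borel_measurable borel" for i
    using borel_measurable_simple_function[OF F(1)] by simp
  let ?J = "\<lambda>i::nat. {- real i<..real i}"
  let ?g = "\<lambda>i s. indicator (?J i) s * F i s"
  have g: "steppable (?g i)" for i
  proof -
    have fin: "finite (range (F i))" using simple_functionD(1)[OF F(1)] by simp
    have "?g i = (\<lambda>s. \<Sum>y\<in>range (F i). y * indicator (F i -` {y} \<inter> ?J i) s)"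
    proof
      fix s
      have "F i s = (\<Sum>y\<in>range (F i). indicator (F i -` {y}) s *\<^sub>R y)"
        using simple_function_indicator_representation_banach[OF F(1), of s i]
        by (simp only: space_lborel space_borel Int_UNIV_right UNIV_I simp_thms)
      then have "?g i s = (\<Sum>y\<in>range (F i). indicator (?J i) s * (indicator (F i -` {y}) s *\<^sub>R y))"
        by (simp only: sum_distrib_left)
      also have "\<dots> = (\<Sum>y\<in>range (F i). y * indicator (F i -` {y} \<inter> ?J i) s)"
        by (intro sum.cong refl) (simp add: indicator_inter_arith del: vimage_singleton_eq)
      finally show "?g i s = (\<Sum>y\<in>range (F i). y * indicator (F i -` {y} \<inter> ?J i) s)" .
    qed
    moreover have "F i -` {y} \<in> sets borel" for y
      using measurable_sets[OF Fm, of "{y}"] by simp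
    ultimately show ?thesis by (auto intro!: steppable_sum steppable_scale steppable_indicator)
  qed
  show ?thesis
  proof (rule steppable_limit[OF fm g])
    have "(\<lambda>i. \<integral>\<^sup>+ s. ennreal ((f s - ?g i s)\<^sup>2) \<partial>lborel) \<longlonglongrightarrow> integral\<^sup>N lborel (\<lambda>s :: real. 0)"
    proof (rule nn_integral_dominated_convergence[where w = "\<lambda>s. ennreal (9 * (f s)\<^sup>2)"])
      show "AE s in lborel. ennreal ((f s - ?g i s)\<^sup>2) \<le> ennreal (9 * (f s)\<^sup>2)" for i
      proof (rule AE_I2, rule ennreal_leI)
        fix s
        have "\<bar>F i s\<bar> \<le> 2 * \<bar>f s\<bar>" using F(3)[of i s] by simp
        then have "\<bar>f s - ?g i s\<bar> \<le> \<bar>3 * f s\<bar>" by (auto simp: indicator_def)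
        then have "(f s - ?g i s)\<^sup>2 \<le> (3 * f s)\<^sup>2" by (simp only: abs_le_square_iff)
        then show "(f s - ?g i s)\<^sup>2 \<le> 9 * (f s)\<^sup>2" by (simp add: power_mult_distrib)
      qed
      have "integrable lborel (\<lambda>s. 9 * (f s)\<^sup>2)" using f by (auto simp: L2_def)
      then show "(\<integral>\<^sup>+ s. ennreal (9 * (f s)\<^sup>2) \<partial>lborel) < \<infinity>"
        by (subst nn_integral_eq_integral) auto
      show "AE s in lborel. (\<lambda>i. ennreal ((f s - ?g i s)\<^sup>2)) \<longlonglongrightarrow> 0"
      proof (rule AE_I2)
        fix s
        have "(\<lambda>i. ?g i s) \<longlonglongrightarrow> 1 * f s"
        proof (rule tendsto_mult[OF _ F(2)], rule tendsto_eventually)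
          obtain n where n: "\<bar>s\<bar> < real n" using reals_Archimedean2 by blast
          show "eventually (\<lambda>i. indicator (?J i) s = (1 :: real)) sequentially"
            using n by (auto simp: eventually_sequentially indicator_def intro!: exI[of _ n])
        qed
        then have "(\<lambda>i. (f s - ?g i s)\<^sup>2) \<longlonglongrightarrow> (f s - 1 * f s)\<^sup>2"
          by (intro tendsto_power tendsto_diff tendsto_const)
        then show "(\<lambda>i. ennreal ((f s - ?g i s)\<^sup>2)) \<longlonglongrightarrow> 0" by (simp flip: ennreal_0)
      qed
    qed auto
    then show "(\<lambda>i. sqdist f (?g i)) \<longlonglongrightarrow> 0" by (simp add: sqdist_def)
  qed
qed

context two_sided_brownian_motion
begin

text \<open>Completeness of L2 over \<open>M\<close>, made explicit: along a fast approximation the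
  step integrals converge almost surely, and Fatou's lemma turns the pointwise limit into an L2
  limit.\<close>

lemma has_wiener_integral_exists:
  assumes f: "f \<in> L2"
  shows "\<exists>X. has_wiener_integral M B f X"
proof -
  have fm [measurable]: "f \<in> borel_measurable borel" using f by (simp add: L2_def)
  \<comment> \<open>The rate 16^-n leaves room for the weight 4^n in \<open>D\<close> below: its
    n-th term has expectation at most 4 * 4^-n, which is summable.\<close>
  have "\<exists>l. ordered l \<and> sqdist f (step_function l) < ennreal (1 / 16 ^ n)" for n :: nat
    using L2_steppable[OF f] unfolding steppable_def by simp
  then obtain l where l: "\<And>n :: nat. ordered (l n)" "\<And>n. sqdist f (step_function (l n)) < ennreal (1 / 16 ^ n)"
    by metis
  let ?S = "\<lambda>n. step_integral B (l n)"
  have Sm [measurable]: "?S n \<in> borel_measurable M" for n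
    using gauss_step_integral[OF l(1)] by (simp add: gauss_def)
  have SS: "(\<integral>\<^sup>+ \<omega>. ennreal ((?S m \<omega> - ?S n \<omega>)\<^sup>2) \<partial>M) \<le> ennreal (4 / 16 ^ n)" if "n \<le> m" for m n
  proof -
    have "(\<integral>\<^sup>+ \<omega>. ennreal ((?S m \<omega> - ?S n \<omega>)\<^sup>2) \<partial>M) = sqdist (step_function (l m)) (step_function (l n))"
      unfolding sqdist_def by (rule step_integral_isometry[OF l(1) l(1)])
    also have "\<dots> \<le> 2 * sqdist (step_function (l m)) f + 2 * sqdist f (step_function (l n))"
      by (rule sqdist_triangle) auto
    also have "sqdist (step_function (l m)) f = sqdist f (step_function (l m))"
      unfolding sqdist_def by (simp add: power2_commute)
    also have "2 * sqdist f (step_function (l m)) + 2 * sqdist f (step_function (l n))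
        \<le> 2 * ennreal (1 / 16 ^ n) + 2 * ennreal (1 / 16 ^ n)"
    proof (intro add_mono mult_left_mono)
      have "sqdist f (step_function (l m)) \<le> ennreal (1 / 16 ^ m)" using l(2) by (simp add: less_imp_le)
      also have "\<dots> \<le> ennreal (1 / 16 ^ n)" using that by (intro ennreal_leI divide_left_mono power_increasing) auto
      finally show "sqdist f (step_function (l m)) \<le> ennreal (1 / 16 ^ n)" .
      show "sqdist f (step_function (l n)) \<le> ennreal (1 / 16 ^ n)" using l(2) by (simp add: less_imp_le)
    qed auto
    also have "\<dots> = ennreal (2 * (1 / 16 ^ n) + 2 * (1 / 16 ^ n))" by (simp add: ennreal_double flip: ennreal_plus)
    also have "\<dots> = ennreal (4 / 16 ^ n)" by (intro arg_cong[of _ _ ennreal]) simp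
    finally show ?thesis .
  qed
  \<comment> \<open>If this sum equals K, the n-th increment is at most sqrt K * 2^-n, so the
    sequence converges at that outcome.\<close>
  define D where "D \<omega> = (\<Sum>n. ennreal (4 ^ n * (?S (Suc n) \<omega> - ?S n \<omega>)\<^sup>2))" for \<omega>
  have "(\<integral>\<^sup>+ \<omega>. D \<omega> \<partial>M) = (\<Sum>n. \<integral>\<^sup>+ \<omega>. ennreal (4 ^ n * (?S (Suc n) \<omega> - ?S n \<omega>)\<^sup>2) \<partial>M)"
    unfolding D_def by (rule nn_integral_suminf) auto
  also have "\<dots> \<le> (\<Sum>n. ennreal (4 * (1 / 4) ^ n))"
  proof (rule suminf_le)
    fix n :: nat
    have "(\<integral>\<^sup>+ \<omega>. ennreal (4 ^ n * (?S (Suc n) \<omega> - ?S n \<omega>)\<^sup>2) \<partial>M)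
        = ennreal (4 ^ n) * (\<integral>\<^sup>+ \<omega>. ennreal ((?S (Suc n) \<omega> - ?S n \<omega>)\<^sup>2) \<partial>M)"
      by (simp add: ennreal_mult nn_integral_cmult del: ennreal_numeral ennreal_power flip: ennreal_power)
    also have "\<dots> \<le> ennreal (4 ^ n) * ennreal (4 / 16 ^ n)" by (intro mult_left_mono SS) auto
    also have "\<dots> = ennreal (4 ^ n * (4 / 16 ^ n))" by (rule ennreal_mult[symmetric]) auto
    also have "4 ^ n * (4 / 16 ^ n) = 4 * (1 / 4 :: real) ^ n"
    proof -
      have "(16 :: real) ^ n = 4 ^ n * 4 ^ n" by (simp add: power_mult_distrib[symmetric])
      then show ?thesis by (simp add: power_divide)
    qed
    finally show "(\<integral>\<^sup>+ \<omega>. ennreal (4 ^ n * (?S (Suc n) \<omega> - ?S n \<omega>)\<^sup>2) \<partial>M) \<le> ennreal (4 * (1 / 4) ^ n)" .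
  qed auto
  also have "\<dots> < \<infinity>"
  proof -
    have "summable (\<lambda>n. 4 * (1 / 4 :: real) ^ n)" by (intro summable_mult summable_geometric) simp
    then have "(\<Sum>n. ennreal (4 * (1 / 4) ^ n)) = ennreal (\<Sum>n. 4 * (1 / 4 :: real) ^ n)"
      by (intro suminf_ennreal2) auto
    then show ?thesis by simp
  qed
  finally have "AE \<omega> in M. D \<omega> \<noteq> \<infinity>"
    by (intro nn_integral_PInf_AE) (auto simp: D_def)
  moreover have "convergent (\<lambda>n. ?S n \<omega>)" if D: "D \<omega> \<noteq> \<infinity>" for \<omega>
  proof -
    obtain K where K: "D \<omega> = ennreal K" "K \<ge> 0" using D by (cases "D \<omega>") auto
    have b: "\<bar>?S (Suc n) \<omega> - ?S n \<omega>\<bar> \<le> sqrt K * (1 / 2) ^ n" for n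
    proof -
      have "ennreal (4 ^ n * (?S (Suc n) \<omega> - ?S n \<omega>)\<^sup>2) \<le> D \<omega>"
        unfolding D_def by (rule sum_le_suminf[of _ "{n}", simplified]) auto
      then have "4 ^ n * (?S (Suc n) \<omega> - ?S n \<omega>)\<^sup>2 \<le> K" using K by simp
      moreover have "((2 :: real) ^ n)\<^sup>2 = 4 ^ n" by (simp add: power2_eq_square flip: power_mult_distrib)
      ultimately have "(2 ^ n * \<bar>?S (Suc n) \<omega> - ?S n \<omega>\<bar>)\<^sup>2 \<le> K"
        by (simp only: power_mult_distrib power2_abs)
      then have "2 ^ n * \<bar>?S (Suc n) \<omega> - ?S n \<omega>\<bar> \<le> sqrt K" by (rule real_le_rsqrt)
      then show ?thesis by (simp add: field_simps power_divide)
    qed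
    have "summable (\<lambda>n. ?S (Suc n) \<omega> - ?S n \<omega>)"
    proof (rule summable_comparison_test)
      show "\<exists>N. \<forall>n\<ge>N. norm (?S (Suc n) \<omega> - ?S n \<omega>) \<le> sqrt K * (1 / 2) ^ n" using b by auto
      show "summable (\<lambda>n. sqrt K * (1 / 2 :: real) ^ n)" by (intro summable_mult summable_geometric) simp
    qed
    then have "convergent (\<lambda>n. \<Sum>i<n. ?S (Suc i) \<omega> - ?S i \<omega>)" by (simp add: summable_iff_convergent)
    then have "convergent (\<lambda>n. ?S n \<omega> - ?S 0 \<omega>)" by (simp only: sum_lessThan_telescope[of "\<lambda>n. ?S n \<omega>"])
    then show ?thesis by (simp add: convergent_diff_const_right_iff)
  qed
  ultimately have conv: "AE \<omega> in M. convergent (\<lambda>n. ?S n \<omega>)" by auto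
  define X where "X \<omega> = lim (\<lambda>n. ?S n \<omega>)" for \<omega>
  have Xm [measurable]: "X \<in> borel_measurable M" unfolding X_def by measurable
  \<comment> \<open>Fatou's lemma with n fixed and m tending to infinity in the Cauchy estimate
    \<open>SS\<close>.\<close>
  have X: "(\<integral>\<^sup>+ \<omega>. ennreal ((X \<omega> - ?S n \<omega>)\<^sup>2) \<partial>M) \<le> ennreal (4 / 16 ^ n)" for n
  proof -
    have "(\<integral>\<^sup>+ \<omega>. ennreal ((X \<omega> - ?S n \<omega>)\<^sup>2) \<partial>M) = (\<integral>\<^sup>+ \<omega>. liminf (\<lambda>m. ennreal ((?S m \<omega> - ?S n \<omega>)\<^sup>2)) \<partial>M)"
    proof (rule nn_integral_cong_AE, use conv in eventually_elim)
      fix \<omega> assume "convergent (\<lambda>n. ?S n \<omega>)"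
      then have "(\<lambda>m. ?S m \<omega>) \<longlonglongrightarrow> X \<omega>" unfolding X_def by (simp add: convergent_LIMSEQ_iff)
      then have "(\<lambda>m. ennreal ((?S m \<omega> - ?S n \<omega>)\<^sup>2)) \<longlonglongrightarrow> ennreal ((X \<omega> - ?S n \<omega>)\<^sup>2)"
        by (intro tendsto_ennrealI tendsto_intros)
      then show "ennreal ((X \<omega> - ?S n \<omega>)\<^sup>2) = liminf (\<lambda>m. ennreal ((?S m \<omega> - ?S n \<omega>)\<^sup>2))"
        by (intro lim_imp_Liminf[symmetric]) auto
    qed
    also have "\<dots> \<le> liminf (\<lambda>m. \<integral>\<^sup>+ \<omega>. ennreal ((?S m \<omega> - ?S n \<omega>)\<^sup>2) \<partial>M)"
      by (rule nn_integral_liminf) auto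
    also have "\<dots> \<le> limsup (\<lambda>m. \<integral>\<^sup>+ \<omega>. ennreal ((?S m \<omega> - ?S n \<omega>)\<^sup>2) \<partial>M)"
      by (rule Liminf_le_Limsup) simp
    also have "\<dots> \<le> ennreal (4 / 16 ^ n)"
      by (rule Limsup_bounded) (auto simp: eventually_sequentially intro!: exI[of _ n] SS)
    finally show ?thesis .
  qed
  have lim0: "(\<lambda>n :: nat. ennreal (c * (1 / 16) ^ n)) \<longlonglongrightarrow> 0" for c
  proof -
    have "(\<lambda>n. c * (1 / 16 :: real) ^ n) \<longlonglongrightarrow> c * 0" by (intro tendsto_intros LIMSEQ_realpow_zero) auto
    then show ?thesis using tendsto_ennrealI by fastforce
  qed
  have "has_wiener_integral M B f X"
    unfolding has_wiener_integral_def
  proof (intro conjI exI[of _ l] allI l)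
    show "(\<lambda>n. \<integral>\<^sup>+ s. ennreal ((f s - step_function (l n) s)\<^sup>2) \<partial>lborel) \<longlonglongrightarrow> 0"
      by (rule tendsto_sandwich[OF _ _ tendsto_const lim0[of 1]])
        (use l(2) in \<open>auto simp: sqdist_def power_divide intro!: always_eventually less_imp_le\<close>)
    show "(\<lambda>n. \<integral>\<^sup>+ \<omega>. ennreal ((X \<omega> - ?S n \<omega>)\<^sup>2) \<partial>M) \<longlonglongrightarrow> 0"
      by (rule tendsto_sandwich[OF _ _ tendsto_const lim0[of 4]]) (use X in \<open>auto simp: power_divide\<close>)
  qed auto
  then show ?thesis by blast
qed

lemma has_wiener_integral_wiener_integral:
  assumes "(\<lambda>s. indicator A s * f s) \<in> L2"
  shows "has_wiener_integral M B (\<lambda>s. indicator A s * f s) (wiener_integral M B A f)"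
  unfolding wiener_integral_def using has_wiener_integral_exists[OF assms] by (rule someI_ex)

end

subsection \<open>The Mandelbrot--van Ness constant\<close>

text \<open>The substitution s = x / (1 - x) maps the unit interval onto the half-line and gives the
  classical Beta integrand.\<close>

lemma Beta_integral_infinite:
  assumes a: "0 < a" and b: "(0 :: real) < b"
  shows "set_integrable lborel {0<..} (\<lambda>s. s powr (a - 1) * (1 + s) powr (- a - b))"
    "(LINT s:{0<..}|lborel. s powr (a - 1) * (1 + s) powr (- a - b)) = Beta a b"
proof -
  let ?f = "\<lambda>s. s powr (a - 1) * (1 + s) powr (- a - b)"
  let ?g = "\<lambda>x :: real. x / (1 - x)" and ?g' = "\<lambda>x :: real. 1 / (1 - x)\<^sup>2"
  let ?b = "\<lambda>t. t powr (a - 1) * (1 - t) powr (b - 1)"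
  have eq: "?f (?g x) * ?g' x = ?b x" if "0 < x" "x < 1" for x
  proof -
    have 1: "1 + ?g x = 1 / (1 - x)" using that by (simp add: field_simps)
    have "?g x powr (a - 1) = x powr (a - 1) * (1 - x) powr (1 - a)"
      using that powr_minus_divide[of "1 - x" "a - 1"] by (simp add: powr_divide)
    moreover have "(1 + ?g x) powr (- a - b) = (1 - x) powr (a + b)"
      unfolding 1 using that powr_minus_divide[of "1 - x" "- a - b"] by (simp add: powr_divide add.commute)
    moreover have "?g' x = (1 - x) powr (- 2)"
      using that by (simp add: powr_minus divide_inverse powr_numeral)
    ultimately have "?f (?g x) * ?g' x = x powr (a - 1) * ((1 - x) powr (1 - a) * (1 - x) powr (a + b) * (1 - x) powr (- 2))"
      by simp
    also have "(1 - x) powr (1 - a) * (1 - x) powr (a + b) * (1 - x) powr (- 2) = (1 - x) powr (b - 1)"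
      using that by (simp flip: powr_add)
    finally show ?thesis .
  qed
  have int: "set_integrable lborel {0<..<1} ?b"
  proof -
    have "set_integrable lborel {0..1} ?b" using a b by (rule integrable_Beta)
    then show ?thesis by (rule set_integrable_subset) auto
  qed
  have E: "einterval 0 1 = {0<..<1 :: real}" "einterval 0 \<infinity> = {0<..}"
    by (auto simp: einterval_def)
  have fg: "set_integrable lborel (einterval 0 1) (\<lambda>x. ?f (?g x) * ?g' x)"
    unfolding E using int eq by (subst set_integrable_cong[OF refl refl, of _ _ ?b]) auto
  have A: "((ereal \<circ> ?g \<circ> real_of_ereal) \<longlongrightarrow> 0) (at_right 0)"
  proof -
    have "(?g \<longlongrightarrow> 0 / (1 - 0)) (at_right 0)" by (intro tendsto_intros) auto
    then show ?thesis unfolding zero_ereal_def ereal_tendsto_simps1 by (simp add: comp_def)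
  qed
  have B: "((ereal \<circ> ?g \<circ> real_of_ereal) \<longlongrightarrow> \<infinity>) (at_left 1)"
  proof -
    have "filterlim ?g at_top (at_left 1)" by real_asymp
    then show ?thesis unfolding one_ereal_def ereal_tendsto_simps1 by (simp add: comp_def tendsto_PInfty_eq_at_top)
  qed
  have D: "(?g has_real_derivative ?g' x) (at x)" if "x < 1" for x
  proof -
    have "(?g has_real_derivative (1 * (1 - x) - x * (0 - 1)) / ((1 - x) * (1 - x))) (at x)"
      using that by (intro derivative_intros) auto
    then show ?thesis by (simp add: power2_eq_square)
  qed
  have C1: "isCont ?f (?g x)" if "0 < x" "x < 1" for x
    using that by (intro continuous_intros) (auto simp: field_simps)
  have C2: "isCont ?g' x" if "x < 1" for x using that by (intro continuous_intros) auto
  have S: "set_integrable lborel (einterval 0 \<infinity>) ?f"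
    "(LBINT x=0..\<infinity>. ?f x) = (LBINT x=0..1. ?f (?g x) * ?g' x)"
    by (rule interval_integral_substitution_nonneg[OF _ D C1 C2 _ _ A B fg]; simp)+
  show "set_integrable lborel {0<..} ?f" using S(1) unfolding E .
  have "(LINT s:{0<..}|lborel. ?f s) = (LBINT x=0..\<infinity>. ?f x)"
    by (simp add: interval_lebesgue_integral_def E)
  also have "\<dots> = (LINT x:{0<..<1}|lborel. ?f (?g x) * ?g' x)"
    unfolding S(2) by (simp add: interval_lebesgue_integral_def E)
  also have "\<dots> = (LINT x:{0<..<1}|lborel. ?b x)"
    using eq by (intro set_lebesgue_integral_cong) auto
  also have "\<dots> = integral {0<..<1} ?b"
    by (rule set_borel_integral_eq_integral[OF int])
  also have "\<dots> = Beta a b"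
    using has_integral_Beta_real[OF a b] by (simp add: has_integral_Icc_iff_Ioo integral_unique)
  finally show "(LINT s:{0<..}|lborel. ?f s) = Beta a b" .
qed

text \<open>For a = 0 and q < 1 the integrand is unbounded at 0, whereas the primitive x^q / q still
  has a limit there. Hence the fundamental theorem on the open interval, with one-sided limits at
  the ends.\<close>

lemma powr_integral:
  assumes q: "0 < q" and ab: "0 \<le> a" "a < (b :: real)"
  shows "set_integrable lborel {a<..<b} (\<lambda>x. x powr (q - 1))"
    "(LINT x:{a<..<b}|lborel. x powr (q - 1)) = (b powr q - a powr q) / q"
proof -
  have E: "einterval (ereal a) (ereal b) = {a<..<b}" by (auto simp: einterval_def)
  have t: "((\<lambda>x. x powr q / q) \<longlongrightarrow> c powr q / q) (at c within S)" if "S \<subseteq> {0..}" "0 \<le> c" for c S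
  proof -
    have ev: "eventually (\<lambda>x. 0 \<le> x) (at c within S)"
      using that by (auto simp: eventually_at_filter intro!: always_eventually)
    have "((\<lambda>x. x powr q) \<longlongrightarrow> c powr q) (at c within S)"
      by (rule tendsto_powr'[OF tendsto_ident_at tendsto_const]) (use ev q in auto)
    then show ?thesis by (rule tendsto_divide[OF _ tendsto_const]) (use q in auto)
  qed
  have F: "((\<lambda>x. x powr q / q) has_real_derivative x powr (q - 1)) (at x)" if "ereal a < ereal x" for x
    using that ab q by (auto intro!: derivative_eq_intros)
  have c: "isCont (\<lambda>x. x powr (q - 1)) x" if "ereal a < ereal x" for x
    using that ab by (intro continuous_intros) auto
  have A: "(((\<lambda>x. x powr q / q) \<circ> real_of_ereal) \<longlongrightarrow> a powr q / q) (at_right (ereal a))"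
    unfolding ereal_tendsto_simps using ab by (intro t) auto
  have B: "(((\<lambda>x. x powr q / q) \<circ> real_of_ereal) \<longlongrightarrow> b powr q / q) (at_left (ereal b))"
  proof -
    have "isCont (\<lambda>x. x powr q / q) b" using ab q by (intro continuous_intros) auto
    then show ?thesis unfolding ereal_tendsto_simps isCont_def by (rule tendsto_within_subset) simp
  qed
  have S: "set_integrable lborel (einterval (ereal a) (ereal b)) (\<lambda>x. x powr (q - 1))"
    "(LBINT x=ereal a..ereal b. x powr (q - 1)) = b powr q / q - a powr q / q"
    using ab by (intro interval_integral_FTC_nonneg[OF _ F c _ A B]; simp)+
  show "set_integrable lborel {a<..<b} (\<lambda>x. x powr (q - 1))" using S(1) unfolding E .
  show "(LINT x:{a<..<b}|lborel. x powr (q - 1)) = (b powr q - a powr q) / q"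
    using S(2) ab by (simp add: interval_lebesgue_integral_def E diff_divide_distrib)
qed

text \<open>After factoring out s^h, the power h of (1 + s) / s is compared with its power -1. The
  gain 1 / (1 + s) makes the square integrable at infinity.\<close>

lemma powr_difference_bound_neg:
  assumes "- 1 < h" "h < 0" "0 < (s :: real)"
  shows "\<bar>(1 + s) powr h - s powr h\<bar> \<le> s powr h / (1 + s)"
proof -
  have "(1 + s) powr h \<le> s powr h" using assms by (intro powr_mono2') auto
  then have "\<bar>(1 + s) powr h - s powr h\<bar> = s powr h - (1 + s) powr h" by simp
  also have "\<dots> = s powr h * (1 - ((1 + s) / s) powr h)"
    using assms by (simp add: powr_divide algebra_simps)
  also have "\<dots> \<le> s powr h * (1 - ((1 + s) / s) powr (- 1))"
    using assms by (intro mult_left_mono diff_left_mono powr_mono) auto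
  also have "((1 + s) / s) powr (- 1) = s / (1 + s)" using assms by (simp add: powr_minus_divide)
  also have "1 - s / (1 + s) = 1 / (1 + s)" using assms by (simp add: field_simps)
  finally show ?thesis by simp
qed

text \<open>The base s / (1 + s) is below 1, so its power h is at least its power 1. The resulting
  exponent h - 1 makes the square integrable at infinity for h < 1/2.\<close>

lemma powr_difference_bound_pos:
  assumes "0 < h" "h < 1" "0 < (s :: real)"
  shows "s powr h \<le> (1 + s) powr h" "(1 + s) powr h - s powr h \<le> (1 + s) powr (h - 1)"
proof -
  show "s powr h \<le> (1 + s) powr h" using assms by (intro powr_mono2) auto
  have "(1 + s) powr h - s powr h = (1 + s) powr h * (1 - (s / (1 + s)) powr h)"
    using assms by (simp add: powr_divide algebra_simps)
  also have "\<dots> \<le> (1 + s) powr h * (1 - (s / (1 + s)) powr 1)"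
    using assms by (intro mult_left_mono diff_left_mono powr_mono') auto
  also have "\<dots> = (1 + s) powr h * (1 / (1 + s))"
    using assms by (simp add: field_simps)
  also have "\<dots> = (1 + s) powr (h - 1)" using assms by (simp add: powr_diff)
  finally show "(1 + s) powr h - s powr h \<le> (1 + s) powr (h - 1)" .
qed

lemma improper_FTC:
  fixes F f :: "real \<Rightarrow> real"
  assumes F: "\<And>x. 0 < x \<Longrightarrow> (F has_real_derivative f x) (at x)"
    and f: "\<And>x. 0 < x \<Longrightarrow> isCont f x" and i: "set_integrable lborel {0<..} f"
    and A: "(F \<longlongrightarrow> A) (at_right 0)" and B: "(F \<longlongrightarrow> B) at_top"
  shows "(LINT x:{0<..}|lborel. f x) = B - A"
proof -
  have E: "einterval 0 \<infinity> = {0<..}" by (auto simp: einterval_def)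
  have "(LBINT x=0..\<infinity>. f x) = B - A"
  proof (rule interval_integral_FTC_integrable)
    show "((F \<circ> real_of_ereal) \<longlongrightarrow> A) (at_right 0)"
      using A unfolding zero_ereal_def by (simp add: ereal_tendsto_simps)
    show "((F \<circ> real_of_ereal) \<longlongrightarrow> B) (at_left \<infinity>)" using B by (simp add: ereal_tendsto_simps)
    show "(F has_vector_derivative f x) (at x)" if "0 < ereal x" for x
      using F[of x] that by (simp add: has_real_derivative_iff_has_vector_derivative)
    show "isCont f x" if "0 < ereal x" for x using f[of x] that by simp
  qed (use i in \<open>auto simp: E\<close>)
  then show ?thesis by (simp add: interval_lebesgue_integral_def E)
qed

text \<open>
  The cross term \<open>s\<^sup>h (1 + s)\<^sup>h\<close> of the square is not integrable at infinity. Integration by parts turns it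
  into a Beta integrand, which is \<open>?b\<close> below; \<open>?F\<close> collects the boundary terms. The two signs of \<open>h\<close> need
  different primitives because \<open>?b\<close> must be integrable both at \<open>0\<close> and at infinity.
\<close>

lemma kernel_norm_neg:
  fixes h :: real
  assumes h: "- 1 / 2 < h" "h < 0"
  shows "set_integrable lborel {0<..} (\<lambda>s. ((1 + s) powr h - s powr h)\<^sup>2)"
    "(LINT s:{0<..}|lborel. ((1 + s) powr h - s powr h)\<^sup>2)
      = - 1 / (2 * h + 1) - (2 * h / (2 * h + 1)) * Beta (h + 1) (- 2 * h)"
proof -
  let ?f = "\<lambda>s :: real. ((1 + s) powr h - s powr h)\<^sup>2"
  let ?b = "\<lambda>s :: real. s powr h * (1 + s) powr (h - 1)"
  let ?F = "\<lambda>s :: real. ((1 + s) powr (2 * h + 1) + s powr (2 * h + 1) - 2 * (s powr (h + 1) * (1 + s) powr h)) / (2 * h + 1)"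
  have h1: "2 * h + 1 > 0" using h by simp
  show I: "set_integrable lborel {0<..} ?f"
  proof (rule set_integrable_bound)
    show "set_integrable lborel {0<..} (\<lambda>s. s powr ((2 * h + 1) - 1) * (1 + s) powr (- (2 * h + 1) - (1 - 2 * h)))"
      using h by (intro Beta_integral_infinite) auto
    show "set_borel_measurable lborel {0<..} ?f" unfolding set_borel_measurable_def by measurable
    show "AE s in lborel. s \<in> {0<..} \<longrightarrow> norm (?f s) \<le> norm (s powr ((2 * h + 1) - 1) * (1 + s) powr (- (2 * h + 1) - (1 - 2 * h)))"
    proof (intro AE_I2 impI)
      fix s :: real assume "s \<in> {0<..}"
      then have s: "s > 0" by simp
      have "?f s \<le> (s powr h / (1 + s))\<^sup>2"
        using power_mono[OF powr_difference_bound_neg[of h s], of 2] h s by simp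
      also have "\<dots> = s powr (2 * h) * (1 + s) powr (- 2)"
        using s by (simp add: power_divide powr_minus_divide powr_numeral powr_power mult.commute)
      finally show "norm (?f s) \<le> norm (s powr ((2 * h + 1) - 1) * (1 + s) powr (- (2 * h + 1) - (1 - 2 * h)))"
        by simp
    qed
  qed
  have Ib: "set_integrable lborel {0<..} ?b" "(LINT s:{0<..}|lborel. ?b s) = Beta (h + 1) (- 2 * h)"
    using Beta_integral_infinite[of "h + 1" "- 2 * h"] h by simp_all
  let ?c = "2 * h / (2 * h + 1)"
  have "(LINT s:{0<..}|lborel. ?f s + ?c * ?b s) = 0 - 1 / (2 * h + 1)"
  proof (rule improper_FTC[where F = ?F])
    fix s :: real assume s: "0 < s"
    define u w where "u = s powr h" and "w = (1 + s) powr (h - 1)"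
    have e: "(1 + s) powr h = (1 + s) * w" "s powr (h + 1) = s * u" "(1 + s) powr (2 * h) = ((1 + s) * w)\<^sup>2" "s powr (2 * h) = u\<^sup>2"
      using s powr_mult_base[of "1 + s" "h - 1"] powr_mult_base[of s h]
      by (simp_all add: u_def w_def powr_power add.commute mult.commute flip: powr_mult_base)
    have "(?F has_real_derivative ((2 * h + 1) * (1 + s) powr (2 * h) + (2 * h + 1) * s powr (2 * h)
        - 2 * ((h + 1) * s powr h * (1 + s) powr h + s powr (h + 1) * (h * (1 + s) powr (h - 1)))) / (2 * h + 1)) (at s)"
      by (rule DERIV_cdivide) (use s in \<open>auto intro!: derivative_eq_intros simp: algebra_simps\<close>)
    also have "((2 * h + 1) * (1 + s) powr (2 * h) + (2 * h + 1) * s powr (2 * h)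
        - 2 * ((h + 1) * s powr h * (1 + s) powr h + s powr (h + 1) * (h * (1 + s) powr (h - 1)))) / (2 * h + 1)
        = ?f s + ?c * ?b s"
      unfolding e u_def[symmetric] w_def[symmetric] using h1 by (simp add: field_simps power2_eq_square)
    finally show "(?F has_real_derivative ?f s + ?c * ?b s) (at s)" .
    show "isCont (\<lambda>s. ?f s + ?c * ?b s) s" using s h1 by (intro continuous_intros) auto
  next
    show "set_integrable lborel {0<..} (\<lambda>s. ?f s + ?c * ?b s)"
      by (intro set_integral_add I set_integrable_mult_right Ib)
    have z: "((\<lambda>s. s powr q) \<longlongrightarrow> 0) (at_right 0)" if "q > 0" for q :: real
      using that by (intro tendsto_zero_powrI[where b = q]) (auto simp: eventually_at_filter)
    have "(?F \<longlongrightarrow> ((1 + 0) powr (2 * h + 1) + 0 - 2 * (0 * (1 + 0) powr h)) / (2 * h + 1)) (at_right 0)"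
      using h1 h by (intro tendsto_intros z) auto
    then show "(?F \<longlongrightarrow> 1 / (2 * h + 1)) (at_right 0)" by simp
    have lim: "((\<lambda>s :: real. (1 + s) powr (2 * h) + s powr (2 * h)) \<longlongrightarrow> 0 + 0) at_top"
      using h by (intro tendsto_add tendsto_neg_powr filterlim_tendsto_add_at_top[OF tendsto_const] filterlim_ident) auto
    show "(?F \<longlongrightarrow> 0) at_top"
    proof (rule Lim_null_comparison)
      show "((\<lambda>s :: real. ((1 + s) powr (2 * h) + s powr (2 * h)) / (2 * h + 1)) \<longlongrightarrow> 0) at_top"
        using tendsto_divide[OF lim tendsto_const, of "2 * h + 1"] h1 by simp
      show "eventually (\<lambda>s. norm (?F s) \<le> ((1 + s) powr (2 * h) + s powr (2 * h)) / (2 * h + 1)) at_top"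
        using eventually_gt_at_top[of 0]
      proof eventually_elim
        fix s :: real assume s: "0 < s"
        define A D where "A = (1 + s) powr h" and "D = s powr h"
        have e: "(1 + s) powr (2 * h + 1) = (1 + s) * A\<^sup>2" "s powr (2 * h + 1) = s * D\<^sup>2" "s powr (h + 1) = s * D"
          "(1 + s) powr (2 * h) = A\<^sup>2" "s powr (2 * h) = D\<^sup>2"
          using s by (simp_all add: A_def D_def powr_add powr_power mult.commute)
        have AD: "\<bar>A - D\<bar> \<le> D / (1 + s)" unfolding A_def D_def using h s by (intro powr_difference_bound_neg) auto
        have "(A - D)\<^sup>2 \<le> (D / (1 + s))\<^sup>2" using power_mono[OF AD, of 2] by simp
        then have "s * (A - D)\<^sup>2 \<le> s * (D / (1 + s))\<^sup>2" using s by (intro mult_left_mono) auto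
        also have "\<dots> = D\<^sup>2 * (s / (1 + s)\<^sup>2)" by (simp add: power_divide)
        also have "\<dots> \<le> D\<^sup>2 * 1"
        proof (intro mult_left_mono)
          have "s \<le> (1 + s)\<^sup>2" using s zero_le_power2[of s] unfolding power2_sum by simp
          then show "s / (1 + s)\<^sup>2 \<le> 1" using s by simp
        qed auto
        finally have b: "s * (A - D)\<^sup>2 \<le> D\<^sup>2" by simp
        \<comment> \<open>In this form the growing terms of order 2 h + 1 have cancelled. What is
          left is at most a sum of powers 2 h, which vanish at infinity since h < 0.\<close>
        have n: "(1 + s) * A\<^sup>2 + s * D\<^sup>2 - 2 * (s * D * A) = A\<^sup>2 + s * (A - D)\<^sup>2"
          by (simp add: power2_eq_square algebra_simps)
        have "0 \<le> A\<^sup>2 + s * (A - D)\<^sup>2" using s by simp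
        then show "norm (?F s) \<le> ((1 + s) powr (2 * h) + s powr (2 * h)) / (2 * h + 1)"
          unfolding e A_def[symmetric] D_def[symmetric] n using b h1 by (simp add: divide_right_mono)
      qed
    qed
  qed
  moreover have "(LINT s:{0<..}|lborel. ?f s + ?c * ?b s) = (LINT s:{0<..}|lborel. ?f s) + ?c * Beta (h + 1) (- 2 * h)"
    unfolding Ib(2)[symmetric] set_integral_mult_right[symmetric]
    by (intro set_integral_add(2) I set_integrable_mult_right Ib(1))
  ultimately show "(LINT s:{0<..}|lborel. ?f s) = - 1 / (2 * h + 1) - (2 * h / (2 * h + 1)) * Beta (h + 1) (- 2 * h)"
    by simp
qed

text \<open>For h > 0 the Beta integrand of the negative case has order 2 h - 1 at infinity and is
  not integrable. The symmetric factor 2 s + 1 in the primitive produces the exponent h - 1 twice: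
  integrable at 0 because h > 0, and at infinity because 2 h - 2 < -1.\<close>

lemma kernel_norm_pos:
  fixes h :: real
  assumes h: "0 < h" "h < 1 / 2"
  shows "set_integrable lborel {0<..} (\<lambda>s. ((1 + s) powr h - s powr h)\<^sup>2)"
    "(LINT s:{0<..}|lborel. ((1 + s) powr h - s powr h)\<^sup>2)
      = - 1 / (2 * h + 1) + (h / (2 * h + 1)) * Beta h (1 - 2 * h)"
proof -
  let ?f = "\<lambda>s :: real. ((1 + s) powr h - s powr h)\<^sup>2"
  let ?b = "\<lambda>s :: real. s powr (h - 1) * (1 + s) powr (h - 1)"
  let ?F = "\<lambda>s :: real. ((1 + s) powr (2 * h + 1) + s powr (2 * h + 1) - (2 * s + 1) * (s powr h * (1 + s) powr h)) / (2 * h + 1)"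
  have h1: "2 * h + 1 > 0" using h by simp
  show I: "set_integrable lborel {0<..} ?f"
  proof (rule set_integrable_bound)
    show "set_integrable lborel {0<..} (\<lambda>s. s powr (1 - 1) * (1 + s) powr (- 1 - (1 - 2 * h)))"
      using h by (intro Beta_integral_infinite) auto
    show "set_borel_measurable lborel {0<..} ?f" unfolding set_borel_measurable_def by measurable
    show "AE s in lborel. s \<in> {0<..} \<longrightarrow> norm (?f s) \<le> norm (s powr (1 - 1) * (1 + s) powr (- 1 - (1 - 2 * h)))"
    proof (intro AE_I2 impI)
      fix s :: real assume "s \<in> {0<..}"
      then have s: "s > 0" by simp
      have "?f s \<le> ((1 + s) powr (h - 1))\<^sup>2"
        using powr_difference_bound_pos[of h s] h s by (intro power_mono) auto
      also have "\<dots> = (1 + s) powr (- 1 - (1 - 2 * h))"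
        using s by (simp add: powr_power algebra_simps)
      finally show "norm (?f s) \<le> norm (s powr (1 - 1) * (1 + s) powr (- 1 - (1 - 2 * h)))"
        using s by simp
    qed
  qed
  have Ib: "set_integrable lborel {0<..} ?b" "(LINT s:{0<..}|lborel. ?b s) = Beta h (1 - 2 * h)"
    using Beta_integral_infinite[of h "1 - 2 * h"] h by simp_all
  let ?c = "- h / (2 * h + 1)"
  have "(LINT s:{0<..}|lborel. ?f s + ?c * ?b s) = 0 - 1 / (2 * h + 1)"
  proof (rule improper_FTC[where F = ?F])
    fix s :: real assume s: "0 < s"
    define x w where "x = s powr (h - 1)" and "w = (1 + s) powr (h - 1)"
    have e: "(1 + s) powr h = (1 + s) * w" "s powr h = s * x" "(1 + s) powr (2 * h) = ((1 + s) * w)\<^sup>2" "s powr (2 * h) = (s * x)\<^sup>2"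
      using s powr_mult_base[of "1 + s" "h - 1"] powr_mult_base[of s "h - 1"]
      by (simp_all add: x_def w_def powr_power add.commute mult.commute flip: powr_mult_base)
    have "(?F has_real_derivative ((2 * h + 1) * (1 + s) powr (2 * h) + (2 * h + 1) * s powr (2 * h)
        - (2 * (s powr h * (1 + s) powr h) + (2 * s + 1) * (h * s powr (h - 1) * (1 + s) powr h + s powr h * (h * (1 + s) powr (h - 1))))) / (2 * h + 1)) (at s)"
      by (rule DERIV_cdivide) (use s in \<open>auto intro!: derivative_eq_intros simp: algebra_simps\<close>)
    also have "((2 * h + 1) * (1 + s) powr (2 * h) + (2 * h + 1) * s powr (2 * h)
        - (2 * (s powr h * (1 + s) powr h) + (2 * s + 1) * (h * s powr (h - 1) * (1 + s) powr h + s powr h * (h * (1 + s) powr (h - 1))))) / (2 * h + 1)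
        = ?f s + ?c * ?b s"
      unfolding e x_def[symmetric] w_def[symmetric] using h1 by (simp add: field_simps power2_eq_square)
    finally show "(?F has_real_derivative ?f s + ?c * ?b s) (at s)" .
    show "isCont (\<lambda>s. ?f s + ?c * ?b s) s" using s h1 by (intro continuous_intros) auto
  next
    show "set_integrable lborel {0<..} (\<lambda>s. ?f s + ?c * ?b s)"
      by (intro set_integral_add I set_integrable_mult_right Ib)
    have z: "((\<lambda>s. s powr q) \<longlongrightarrow> 0) (at_right 0)" if "q > 0" for q :: real
      using that by (intro tendsto_zero_powrI[where b = q]) (auto simp: eventually_at_filter)
    have "(?F \<longlongrightarrow> ((1 + 0) powr (2 * h + 1) + 0 - (2 * 0 + 1) * (0 * (1 + 0) powr h)) / (2 * h + 1)) (at_right 0)"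
      using h1 h by (intro tendsto_intros z) auto
    then show "(?F \<longlongrightarrow> 1 / (2 * h + 1)) (at_right 0)" by simp
    have lim: "((\<lambda>s :: real. 2 * (1 + s) powr (2 * h - 1)) \<longlongrightarrow> 2 * 0) at_top"
      using h by (intro tendsto_mult tendsto_const tendsto_neg_powr filterlim_tendsto_add_at_top[OF tendsto_const] filterlim_ident) auto
    show "(?F \<longlongrightarrow> 0) at_top"
    proof (rule Lim_null_comparison)
      show "((\<lambda>s :: real. 2 * (1 + s) powr (2 * h - 1) / (2 * h + 1)) \<longlongrightarrow> 0) at_top"
        using tendsto_divide[OF lim tendsto_const, of "2 * h + 1"] h1 by simp
      show "eventually (\<lambda>s. norm (?F s) \<le> 2 * (1 + s) powr (2 * h - 1) / (2 * h + 1)) at_top"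
        using eventually_gt_at_top[of 0]
      proof eventually_elim
        fix s :: real assume s: "0 < s"
        define A D W where "A = (1 + s) powr h" and "D = s powr h" and "W = (1 + s) powr (h - 1)"
        have e: "(1 + s) powr (2 * h + 1) = (1 + s) * A\<^sup>2" "s powr (2 * h + 1) = s * D\<^sup>2"
          using s by (simp_all add: A_def D_def powr_add powr_power mult.commute)
        have AW: "A = (1 + s) * W" using s powr_mult_base[of "1 + s" "h - 1"] by (simp add: A_def W_def)
        have WW: "(1 + s) powr (2 * h - 1) = A * W"
          using s by (simp add: A_def W_def flip: powr_add)
        have W0: "W \<ge> 0" "A \<ge> 0" by (auto simp: W_def A_def)
        have AD: "D \<le> A" "A - D \<le> W" unfolding A_def D_def W_def
          using h s powr_difference_bound_pos[of h s] by auto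
        \<comment> \<open>The factorization exposes the cancellation: the first factor is at most
          \<open>W\<close> and the second at most 2 \<open>A\<close>, so the boundary term has order
          2 h - 1 < 0.\<close>
        have n: "(1 + s) * A\<^sup>2 + s * D\<^sup>2 - (2 * s + 1) * (D * A) = (A - D) * (A + s * (A - D))"
          by (simp add: power2_eq_square algebra_simps)
        have "s * (A - D) \<le> s * W" using AD s by (intro mult_left_mono) auto
        also have "\<dots> \<le> A" unfolding AW using W0 by (simp add: distrib_right)
        finally have "(A - D) * (A + s * (A - D)) \<le> W * (2 * A)"
          using AD W0 s by (intro mult_mono) auto
        moreover have "0 \<le> (A - D) * (A + s * (A - D))" using AD s W0 by (intro mult_nonneg_nonneg add_nonneg_nonneg) auto
        ultimately show "norm (?F s) \<le> 2 * (1 + s) powr (2 * h - 1) / (2 * h + 1)"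
          unfolding e WW A_def[symmetric] D_def[symmetric] n using h1 by (simp add: divide_right_mono mult_ac)
      qed
    qed
  qed
  moreover have "(LINT s:{0<..}|lborel. ?f s + ?c * ?b s) = (LINT s:{0<..}|lborel. ?f s) + ?c * Beta h (1 - 2 * h)"
    unfolding Ib(2)[symmetric] set_integral_mult_right[symmetric]
    by (intro set_integral_add(2) I set_integrable_mult_right Ib(1))
  ultimately show "(LINT s:{0<..}|lborel. ?f s) = - 1 / (2 * h + 1) + (h / (2 * h + 1)) * Beta h (1 - 2 * h)"
    by simp
qed

section \<open>Gamma function identities behind the constant \<open>C H\<close>\<close>

lemma Gamma_plus1_pos:
  assumes "0 < (x :: real)"
  shows "Gamma (x + 1) = x * Gamma x"
proof -
  have "x \<notin> \<int>\<^sub>\<le>\<^sub>0" using assms by (auto elim!: nonpos_Ints_cases)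
  then show ?thesis by (rule Gamma_plus1)
qed

lemma C_pos: "0 < H \<Longrightarrow> H < 1 \<Longrightarrow> 0 < C H"
  unfolding C_def by (intro real_sqrt_gt_zero divide_pos_pos mult_pos_pos Gamma_real_pos) auto

lemma C_square: "0 < H \<Longrightarrow> H < 1 \<Longrightarrow> (C H)\<^sup>2 = Gamma (1/2 + H) * Gamma (2 - 2 * H) / (2 * H * Gamma (3/2 - H))"
  unfolding C_def by (intro real_sqrt_pow2 divide_nonneg_pos mult_nonneg_nonneg mult_pos_pos Gamma_real_pos less_imp_le[OF Gamma_real_pos]) auto

text \<open>Contribution of the negative half-line to the variance of X+ at time 1; the missing 1 /
  (2 H) is the contribution of the interval (0, 1). For either sign of h the equation Gamma (x + 1)
  = x Gamma x turns the Beta value into (C H)^2.\<close>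

lemma kernel_norm:
  assumes H: "0 < H" "H < 1"
  shows "set_integrable lborel {0<..} (\<lambda>s. ((1 + s) powr (H - 1/2) - s powr (H - 1/2))\<^sup>2)"
    "(LINT s:{0<..}|lborel. ((1 + s) powr (H - 1/2) - s powr (H - 1/2))\<^sup>2) = (C H)\<^sup>2 - 1 / (2 * H)"
proof -
  define h where "h = H - 1/2"
  have H_eq: "H = h + 1/2" by (simp add: h_def)
  have "1/2 + H = h + 1" "2 - 2 * H = 1 - 2 * h" "3/2 - H = 1 - h" by (simp_all add: h_def)
  then have C2: "(C H)\<^sup>2 = Gamma (h + 1) * Gamma (1 - 2 * h) / (2 * H * Gamma (1 - h))"
    using C_square[OF H] by (simp only:)
  have H2: "2 * h + 1 = 2 * H" by (simp add: h_def)
  have hb: "- 1 / 2 < h" "h < 1 / 2" using H by (auto simp: h_def)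
  consider "h < 0" | "h = 0" | "h > 0" by linarith
  then have "set_integrable lborel {0<..} (\<lambda>s. ((1 + s) powr h - s powr h)\<^sup>2) \<and>
    (LINT s:{0<..}|lborel. ((1 + s) powr h - s powr h)\<^sup>2) = (C H)\<^sup>2 - 1 / (2 * H)"
  proof cases
    case 1
    have "Gamma (1 - 2 * h) = (- 2 * h) * Gamma (- 2 * h)"
      using Gamma_plus1_pos[of "- 2 * h"] 1 by (simp add: add.commute)
    moreover have "h + 1 + - 2 * h = 1 - h" by simp
    ultimately have "- (2 * h / (2 * h + 1)) * Beta (h + 1) (- 2 * h) = (C H)\<^sup>2"
      unfolding C2 H2 Beta_def by (simp only:) simp
    then show ?thesis using kernel_norm_neg[OF hb(1) 1] unfolding H2 by simp
  next
    \<comment> \<open>For h = 0 the integrand vanishes on the half-line and all Gamma factors equal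
      1, so that (C H)^2 = 1 / (2 H).\<close>
    case 2
    have "(C H)\<^sup>2 = 1 / (2 * H)"
      unfolding C2 2 by simp
    moreover have "(LINT s:{0<..}|lborel. ((1 + s) powr h - s powr h)\<^sup>2) = (LINT s:{0 :: real<..}|lborel. 0 :: real)"
      unfolding 2 by (intro set_lebesgue_integral_cong) auto
    moreover have "set_integrable lborel {0<..} (\<lambda>s :: real. ((1 + s) powr h - s powr h)\<^sup>2)
        = set_integrable lborel {0 :: real<..} (\<lambda>s. 0 :: real)"
      unfolding 2 by (intro set_integrable_cong) auto
    ultimately show ?thesis by (simp add: set_integrable_def set_lebesgue_integral_def)
  next
    case 3
    have "Gamma (1 + h) = h * Gamma h"
      using Gamma_plus1_pos[of h] 3 by (simp add: add.commute)
    moreover have "h + (1 - 2 * h) = 1 - h" by simp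
    ultimately have "(h / (2 * h + 1)) * Beta h (1 - 2 * h) = (C H)\<^sup>2"
      unfolding C2 H2 Beta_def add.commute[of h 1] by (simp only:) simp
    then show ?thesis using kernel_norm_pos[OF 3 hb(2)] unfolding H2 by simp
  qed
  then show "set_integrable lborel {0<..} (\<lambda>s. ((1 + s) powr (H - 1/2) - s powr (H - 1/2))\<^sup>2)"
    "(LINT s:{0<..}|lborel. ((1 + s) powr (H - 1/2) - s powr (H - 1/2))\<^sup>2) = (C H)\<^sup>2 - 1 / (2 * H)"
    by (simp_all add: h_def)
qed

lemma Gamma_reflection_real: "Gamma x * Gamma (1 - x) = pi / sin (pi * x)" for x :: real
proof -
  have "1 - complex_of_real x = complex_of_real (1 - x)" "complex_of_real pi * complex_of_real x = complex_of_real (pi * x)"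
    by simp_all
  then have "Gamma (complex_of_real x) * Gamma (complex_of_real (1 - x)) = complex_of_real pi / sin (complex_of_real (pi * x))"
    using Gamma_reflection_complex[of "complex_of_real x"] by (simp only:)
  then have "complex_of_real (Gamma x * Gamma (1 - x)) = complex_of_real (pi / sin (pi * x))"
    by (simp only: Gamma_complex_of_real sin_of_real of_real_mult[symmetric] of_real_divide[symmetric])
  then show ?thesis by (simp only: of_real_eq_iff)
qed

lemma Gamma_duplication_real:
  fixes x :: real
  assumes "x > 0"
  shows "Gamma x * Gamma (x + 1/2) = 2 powr (1 - 2 * x) * sqrt pi * Gamma (2 * x)"
proof -
  have "complex_of_real x \<notin> \<int>\<^sub>\<le>\<^sub>0" "complex_of_real x + 1/2 \<notin> \<int>\<^sub>\<le>\<^sub>0"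
    using assms by (auto elim!: nonpos_Ints_cases simp: complex_eq_iff)
  moreover have "complex_of_real x + 1/2 = complex_of_real (x + 1/2)" "2 * complex_of_real x = complex_of_real (2 * x)"
    by simp_all
  moreover have "(1 - complex_of_real (2 * x)) * complex_of_real (ln 2) = complex_of_real ((1 - 2 * x) * ln 2)"
    by simp
  ultimately have "Gamma (complex_of_real x) * Gamma (complex_of_real (x + 1/2)) =
      exp (complex_of_real ((1 - 2 * x) * ln 2)) * complex_of_real (sqrt pi) * Gamma (complex_of_real (2 * x))"
    using Gamma_legendre_duplication[of "complex_of_real x"] by (simp only: simp_thms)
  then have "complex_of_real (Gamma x * Gamma (x + 1/2)) = complex_of_real (exp ((1 - 2 * x) * ln 2) * sqrt pi * Gamma (2 * x))"
    by (simp only: Gamma_complex_of_real exp_of_real of_real_mult[symmetric])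
  then have "Gamma x * Gamma (x + 1/2) = exp ((1 - 2 * x) * ln 2) * sqrt pi * Gamma (2 * x)"
    by (simp only: of_real_eq_iff)
  then show ?thesis by (simp add: powr_def)
qed

text \<open>Duplication at H and at 1 - H together with the reflection formula eliminates the sine.
  The Beta value arises as the overlap of the kernels of X+ and X- at time 1, so this yields their
  covariance.\<close>

lemma C_square_sin:
  assumes H: "0 < H" "H < 1"
  shows "(C H)\<^sup>2 * sin (pi * H) = Beta (H + 1/2) (H + 1/2)"
proof -
  define g2 where "g2 = 2 powr (1 - 2 * H)"
  have d1: "Gamma (1 - H) * Gamma (3/2 - H) * g2 = sqrt pi * Gamma (2 - 2 * H)"
  proof -
    have "Gamma (1 - H) * Gamma (3/2 - H) = 2 powr (2 * H - 1) * sqrt pi * Gamma (2 - 2 * H)"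
      using Gamma_duplication_real[of "1 - H"] H by (simp add: algebra_simps)
    moreover have "2 powr (2 * H - 1) * g2 = (1 :: real)" by (simp add: g2_def flip: powr_add)
    ultimately show ?thesis by (simp add: algebra_simps)
  qed
  have d2: "Gamma H * Gamma (H + 1/2) = g2 * sqrt pi * Gamma (2 * H)"
    unfolding g2_def using H by (intro Gamma_duplication_real)
  have r: "Gamma H * Gamma (1 - H) * sin (pi * H) = pi"
  proof -
    have "sin (pi * H) > 0" using H by (intro sin_gt_zero) auto
    then show ?thesis using Gamma_reflection_real[of H] by simp
  qed
  have p: "Gamma (H + 1/2) > 0" "Gamma H > 0" "Gamma (1 - H) > 0" "Gamma (3/2 - H) > 0" "Gamma (2 * H) > 0" "g2 > 0" "sqrt pi > 0"
    using H by (auto simp: g2_def intro!: Gamma_real_pos)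
  have G2: "Gamma (2 * H + 1) = 2 * H * Gamma (2 * H)"
    using Gamma_plus1_pos[of "2 * H"] H by simp
  have e1: "Gamma (2 - 2 * H) = Gamma (1 - H) * Gamma (3/2 - H) * g2 / sqrt pi"
    using d1 p by (simp add: field_simps)
  have e2: "Gamma H = g2 * sqrt pi * Gamma (2 * H) / Gamma (H + 1/2)"
    using d2 p by (simp add: field_simps)
  have r': "Gamma (1 - H) * g2 * sin (pi * H) = sqrt pi * Gamma (H + 1/2) / Gamma (2 * H)"
  proof -
    have "Gamma (1 - H) * g2 * sin (pi * H) * (sqrt pi * Gamma (2 * H)) = pi * Gamma (H + 1/2)"
      using r p unfolding e2 by (simp add: field_simps)
    also have "\<dots> = sqrt pi * (sqrt pi * Gamma (H + 1/2))" by simp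
    finally show ?thesis using p by (simp add: field_simps)
  qed
  have "(C H)\<^sup>2 * sin (pi * H) = Gamma (H + 1/2) * (Gamma (1 - H) * g2 * sin (pi * H)) / (sqrt pi * (2 * H))"
  proof -
    have "a * (x * y * g / r) / (2 * H * y) * s = a * (x * g * s) / (r * (2 * H))" if "y \<noteq> 0" for a x y g r s :: real
      using that by simp
    from this[of "Gamma (3/2 - H)"] show ?thesis
      using p unfolding C_square[OF H] e1 add.commute[of "1/2" H] by simp
  qed
  also have "\<dots> = Gamma (H + 1/2) * Gamma (H + 1/2) / Gamma (2 * H + 1)"
    unfolding r' G2 using p H by (simp add: field_simps)
  also have "\<dots> = Beta (H + 1/2) (H + 1/2)" by (simp add: Beta_def algebra_simps)
  finally show ?thesis .
qed

subsection \<open>Kernels\<close>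

text \<open>The power of the positive part. The explicit case distinction makes \<open>pp 0\<close>
  the indicator of the positive half-line, as H = 1/2 requires, and lets one formula describe each
  kernel on the whole line.\<close>

definition pp :: "real \<Rightarrow> real \<Rightarrow> real" where
  "pp h x = (if 0 < x then x powr h else 0)"

definition Kp :: "real \<Rightarrow> real \<Rightarrow> real \<Rightarrow> real" where
  "Kp H t s = pp (H - 1/2) (t - s) - pp (H - 1/2) (- s)"

definition Km :: "real \<Rightarrow> real \<Rightarrow> real \<Rightarrow> real" where
  "Km H t s = pp (H - 1/2) (s - t) - pp (H - 1/2) s"

definition kB :: "real \<Rightarrow> real \<Rightarrow> real" where
  "kB t = indicator {0<..t}"

lemma pp_measurable [measurable]: "pp h \<in> borel_measurable borel"
  unfolding pp_def[abs_def] by measurable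

lemma Kp_measurable [measurable]: "Kp H t \<in> borel_measurable borel"
  unfolding Kp_def[abs_def] by measurable

lemma Km_measurable [measurable]: "Km H t \<in> borel_measurable borel"
  unfolding Km_def[abs_def] by measurable

lemma pp_integral:
  assumes q: "0 < q" and ab: "a \<le> b"
  shows "integrable lborel (\<lambda>x. indicator {a<..b} x * pp (q - 1) x)"
    "(\<integral>x. indicator {a<..b} x * pp (q - 1) x \<partial>lborel) = (pp q b - pp q a) / q"
proof -
  let ?a = "max 0 a"
  have "integrable lborel (\<lambda>x. indicator {a<..b} x * pp (q - 1) x) \<and>
    (\<integral>x. indicator {a<..b} x * pp (q - 1) x \<partial>lborel) = (pp q b - pp q a) / q"
  proof (cases "?a < b")
    case True
    note S = powr_integral[OF q max.cobounded1 True, unfolded set_integrable_def set_lebesgue_integral_def]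
    have ae: "AE x in lborel. indicator {?a<..<b} x *\<^sub>R x powr (q - 1) = indicator {a<..b} x * pp (q - 1) x"
      using AE_lborel_singleton[of b] by eventually_elim (auto simp: indicator_def pp_def)
    have "integrable lborel (\<lambda>x. indicator {a<..b} x * pp (q - 1) x)"
      by (rule integrable_cong_AE_imp[OF S(1)]) (use ae in auto)
    moreover have "(\<integral>x. indicator {a<..b} x * pp (q - 1) x \<partial>lborel) = (b powr q - ?a powr q) / q"
      unfolding S(2)[symmetric] by (rule integral_cong_AE) (use ae in auto)
    moreover have "b powr q - ?a powr q = pp q b - pp q a"
      using True q by (auto simp: pp_def max_def split: if_splits)
    ultimately show ?thesis by simp
  next
    case False
    have "(\<lambda>x. indicator {a<..b} x * pp (q - 1) x) = (\<lambda>x. 0)"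
      using False by (auto simp: indicator_def pp_def)
    moreover have "pp q b = pp q a" using False ab by (auto simp: pp_def)
    ultimately show ?thesis by simp
  qed
  then show "integrable lborel (\<lambda>x. indicator {a<..b} x * pp (q - 1) x)"
    "(\<integral>x. indicator {a<..b} x * pp (q - 1) x \<partial>lborel) = (pp q b - pp q a) / q" by auto
qed

lemma L2_affine:
  assumes "f \<in> L2" "c \<noteq> 0"
  shows "(\<lambda>x. f (t + c * x)) \<in> L2"
proof -
  have [measurable]: "f \<in> borel_measurable borel" using assms by (simp add: L2_def)
  have "integrable lborel (\<lambda>x. (f (t + c * x))\<^sup>2)"
    using assms lborel_integrable_real_affine_iff[of c "\<lambda>x. (f x)\<^sup>2" t] by (simp add: L2_def)
  then show ?thesis by (simp add: L2_def)
qed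

lemma ip_affine:
  assumes "c \<noteq> 0"
  shows "ip f g = \<bar>c\<bar> * ip (\<lambda>x. f (t + c * x)) (\<lambda>x. g (t + c * x))"
  unfolding ip_def using lborel_integral_real_affine[OF assms, of "\<lambda>x. f x * g x" t] by simp

text \<open>After reflection at 0 the square of the kernel splits into the half-line integrand of
  \<open>kernel_norm\<close> and a pure power on (0, 1], whose integral is 1 / (2 H). This
  identifies \<open>C H\<close> as the standard deviation of X+ at time 1.\<close>

lemma Kp_one:
  assumes H: "0 < H" "H < 1"
  shows "Kp H 1 \<in> L2" "ip (Kp H 1) (Kp H 1) = (C H)\<^sup>2"
proof -
  let ?h = "H - 1/2"
  let ?f = "\<lambda>x. indicator {0<..} x * ((1 + x) powr ?h - x powr ?h)\<^sup>2"
  let ?g = "\<lambda>y. indicator {0<..1} y * pp (2 * H - 1) y"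
  have e: "(Kp H 1 (0 + (-1) * x))\<^sup>2 = ?f x + ?g (1 + 1 * x)" for x
  proof -
    have "2 * H - 1 = ?h + ?h" by simp
    then have "((1 + x) powr ?h)\<^sup>2 = (1 + x) powr (2 * H - 1)" by (simp only: powr_add power2_eq_square)
    then show ?thesis by (auto simp: Kp_def pp_def indicator_def)
  qed
  have f: "integrable lborel ?f" "(\<integral>x. ?f x \<partial>lborel) = (C H)\<^sup>2 - 1 / (2 * H)"
    using kernel_norm[OF H] by (simp_all add: set_integrable_def set_lebesgue_integral_def)
  have g: "integrable lborel ?g" "(\<integral>x. ?g x \<partial>lborel) = 1 / (2 * H)"
    using pp_integral[of "2 * H" 0 1] H by (simp_all add: pp_def)
  have g': "integrable lborel (\<lambda>x. ?g (1 + 1 * x))"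
    using g(1) by (subst lborel_integrable_real_affine_iff) auto
  have i: "integrable lborel (\<lambda>x. (Kp H 1 (0 + (-1) * x))\<^sup>2)"
    unfolding e using f(1) g' by (rule Bochner_Integration.integrable_add)
  then have "integrable lborel (\<lambda>x. (Kp H 1 x)\<^sup>2)"
    using lborel_integrable_real_affine_iff[of "-1" "\<lambda>x. (Kp H 1 x)\<^sup>2" 0] by simp
  then show "Kp H 1 \<in> L2" by (simp add: L2_def)
  have "ip (Kp H 1) (Kp H 1) = (\<integral>x. (Kp H 1 (0 + (-1) * x))\<^sup>2 \<partial>lborel)"
    unfolding ip_self using lborel_integral_real_affine[of "-1" "\<lambda>x. (Kp H 1 x)\<^sup>2" 0] by simp
  also have "\<dots> = (\<integral>x. ?f x \<partial>lborel) + (\<integral>x. ?g (1 + 1 * x) \<partial>lborel)"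
    unfolding e using f(1) g' by (rule Bochner_Integration.integral_add)
  also have "(\<integral>x. ?g (1 + 1 * x) \<partial>lborel) = (\<integral>x. ?g x \<partial>lborel)"
    using lborel_integral_real_affine[of 1 ?g 1] by simp
  finally show "ip (Kp H 1) (Kp H 1) = (C H)\<^sup>2" using f g by simp
qed

lemma pp_scale: "0 < c \<Longrightarrow> pp h (c * x) = c powr h * pp h x"
  by (auto simp: pp_def powr_mult zero_less_mult_iff)

text \<open>Self-similarity: under s = t x the kernel becomes t^(H - 1/2) times the kernel at time
  1, and the Jacobian supplies one further factor t.\<close>

lemma Kp_norm:
  assumes H: "0 < H" "H < 1" and t: "0 \<le> t"
  shows "Kp H t \<in> L2" "ip (Kp H t) (Kp H t) = (C H)\<^sup>2 * t powr (2 * H)"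
proof -
  let ?h = "H - 1/2"
  have "Kp H t \<in> L2 \<and> ip (Kp H t) (Kp H t) = (C H)\<^sup>2 * t powr (2 * H)"
  proof (cases "t = 0")
    case True
    have "Kp H t = (\<lambda>s. 0)" by (auto simp: Kp_def True)
    then show ?thesis using True L2_zero by (simp add: ip_def)
  next
    case False
    then have t: "t > 0" using t by simp
    have e: "Kp H t (0 + t * x) = t powr ?h * Kp H 1 x" for x
      using t pp_scale[OF t, of ?h "1 - x"] pp_scale[OF t, of ?h "- x"] by (simp add: Kp_def algebra_simps)
    have "(\<lambda>x. Kp H t (0 + t * x)) \<in> L2" unfolding e by (intro L2_scale Kp_one H)
    then have "Kp H t \<in> L2"
      using L2_affine[of "\<lambda>y. Kp H t (0 + t * y)" "1 / t" 0] t by simp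
    moreover have "ip (Kp H t) (Kp H t) = \<bar>t\<bar> * ip (\<lambda>x. t powr ?h * Kp H 1 x) (\<lambda>x. t powr ?h * Kp H 1 x)"
      using ip_affine[of t "Kp H t" "Kp H t" 0] t unfolding e by simp
    moreover have "\<dots> = (t * t powr ?h * t powr ?h) * (C H)\<^sup>2"
      using t by (simp add: ip_scale_left ip_scale_right Kp_one[OF H])
    moreover have "t * t powr ?h * t powr ?h = t powr (2 * H)"
      using t powr_add[of t ?h ?h] powr_mult_base[of t "?h + ?h"] by (simp add: mult.assoc)
    ultimately show ?thesis by simp
  qed
  then show "Kp H t \<in> L2" "ip (Kp H t) (Kp H t) = (C H)\<^sup>2 * t powr (2 * H)" by auto
qed

lemma Km_reflect: "Km H t x = (-1) * Kp H t (t + (-1) * x)"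
  by (simp add: Km_def Kp_def)

lemma Km_L2: "0 < H \<Longrightarrow> H < 1 \<Longrightarrow> 0 \<le> t \<Longrightarrow> Km H t \<in> L2"
  unfolding Km_reflect[abs_def] by (intro L2_scale L2_affine Kp_norm) auto

text \<open>Stationary increments: translation by \<open>s\<close> carries the difference of kernels
  to \<open>Kp H (t - s)\<close>.\<close>

lemma Kp_increment:
  assumes H: "0 < H" "H < 1" and st: "0 \<le> s" "s \<le> t"
  shows "ip (\<lambda>x. Kp H t x - Kp H s x) (\<lambda>x. Kp H t x - Kp H s x) = (C H)\<^sup>2 * (t - s) powr (2 * H)"
proof -
  have "Kp H t (s + 1 * x) - Kp H s (s + 1 * x) = Kp H (t - s) x" for x
    by (simp add: Kp_def algebra_simps)
  then show ?thesis
    using ip_affine[of 1 "\<lambda>x. Kp H t x - Kp H s x" "\<lambda>x. Kp H t x - Kp H s x" s] Kp_norm(2)[OF H, of "t - s"] st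
    by simp
qed

text \<open>The reflection x -> s + t - x carries an increment of \<open>Km\<close> to minus the
  same increment of \<open>Kp\<close>.\<close>

lemma Km_increment:
  assumes H: "0 < H" "H < 1" and st: "0 \<le> s" "s \<le> t"
  shows "ip (\<lambda>x. Km H t x - Km H s x) (\<lambda>x. Km H t x - Km H s x) = (C H)\<^sup>2 * (t - s) powr (2 * H)"
proof -
  have e: "Km H t ((s + t) + (-1) * x) - Km H s ((s + t) + (-1) * x) = (-1) * (Kp H t x - Kp H s x)" for x
    by (simp add: Kp_def Km_def algebra_simps)
  show ?thesis
    using ip_affine[of "-1" "\<lambda>x. Km H t x - Km H s x" "\<lambda>x. Km H t x - Km H s x" "s + t"] Kp_increment[OF H st]
    unfolding e ip_scale_left ip_scale_right by simp
qed

lemma Kp_covariance: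
  assumes H: "0 < H" "H < 1" and st: "0 \<le> s" "0 \<le> t"
  shows "ip (Kp H s) (Kp H t) = (C H)\<^sup>2 / 2 * (s powr (2 * H) + t powr (2 * H) - \<bar>t - s\<bar> powr (2 * H))"
proof -
  have *: "ip (Kp H s) (Kp H t) = (C H)\<^sup>2 / 2 * (s powr (2 * H) + t powr (2 * H) - (t - s) powr (2 * H))"
    if st: "0 \<le> s" "s \<le> t" for s t
  proof -
    have L: "Kp H s \<in> L2" "Kp H t \<in> L2" using Kp_norm[OF H] st by auto
    have "ip (\<lambda>x. Kp H t x - Kp H s x) (\<lambda>x. Kp H t x - Kp H s x)
        = ip (Kp H t) (Kp H t) - 2 * ip (Kp H s) (Kp H t) + ip (Kp H s) (Kp H s)"
      using L by (simp add: ip_diff_left ip_diff_right L2_diff ip_commute[of "Kp H t" "Kp H s"])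
    then show ?thesis using Kp_increment[OF H st] Kp_norm(2)[OF H] st by (simp add: field_simps)
  qed
  show ?thesis
  proof (cases "s \<le> t")
    case True
    then show ?thesis using *[of s t] st by simp
  next
    case False
    then show ?thesis using *[of t s] st by (simp add: ip_commute[of "Kp H s"] abs_if add.commute)
  qed
qed

text \<open>\<open>Kp H 1\<close> vanishes to the right of 1 and \<open>Km H 1\<close> to the left
  of 0. On the interval between, their product is minus a Beta integrand.\<close>

lemma Kp_Km_one:
  assumes H: "0 < H" "H < 1"
  shows "ip (Kp H 1) (Km H 1) = - ((C H)\<^sup>2 * sin (pi * H))"
proof -
  let ?b = "\<lambda>x. x powr ((H + 1/2) - 1) * (1 - x) powr ((H + 1/2) - 1)"
  have int: "set_integrable lborel {0..1} ?b" using H by (intro integrable_Beta) auto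
  have "Kp H 1 x * Km H 1 x = - (indicator {0..1} x *\<^sub>R ?b x)" for x
    by (auto simp: Kp_def Km_def pp_def indicator_def)
  then have "ip (Kp H 1) (Km H 1) = - (LINT x:{0..1}|lborel. ?b x)"
    by (simp add: ip_def set_lebesgue_integral_def)
  also have "(LINT x:{0..1}|lborel. ?b x) = integral {0..1} ?b"
    by (rule set_borel_integral_eq_integral[OF int])
  also have "\<dots> = Beta (H + 1/2) (H + 1/2)"
    using H by (intro integral_unique has_integral_Beta_real) auto
  finally show ?thesis by (simp add: C_square_sin[OF H])
qed

section \<open>Cross-covariances with \<open>B\<close>\<close>

lemma kB_L2: "kB t \<in> L2" unfolding kB_def by (rule L2_indicator_Ioc)

lemma kB_covariance:
  assumes "0 \<le> s" "0 \<le> t"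
  shows "ip (kB s) (kB t) = min s t"
proof -
  have "ip (kB s) (kB t) = (\<integral>x. indicator ({0<..s} \<inter> {0<..t}) x \<partial>lborel)"
    by (simp only: ip_def kB_def indicator_inter_arith)
  also have "{0<..s} \<inter> {0<..t} = {0<..min s t}" by auto
  also have "(\<integral>x. indicator {0<..min s t} x \<partial>lborel) = min s t" using assms by simp
  finally show ?thesis .
qed

lemma kB_increment:
  assumes "0 \<le> s" "s \<le> t"
  shows "ip (\<lambda>x. kB t x - kB s x) (\<lambda>x. kB t x - kB s x) = t - s"
  using assms by (simp add: ip_diff_left ip_diff_right L2_diff kB_L2 kB_covariance)

lemma pp_shift_integral:
  assumes q: "0 < q" and s: "0 \<le> s"
  shows "integrable lborel (\<lambda>x. kB s x * pp (q - 1) (t - x))"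
    "(\<integral>x. kB s x * pp (q - 1) (t - x) \<partial>lborel) = (pp q t - pp q (t - s)) / q"
    "integrable lborel (\<lambda>x. kB s x * pp (q - 1) (x - t))"
    "(\<integral>x. kB s x * pp (q - 1) (x - t) \<partial>lborel) = (pp q (s - t) - pp q (- t)) / q"
proof -
  have m: "(\<lambda>x. indicator {a<..b} x * pp r x) \<in> borel_measurable borel" for a b r by measurable
  note P = pp_integral[OF q, of "t - s" t] and Q = pp_integral[OF q, of "- t" "s - t"]
  have ae: "AE x in lborel. indicator {t - s<..t} (t + (-1) * x) * pp (q - 1) (t + (-1) * x) = kB s x * pp (q - 1) (t - x)"
    using AE_lborel_singleton[of 0] AE_lborel_singleton[of s] by eventually_elim (auto simp: kB_def indicator_def)
  have i: "integrable lborel (\<lambda>x. indicator {t - s<..t} (t + (-1) * x) * pp (q - 1) (t + (-1) * x))"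
    using P(1) s lborel_integrable_real_affine_iff[of "-1" "\<lambda>x. indicator {t - s<..t} x * pp (q - 1) x" t] by simp
  have [measurable]: "kB s \<in> borel_measurable borel" by (simp add: kB_def)
  show "integrable lborel (\<lambda>x. kB s x * pp (q - 1) (t - x))"
    using i ae by (subst (asm) integrable_cong_AE) auto
  have "(\<integral>x. indicator {t - s<..t} x * pp (q - 1) x \<partial>lborel)
      = (\<integral>x. indicator {t - s<..t} (t + (-1) * x) * pp (q - 1) (t + (-1) * x) \<partial>lborel)"
    using lborel_integral_real_affine[of "-1" "\<lambda>x. indicator {t - s<..t} x * pp (q - 1) x" t] by simp
  also have "\<dots> = (\<integral>x. kB s x * pp (q - 1) (t - x) \<partial>lborel)"
    using ae by (intro integral_cong_AE) auto
  finally show "(\<integral>x. kB s x * pp (q - 1) (t - x) \<partial>lborel) = (pp q t - pp q (t - s)) / q"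
    using P(2) s by simp
  have e: "indicator {- t<..s - t} (- t + 1 * x) * pp (q - 1) (- t + 1 * x) = kB s x * pp (q - 1) (x - t)" for x
    by (auto simp: kB_def indicator_def)
  show "integrable lborel (\<lambda>x. kB s x * pp (q - 1) (x - t))"
    using Q(1) s lborel_integrable_real_affine_iff[of 1 "\<lambda>x. indicator {- t<..s - t} x * pp (q - 1) x" "- t"]
    unfolding e by simp
  show "(\<integral>x. kB s x * pp (q - 1) (x - t) \<partial>lborel) = (pp q (s - t) - pp q (- t)) / q"
    using Q(2) s lborel_integral_real_affine[of 1 "\<lambda>x. indicator {- t<..s - t} x * pp (q - 1) x" "- t"]
    unfolding e by simp
qed

lemma kB_Kp:
  assumes H: "0 < H" and st: "0 \<le> s" "0 \<le> t"
  shows "ip (kB s) (Kp H t) = (pp (H + 1/2) t - pp (H + 1/2) (t - s)) / (H + 1/2)"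
proof -
  have h: "(H + 1/2) - 1 = H - 1/2" by simp
  \<comment> \<open>On the support of \<open>kB s\<close> the argument -x is negative, so the second
    term of the kernel drops out.\<close>
  have e: "(\<lambda>x. kB s x * Kp H t x) = (\<lambda>x. kB s x * pp (H - 1/2) (t - x))"
    by (auto simp: Kp_def kB_def indicator_def pp_def)
  show ?thesis
    using pp_shift_integral(2)[of "H + 1/2" s t] H st unfolding h by (simp add: ip_def e)
qed

lemma kB_Km:
  assumes H: "0 < H" and st: "0 \<le> s" "0 \<le> t"
  shows "ip (kB s) (Km H t) = (pp (H + 1/2) (s - t) - pp (H + 1/2) s) / (H + 1/2)"
proof -
  have h: "(H + 1/2) - 1 = H - 1/2" by simp
  note I = pp_shift_integral[of "H + 1/2" s, unfolded h]
  have "ip (kB s) (Km H t) = (\<integral>x. kB s x * pp (H - 1/2) (x - t) - kB s x * pp (H - 1/2) (x - 0) \<partial>lborel)"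
    by (simp add: ip_def Km_def right_diff_distrib)
  also have "\<dots> = (\<integral>x. kB s x * pp (H - 1/2) (x - t) \<partial>lborel) - (\<integral>x. kB s x * pp (H - 1/2) (x - 0) \<partial>lborel)"
    using H st by (intro Bochner_Integration.integral_diff I) auto
  also have "\<dots> = (pp (H + 1/2) (s - t) - pp (H + 1/2) (- t)) / (H + 1/2) - (pp (H + 1/2) (s - 0) - pp (H + 1/2) (- 0)) / (H + 1/2)"
    using H st by (simp only: I)
  also have "\<dots> = (pp (H + 1/2) (s - t) - pp (H + 1/2) s) / (H + 1/2)"
    using st by (simp add: pp_def diff_divide_distrib)
  finally show ?thesis .
qed

definition Ks :: "real \<Rightarrow> real \<Rightarrow> real \<Rightarrow> real" where
  "Ks H t x = Kp H t x + Km H t x"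

text \<open>This antisymmetry is the reason why \<open>E X\<^sup>-(\<tau>) = - E X\<^sup>+(\<tau>)\<close>.\<close>

lemma kB_Ks_antisym:
  assumes H: "0 < H" "H < 1" and st: "0 \<le> s" "0 \<le> t"
  shows "ip (kB s) (Ks H t) + ip (kB t) (Ks H s) = 0"
proof -
  have "ip (kB s) (Ks H t) = ip (kB s) (Kp H t) + ip (kB s) (Km H t)" if "0 \<le> s" "0 \<le> t" for s t
    unfolding Ks_def[abs_def] by (intro ip_add_right kB_L2 Kp_norm Km_L2 H that)
  then show ?thesis
    using H st by (simp add: kB_Kp kB_Km flip: add_divide_distrib)
qed

text \<open>Each order of the arguments contributes a one-sided power; the powers of t - s and s - t
  add up to a power of |t - s|. Only after symmetrization does the covariance of a fractional
  Brownian motion appear.\<close>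

lemma kB_Kp_sym:
  assumes H: "0 < H" "H < 1" and st: "0 \<le> s" "0 \<le> t"
  shows "ip (kB s) (Kp H t) + ip (kB t) (Kp H s)
    = (s powr (H + 1/2) + t powr (H + 1/2) - \<bar>t - s\<bar> powr (H + 1/2)) / (H + 1/2)"
proof -
  have "pp (H + 1/2) (t - s) + pp (H + 1/2) (s - t) = \<bar>t - s\<bar> powr (H + 1/2)"
    by (auto simp: pp_def abs_if)
  moreover have "pp (H + 1/2) s = s powr (H + 1/2)" "pp (H + 1/2) t = t powr (H + 1/2)"
    using st by (auto simp: pp_def)
  ultimately show ?thesis using H st by (simp add: kB_Kp flip: add_divide_distrib)
qed

subsection \<open>The processes as Wiener integrals\<close>

lemma L2_restrict:
  assumes "f \<in> L2" and [measurable]: "A \<in> sets borel"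
  shows "(\<lambda>s. indicator A s * f s) \<in> L2"
proof -
  have [measurable]: "f \<in> borel_measurable borel" using assms by (simp add: L2_def)
  have "integrable lborel (\<lambda>s. (indicator A s * f s)\<^sup>2)"
    by (rule Bochner_Integration.integrable_bound[OF L2_square_integrable[OF assms(1)]])
      (auto simp: indicator_def)
  then show ?thesis by (simp add: L2_def)
qed

context two_sided_brownian_motion
begin

lemma X_plus_wiener:
  assumes H: "0 < H" "H < 1" and t: "0 \<le> t"
  shows "has_wiener_integral M B (Kp H t) (X_plus M B H t)"
proof -
  let ?f = "\<lambda>s. (t - s) powr (H - 1/2) - (- s) powr (H - 1/2)" and ?g = "\<lambda>s. (t - s) powr (H - 1/2)"
  have e: "(\<lambda>s. indicator {..<0} s * ?f s) = (\<lambda>s. indicator {..<0} s * Kp H t s)"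
    "(\<lambda>s. indicator {0<..<t} s * ?g s) = (\<lambda>s. indicator {0<..<t} s * Kp H t s)"
    using t by (auto simp: indicator_def Kp_def pp_def)
  have L: "(\<lambda>s. indicator {..<0} s * ?f s) \<in> L2" "(\<lambda>s. indicator {0<..<t} s * ?g s) \<in> L2"
    unfolding e by (intro L2_restrict Kp_norm(1)[OF H t]; simp)+
  have W: "has_wiener_integral M B (\<lambda>s. indicator {..<0} s * ?f s + indicator {0<..<t} s * ?g s)
      (\<lambda>\<omega>. wiener_integral M B {..<0} ?f \<omega> + wiener_integral M B {0<..<t} ?g \<omega>)"
    by (intro has_wiener_integral_add has_wiener_integral_wiener_integral L)
  show ?thesis
  proof (rule has_wiener_integral_cong[OF W])
    \<comment> \<open>The two ranges of integration in \<open>X_plus\<close> leave out the single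
      point 0.\<close>
    show "AE s in lborel. indicator {..<0} s * ?f s + indicator {0<..<t} s * ?g s = Kp H t s"
      using AE_lborel_singleton[of 0] by eventually_elim (use t in \<open>auto simp: indicator_def Kp_def pp_def\<close>)
    show "AE \<omega> in M. wiener_integral M B {..<0} ?f \<omega> + wiener_integral M B {0<..<t} ?g \<omega> = X_plus M B H t \<omega>"
      by (simp add: X_plus_def)
    show "X_plus M B H t \<in> borel_measurable M"
      using W unfolding has_wiener_integral_def X_plus_def[abs_def] by auto
  qed simp
qed

lemma X_minus_wiener:
  assumes H: "0 < H" "H < 1" and t: "0 \<le> t"
  shows "has_wiener_integral M B (Km H t) (X_minus M B H t)"
proof -
  let ?f = "\<lambda>s. s powr (H - 1/2)" and ?g = "\<lambda>s. s powr (H - 1/2) - (s - t) powr (H - 1/2)"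
  have e: "(\<lambda>s. indicator {0<..<t} s * ?f s) = (\<lambda>s. (-1) * (indicator {0<..<t} s * Km H t s))"
    "(\<lambda>s. indicator {t<..} s * ?g s) = (\<lambda>s. (-1) * (indicator {t<..} s * Km H t s))"
    using t by (auto simp: indicator_def Km_def pp_def)
  have L: "(\<lambda>s. indicator {0<..<t} s * ?f s) \<in> L2" "(\<lambda>s. indicator {t<..} s * ?g s) \<in> L2"
    unfolding e by (intro L2_scale L2_restrict Km_L2[OF H t]; simp)+
  have W: "has_wiener_integral M B (\<lambda>s. (-1) * (indicator {0<..<t} s * ?f s) + (-1) * (indicator {t<..} s * ?g s))
      (\<lambda>\<omega>. (-1) * wiener_integral M B {0<..<t} ?f \<omega> + (-1) * wiener_integral M B {t<..} ?g \<omega>)"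
    by (intro has_wiener_integral_comb has_wiener_integral_wiener_integral L)
  show ?thesis
  proof (rule has_wiener_integral_cong[OF W])
    show "AE s in lborel. (-1) * (indicator {0<..<t} s * ?f s) + (-1) * (indicator {t<..} s * ?g s) = Km H t s"
      using AE_lborel_singleton[of t] by eventually_elim (use t in \<open>auto simp: indicator_def Km_def pp_def\<close>)
    show "AE \<omega> in M. (-1) * wiener_integral M B {0<..<t} ?f \<omega> + (-1) * wiener_integral M B {t<..} ?g \<omega> = X_minus M B H t \<omega>"
      by (simp add: X_minus_def)
    show "X_minus M B H t \<in> borel_measurable M"
      using W unfolding has_wiener_integral_def X_minus_def[abs_def] by auto
  qed simp
qed

lemma B_wiener: "0 \<le> t \<Longrightarrow> has_wiener_integral M B (kB t) (B t)"
  unfolding kB_def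
  by (rule has_wiener_integral_cong[OF has_wiener_integral_increment[of 0 t]]) (auto simp: B_zero)

text \<open>The squared norm of the combined kernel. By the half-angle formulas it is the known
  expression with the squares of cosine and sine of pi (H + 1/2) / 2.\<close>

lemma V_eq:
  assumes H: "0 < H" "H < 1"
  shows "V M B c H = (C H)\<^sup>2 * ((fst c)\<^sup>2 + (snd c)\<^sup>2 - 2 * fst c * snd c * sin (pi * H))"
proof -
  let ?k = "\<lambda>s. fst c * Kp H 1 s + snd c * Km H 1 s"
  let ?X = "linear_comb c (X_plus M B) (X_minus M B) H 1"
  have "has_wiener_integral M B ?k ?X"
    unfolding linear_comb_def[abs_def] by (intro has_wiener_integral_comb X_plus_wiener X_minus_wiener H) auto
  then have g: "gauss M ?X (ip ?k ?k)" by (rule has_wiener_integral_gauss)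
  have L: "Kp H 1 \<in> L2" "Km H 1 \<in> L2" using Kp_norm Km_L2 H by auto
  have km: "ip (Km H 1) (Km H 1) = (C H)\<^sup>2"
    using Km_increment[OF H, of 0 1] by (simp add: Km_def[of H 0])
  have "V M B c H = ip ?k ?k"
    using gauss_mean[OF g ip_self_nonneg] gauss_variance[OF g ip_self_nonneg] by (simp add: V_def Let_def)
  also have "\<dots> = (fst c)\<^sup>2 * ip (Kp H 1) (Kp H 1) + 2 * fst c * snd c * ip (Kp H 1) (Km H 1) + (snd c)\<^sup>2 * ip (Km H 1) (Km H 1)"
    using L by (simp add: ip_add_left ip_add_right L2_add L2_scale ip_scale_left ip_scale_right
        ip_commute[of "Km H 1" "Kp H 1"] power2_eq_square algebra_simps)
  also have "\<dots> = (C H)\<^sup>2 * ((fst c)\<^sup>2 + (snd c)\<^sup>2 - 2 * fst c * snd c * sin (pi * H))"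
    unfolding km Kp_one(2)[OF H] Kp_Km_one[OF H] by (simp add: algebra_simps)
  finally show ?thesis .
qed

end

subsection \<open>Suprema over intervals and dyadic grids\<close>

definition csup :: "(real \<Rightarrow> real) \<Rightarrow> real \<Rightarrow> real \<Rightarrow> real" where
  "csup f a b = Sup (f ` {a..b})"

definition gpt :: "real \<Rightarrow> real \<Rightarrow> nat \<Rightarrow> nat \<Rightarrow> real" where
  "gpt a b n i = a + (b - a) * real i / 2 ^ n"

definition gridmax :: "(real \<Rightarrow> real) \<Rightarrow> real \<Rightarrow> real \<Rightarrow> nat \<Rightarrow> real" where
  "gridmax f a b n = Max ((\<lambda>i. f (gpt a b n i)) ` {..2 ^ n})"

lemma gpt_mem:
  assumes "a \<le> b" "i \<le> 2 ^ n"
  shows "gpt a b n i \<in> {a..b}"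
proof -
  have "real i \<le> real (2 ^ n)" using assms(2) by (simp only: of_nat_le_iff)
  then have "real i / 2 ^ n \<le> 1" by simp
  then have "(b - a) * (real i / 2 ^ n) \<le> (b - a) * 1" using assms by (intro mult_left_mono) auto
  moreover have "0 \<le> (b - a) * (real i / 2 ^ n)" using assms by auto
  ultimately show ?thesis by (simp add: gpt_def)
qed

lemma gridmax_ge: "i \<le> 2 ^ n \<Longrightarrow> f (gpt a b n i) \<le> gridmax f a b n"
  unfolding gridmax_def by (intro Max_ge) auto

lemma gridmax_attained: "\<exists>i\<le>2 ^ n. gridmax f a b n = f (gpt a b n i)"
proof -
  have "gridmax f a b n \<in> (\<lambda>i. f (gpt a b n i)) ` {..2 ^ n}" unfolding gridmax_def by (intro Max_in) auto
  then show ?thesis by auto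
qed

lemma gridmax_le: "(\<And>i. i \<le> 2 ^ n \<Longrightarrow> f (gpt a b n i) \<le> c) \<Longrightarrow> gridmax f a b n \<le> c"
  using gridmax_attained[of n f a b] by auto

lemma csup_attained:
  assumes "continuous_on {a..b} f" "a \<le> b"
  shows "\<exists>t\<in>{a..b}. csup f a b = f t \<and> (\<forall>s\<in>{a..b}. f s \<le> f t)"
proof -
  obtain t where t: "t \<in> {a..b}" "\<forall>s\<in>{a..b}. f s \<le> f t"
    using continuous_attains_sup[of "{a..b}" f] assms by auto
  then have "csup f a b = f t" unfolding csup_def by (intro cSup_eq_maximum) auto
  then show ?thesis using t by blast
qed

lemma csup_ge:
  assumes "continuous_on {a..b} f" "s \<in> {a..b}"
  shows "f s \<le> csup f a b"
  using csup_attained[OF assms(1)] assms(2) by force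

lemma csup_le:
  assumes "continuous_on {a..b} f" "a \<le> b" "\<And>s. s \<in> {a..b} \<Longrightarrow> f s \<le> c"
  shows "csup f a b \<le> c"
  using csup_attained[OF assms(1,2)] assms(3) by force

text \<open>Squeezed between the maximum itself and the value at the grid point just below a
  maximizer, found by rounding down its relative position \<open>z\<close>.\<close>

lemma gridmax_tendsto:
  assumes f: "continuous_on {a..b} f" and ab: "a \<le> b"
  shows "(\<lambda>n. gridmax f a b n) \<longlonglongrightarrow> csup f a b"
proof (cases "a = b")
  case True
  have "gridmax f a b n = f a" for n using True gridmax_attained[of n f a b] by (auto simp: gpt_def)
  moreover have "csup f a b = f a" by (simp add: csup_def True)
  ultimately show ?thesis by simp
next
  case False
  then have ab: "a < b" using ab by simp
  obtain t where t: "t \<in> {a..b}" "csup f a b = f t" using csup_attained[OF f] ab by force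
  define z where "z = (t - a) / (b - a)"
  define i where "i n = nat \<lfloor>z * 2 ^ n\<rfloor>" for n :: nat
  have z: "0 \<le> z" "z \<le> 1" and tz: "t = a + (b - a) * z" using t(1) ab by (auto simp: z_def)
  have i2: "i n \<le> 2 ^ n" for n
  proof -
    have "z * 2 ^ n \<le> 1 * 2 ^ n" using z by (intro mult_right_mono) auto
    then have "\<lfloor>z * 2 ^ n\<rfloor> \<le> \<lfloor>2 ^ n :: real\<rfloor>" by (intro floor_mono) simp
    also have "\<lfloor>2 ^ n :: real\<rfloor> = 2 ^ n" by (metis floor_of_int of_int_numeral of_int_power)
    finally show ?thesis by (simp add: i_def nat_le_iff)
  qed
  have d: "\<bar>gpt a b n (i n) - t\<bar> \<le> (b - a) * (1 / 2) ^ n" for n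
  proof -
    have "real (i n) = of_int \<lfloor>z * 2 ^ n\<rfloor>" using z by (simp add: i_def)
    then have "\<bar>real (i n) - z * 2 ^ n\<bar> \<le> 1" by linarith
    then have "((b - a) / 2 ^ n) * \<bar>real (i n) - z * 2 ^ n\<bar> \<le> ((b - a) / 2 ^ n) * 1"
      using ab by (intro mult_left_mono) auto
    moreover have "gpt a b n (i n) - t = ((b - a) / 2 ^ n) * (real (i n) - z * 2 ^ n)"
      by (simp add: gpt_def tz field_simps)
    then have "\<bar>gpt a b n (i n) - t\<bar> = ((b - a) / 2 ^ n) * \<bar>real (i n) - z * 2 ^ n\<bar>"
      using ab by (simp add: abs_mult)
    ultimately show ?thesis by (simp add: power_divide)
  qed
  have "(\<lambda>n. gpt a b n (i n) - t) \<longlonglongrightarrow> 0"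
  proof (rule Lim_null_comparison)
    show "eventually (\<lambda>n. norm (gpt a b n (i n) - t) \<le> (b - a) * (1 / 2) ^ n) sequentially" using d by simp
    show "(\<lambda>n. (b - a) * (1 / 2) ^ n) \<longlonglongrightarrow> 0" by (intro tendsto_mult_right_zero LIMSEQ_realpow_zero) auto
  qed
  then have lim: "(\<lambda>n. gpt a b n (i n)) \<longlonglongrightarrow> t" by (simp add: LIM_zero_iff)
  have low: "(\<lambda>n. f (gpt a b n (i n))) \<longlonglongrightarrow> f t"
    by (rule continuous_on_tendsto_compose[OF f lim t(1)]) (use gpt_mem[OF less_imp_le[OF ab] i2] in auto)
  have up: "gridmax f a b n \<le> f t" for n
    unfolding t(2)[symmetric] by (intro gridmax_le csup_ge[OF f] gpt_mem less_imp_le[OF ab])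
  show ?thesis
    unfolding t(2)
  proof (rule tendsto_sandwich[OF _ _ low tendsto_const])
    show "eventually (\<lambda>n. f (gpt a b n (i n)) \<le> gridmax f a b n) sequentially" using gridmax_ge[OF i2] by auto
    show "eventually (\<lambda>n. gridmax f a b n \<le> f t) sequentially" using up by auto
  qed
qed

lemma gridmax_measurable:
  assumes "\<And>t. t \<in> {a..b} \<Longrightarrow> (\<lambda>\<omega>. Y t \<omega>) \<in> borel_measurable M" "a \<le> b"
  shows "(\<lambda>\<omega>. gridmax (\<lambda>t. Y t \<omega>) a b n) \<in> borel_measurable M"
  unfolding gridmax_def by (intro borel_measurable_Max) (use assms gpt_mem in auto)

lemma csup_measurable:
  assumes "\<And>t. t \<in> {a..b} \<Longrightarrow> (\<lambda>\<omega>. Y t \<omega>) \<in> borel_measurable M" "a \<le> b"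
    and "\<And>\<omega>. \<omega> \<in> space M \<Longrightarrow> continuous_on {a..b} (\<lambda>t. Y t \<omega>)"
  shows "(\<lambda>\<omega>. csup (\<lambda>t. Y t \<omega>) a b) \<in> borel_measurable M"
proof (rule borel_measurable_LIMSEQ_real)
  show "(\<lambda>\<omega>. gridmax (\<lambda>t. Y t \<omega>) a b n) \<in> borel_measurable M" for n
    by (rule gridmax_measurable[OF assms(1,2)])
  show "(\<lambda>n. gridmax (\<lambda>t. Y t \<omega>) a b n) \<longlonglongrightarrow> csup (\<lambda>t. Y t \<omega>) a b" if "\<omega> \<in> space M" for \<omega>
    by (rule gridmax_tendsto[OF assms(3)[OF that] assms(2)])
qed

text \<open>A grid point of even index belongs to the previous level, and one of odd index is a
  single step away from such a point. Hence at most one increment of each level is used.\<close>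

lemma dyadic_chain:
  fixes y :: "real \<Rightarrow> real"
  assumes "\<And>j k. j \<le> n \<Longrightarrow> k < 2 ^ j \<Longrightarrow> \<bar>y (gpt 0 T j (Suc k)) - y (gpt 0 T j k)\<bar> \<le> d j" "i \<le> 2 ^ n"
  shows "\<bar>y (gpt 0 T n i)\<bar> \<le> \<bar>y 0\<bar> + (\<Sum>j\<le>n. d j)"
  using assms
proof (induction n arbitrary: i)
  case 0
  then have "i = 0 \<or> i = 1" by auto
  moreover have "d 0 \<ge> 0" using order_trans[OF abs_ge_zero 0(1)[of 0 0]] by simp
  ultimately show ?case using 0(1)[of 0 0] by (auto simp: gpt_def)
next
  case (Suc n)
  have half: "gpt 0 T (Suc n) (2 * k) = gpt 0 T n k" for k by (simp add: gpt_def)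
  have IH: "\<bar>y (gpt 0 T n k)\<bar> \<le> \<bar>y 0\<bar> + (\<Sum>j\<le>n. d j)" if "k \<le> 2 ^ n" for k
    using Suc.IH[OF Suc.prems(1) that] by simp
  have d0: "d (Suc n) \<ge> 0"
    using Suc.prems(1)[of "Suc n" 0] abs_ge_zero[of "y (gpt 0 T (Suc n) (Suc 0)) - y (gpt 0 T (Suc n) 0)"] by force
  show ?case
  proof (cases "even i")
    case True
    then obtain k where k: "i = 2 * k" by auto
    then show ?thesis using IH[of k] Suc.prems(2) d0 half by simp
  next
    case False
    then obtain k where k: "i = Suc (2 * k)" by (metis oddE Suc_eq_plus1)
    then have k2: "2 * k < 2 ^ Suc n" "k \<le> 2 ^ n" using Suc.prems(2) by auto
    have "\<bar>y (gpt 0 T (Suc n) i)\<bar> \<le> \<bar>y (gpt 0 T (Suc n) (2 * k))\<bar> + d (Suc n)"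
      using Suc.prems(1)[OF le_refl k2(1)] unfolding k by linarith
    then show ?thesis using IH[OF k2(2)] half by simp
  qed
qed

text \<open>The weighted sum \<open>?S\<close> of the 2r-th powers of all dyadic increments
  dominates the 2r-th power of the grid maximum up to a constant. Level j has 2^j increments, each
  with moment of order a^(2 j r) and weight a^(- j r), so it contributes (2 a^r)^j; the hypothesis
  \<open>r\<close> gives 2 a^r <= 1/2.\<close>

lemma (in prob_space) chaining:
  assumes m: "\<And>t. 0 \<le> t \<Longrightarrow> Y t \<in> borel_measurable M"
    and cont: "\<And>\<omega>. \<omega> \<in> space M \<Longrightarrow> continuous_on {0..} (\<lambda>t. Y t \<omega>)"
    and zero: "AE \<omega> in M. Y 0 \<omega> = 0"
    and inc: "\<And>s t. 0 \<le> s \<Longrightarrow> s \<le> t \<Longrightarrow> gauss M (\<lambda>\<omega>. Y t \<omega> - Y s \<omega>) (c * (t - s) powr (2 * H))"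
    and c: "0 \<le> c" and H: "0 < H" and r: "2 \<le> real r * H"
  obtains K where "0 \<le> K"
    "\<And>T. 0 < T \<Longrightarrow> (\<integral>\<^sup>+ \<omega>. ennreal ((csup (\<lambda>t. \<bar>Y t \<omega>\<bar>) 0 T) ^ (2 * r)) \<partial>M) \<le> ennreal (K * T powr (2 * H * real r))"
proof -
  define g :: real where "g = fact (2 * r) / (2 ^ r * fact r)"
  define a :: real where "a = 2 powr (- H)"
  \<comment> \<open>The 2r-th power of \<rho> is a^r, the ratio of the weights in \<open>?S\<close>.
    An increment of level j is thus at most R \<rho>^j with R the 2r-th root of \<open>?S\<close>,
    and the chain is a geometric series.\<close>
  define \<rho> :: real where "\<rho> = 2 powr (- H / 2)"
  have g0: "g \<ge> 0" by (simp add: g_def)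
  have a0: "a > 0" by (simp add: a_def)
  have r0: "r > 0" using r H by (cases r) auto
  have \<rho>: "0 < \<rho>" "\<rho> < 1" using H by (auto simp: \<rho>_def powr_less_one)
  have \<rho>a: "\<rho> ^ (2 * r) = a ^ r"
    by (simp add: \<rho>_def a_def power_mult power2_eq_square flip: powr_add)
  have ar: "2 * a ^ r \<le> 1 / 2"
  proof -
    have "a ^ r = 2 powr (- (real r * H))" by (simp add: a_def powr_power mult.commute)
    also have "\<dots> \<le> 2 powr (- 2)" using r by (intro powr_mono) auto
    also have "\<dots> = 1 / 4" by (simp add: powr_minus_divide)
    finally show ?thesis by simp
  qed
  \<comment> \<open>The 2 bounds the series of level contributions, and (1 - \<rho>)^(- 2 r) comes
    from the geometric series along a chain.\<close>
  define K where "K = 2 * g * c ^ r / (1 - \<rho>) ^ (2 * r)"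
  have K0: "K \<ge> 0" using g0 c \<rho> by (simp add: K_def)
  have "(\<integral>\<^sup>+ \<omega>. ennreal ((csup (\<lambda>t. \<bar>Y t \<omega>\<bar>) 0 T) ^ (2 * r)) \<partial>M) \<le> ennreal (K * T powr (2 * H * real r))" if T: "0 < T" for T
  proof -
    let ?\<Delta> = "\<lambda>j k \<omega>. Y (gpt 0 T j (Suc k)) \<omega> - Y (gpt 0 T j k) \<omega>"
    let ?S = "\<lambda>n \<omega>. \<Sum>j\<le>n. \<Sum>k<2 ^ j. (?\<Delta> j k \<omega>) ^ (2 * r) / (a ^ r) ^ j"
    let ?m = "\<lambda>n \<omega>. gridmax (\<lambda>t. \<bar>Y t \<omega>\<bar>) 0 T n"
    have gp: "0 \<le> gpt 0 T j k" for j k using T by (simp add: gpt_def)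
    have Ym: "Y (gpt 0 T j k) \<in> borel_measurable M" for j k by (rule m[OF gp])
    have inc': "gauss M (?\<Delta> j k) ((c * T powr (2 * H)) * a ^ (2 * j))" for j k
    proof -
      have d: "gpt 0 T j (Suc k) - gpt 0 T j k = T * (1 / 2 ^ j)" by (simp add: gpt_def field_simps)
      have "(1 / 2 ^ j :: real) powr (2 * H) = a ^ (2 * j)"
      proof -
        have "(1 / 2 ^ j :: real) = 2 powr (- real j)" by (simp add: powr_minus_divide powr_realpow)
        then have "(1 / 2 ^ j :: real) powr (2 * H) = 2 powr (- real j * (2 * H))" by (simp add: powr_powr)
        also have "\<dots> = a ^ (2 * j)" by (simp add: a_def powr_power mult_ac)
        finally show ?thesis .
      qed
      then have "c * (gpt 0 T j (Suc k) - gpt 0 T j k) powr (2 * H) = (c * T powr (2 * H)) * a ^ (2 * j)"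
        unfolding d using T by (subst powr_mult) auto
      moreover have "gpt 0 T j k \<le> gpt 0 T j (Suc k)" using d T by (smt (verit) divide_nonneg_nonneg mult_nonneg_nonneg zero_le_power)
      ultimately show ?thesis using inc[OF gp, of j k "gpt 0 T j (Suc k)"] by (simp only: simp_thms)
    qed
    have v0: "0 \<le> (c * T powr (2 * H)) * a ^ (2 * j)" for j using c a0 by simp
    have Si: "integrable M (?S n)" for n
      by (intro Bochner_Integration.integrable_sum integrable_divide gauss_moment(1)[OF inc' v0])
    have SE: "(\<integral>\<omega>. ?S n \<omega> \<partial>M) \<le> 2 * (g * (c * T powr (2 * H)) ^ r)" for n
    proof -
      have "(\<integral>\<omega>. ?S n \<omega> \<partial>M) = (\<Sum>j\<le>n. \<Sum>k<2 ^ j. (\<integral>\<omega>. (?\<Delta> j k \<omega>) ^ (2 * r) \<partial>M) / (a ^ r) ^ j)"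
        by (subst Bochner_Integration.integral_sum, intro Bochner_Integration.integrable_sum integrable_divide gauss_moment(1)[OF inc' v0])
          (auto intro!: sum.cong Bochner_Integration.integral_sum integrable_divide gauss_moment(1)[OF inc' v0] trans[OF Bochner_Integration.integral_sum])
      also have "\<dots> = (\<Sum>j\<le>n. (g * (c * T powr (2 * H)) ^ r) * (2 * a ^ r) ^ j)"
      proof (rule sum.cong[OF refl])
        fix j
        have "(\<integral>\<omega>. (?\<Delta> j k \<omega>) ^ (2 * r) \<partial>M) / (a ^ r) ^ j = (g * (c * T powr (2 * H)) ^ r) * (a ^ r) ^ j" for k
        proof -
          have "2 * j * r = r * j + r * j" by simp
          then have "(a ^ (2 * j)) ^ r = (a ^ r) ^ j * (a ^ r) ^ j"
            by (simp only: power_mult[symmetric] power_add[symmetric])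
          then show ?thesis
            unfolding gauss_moment(2)[OF inc' v0] g_def[symmetric] using a0 by (simp add: power_mult_distrib)
        qed
        then show "(\<Sum>k<2 ^ j. (\<integral>\<omega>. (?\<Delta> j k \<omega>) ^ (2 * r) \<partial>M) / (a ^ r) ^ j)
            = (g * (c * T powr (2 * H)) ^ r) * (2 * a ^ r) ^ j"
          by (simp add: power_mult_distrib)
      qed
      also have "\<dots> = (g * (c * T powr (2 * H)) ^ r) * (\<Sum>j\<le>n. (2 * a ^ r) ^ j)" by (simp add: sum_distrib_left)
      also have "\<dots> \<le> (g * (c * T powr (2 * H)) ^ r) * 2"
      proof (rule mult_left_mono)
        have "(\<Sum>j\<le>n. (2 * a ^ r) ^ j) \<le> (\<Sum>j\<le>n. (1 / 2) ^ j)" using ar a0 by (intro sum_mono power_mono) auto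
        also have "(\<Sum>j\<le>n. (1 / 2 :: real) ^ j) = 2 * (1 - (1 / 2) ^ Suc n)" by (subst sum_gp0) simp
        also have "\<dots> \<le> (2 :: real)" by simp
        finally show "(\<Sum>j\<le>n. (2 * a ^ r) ^ j) \<le> 2" .
        show "0 \<le> g * (c * T powr (2 * H)) ^ r" using g0 c by simp
      qed
      finally show ?thesis by simp
    qed
    have S0: "0 \<le> ?S n \<omega>" for n \<omega> using a0 by (intro sum_nonneg divide_nonneg_nonneg) (auto simp: zero_le_even_power)
    have mS: "(?m n \<omega>) ^ (2 * r) \<le> ?S n \<omega> / (1 - \<rho>) ^ (2 * r)" if y0: "Y 0 \<omega> = 0" for n \<omega>
    proof -
      let ?R = "root (2 * r) (?S n \<omega>)"
      have R0: "0 \<le> ?R" using S0 r0 by simp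
      have "\<bar>?\<Delta> j k \<omega>\<bar> \<le> ?R * \<rho> ^ j" if jk: "j \<le> n" "k < 2 ^ j" for j k
      proof -
        have "(?\<Delta> j k \<omega>) ^ (2 * r) / (a ^ r) ^ j \<le> (\<Sum>k<2 ^ j. (?\<Delta> j k \<omega>) ^ (2 * r) / (a ^ r) ^ j)"
          using jk a0 by (intro member_le_sum) (auto simp: zero_le_even_power)
        also have "\<dots> \<le> ?S n \<omega>"
          using jk a0 by (intro member_le_sum[of j "{..n}"] sum_nonneg divide_nonneg_nonneg) (auto simp: zero_le_even_power)
        finally have "(?\<Delta> j k \<omega>) ^ (2 * r) \<le> ?S n \<omega> * (a ^ r) ^ j" using a0 by (simp add: field_simps)
        also have "\<dots> = (?R * \<rho> ^ j) ^ (2 * r)"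
        proof -
          have "(\<rho> ^ j) ^ (2 * r) = (a ^ r) ^ j" unfolding \<rho>a[symmetric] by (simp add: mult.commute flip: power_mult)
          then show ?thesis using S0[of \<omega> n] r0 by (simp add: power_mult_distrib real_root_pow_pos2)
        qed
        finally have "\<bar>?\<Delta> j k \<omega>\<bar> ^ (2 * r) \<le> (?R * \<rho> ^ j) ^ (2 * r)" by (simp add: power_even_abs)
        then show ?thesis using R0 \<rho> r0 power_mono_iff[of "\<bar>?\<Delta> j k \<omega>\<bar>" "?R * \<rho> ^ j" "2 * r"] by simp
      qed
      then have "\<bar>Y (gpt 0 T n i) \<omega>\<bar> \<le> \<bar>Y 0 \<omega>\<bar> + (\<Sum>j\<le>n. ?R * \<rho> ^ j)" if "i \<le> 2 ^ n" for i
        using dyadic_chain[where y = "\<lambda>t. Y t \<omega>" and n = n and T = T and d = "\<lambda>j. ?R * \<rho> ^ j" and i = i] that by blast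
      moreover have "(\<Sum>j\<le>n. ?R * \<rho> ^ j) \<le> ?R * (1 / (1 - \<rho>))"
      proof -
        have "(\<Sum>j\<le>n. \<rho> ^ j) \<le> 1 / (1 - \<rho>)"
          using \<rho> by (simp add: sum_gp0 divide_right_mono)
        then show ?thesis using R0 by (simp only: sum_distrib_left[symmetric]) (rule mult_left_mono)
      qed
      ultimately have "?m n \<omega> \<le> ?R / (1 - \<rho>)" using y0 by (intro gridmax_le) force
      moreover have "0 \<le> ?m n \<omega>" using gridmax_ge[of 0 n "\<lambda>t. \<bar>Y t \<omega>\<bar>" 0 T] by (simp add: gpt_def y0)
      ultimately have "(?m n \<omega>) ^ (2 * r) \<le> (?R / (1 - \<rho>)) ^ (2 * r)" by (intro power_mono)
      also have "\<dots> = ?S n \<omega> / (1 - \<rho>) ^ (2 * r)"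
        using S0[of \<omega> n] r0 by (simp add: power_divide real_root_pow_pos2)
      finally show ?thesis .
    qed
    have bound: "(\<integral>\<^sup>+ \<omega>. ennreal ((?m n \<omega>) ^ (2 * r)) \<partial>M) \<le> ennreal (K * T powr (2 * H * real r))" for n
    proof -
      have "(\<integral>\<^sup>+ \<omega>. ennreal ((?m n \<omega>) ^ (2 * r)) \<partial>M) \<le> (\<integral>\<^sup>+ \<omega>. ennreal (?S n \<omega> / (1 - \<rho>) ^ (2 * r)) \<partial>M)"
        using zero by (intro nn_integral_mono_AE) (auto elim!: eventually_mono intro!: ennreal_leI mS)
      also have "\<dots> = ennreal ((\<integral>\<omega>. ?S n \<omega> \<partial>M) / (1 - \<rho>) ^ (2 * r))"
        using Si S0 \<rho> by (subst nn_integral_eq_integral) (auto intro!: divide_nonneg_nonneg)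
      also have "\<dots> \<le> ennreal (2 * (g * (c * T powr (2 * H)) ^ r) / (1 - \<rho>) ^ (2 * r))"
        using SE \<rho> by (intro ennreal_leI divide_right_mono) auto
      also have "2 * (g * (c * T powr (2 * H)) ^ r) / (1 - \<rho>) ^ (2 * r) = K * T powr (2 * H * real r)"
        using T by (simp add: K_def power_mult_distrib powr_power mult_ac)
      finally show ?thesis .
    qed
    have cs: "continuous_on {0..T} (\<lambda>t. \<bar>Y t \<omega>\<bar>)" if "\<omega> \<in> space M" for \<omega>
      by (rule continuous_on_rabs, rule continuous_on_subset[OF cont[OF that]]) auto
    have mm: "?m n \<in> borel_measurable M" for n
      by (rule gridmax_measurable) (use m T in auto)
    have "(\<integral>\<^sup>+ \<omega>. ennreal ((csup (\<lambda>t. \<bar>Y t \<omega>\<bar>) 0 T) ^ (2 * r)) \<partial>M)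
        = (\<integral>\<^sup>+ \<omega>. liminf (\<lambda>n. ennreal ((?m n \<omega>) ^ (2 * r))) \<partial>M)"
    proof (rule nn_integral_cong)
      fix \<omega> assume "\<omega> \<in> space M"
      then have "(\<lambda>n. ?m n \<omega>) \<longlonglongrightarrow> csup (\<lambda>t. \<bar>Y t \<omega>\<bar>) 0 T" using cs T by (intro gridmax_tendsto) auto
      then have "(\<lambda>n. ennreal ((?m n \<omega>) ^ (2 * r))) \<longlonglongrightarrow> ennreal ((csup (\<lambda>t. \<bar>Y t \<omega>\<bar>) 0 T) ^ (2 * r))"
        by (intro tendsto_ennrealI tendsto_power)
      then show "ennreal ((csup (\<lambda>t. \<bar>Y t \<omega>\<bar>) 0 T) ^ (2 * r)) = liminf (\<lambda>n. ennreal ((?m n \<omega>) ^ (2 * r)))"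
        by (intro lim_imp_Liminf[symmetric]) auto
    qed
    also have "\<dots> \<le> liminf (\<lambda>n. \<integral>\<^sup>+ \<omega>. ennreal ((?m n \<omega>) ^ (2 * r)) \<partial>M)"
      using mm by (intro nn_integral_liminf) measurable
    also have "\<dots> \<le> limsup (\<lambda>n. \<integral>\<^sup>+ \<omega>. ennreal ((?m n \<omega>) ^ (2 * r)) \<partial>M)"
      by (rule Liminf_le_Limsup) simp
    also have "\<dots> \<le> ennreal (K * T powr (2 * H * real r))"
      by (rule Limsup_bounded) (use bound in auto)
    finally show ?thesis .
  qed
  then show ?thesis using that K0 by blast
qed

subsection \<open>Uniqueness of the maximizer\<close>

lemma continuous_Max:
  fixes f :: "'i \<Rightarrow> 'a :: topological_space \<Rightarrow> real"
  assumes "finite I" "I \<noteq> {}" "\<And>i. i \<in> I \<Longrightarrow> continuous_on S (f i)"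
  shows "continuous_on S (\<lambda>x. Max ((\<lambda>i. f i x) ` I))"
  using assms
proof (induction I rule: finite_ne_induct)
  case (insert i I)
  have "(\<lambda>x. Max ((\<lambda>i. f i x) ` insert i I)) = (\<lambda>x. max (f i x) (Max ((\<lambda>i. f i x) ` I)))"
    using insert.hyps by (auto simp: Max_insert)
  then show ?case using insert by (auto intro!: continuous_on_max)
qed auto

lemma continuous_on_coordinate: "continuous_on UNIV (\<lambda>x :: nat \<Rightarrow> real. x i)"
  by (intro continuous_on_product_coordinates)

text \<open>
  A Wiener integral that is orthogonal to finitely many others is independent of them. This is
  expressed by comparison with the product space, on which it is moved to a separate coordinate.
\<close>

lemma (in two_sided_brownian_motion) orthogonal_small_ball:
  fixes n :: nat and \<phi> :: "(nat \<Rightarrow> real) \<Rightarrow> real"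
  assumes z: "has_wiener_integral M B z \<xi>" and w: "\<And>k. k < n \<Longrightarrow> has_wiener_integral M B (w k) (W k)"
    and orth: "\<And>k. k < n \<Longrightarrow> ip z (w k) = 0" and v: "0 < ip z z" and d: "0 < d"
    and \<phi>: "continuous_on UNIV \<phi>"
  shows "(\<integral>\<omega>. max 0 (1 - \<bar>\<xi> \<omega> + \<phi> (\<lambda>k. if k < n then W k \<omega> else 0)\<bar> / d) \<partial>M) \<le> 2 * d / sqrt (ip z z)"
proof -
  let ?W = "\<lambda>\<omega> k. if k < n then W k \<omega> else 0"
  \<comment> \<open>A tent in place of an indicator, because laws are compared on continuous test
    functions. It lies below the indicator of |x| <= d and equals 1 at 0.\<close>
  let ?g = "\<lambda>x :: real. max 0 (1 - \<bar>x\<bar> / d)"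
  define X where "X \<omega> k = (case k of 0 \<Rightarrow> \<xi> \<omega> | Suc k \<Rightarrow> ?W \<omega> k)" for \<omega> k
  define Y where "Y p k = (case k of 0 \<Rightarrow> \<xi> (fst p) | Suc k \<Rightarrow> ?W (snd p) k)" for p k
  define f where "f x = ?g (x 0 + \<phi> (\<lambda>k. x (Suc k)))" for x :: "nat \<Rightarrow> real"
  interpret P: pair_prob_space M M ..
  have [measurable]: "\<xi> \<in> borel_measurable M" using z by (simp add: has_wiener_integral_def)
  have Wm: "W k \<in> borel_measurable M" if "k < n" for k using w[OF that] by (simp add: has_wiener_integral_def)
  have Wm' [measurable]: "(\<lambda>\<omega>. ?W \<omega> k) \<in> borel_measurable M" for k using Wm by (cases "k < n") auto
  have WV: "?W \<in> borel_measurable M" by (rule measurable_vector[of n], rule Wm') simp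
  have L: "z \<in> L2" "\<And>k. k < n \<Longrightarrow> w k \<in> L2"
    using has_wiener_integral_gauss(1) z w by auto
  have \<phi>m: "\<phi> \<in> borel_measurable borel" using \<phi> by (rule borel_measurable_continuous_onI)
  have [measurable]: "(\<lambda>\<omega>. \<phi> (?W \<omega>)) \<in> borel_measurable M" using WV \<phi>m by simp
  have "(\<integral>\<omega>. f (X \<omega>) \<partial>M) = (\<integral>p. f (Y p) \<partial>(M \<Otimes>\<^sub>M M))"
  proof (rule law_eq_bounded[where X = X and Y = Y and f = f and n = "Suc n" and b = 1])
    show "prob_space M" by unfold_locales
    show "prob_space (M \<Otimes>\<^sub>M M)" by unfold_locales
    show "(\<lambda>\<omega>. X \<omega> i) \<in> borel_measurable M" for i by (cases i) (auto simp: X_def)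
    show "(\<lambda>p. Y p i) \<in> borel_measurable (M \<Otimes>\<^sub>M M)" for i by (cases i) (auto simp: Y_def)
    show "X \<omega> i = 0" if "Suc n \<le> i" for i \<omega> using that by (cases i) (auto simp: X_def)
    show "Y p i = 0" if "Suc n \<le> i" for i p using that by (cases i) (auto simp: Y_def)
    show "\<bar>f x\<bar> \<le> 1" for x using d by (auto simp: f_def abs_le_iff)
    have "continuous_on UNIV (\<lambda>x :: nat \<Rightarrow> real. \<lambda>k. x (Suc k))"
      by (rule continuous_on_coordinatewise_then_product, rule continuous_on_coordinate)
    then have "continuous_on UNIV (\<lambda>x :: nat \<Rightarrow> real. \<phi> (\<lambda>k. x (Suc k)))"
      by (rule continuous_on_compose2[OF \<phi>]) auto
    then show "continuous_on UNIV f" unfolding f_def using d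
      by (intro continuous_on_max continuous_on_diff continuous_on_divide continuous_on_const continuous_on_rabs
          continuous_on_add continuous_on_coordinate) auto
    fix u :: "nat \<Rightarrow> real"
    let ?s = "\<lambda>s. \<Sum>k<n. u (Suc k) * w k s"
    have sum: "has_wiener_integral M B ?s (\<lambda>\<omega>. \<Sum>k<n. u (Suc k) * W k \<omega>)"
      by (intro has_wiener_integral_sum has_wiener_integral_scale w) auto
    have sL: "?s \<in> L2" using sum by (rule has_wiener_integral_gauss)
    have uz: "has_wiener_integral M B (\<lambda>s. u 0 * z s) (\<lambda>\<omega>. u 0 * \<xi> \<omega>)"
      by (intro has_wiener_integral_scale z)
    have "ip z ?s = (\<Sum>k<n. u (Suc k) * ip z (w k))"
      using L ip_sum_left[of "{..<n}" "\<lambda>k s. u (Suc k) * w k s" z]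
      by (simp add: ip_commute[of z] ip_scale_left L2_scale)
    then have zs: "ip z ?s = 0" using orth by simp
    \<comment> \<open>Orthogonality makes the variance split exactly as for independent coordinates
      on the product space.\<close>
    have v: "ip (\<lambda>s. u 0 * z s + ?s s) (\<lambda>s. u 0 * z s + ?s s) = ip (\<lambda>s. u 0 * z s) (\<lambda>s. u 0 * z s) + ip ?s ?s"
      using L(1) sL zs by (simp add: ip_add_left ip_add_right L2_add L2_scale ip_scale_left ip_scale_right
          ip_commute[of ?s z])
    have g1: "gauss M (\<lambda>\<omega>. u 0 * \<xi> \<omega> + (\<Sum>k<n. u (Suc k) * W k \<omega>)) (ip (\<lambda>s. u 0 * z s) (\<lambda>s. u 0 * z s) + ip ?s ?s)"
      using has_wiener_integral_gauss(2)[OF has_wiener_integral_add[OF uz sum]] unfolding v .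
    have e1: "(\<lambda>\<omega>. u 0 * \<xi> \<omega> + (\<Sum>k<n. u (Suc k) * W k \<omega>)) = (\<lambda>\<omega>. \<Sum>i<Suc n. u i * X \<omega> i)"
      unfolding sum.lessThan_Suc_shift by (simp add: X_def)
    have g2: "gauss (M \<Otimes>\<^sub>M M) (\<lambda>p. u 0 * \<xi> (fst p) + (\<Sum>k<n. u (Suc k) * W k (snd p)))
        (ip (\<lambda>s. u 0 * z s) (\<lambda>s. u 0 * z s) + ip ?s ?s)"
      by (rule gauss_pair[OF _ _ has_wiener_integral_gauss(2)[OF uz] has_wiener_integral_gauss(2)[OF sum]]) unfold_locales
    have e2: "(\<lambda>p. u 0 * \<xi> (fst p) + (\<Sum>k<n. u (Suc k) * W k (snd p))) = (\<lambda>p. \<Sum>i<Suc n. u i * Y p i)"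
      unfolding sum.lessThan_Suc_shift by (simp add: Y_def)
    show "\<exists>v. gauss M (\<lambda>\<omega>. \<Sum>i<Suc n. u i * X \<omega> i) v \<and> gauss (M \<Otimes>\<^sub>M M) (\<lambda>\<omega>. \<Sum>i<Suc n. u i * Y \<omega> i) v"
      by (intro exI conjI) (rule g1[unfolded e1], rule g2[unfolded e2])
  qed
  also have "(\<integral>p. f (Y p) \<partial>(M \<Otimes>\<^sub>M M)) = (\<integral>p. (\<lambda>(\<omega>1, \<omega>2). ?g (\<xi> \<omega>1 + \<phi> (?W \<omega>2))) p \<partial>(M \<Otimes>\<^sub>M M))"
    by (intro Bochner_Integration.integral_cong) (auto simp: f_def Y_def split: prod.split cong: if_cong)
  also have "\<dots> = (\<integral>\<omega>2. (\<integral>\<omega>1. ?g (\<xi> \<omega>1 + \<phi> (?W \<omega>2)) \<partial>M) \<partial>M)"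
  proof (rule P.integral_snd[symmetric])
    show "integrable (M \<Otimes>\<^sub>M M) (\<lambda>(\<omega>1, \<omega>2). ?g (\<xi> \<omega>1 + \<phi> (?W \<omega>2)))"
      by (rule P.integrable_const_bound[where B = 1]) (use d in \<open>auto simp: abs_le_iff\<close>)
  qed
  also have "\<dots> \<le> (\<integral>\<omega>2. 2 * d / sqrt (ip z z) \<partial>M)"
  proof (rule integral_mono')
    fix \<omega>2
    let ?r = "\<phi> (?W \<omega>2)"
    have "(\<integral>\<omega>1. ?g (\<xi> \<omega>1 + ?r) \<partial>M) \<le> (\<integral>\<omega>1. indicator {\<omega> \<in> space M. \<bar>\<xi> \<omega> + ?r\<bar> \<le> d} \<omega>1 \<partial>M)"
    proof (rule integral_mono')
      show "integrable M (indicat_real {\<omega> \<in> space M. \<bar>\<xi> \<omega> + ?r\<bar> \<le> d})"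
        by (rule integrable_real_indicator) (auto simp: emeasure_eq_measure)
      show "?g (\<xi> \<omega>1 + ?r) \<le> indicator {\<omega> \<in> space M. \<bar>\<xi> \<omega> + ?r\<bar> \<le> d} \<omega>1" if "\<omega>1 \<in> space M" for \<omega>1
        using that d by (auto simp: indicator_def field_simps)
    qed auto
    also have "\<dots> = prob {\<omega> \<in> space M. \<bar>\<xi> \<omega> + ?r\<bar> \<le> d}" by (simp add: Int_absorb2 subset_eq)
    also have "\<dots> \<le> 2 * d / sqrt (ip z z)"
      by (rule gauss_small_ball[OF has_wiener_integral_gauss(2)[OF z] v d])
    finally show "(\<integral>\<omega>1. ?g (\<xi> \<omega>1 + ?r) \<partial>M) \<le> 2 * d / sqrt (ip z z)" .
  qed (use d in \<open>auto intro!: Bochner_Integration.integral_nonneg divide_nonneg_nonneg simp: ip_self_nonneg\<close>)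
  also have "\<dots> = 2 * d / sqrt (ip z z)" by (simp add: prob_space)
  finally show ?thesis by (simp add: f_def X_def)
qed

lemma gridmax_shift:
  "gridmax (\<lambda>t. g t + c) x y n = gridmax g x y n + (c :: real)"
  unfolding gridmax_def by (rule Max_add_commute) auto

context two_sided_brownian_motion
begin

lemma B_drift_continuous: "\<omega> \<in> space M \<Longrightarrow> continuous_on S (\<lambda>t. B t \<omega> - a * t)"
  by (intro continuous_intros continuous_on_subset[OF B_continuous]) auto

lemma csup_B_drift_measurable [measurable]:
  "x \<le> y \<Longrightarrow> (\<lambda>\<omega>. csup (\<lambda>t. B t \<omega> - a * t) x y) \<in> borel_measurable M"
  by (rule csup_measurable) (auto intro: B_drift_continuous)

text \<open>The difference of the two maxima is \<open>B y' - B y\<close> plus a function of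
  increments inside {0..y} and {y'..T}. The first term is orthogonal to all of these, so the
  small-ball bound rules out an atom at 0; it is proved on grids, uniformly in the level.\<close>

lemma distinct_maxima:
  assumes y: "0 < y" "y < y'" "y' < T"
  shows "AE \<omega> in M. csup (\<lambda>t. B t \<omega> - a * t) 0 y \<noteq> csup (\<lambda>t. B t \<omega> - a * t) y' T"
proof -
  let ?f = "\<lambda>\<omega> t. B t \<omega> - a * t"
  let ?D = "\<lambda>\<omega>. csup (?f \<omega>) y' T - csup (?f \<omega>) 0 y"
  let ?Dn = "\<lambda>n \<omega>. gridmax (?f \<omega>) y' T n - gridmax (?f \<omega>) 0 y n"
  let ?g = "\<lambda>d x :: real. max 0 (1 - \<bar>x\<bar> / d)"
  have [measurable]: "?D \<in> borel_measurable M" using y by (intro borel_measurable_diff csup_B_drift_measurable) auto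
  have [measurable]: "(\<lambda>\<omega>. csup (?f \<omega>) y' T) \<in> borel_measurable M" "(\<lambda>\<omega>. csup (?f \<omega>) 0 y) \<in> borel_measurable M"
    using y by (auto intro!: csup_B_drift_measurable)
  have Dnm [measurable]: "?Dn n \<in> borel_measurable M" for n
    using y by (intro borel_measurable_diff gridmax_measurable) auto
  let ?c = "2 / sqrt (y' - y)"
  have En: "(\<integral>\<omega>. ?g d (?Dn n \<omega>) \<partial>M) \<le> ?c * d" if d: "d > 0" for d n
  proof -
    let ?N = "Suc (2 ^ n)"
    let ?\<xi> = "\<lambda>\<omega>. 1 * B y' \<omega> + (-1) * B y \<omega>"
    let ?z = "\<lambda>s. 1 * kB y' s + (-1) * kB y s"
    \<comment> \<open>The points of both grids in one list; \<open>c\<close> is the reference point,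
      the end of the own interval that faces the gap. Increments are taken from there so that they
      avoid the gap between y and y'.\<close>
    define t where "t k = (if k < ?N then gpt 0 y n k else gpt y' T n (k - ?N))" for k
    define c where "c k = (if k < ?N then y else y')" for k
    let ?W = "\<lambda>k \<omega>. 1 * B (t k) \<omega> + (-1) * B (c k) \<omega>"
    let ?w = "\<lambda>k s. 1 * kB (t k) s + (-1) * kB (c k) s"
    have t: "(k < ?N \<and> t k \<in> {0..y} \<and> c k = y) \<or> (t k \<in> {y'..T} \<and> c k = y')" if "k < 2 * ?N" for k
    proof (cases "k < ?N")
      case True
      then show ?thesis using gpt_mem[of 0 y k n] y by (simp add: t_def c_def)
    next
      case False
      then have "k - ?N \<le> 2 ^ n" using that by simp
      then show ?thesis using False gpt_mem[of y' T "k - ?N" n] y by (simp add: t_def c_def)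
    qed
    have tc: "0 \<le> t k" "0 \<le> c k" if "k < 2 * ?N" for k using t[OF that] y by auto
    define \<phi> where "\<phi> x = Max ((\<lambda>i. x (?N + i) - a * gpt y' T n i) ` {..2 ^ n}) - Max ((\<lambda>i. x i - a * gpt 0 y n i) ` {..2 ^ n})"
      for x :: "nat \<Rightarrow> real"
    have \<phi>: "continuous_on UNIV \<phi>" unfolding \<phi>_def
      by (intro continuous_on_diff continuous_Max continuous_on_coordinate continuous_on_const) auto
    have z: "has_wiener_integral M B ?z ?\<xi>" using y by (intro has_wiener_integral_comb B_wiener) auto
    have w: "has_wiener_integral M B (?w k) (?W k)" if "k < 2 * ?N" for k
      using tc[OF that] by (intro has_wiener_integral_comb B_wiener)
    have ipf: "ip (\<lambda>s. 1 * kB p s + (-1) * kB q s) (\<lambda>s. 1 * kB p' s + (-1) * kB q' s)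
        = min p p' - min p q' - min q p' + min q q'" if "0 \<le> p" "0 \<le> q" "0 \<le> p'" "0 \<le> q'" for p q p' q'
      using that by (simp add: ip_diff_left ip_diff_right L2_diff kB_L2 kB_covariance)
    have zz: "ip ?z ?z = y' - y" using y by (subst ipf) auto
    have orth: "ip ?z (?w k) = 0" if "k < 2 * ?N" for k
      using t[OF that] tc[OF that] y by (subst ipf) auto
    have "(\<integral>\<omega>. ?g d (?\<xi> \<omega> + \<phi> (\<lambda>k. if k < 2 * ?N then ?W k \<omega> else 0)) \<partial>M) \<le> 2 * d / sqrt (ip ?z ?z)"
      by (rule orthogonal_small_ball[OF z w orth _ d \<phi>]) (use y zz in auto)
    moreover have "?\<xi> \<omega> + \<phi> (\<lambda>k. if k < 2 * ?N then ?W k \<omega> else 0) = ?Dn n \<omega>" for \<omega>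
    proof -
      have "Max ((\<lambda>i. (if ?N + i < 2 * ?N then ?W (?N + i) \<omega> else 0) - a * gpt y' T n i) ` {..2 ^ n})
          = gridmax (\<lambda>t. ?f \<omega> t + (- B y' \<omega>)) y' T n"
        unfolding gridmax_def by (intro arg_cong[where f = Max] image_cong) (auto simp: t_def c_def)
      moreover have "Max ((\<lambda>i. (if i < 2 * ?N then ?W i \<omega> else 0) - a * gpt 0 y n i) ` {..2 ^ n})
          = gridmax (\<lambda>t. ?f \<omega> t + (- B y \<omega>)) 0 y n"
        unfolding gridmax_def by (intro arg_cong[where f = Max] image_cong) (auto simp: t_def c_def)
      ultimately show ?thesis unfolding \<phi>_def gridmax_shift by simp
    qed
    ultimately show ?thesis unfolding zz by simp
  qed
  have ED: "(\<integral>\<omega>. ?g d (?D \<omega>) \<partial>M) \<le> ?c * d" if d: "d > 0" for d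
  proof (rule tendsto_upperbound)
    show "(\<lambda>n. \<integral>\<omega>. ?g d (?Dn n \<omega>) \<partial>M) \<longlonglongrightarrow> (\<integral>\<omega>. ?g d (?D \<omega>) \<partial>M)"
    proof (rule integral_dominated_convergence[where w = "\<lambda>_. 1"])
      show "AE \<omega> in M. (\<lambda>n. ?g d (?Dn n \<omega>)) \<longlonglongrightarrow> ?g d (?D \<omega>)"
      proof (rule AE_I2)
        fix \<omega> assume "\<omega> \<in> space M"
        then have c: "continuous_on S (?f \<omega>)" for S by (rule B_drift_continuous)
        have lim: "(\<lambda>n. ?Dn n \<omega>) \<longlonglongrightarrow> ?D \<omega>" using y by (intro tendsto_diff gridmax_tendsto c) auto
        have "isCont (?g d) (?D \<omega>)" using d by (intro continuous_intros) auto
        from isCont_tendsto_compose[OF this lim]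
        show "(\<lambda>n. ?g d (?Dn n \<omega>)) \<longlonglongrightarrow> ?g d (?D \<omega>)" .
      qed
    qed (use d in \<open>auto simp: abs_le_iff\<close>)
    show "eventually (\<lambda>n. (\<integral>\<omega>. ?g d (?Dn n \<omega>) \<partial>M) \<le> ?c * d) sequentially" using En[OF d] by simp
  qed simp
  let ?E = "{\<omega> \<in> space M. ?D \<omega> = 0}"
  have "prob ?E \<le> ?c * d" if d: "d > 0" for d
  proof -
    have "prob ?E = (\<integral>\<omega>. indicator ?E \<omega> \<partial>M)" by (simp add: Int_absorb2 subset_eq)
    also have "\<dots> \<le> (\<integral>\<omega>. ?g d (?D \<omega>) \<partial>M)"
    proof (rule integral_mono)
      show "integrable M (\<lambda>\<omega>. ?g d (?D \<omega>))"
        by (rule integrable_const_bound[of _ 1]) (use d in \<open>auto simp: abs_le_iff\<close>)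
      show "integrable M (indicat_real ?E)"
        by (rule integrable_real_indicator) (auto simp: emeasure_eq_measure)
      show "indicat_real ?E \<omega> \<le> ?g d (?D \<omega>)" for \<omega> by (auto simp: indicator_def)
    qed
    also have "\<dots> \<le> ?c * d" by (rule ED[OF d])
    finally show ?thesis .
  qed
  moreover have "((\<lambda>d. ?c * d) \<longlongrightarrow> ?c * 0) (at_right 0)" by (intro tendsto_intros)
  ultimately have "prob ?E \<le> ?c * 0"
    by (intro tendsto_lowerbound[where F = "at_right 0" and f = "\<lambda>d. ?c * d"]) (auto intro!: eventually_at_rightI[of 0 1])
  then have "prob ?E = 0" using measure_nonneg[of M ?E] by linarith
  then have "AE \<omega> in M. \<not> (?D \<omega> = 0)" by (subst (asm) prob_eq_0) auto
  then show ?thesis by (auto elim!: eventually_mono)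
qed

text \<open>Two maximizers s < t are separated by rationals s < y < y' < t, and then the maxima over
  {0..y} and {y'..T} agree. Countably many exceptional null sets exclude this.\<close>

lemma unique_argmax:
  assumes T: "0 < T"
  shows "AE \<omega> in M. \<forall>s\<in>{0..T}. \<forall>t\<in>{0..T}.
    (\<forall>u\<in>{0..T}. B u \<omega> - a * u \<le> B s \<omega> - a * s) \<longrightarrow> (\<forall>u\<in>{0..T}. B u \<omega> - a * u \<le> B t \<omega> - a * t) \<longrightarrow> s = t"
proof -
  have "AE \<omega> in M. \<forall>p\<in>\<rat> \<times> \<rat>. 0 < fst p \<and> fst p < snd p \<and> snd p < T \<longrightarrow>
    csup (\<lambda>t. B t \<omega> - a * t) 0 (fst p) \<noteq> csup (\<lambda>t. B t \<omega> - a * t) (snd p) T"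
  proof (subst AE_ball_countable)
    show "countable (\<rat> \<times> \<rat> :: (real \<times> real) set)" by (intro countable_SIGMA countable_rat)
    show "\<forall>p\<in>\<rat> \<times> \<rat>. AE \<omega> in M. 0 < fst p \<and> fst p < snd p \<and> snd p < T \<longrightarrow>
      csup (\<lambda>t. B t \<omega> - a * t) 0 (fst p) \<noteq> csup (\<lambda>t. B t \<omega> - a * t) (snd p) T"
      using distinct_maxima by auto
  qed
  then show ?thesis
  proof (rule AE_mp, intro AE_I2 impI ballI)
    fix \<omega> s t
    assume \<omega>: "\<omega> \<in> space M" and st: "s \<in> {0..T}" "t \<in> {0..T}"
      and ne: "\<forall>p\<in>\<rat> \<times> \<rat>. 0 < fst p \<and> fst p < snd p \<and> snd p < T \<longrightarrow>
        csup (\<lambda>t. B t \<omega> - a * t) 0 (fst p) \<noteq> csup (\<lambda>t. B t \<omega> - a * t) (snd p) T"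
      and ms: "\<forall>u\<in>{0..T}. B u \<omega> - a * u \<le> B s \<omega> - a * s" and mt: "\<forall>u\<in>{0..T}. B u \<omega> - a * u \<le> B t \<omega> - a * t"
    let ?f = "\<lambda>t. B t \<omega> - a * t"
    have c: "continuous_on S ?f" for S using \<omega> by (rule B_drift_continuous)
    have *: False if st: "s \<in> {0..T}" "t \<in> {0..T}" "s < t" and ms: "\<forall>u\<in>{0..T}. ?f u \<le> ?f s" and mt: "\<forall>u\<in>{0..T}. ?f u \<le> ?f t" for s t
    proof -
      obtain y where y: "y \<in> \<rat>" "s < y" "y < t" using Rats_dense_in_real[OF \<open>s < t\<close>] by blast
      obtain y' where y': "y' \<in> \<rat>" "y < y'" "y' < t" using Rats_dense_in_real[OF \<open>y < t\<close>] by blast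
      have "?f s = ?f t" using ms mt st by (meson order_antisym)
      moreover have "csup ?f 0 y = ?f s"
        using ms st y y' by (intro antisym csup_le csup_ge c) auto
      moreover have "csup ?f y' T = ?f t"
        using mt st y y' by (intro antisym csup_le csup_ge c) auto
      ultimately show False using ne y y' st by force
    qed
    show "s = t" using *[of s t] *[of t s] st ms mt by (cases s t rule: linorder_cases) auto
  qed
qed

end

subsection \<open>The maximizer\<close>

lemma horizon_finite: "horizon (ereal T) = {0..T}"
  by (auto simp: horizon_def)

lemma horizon_infinite: "horizon \<infinity> = {0..}"
  by (auto simp: horizon_def)

text \<open>By continuity the maximizers form a nonempty closed set, which therefore contains its
  infimum.\<close>

lemma \<tau>_finite:
  assumes c: "continuous_on {0..T} (\<lambda>t. B t \<omega> - a * t)" and T: "0 \<le> T"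
  shows "\<tau> B (ereal T) a \<omega> \<in> {0..T}"
    "s \<in> {0..T} \<Longrightarrow> B s \<omega> - a * s \<le> B (\<tau> B (ereal T) a \<omega>) \<omega> - a * \<tau> B (ereal T) a \<omega>"
    "t \<in> {0..T} \<Longrightarrow> (\<And>s. s \<in> {0..T} \<Longrightarrow> B s \<omega> - a * s \<le> B t \<omega> - a * t) \<Longrightarrow> \<tau> B (ereal T) a \<omega> \<le> t"
proof -
  let ?f = "\<lambda>t. B t \<omega> - a * t"
  let ?A = "{t \<in> {0..T}. \<forall>s\<in>{0..T}. ?f s \<le> ?f t}"
  obtain m where m: "m \<in> {0..T}" "csup ?f 0 T = ?f m" "\<forall>s\<in>{0..T}. ?f s \<le> ?f m" using csup_attained[OF c T] by blast
  have A: "?A = {t \<in> {0..T}. ?f t = ?f m}" using m by (auto intro: antisym)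
  have "closed ?A" unfolding A by (rule continuous_closed_preimage_constant[OF c]) auto
  moreover have "?A \<noteq> {}" using m by auto
  moreover have b: "bdd_below ?A" by (rule bdd_belowI[of _ 0]) auto
  ultimately have I: "Inf ?A \<in> ?A" by (intro closed_contains_Inf)
  have t: "\<tau> B (ereal T) a \<omega> = Inf ?A" using \<open>?A \<noteq> {}\<close> by (simp add: \<tau>_def horizon_finite Let_def del: Collect_empty_eq)
  show "\<tau> B (ereal T) a \<omega> \<in> {0..T}" "s \<in> {0..T} \<Longrightarrow> ?f s \<le> ?f (\<tau> B (ereal T) a \<omega>)"
    using I unfolding t by auto
  show "t \<in> {0..T} \<Longrightarrow> (\<And>s. s \<in> {0..T} \<Longrightarrow> ?f s \<le> ?f t) \<Longrightarrow> \<tau> B (ereal T) a \<omega> \<le> t"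
    unfolding t using b by (intro cInf_lower) auto
qed

text \<open>Danskin's envelope theorem. The difference quotient lies between y at the maximizer
  \<open>tm\<close> and y at a maximizer \<open>t n\<close> of the perturbed function; uniqueness
  forces \<open>t n\<close> to converge to \<open>tm\<close>.\<close>

lemma envelope_limit:
  fixes f y :: "real \<Rightarrow> real"
  assumes f: "continuous_on {0..T} f" and y: "continuous_on {0..T} y" and T: "0 \<le> T"
    and tm: "tm \<in> {0..T}" "\<And>s. s \<in> {0..T} \<Longrightarrow> f s \<le> f tm"
    and uniq: "\<And>t. t \<in> {0..T} \<Longrightarrow> (\<And>s. s \<in> {0..T} \<Longrightarrow> f s \<le> f t) \<Longrightarrow> t = tm"
  shows "(\<lambda>n. (csup (\<lambda>t. f t + (1 / real (Suc n)) * y t) 0 T - csup f 0 T) / (1 / real (Suc n))) \<longlonglongrightarrow> y tm"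
proof -
  define e where "e n = 1 / real (Suc n)" for n
  have e: "e n > 0" for n by (simp add: e_def)
  have e0: "e \<longlonglongrightarrow> 0" unfolding e_def using LIMSEQ_inverse_real_of_nat by (simp add: inverse_eq_divide)
  have c: "continuous_on {0..T} (\<lambda>t. f t + e n * y t)" for n by (intro continuous_intros f y)
  have "\<forall>n. \<exists>t\<in>{0..T}. csup (\<lambda>t. f t + e n * y t) 0 T = f t + e n * y t"
    using csup_attained[OF c T] by blast
  then obtain t where t: "\<And>n. t n \<in> {0..T}" "\<And>n. csup (\<lambda>t. f t + e n * y t) 0 T = f (t n) + e n * y (t n)" by metis
  have f0: "csup f 0 T = f tm" by (intro antisym csup_le csup_ge f T tm)
  have ge: "f tm + e n * y tm \<le> f (t n) + e n * y (t n)" for n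
    using csup_ge[OF c tm(1)] t(2) by metis
  define m where "m = csup (\<lambda>t. \<bar>y t\<bar>) 0 T"
  have m: "\<bar>y s\<bar> \<le> m" if "s \<in> {0..T}" for s
    unfolding m_def using csup_ge[OF continuous_on_rabs[OF y] that] by simp
  have lim: "t \<longlonglongrightarrow> tm"
  proof (rule LIMSEQ_I)
    fix \<eta> :: real assume "\<eta> > 0"
    \<comment> \<open>On this compact set f stays below \<open>f tm\<close> by a fixed gap, which a
      perturbation cannot bridge once 2 m e(n) is smaller than the gap.\<close>
    let ?K = "{0..T} \<inter> {s. \<eta> \<le> \<bar>s - tm\<bar>}"
    have "closed {s. \<eta> \<le> \<bar>s - tm\<bar>}" by (intro closed_Collect_le continuous_intros)
    then have K: "compact ?K" by (intro compact_Int_closed) auto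
    show "\<exists>n0. \<forall>n\<ge>n0. norm (t n - tm) < \<eta>"
    proof (cases "?K = {}")
      case True
      have "norm (t n - tm) < \<eta>" for n
      proof (rule ccontr)
        assume "\<not> norm (t n - tm) < \<eta>"
        then have "t n \<in> ?K" using t(1) by auto
        then show False using True by blast
      qed
      then show ?thesis by blast
    next
      case False
      obtain k where k: "k \<in> ?K" "\<forall>s\<in>?K. f s \<le> f k"
        using continuous_attains_sup[OF K False continuous_on_subset[OF f]] by auto
      have "f k < f tm"
      proof (rule ccontr)
        assume "\<not> f k < f tm"
        then have "f k = f tm" using tm(2)[of k] k(1) by simp
        then have "f s \<le> f k" if "s \<in> {0..T}" for s using tm(2)[OF that] by simp
        then have "k = tm" using k(1) by (intro uniq) auto
        then show False using k(1) \<open>\<eta> > 0\<close> by simp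
      qed
      moreover have "(\<lambda>n. e n * (2 * m)) \<longlonglongrightarrow> 0 * (2 * m)" by (intro tendsto_mult e0 tendsto_const)
      ultimately have "eventually (\<lambda>n. e n * (2 * m) < f tm - f k) sequentially"
        by (intro order_tendstoD(2)[of _ 0]) auto
      then obtain n0 where n0: "\<And>n. n \<ge> n0 \<Longrightarrow> e n * (2 * m) < f tm - f k" by (auto simp: eventually_sequentially)
      have "norm (t n - tm) < \<eta>" if n: "n \<ge> n0" for n
      proof (rule ccontr)
        assume "\<not> norm (t n - tm) < \<eta>"
        then have "t n \<in> ?K" using t(1) by auto
        then have "f (t n) \<le> f k" using k by blast
        moreover have "e n * (y (t n) - y tm) \<le> e n * (2 * m)"
          using m[OF t(1)[of n]] m[OF tm(1)] e[of n] by (intro mult_left_mono) auto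
        ultimately show False using ge[of n] n0[OF n] by (simp add: algebra_simps)
      qed
      then show ?thesis by blast
    qed
  qed
  have up: "(\<lambda>n. y (t n)) \<longlonglongrightarrow> y tm"
    by (rule continuous_on_tendsto_compose[OF y lim tm(1)]) (use t(1) in auto)
  have "(\<lambda>n. (csup (\<lambda>t. f t + e n * y t) 0 T - csup f 0 T) / e n) \<longlonglongrightarrow> y tm"
  proof (rule tendsto_sandwich[OF _ _ tendsto_const up])
    show "eventually (\<lambda>n. y tm \<le> (csup (\<lambda>t. f t + e n * y t) 0 T - csup f 0 T) / e n) sequentially"
      unfolding f0 t(2) using ge e by (auto simp: field_simps intro!: always_eventually)
    show "eventually (\<lambda>n. (csup (\<lambda>t. f t + e n * y t) 0 T - csup f 0 T) / e n \<le> y (t n)) sequentially"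
      unfolding f0 t(2) using tm(2)[OF t(1)] e by (auto simp: field_simps intro!: always_eventually)
  qed
  then show ?thesis by (simp add: e_def)
qed

section \<open>Measurability of the maximizer and of a process evaluated there\<close>

context two_sided_brownian_motion
begin

text \<open>As the leftmost maximizer is taken, it is at most s exactly when the maximum over {0..s}
  already reaches the maximum over {0..T}.\<close>

lemma \<tau>_finite_measurable:
  assumes T: "0 \<le> T"
  shows "\<tau> B (ereal T) a \<in> borel_measurable M"
proof (rule borel_measurableI_le)
  fix s :: real
  let ?f = "\<lambda>\<omega> t. B t \<omega> - a * t"
  note t = \<tau>_finite[where B = B and a = a, OF B_drift_continuous T]
  consider "s < 0" | "0 \<le> s" "s < T" | "T \<le> s" by linarith
  then show "{\<omega> \<in> space M. \<tau> B (ereal T) a \<omega> \<le> s} \<in> sets M"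
  proof cases
    case 1
    then have "{\<omega> \<in> space M. \<tau> B (ereal T) a \<omega> \<le> s} = {}" using t(1) by force
    then show ?thesis by (simp only: sets.empty_sets)
  next
    case 3
    then have "{\<omega> \<in> space M. \<tau> B (ereal T) a \<omega> \<le> s} = space M" using t(1) by force
    then show ?thesis by (simp only: sets.top)
  next
    case 2
    have "\<tau> B (ereal T) a \<omega> \<le> s \<longleftrightarrow> csup (?f \<omega>) 0 T \<le> csup (?f \<omega>) 0 s" if \<omega>: "\<omega> \<in> space M" for \<omega>
    proof
      have c: "continuous_on S (?f \<omega>)" for S using \<omega> by (rule B_drift_continuous)
      {
        assume "\<tau> B (ereal T) a \<omega> \<le> s"
        then have "?f \<omega> (\<tau> B (ereal T) a \<omega>) \<le> csup (?f \<omega>) 0 s" using t(1)[OF \<omega>] by (intro csup_ge c) auto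
        moreover have "csup (?f \<omega>) 0 T \<le> ?f \<omega> (\<tau> B (ereal T) a \<omega>)" using t(2)[OF \<omega>] by (intro csup_le c T) auto
        ultimately show "csup (?f \<omega>) 0 T \<le> csup (?f \<omega>) 0 s" by simp
      }
      assume le: "csup (?f \<omega>) 0 T \<le> csup (?f \<omega>) 0 s"
      obtain m where m: "m \<in> {0..s}" "csup (?f \<omega>) 0 s = ?f \<omega> m" using csup_attained[OF c 2(1)] by blast
      have "\<tau> B (ereal T) a \<omega> \<le> m"
      proof (rule t(3)[OF \<omega>])
        show "m \<in> {0..T}" using m 2 by auto
        show "?f \<omega> u \<le> ?f \<omega> m" if "u \<in> {0..T}" for u using csup_ge[OF c that] le m(2) by simp
      qed
      then show "\<tau> B (ereal T) a \<omega> \<le> s" using m by simp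
    qed
    then have "{\<omega> \<in> space M. \<tau> B (ereal T) a \<omega> \<le> s} = {\<omega> \<in> space M. csup (?f \<omega>) 0 T \<le> csup (?f \<omega>) 0 s}" by auto
    moreover have "(\<lambda>\<omega>. csup (?f \<omega>) 0 T) \<in> borel_measurable M" "(\<lambda>\<omega>. csup (?f \<omega>) 0 s) \<in> borel_measurable M"
      using T 2 by (auto intro!: csup_B_drift_measurable)
    ultimately show ?thesis by simp
  qed
qed

text \<open>The random time is rounded down to multiples of 1 / (n + 1), which leaves countably many
  values; continuity of the paths gives the limit.\<close>

lemma process_at_measurable:
  fixes s :: "'w \<Rightarrow> real" and Z :: "real \<Rightarrow> 'w \<Rightarrow> real"
  assumes m: "\<And>t. 0 \<le> t \<Longrightarrow> Z t \<in> borel_measurable M"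
    and c: "\<And>\<omega>. \<omega> \<in> space M \<Longrightarrow> continuous_on {0..} (\<lambda>t. Z t \<omega>)"
    and s [measurable]: "s \<in> borel_measurable M" and s0: "\<And>\<omega>. \<omega> \<in> space M \<Longrightarrow> 0 \<le> s \<omega>"
  shows "(\<lambda>\<omega>. Z (s \<omega>) \<omega>) \<in> borel_measurable M"
proof (rule borel_measurable_LIMSEQ_real)
  let ?k = "\<lambda>n \<omega>. nat \<lfloor>s \<omega> * real (Suc n)\<rfloor>"
  show "(\<lambda>\<omega>. Z (real (?k n \<omega>) / real (Suc n)) \<omega>) \<in> borel_measurable M" for n
  proof (rule measurable_compose_countable[where f = "\<lambda>k \<omega>. Z (real k / real (Suc n)) \<omega>"])
    show "(\<lambda>\<omega>. Z (real k / real (Suc n)) \<omega>) \<in> borel_measurable M" for k :: nat using m by simp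
    show "?k n \<in> measurable M (count_space UNIV)" by measurable
  qed
  fix \<omega> assume \<omega>: "\<omega> \<in> space M"
  have "(\<lambda>n. real (?k n \<omega>) / real (Suc n)) \<longlonglongrightarrow> s \<omega>"
  proof (rule tendsto_sandwich)
    have k: "real (?k n \<omega>) = of_int \<lfloor>s \<omega> * real (Suc n)\<rfloor>" for n using s0[OF \<omega>] by simp
    have "s \<omega> - 1 / real (Suc n) \<le> real (?k n \<omega>) / real (Suc n) \<and> real (?k n \<omega>) / real (Suc n) \<le> s \<omega>" for n
    proof -
      have "s \<omega> * real (Suc n) - 1 \<le> real (?k n \<omega>)" "real (?k n \<omega>) \<le> s \<omega> * real (Suc n)" unfolding k by linarith+
      moreover have "p - 1 / N \<le> q / N \<and> q / N \<le> p" if "p * N - 1 \<le> q" "q \<le> p * N" "0 < N" for p q N :: real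
      proof -
        have "p - 1 / N = (p * N - 1) / N" using that by (simp add: field_simps)
        also have "\<dots> \<le> q / N" using that by (intro divide_right_mono) auto
        finally show ?thesis using that by (simp add: pos_divide_le_eq)
      qed
      ultimately show ?thesis by simp
    qed
    then show "eventually (\<lambda>n. s \<omega> - 1 / real (Suc n) \<le> real (?k n \<omega>) / real (Suc n)) sequentially"
      "eventually (\<lambda>n. real (?k n \<omega>) / real (Suc n) \<le> s \<omega>) sequentially" by auto
    have "(\<lambda>n. s \<omega> - inverse (real (Suc n))) \<longlonglongrightarrow> s \<omega> - 0" by (intro tendsto_diff tendsto_const LIMSEQ_inverse_real_of_nat)
    then show "(\<lambda>n. s \<omega> - 1 / real (Suc n)) \<longlonglongrightarrow> s \<omega>" by (simp add: inverse_eq_divide)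
  qed auto
  then show "(\<lambda>n. Z (real (?k n \<omega>) / real (Suc n)) \<omega>) \<longlonglongrightarrow> Z (s \<omega>) \<omega>"
    by (rule continuous_on_tendsto_compose[OF c[OF \<omega>]]) (use s0[OF \<omega>] in auto)
qed

end

section \<open>Derivative of the expected maximum\<close>

context two_sided_brownian_motion
begin

text \<open>The hypothesis \<open>grid\<close> passes to the maximum over the interval, so
  difference quotients for positive perturbations have nonnegative expectation; their limit is Z at
  the maximizer. A one-sided derivative is enough.\<close>

lemma perturbation_nonneg:
  assumes T: "0 < T"
    and m: "\<And>t. 0 \<le> t \<Longrightarrow> Z t \<in> borel_measurable M"
    and c: "\<And>\<omega>. \<omega> \<in> space M \<Longrightarrow> continuous_on {0..} (\<lambda>t. Z t \<omega>)"
    and iB: "integrable M (\<lambda>\<omega>. csup (\<lambda>t. \<bar>B t \<omega>\<bar>) 0 T)"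
    and iZ: "integrable M (\<lambda>\<omega>. csup (\<lambda>t. \<bar>Z t \<omega>\<bar>) 0 T)"
    and grid: "\<And>\<epsilon> n. 0 < \<epsilon> \<Longrightarrow> (\<integral>\<omega>. gridmax (\<lambda>t. B t \<omega> - a * t) 0 T n \<partial>M)
      \<le> (\<integral>\<omega>. gridmax (\<lambda>t. B t \<omega> - a * t + \<epsilon> * Z t \<omega>) 0 T n \<partial>M)"
  shows "0 \<le> (\<integral>\<omega>. Z (\<tau> B (ereal T) a \<omega>) \<omega> \<partial>M)"
proof -
  let ?f = "\<lambda>\<omega> t. B t \<omega> - a * t"
  let ?F = "\<lambda>\<epsilon> \<omega> t. ?f \<omega> t + \<epsilon> * Z t \<omega>"
  let ?b = "\<lambda>\<omega>. csup (\<lambda>t. \<bar>B t \<omega>\<bar>) 0 T" and ?z = "\<lambda>\<omega>. csup (\<lambda>t. \<bar>Z t \<omega>\<bar>) 0 T"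
  have cB: "continuous_on {0..T} (\<lambda>t. B t \<omega>)" if "\<omega> \<in> space M" for \<omega>
    by (rule continuous_on_subset[OF B_continuous[OF that]]) simp
  have cZ: "continuous_on {0..T} (\<lambda>t. Z t \<omega>)" if "\<omega> \<in> space M" for \<omega>
    by (rule continuous_on_subset[OF c[OF that]]) auto
  have cF: "continuous_on {0..T} (?F \<epsilon> \<omega>)" if "\<omega> \<in> space M" for \<epsilon> \<omega>
    using that by (intro continuous_intros cB cZ)
  have bB: "\<bar>B t \<omega>\<bar> \<le> ?b \<omega>" if "\<omega> \<in> space M" "t \<in> {0..T}" for t \<omega>
    using csup_ge[OF continuous_on_rabs[OF cB[OF that(1)]] that(2)] .
  have bZ: "\<bar>Z t \<omega>\<bar> \<le> ?z \<omega>" if "\<omega> \<in> space M" "t \<in> {0..T}" for t \<omega>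
    using csup_ge[OF continuous_on_rabs[OF cZ[OF that(1)]] that(2)] .
  let ?w = "\<lambda>\<epsilon> \<omega>. ?b \<omega> + \<bar>a\<bar> * T + \<bar>\<epsilon>\<bar> * ?z \<omega>"
  have bF: "\<bar>?F \<epsilon> \<omega> t\<bar> \<le> ?w \<epsilon> \<omega>" if "\<omega> \<in> space M" "t \<in> {0..T}" for \<epsilon> t \<omega>
  proof -
    have "\<bar>a * t\<bar> \<le> \<bar>a\<bar> * T" "\<bar>\<epsilon> * Z t \<omega>\<bar> \<le> \<bar>\<epsilon>\<bar> * ?z \<omega>"
      unfolding abs_mult using that bZ[OF that] by (auto intro!: mult_left_mono)
    then show ?thesis using bB[OF that] by linarith
  qed
  have iw: "integrable M (?w \<epsilon>)" for \<epsilon> using iB iZ by auto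
  have mF: "(\<lambda>\<omega>. ?F \<epsilon> \<omega> t) \<in> borel_measurable M" if "0 \<le> t" for \<epsilon> t using m[OF that] by measurable
  have mg: "(\<lambda>\<omega>. gridmax (?F \<epsilon> \<omega>) 0 T n) \<in> borel_measurable M" for \<epsilon> n
    using T mF by (intro gridmax_measurable) auto
  have mc: "(\<lambda>\<omega>. csup (?F \<epsilon> \<omega>) 0 T) \<in> borel_measurable M" for \<epsilon>
    using T mF cF by (intro csup_measurable) auto
  have bc: "\<bar>csup (?F \<epsilon> \<omega>) 0 T\<bar> \<le> ?w \<epsilon> \<omega>" if "\<omega> \<in> space M" for \<epsilon> \<omega>
    using csup_attained[OF cF[OF that], of \<epsilon>] T bF[OF that] by force
  have ic: "integrable M (\<lambda>\<omega>. csup (?F \<epsilon> \<omega>) 0 T)" for \<epsilon>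
    by (rule Bochner_Integration.integrable_bound[OF iw[of \<epsilon>] mc], rule AE_I2)
      (use order_trans[OF bc abs_ge_self] in simp)
  have lim: "(\<lambda>n. \<integral>\<omega>. gridmax (?F \<epsilon> \<omega>) 0 T n \<partial>M) \<longlonglongrightarrow> (\<integral>\<omega>. csup (?F \<epsilon> \<omega>) 0 T \<partial>M)" for \<epsilon>
  proof (rule integral_dominated_convergence[where w = "?w \<epsilon>"])
    show "(\<lambda>\<omega>. csup (?F \<epsilon> \<omega>) 0 T) \<in> borel_measurable M" by (rule mc)
    show "(\<lambda>\<omega>. gridmax (?F \<epsilon> \<omega>) 0 T n) \<in> borel_measurable M" for n by (rule mg)
    show "integrable M (?w \<epsilon>)" by (rule iw)
    show "AE \<omega> in M. (\<lambda>n. gridmax (?F \<epsilon> \<omega>) 0 T n) \<longlonglongrightarrow> csup (?F \<epsilon> \<omega>) 0 T"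
      by (rule AE_I2) (use T cF in \<open>auto intro!: gridmax_tendsto\<close>)
    show "AE \<omega> in M. norm (gridmax (?F \<epsilon> \<omega>) 0 T n) \<le> ?w \<epsilon> \<omega>" for n
    proof (rule AE_I2)
      fix \<omega> assume \<omega>: "\<omega> \<in> space M"
      obtain i where i: "i \<le> 2 ^ n" "gridmax (?F \<epsilon> \<omega>) 0 T n = ?F \<epsilon> \<omega> (gpt 0 T n i)"
        using gridmax_attained[of n "?F \<epsilon> \<omega>" 0 T] by blast
      show "norm (gridmax (?F \<epsilon> \<omega>) 0 T n) \<le> ?w \<epsilon> \<omega>"
        unfolding i(2) real_norm_def using T by (intro bF \<omega> gpt_mem i(1)) auto
    qed
  qed
  have mono: "(\<integral>\<omega>. csup (?F 0 \<omega>) 0 T \<partial>M) \<le> (\<integral>\<omega>. csup (?F \<epsilon> \<omega>) 0 T \<partial>M)" if "\<epsilon> > 0" for \<epsilon>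
    by (rule LIMSEQ_le[OF lim[of 0] lim[of \<epsilon>]]) (use grid[OF that] in auto)
  let ?q = "\<lambda>n \<omega>. (csup (?F (1 / real (Suc n)) \<omega>) 0 T - csup (?F 0 \<omega>) 0 T) / (1 / real (Suc n))"
  have mt: "(\<lambda>\<omega>. Z (\<tau> B (ereal T) a \<omega>) \<omega>) \<in> borel_measurable M"
  proof (rule process_at_measurable[where Z = Z and s = "\<tau> B (ereal T) a"])
    show "\<tau> B (ereal T) a \<in> borel_measurable M" using T by (intro \<tau>_finite_measurable) simp
    show "0 \<le> \<tau> B (ereal T) a \<omega>" if "\<omega> \<in> space M" for \<omega>
      using \<tau>_finite(1)[where B = B and a = a and T = T and \<omega> = \<omega>, OF B_drift_continuous[OF that]] T by simp
  qed (use m c in auto)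
  have "(\<lambda>n. \<integral>\<omega>. ?q n \<omega> \<partial>M) \<longlonglongrightarrow> (\<integral>\<omega>. Z (\<tau> B (ereal T) a \<omega>) \<omega> \<partial>M)"
  proof (rule integral_dominated_convergence[where w = ?z])
    show "(\<lambda>\<omega>. Z (\<tau> B (ereal T) a \<omega>) \<omega>) \<in> borel_measurable M" by (rule mt)
    show "integrable M ?z" by (rule iZ)
    show "?q n \<in> borel_measurable M" for n
      by (intro borel_measurable_divide borel_measurable_diff mc borel_measurable_const)
    show "AE \<omega> in M. (\<lambda>n. ?q n \<omega>) \<longlonglongrightarrow> Z (\<tau> B (ereal T) a \<omega>) \<omega>"
      using unique_argmax[OF T, of a] AE_space
    proof eventually_elim
      case (elim \<omega>)
      note t = \<tau>_finite[where B = B and a = a and \<omega> = \<omega>, OF B_drift_continuous[OF elim(2)] less_imp_le[OF T]]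
      have "(\<lambda>n. (csup (\<lambda>t. ?f \<omega> t + (1 / real (Suc n)) * Z t \<omega>) 0 T - csup (?f \<omega>) 0 T) / (1 / real (Suc n))) \<longlonglongrightarrow> Z (\<tau> B (ereal T) a \<omega>) \<omega>"
      proof (rule envelope_limit[where f = "?f \<omega>" and y = "\<lambda>t. Z t \<omega>" and tm = "\<tau> B (ereal T) a \<omega>"])
        show "continuous_on {0..T} (?f \<omega>)" using elim(2) by (rule B_drift_continuous)
        show "continuous_on {0..T} (\<lambda>t. Z t \<omega>)" using elim(2) by (rule cZ)
        show "t = \<tau> B (ereal T) a \<omega>" if "t \<in> {0..T}" "\<And>s. s \<in> {0..T} \<Longrightarrow> ?f \<omega> s \<le> ?f \<omega> t" for t
          using elim(1) that t by blast
      qed (use T t in auto)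
      then show ?case by simp
    qed
    \<comment> \<open>Taking a maximum is 1-Lipschitz in the uniform norm, so the quotient is
      bounded by the supremum of |Z| whatever the size of the perturbation.\<close>
    show "AE \<omega> in M. norm (?q n \<omega>) \<le> ?z \<omega>" for n
    proof (rule AE_I2)
      fix \<omega> assume \<omega>: "\<omega> \<in> space M"
      define e where "e = 1 / real (Suc n)"
      have e: "e > 0" by (simp add: e_def)
      have d: "\<bar>e * Z t \<omega>\<bar> \<le> e * ?z \<omega>" if "t \<in> {0..T}" for t
        using bZ[OF \<omega> that] e by (simp add: abs_mult)
      have "csup (?F e \<omega>) 0 T \<le> csup (?F 0 \<omega>) 0 T + e * ?z \<omega>"
      proof (rule csup_le[OF cF[OF \<omega>]])
        fix s assume s: "s \<in> {0..T}"
        show "?F e \<omega> s \<le> csup (?F 0 \<omega>) 0 T + e * ?z \<omega>" using csup_ge[OF cF[OF \<omega>, of 0] s] d[OF s] by (simp add: abs_le_iff)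
      qed (use T in simp)
      moreover have "csup (?F 0 \<omega>) 0 T \<le> csup (?F e \<omega>) 0 T + e * ?z \<omega>"
      proof (rule csup_le[OF cF[OF \<omega>]])
        fix s assume s: "s \<in> {0..T}"
        show "?F 0 \<omega> s \<le> csup (?F e \<omega>) 0 T + e * ?z \<omega>" using csup_ge[OF cF[OF \<omega>, of e] s] d[OF s] by (simp add: abs_le_iff)
      qed (use T in simp)
      ultimately have "\<bar>csup (?F e \<omega>) 0 T - csup (?F 0 \<omega>) 0 T\<bar> \<le> e * ?z \<omega>" by (simp add: abs_le_iff)
      then show "norm (?q n \<omega>) \<le> ?z \<omega>" unfolding e_def[symmetric] using e by (simp add: field_simps)
    qed
  qed
  moreover have "0 \<le> (\<integral>\<omega>. ?q n \<omega> \<partial>M)" for n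
  proof -
    have "(\<integral>\<omega>. ?q n \<omega> \<partial>M) = ((\<integral>\<omega>. csup (?F (1 / real (Suc n)) \<omega>) 0 T \<partial>M) - (\<integral>\<omega>. csup (?F 0 \<omega>) 0 T \<partial>M)) / (1 / real (Suc n))"
      by (subst integral_divide_zero, subst Bochner_Integration.integral_diff[OF ic ic]) (rule refl)
    then show ?thesis using mono[of "1 / real (Suc n)"] by simp
  qed
  ultimately show ?thesis by (intro tendsto_lowerbound) auto
qed

end

subsection \<open>Comparison of expected maxima\<close>

lemma integrable_Max:
  fixes f :: "'i \<Rightarrow> 'a \<Rightarrow> real"
  assumes "finite I" "I \<noteq> {}" "\<And>i. i \<in> I \<Longrightarrow> integrable M (f i)"
  shows "integrable M (\<lambda>x. Max ((\<lambda>i. f i x) ` I))"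
  using assms
proof (induction I rule: finite_ne_induct)
  case (insert i I)
  have "(\<lambda>x. Max ((\<lambda>i. f i x) ` insert i I)) = (\<lambda>x. max (f i x) (Max ((\<lambda>i. f i x) ` I)))"
    using insert.hyps by (auto simp: Max_insert)
  then show ?case using insert by auto
qed auto

lemma law_eq_Max:
  fixes X :: "nat \<Rightarrow> 'a \<Rightarrow> real" and Y :: "nat \<Rightarrow> 'b \<Rightarrow> real"
  assumes P: "prob_space M1" "prob_space M2" and n: "0 < n"
    and iX: "\<And>i. i < n \<Longrightarrow> integrable M1 (X i)" and iY: "\<And>i. i < n \<Longrightarrow> integrable M2 (Y i)"
    and eq: "\<And>u. \<exists>v. gauss M1 (\<lambda>\<omega>. \<Sum>i<n. u i * X i \<omega>) v \<and> gauss M2 (\<lambda>\<omega>. \<Sum>i<n. u i * Y i \<omega>) v"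
  shows "(\<integral>\<omega>. Max ((\<lambda>i. X i \<omega> - b i) ` {..<n}) \<partial>M1) = (\<integral>\<omega>. Max ((\<lambda>i. Y i \<omega> - b i) ` {..<n}) \<partial>M2)"
proof -
  interpret M1: prob_space M1 by fact
  interpret M2: prob_space M2 by fact
  define f where "f x = Max ((\<lambda>i. x i - b i) ` {..<n})" for x :: "nat \<Rightarrow> real"
  define X' where "X' \<omega> i = (if i < n then X i \<omega> else 0)" for \<omega> i
  define Y' where "Y' \<omega> i = (if i < n then Y i \<omega> else 0)" for \<omega> i
  have eX: "f (X' \<omega>) = Max ((\<lambda>i. X i \<omega> - b i) ` {..<n})" for \<omega>
    unfolding f_def X'_def by (intro arg_cong[where f = Max] image_cong) auto
  have eY: "f (Y' \<omega>) = Max ((\<lambda>i. Y i \<omega> - b i) ` {..<n})" for \<omega>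
    unfolding f_def Y'_def by (intro arg_cong[where f = Max] image_cong) auto
  have ne: "{..<n} \<noteq> {}" using n by auto
  have "(\<integral>\<omega>. f (X' \<omega>) \<partial>M1) = (\<integral>\<omega>. f (Y' \<omega>) \<partial>M2)"
  proof (rule law_eq[where X = X' and Y = Y' and f = f and n = n, OF P])
    show "(\<lambda>\<omega>. X' \<omega> i) \<in> borel_measurable M1" if "i < n" for i using iX[OF that] that by (simp add: X'_def)
    show "(\<lambda>\<omega>. Y' \<omega> i) \<in> borel_measurable M2" if "i < n" for i using iY[OF that] that by (simp add: Y'_def)
    show "continuous_on UNIV f" unfolding f_def
      using ne by (intro continuous_Max continuous_on_diff continuous_on_coordinate continuous_on_const) auto
    show "integrable M1 (\<lambda>\<omega>. f (X' \<omega>))" unfolding eX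
      using ne iX by (intro integrable_Max Bochner_Integration.integrable_diff) auto
    show "integrable M2 (\<lambda>\<omega>. f (Y' \<omega>))" unfolding eY
      using ne iY by (intro integrable_Max Bochner_Integration.integrable_diff) auto
    have "(\<Sum>i<n. u i * X' \<omega> i) = (\<Sum>i<n. u i * X i \<omega>)" for u \<omega> by (intro sum.cong) (auto simp: X'_def)
    moreover have "(\<Sum>i<n. u i * Y' \<omega> i) = (\<Sum>i<n. u i * Y i \<omega>)" for u \<omega> by (intro sum.cong) (auto simp: Y'_def)
    ultimately show "\<exists>v. gauss M1 (\<lambda>\<omega>. \<Sum>i<n. u i * X' \<omega> i) v \<and> gauss M2 (\<lambda>\<omega>. \<Sum>i<n. u i * Y' \<omega> i) v" for u
      using eq by (simp only:)
  qed (auto simp: X'_def Y'_def)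
  then show ?thesis by (simp only: eX eY)
qed

text \<open>Averaging the two signs of \<open>N\<close>, convexity of the maximum gives the inequality.\<close>

lemma expected_Max_mono:
  fixes X Z :: "nat \<Rightarrow> 'a \<Rightarrow> real" and F N :: "nat \<Rightarrow> 'b \<Rightarrow> real"
  assumes P: "prob_space M1" "prob_space M2" and n: "0 < n"
    and i1: "\<And>i. i < n \<Longrightarrow> integrable M1 (X i)" "\<And>i. i < n \<Longrightarrow> integrable M1 (Z i)"
    and i2: "\<And>i. i < n \<Longrightarrow> integrable M2 (F i)" "\<And>i. i < n \<Longrightarrow> integrable M2 (N i)"
    and base: "\<And>u. \<exists>v. gauss M1 (\<lambda>\<omega>. \<Sum>i<n. u i * X i \<omega>) v \<and> gauss M2 (\<lambda>\<omega>. \<Sum>i<n. u i * F i \<omega>) v"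
    and plus: "\<And>u. \<exists>v. gauss M1 (\<lambda>\<omega>. \<Sum>i<n. u i * (X i \<omega> + Z i \<omega>)) v \<and>
      gauss M2 (\<lambda>\<omega>. \<Sum>i<n. u i * (F i \<omega> + N i \<omega>)) v"
    and minus: "\<And>u. \<exists>v. gauss M1 (\<lambda>\<omega>. \<Sum>i<n. u i * (X i \<omega> + Z i \<omega>)) v \<and>
      gauss M2 (\<lambda>\<omega>. \<Sum>i<n. u i * (F i \<omega> - N i \<omega>)) v"
  shows "(\<integral>\<omega>. Max ((\<lambda>i. X i \<omega> - b i) ` {..<n}) \<partial>M1) \<le> (\<integral>\<omega>. Max ((\<lambda>i. X i \<omega> + Z i \<omega> - b i) ` {..<n}) \<partial>M1)"
proof -
  interpret M2: prob_space M2 by fact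
  have ne: "{..<n} \<noteq> {}" using n by auto
  let ?I = "\<integral>\<omega>. Max ((\<lambda>i. X i \<omega> + Z i \<omega> - b i) ` {..<n}) \<partial>M1"
  let ?p = "\<lambda>\<omega>. Max ((\<lambda>i. F i \<omega> + N i \<omega> - b i) ` {..<n})" and ?m = "\<lambda>\<omega>. Max ((\<lambda>i. F i \<omega> - N i \<omega> - b i) ` {..<n})"
  let ?f = "\<lambda>\<omega>. Max ((\<lambda>i. F i \<omega> - b i) ` {..<n})"
  have 0: "(\<integral>\<omega>. Max ((\<lambda>i. X i \<omega> - b i) ` {..<n}) \<partial>M1) = (\<integral>\<omega>. ?f \<omega> \<partial>M2)"
    by (rule law_eq_Max[OF P n i1(1) i2(1) base])
  have 1: "?I = (\<integral>\<omega>. ?p \<omega> \<partial>M2)"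
    by (rule law_eq_Max[OF P n, where X = "\<lambda>i \<omega>. X i \<omega> + Z i \<omega>" and Y = "\<lambda>i \<omega>. F i \<omega> + N i \<omega>"])
      (use i1 i2 plus in auto)
  have 2: "?I = (\<integral>\<omega>. ?m \<omega> \<partial>M2)"
    by (rule law_eq_Max[OF P n, where X = "\<lambda>i \<omega>. X i \<omega> + Z i \<omega>" and Y = "\<lambda>i \<omega>. F i \<omega> - N i \<omega>"])
      (use i1 i2 minus in auto)
  have ip: "integrable M2 ?p"
    using ne by (intro integrable_Max Bochner_Integration.integrable_diff Bochner_Integration.integrable_add M2.integrable_const i2) auto
  have im: "integrable M2 ?m"
    using ne by (intro integrable_Max Bochner_Integration.integrable_diff Bochner_Integration.integrable_add M2.integrable_const i2) auto
  have if': "integrable M2 ?f"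
    using ne by (intro integrable_Max Bochner_Integration.integrable_diff Bochner_Integration.integrable_add M2.integrable_const i2) auto
  have "(\<integral>\<omega>. ?f \<omega> \<partial>M2) \<le> (\<integral>\<omega>. (?p \<omega> + ?m \<omega>) / 2 \<partial>M2)"
  proof (rule integral_mono)
    fix \<omega>
    have "?f \<omega> \<in> (\<lambda>i. F i \<omega> - b i) ` {..<n}" using ne by (intro Max_in) auto
    then obtain i where i: "i < n" "?f \<omega> = F i \<omega> - b i" by auto
    have "F i \<omega> + N i \<omega> - b i \<le> ?p \<omega>" "F i \<omega> - N i \<omega> - b i \<le> ?m \<omega>" using i(1) by (auto intro!: Max_ge)
    then show "?f \<omega> \<le> (?p \<omega> + ?m \<omega>) / 2" unfolding i(2) by simp
  qed (use ip im if' in auto)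
  also have "\<dots> = ?I"
    using ip im 1 2 by simp
  finally show ?thesis using 0 by simp
qed

text \<open>A quadratic form sees only the symmetric part of its matrix. This is why just the
  symmetrized cross-covariance with \<open>B\<close> matters.\<close>

lemma cross_symmetrize:
  assumes b: "\<And>i. i < n \<Longrightarrow> b i \<in> L2" and k: "\<And>i. i < n \<Longrightarrow> k i \<in> L2"
  shows "2 * ip (\<lambda>s. \<Sum>i<n. u i * b i s) (\<lambda>s. \<Sum>i<n. u i * k i s)
    = (\<Sum>i<n. \<Sum>j<n. u i * u j * (ip (b i) (k j) + ip (b j) (k i)))"
proof -
  have S: "(\<lambda>s. \<Sum>j<n. u j * k j s) \<in> L2" using k by (intro L2_sum L2_scale) auto
  have "ip (\<lambda>s. \<Sum>i<n. u i * b i s) (\<lambda>s. \<Sum>i<n. u i * k i s)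
      = (\<Sum>i<n. ip (\<lambda>s. u i * b i s) (\<lambda>s. \<Sum>j<n. u j * k j s))"
    using b by (intro ip_sum_left L2_scale S) auto
  also have "\<dots> = (\<Sum>i<n. \<Sum>j<n. u i * u j * ip (b i) (k j))"
  proof (rule sum.cong[OF refl])
    fix i assume "i \<in> {..<n}"
    then have "ip (b i) (\<lambda>s. \<Sum>j<n. u j * k j s) = (\<Sum>j<n. u j * ip (b i) (k j))"
      using b k ip_sum_left[of "{..<n}" "\<lambda>j s. u j * k j s" "b i"]
      by (simp add: ip_commute[of "b i"] ip_scale_left L2_scale)
    then show "ip (\<lambda>s. u i * b i s) (\<lambda>s. \<Sum>j<n. u j * k j s) = (\<Sum>j<n. u i * u j * ip (b i) (k j))"
      by (simp add: ip_scale_left sum_distrib_left mult.assoc)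
  qed
  finally have e: "ip (\<lambda>s. \<Sum>i<n. u i * b i s) (\<lambda>s. \<Sum>i<n. u i * k i s) = (\<Sum>i<n. \<Sum>j<n. u i * u j * ip (b i) (k j))" .
  have sw: "(\<Sum>i<n. \<Sum>j<n. u i * u j * ip (b i) (k j)) = (\<Sum>i<n. \<Sum>j<n. u i * u j * ip (b j) (k i))"
    by (subst sum.swap) (simp add: mult.commute)
  have "(\<Sum>i<n. \<Sum>j<n. u i * u j * (ip (b i) (k j) + ip (b j) (k i)))
      = (\<Sum>i<n. \<Sum>j<n. u i * u j * ip (b i) (k j)) + (\<Sum>i<n. \<Sum>j<n. u i * u j * ip (b j) (k i))"
    by (simp only: distrib_left sum.distrib)
  then show ?thesis unfolding e using sw by simp
qed

lemma ip_perturbed: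
  assumes "f \<in> L2" "g \<in> L2"
  shows "ip (\<lambda>s. f s + c * g s) (\<lambda>s. f s + c * g s) = ip f f + c * (2 * ip f g) + c\<^sup>2 * ip g g"
  using assms by (simp add: ip_add_left ip_add_right L2_add L2_scale ip_scale_left ip_scale_right
      ip_commute[of g f] power2_eq_square algebra_simps)

context two_sided_brownian_motion
begin

lemma wiener_integrable: "has_wiener_integral M B f X \<Longrightarrow> integrable M X"
  using gauss_mean(1) has_wiener_integral_gauss(2) ip_self_nonneg by blast

text \<open>The cross term of the variance vanishes, so \<open>expected_Max_mono\<close> applies
  with \<open>M\<close> itself as second space, the grid values of \<open>B\<close> as base and
  \<epsilon> \<open>Z\<close> as noise.\<close>

lemma grid_antisymmetric:
  assumes T: "0 \<le> T" and Z: "\<And>t. 0 \<le> t \<Longrightarrow> has_wiener_integral M B (k t) (Z t)"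
    and anti: "\<And>s t. 0 \<le> s \<Longrightarrow> 0 \<le> t \<Longrightarrow> ip (kB s) (k t) + ip (kB t) (k s) = 0"
  shows "(\<integral>\<omega>. gridmax (\<lambda>t. B t \<omega> - a * t) 0 T n \<partial>M) \<le> (\<integral>\<omega>. gridmax (\<lambda>t. B t \<omega> - a * t + \<epsilon> * Z t \<omega>) 0 T n \<partial>M)"
proof -
  let ?n = "Suc (2 ^ n)"
  define g where "g i = gpt 0 T n i" for i
  have g0: "0 \<le> g i" for i using T by (simp add: g_def gpt_def)
  have wB: "has_wiener_integral M B (kB (g i)) (B (g i))" for i by (rule B_wiener[OF g0])
  have wZ: "has_wiener_integral M B (k (g i)) (Z (g i))" for i by (rule Z[OF g0])
  let ?b = "\<lambda>u s. \<Sum>i<?n. u i * kB (g i) s" and ?k = "\<lambda>u s. \<Sum>i<?n. u i * k (g i) s"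
  have WB: "has_wiener_integral M B (?b u) (\<lambda>\<omega>. \<Sum>i<?n. u i * B (g i) \<omega>)" for u
    by (intro has_wiener_integral_sum has_wiener_integral_scale wB)
  have WZ: "has_wiener_integral M B (?k u) (\<lambda>\<omega>. \<Sum>i<?n. u i * Z (g i) \<omega>)" for u
    by (intro has_wiener_integral_sum has_wiener_integral_scale wZ)
  have kL: "k (g i) \<in> L2" for i by (rule has_wiener_integral_gauss(1)[OF wZ])
  have "2 * ip (?b u) (?k u) = (\<Sum>i<?n. \<Sum>j<?n. u i * u j * 0)" for u
    by (subst cross_symmetrize) (simp_all only: kB_L2 kL anti[OF g0 g0])
  then have cross: "ip (?b u) (?k u) = 0" for u by simp
  have G: "gauss M (\<lambda>\<omega>. (\<Sum>i<?n. u i * B (g i) \<omega>) + c * (\<Sum>i<?n. u i * Z (g i) \<omega>)) (ip (?b u) (?b u) + c\<^sup>2 * ip (?k u) (?k u))" for u c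
    using has_wiener_integral_gauss(2)[OF has_wiener_integral_add[OF WB[of u] has_wiener_integral_scale[OF WZ[of u], of c]]]
    unfolding ip_perturbed[OF has_wiener_integral_gauss(1)[OF WB] has_wiener_integral_gauss(1)[OF WZ]] cross by simp
  have e: "(\<Sum>i<?n. u i * B (g i) \<omega>) + c * (\<Sum>i<?n. u i * Z (g i) \<omega>) = (\<Sum>i<?n. u i * (B (g i) \<omega> + c * Z (g i) \<omega>))" for u c \<omega>
    by (simp only: sum_distrib_left sum.distrib distrib_left mult.left_commute)
  have plus: "gauss M (\<lambda>\<omega>. \<Sum>i<?n. u i * (B (g i) \<omega> + \<epsilon> * Z (g i) \<omega>)) (ip (?b u) (?b u) + \<epsilon>\<^sup>2 * ip (?k u) (?k u))" for u
    using G[of u \<epsilon>] unfolding e .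
  have minus: "gauss M (\<lambda>\<omega>. \<Sum>i<?n. u i * (B (g i) \<omega> - \<epsilon> * Z (g i) \<omega>)) (ip (?b u) (?b u) + \<epsilon>\<^sup>2 * ip (?k u) (?k u))" for u
    using G[of u "- \<epsilon>"] unfolding e by simp
  have "(\<integral>\<omega>. Max ((\<lambda>i. B (g i) \<omega> - a * g i) ` {..<?n}) \<partial>M)
      \<le> (\<integral>\<omega>. Max ((\<lambda>i. B (g i) \<omega> + \<epsilon> * Z (g i) \<omega> - a * g i) ` {..<?n}) \<partial>M)"
  proof (rule expected_Max_mono[where F = "\<lambda>i. B (g i)" and N = "\<lambda>i \<omega>. \<epsilon> * Z (g i) \<omega>" and ?M2.0 = M])
    show "prob_space M" "prob_space M" by unfold_locales
    show "\<exists>v. gauss M (\<lambda>\<omega>. \<Sum>i<?n. u i * B (g i) \<omega>) v \<and> gauss M (\<lambda>\<omega>. \<Sum>i<?n. u i * B (g i) \<omega>) v" for u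
      using has_wiener_integral_gauss(2)[OF WB[of u]] by blast
    show "\<exists>v. gauss M (\<lambda>\<omega>. \<Sum>i<?n. u i * (B (g i) \<omega> + \<epsilon> * Z (g i) \<omega>)) v \<and>
        gauss M (\<lambda>\<omega>. \<Sum>i<?n. u i * (B (g i) \<omega> + \<epsilon> * Z (g i) \<omega>)) v" for u
      using plus[of u] by blast
    show "\<exists>v. gauss M (\<lambda>\<omega>. \<Sum>i<?n. u i * (B (g i) \<omega> + \<epsilon> * Z (g i) \<omega>)) v \<and>
        gauss M (\<lambda>\<omega>. \<Sum>i<?n. u i * (B (g i) \<omega> - \<epsilon> * Z (g i) \<omega>)) v" for u
      using plus[of u] minus[of u] by blast
  qed (auto intro!: wiener_integrable[OF wB] wiener_integrable[OF wZ])
  then show ?thesis by (simp add: gridmax_def g_def lessThan_Suc_atMost algebra_simps)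
qed

text \<open>Here the cross term is a positive multiple of the variance of X+ with index
  \<open>H'\<close>. On a product space it is matched by an independent copy of that process, whose
  sign may be flipped together with that of an independent copy of \<open>Z\<close>.\<close>

lemma grid_Kp:
  assumes H: "0 < H" "H < 1" and T: "0 \<le> T" and \<epsilon>: "0 < \<epsilon>"
    and Z: "\<And>t. 0 \<le> t \<Longrightarrow> has_wiener_integral M B (Kp H t) (Z t)"
  shows "(\<integral>\<omega>. gridmax (\<lambda>t. B t \<omega> - a * t) 0 T n \<partial>M) \<le> (\<integral>\<omega>. gridmax (\<lambda>t. B t \<omega> - a * t + \<epsilon> * Z t \<omega>) 0 T n \<partial>M)"
proof -
  let ?n = "Suc (2 ^ n)"
  define H' where "H' = (H + 1/2) / 2"
  have H': "0 < H'" "H' < 1" "2 * H' = H + 1/2" using H by (auto simp: H'_def)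
  \<comment> \<open>The ratio of the factor 1 / (H + 1/2) in \<open>kB_Kp_sym\<close> to the factor
    (C H')^2 / 2 in \<open>Kp_covariance\<close>.\<close>
  define q where "q = 2 / ((C H')\<^sup>2 * (H + 1/2))"
  have q: "0 < q" using C_pos[OF H'(1,2)] H by (simp add: q_def)
  \<comment> \<open>The cross term is \<epsilon> q times the variance of the comparison process, and
    \<alpha> is the amplitude that produces it. A real square root needs \<epsilon> > 0, so only one
    sign of the perturbation is available.\<close>
  define \<alpha> where "\<alpha> = sqrt (\<epsilon> * q)"
  have \<alpha>: "\<alpha>\<^sup>2 = \<epsilon> * q" using \<epsilon> q by (simp add: \<alpha>_def)
  define g where "g i = gpt 0 T n i" for i
  have g0: "0 \<le> g i" for i using T by (simp add: g_def gpt_def)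
  have wB: "has_wiener_integral M B (kB (g i)) (B (g i))" for i by (rule B_wiener[OF g0])
  have wZ: "has_wiener_integral M B (Kp H (g i)) (Z (g i))" for i by (rule Z[OF g0])
  define Z' where "Z' i = X_plus M B H' (g i)" for i
  have wZ': "has_wiener_integral M B (Kp H' (g i)) (Z' i)" for i
    unfolding Z'_def by (rule X_plus_wiener[OF H'(1,2) g0])
  let ?b = "\<lambda>u s. \<Sum>i<?n. u i * kB (g i) s" and ?k = "\<lambda>u s. \<Sum>i<?n. u i * Kp H (g i) s"
    and ?k' = "\<lambda>u s. \<Sum>i<?n. u i * Kp H' (g i) s"
  have WB: "has_wiener_integral M B (?b u) (\<lambda>\<omega>. \<Sum>i<?n. u i * B (g i) \<omega>)" for u
    by (intro has_wiener_integral_sum has_wiener_integral_scale wB)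
  have WZ: "has_wiener_integral M B (?k u) (\<lambda>\<omega>. \<Sum>i<?n. u i * Z (g i) \<omega>)" for u
    by (intro has_wiener_integral_sum has_wiener_integral_scale wZ)
  have WZ': "has_wiener_integral M B (?k' u) (\<lambda>\<omega>. \<Sum>i<?n. u i * Z' i \<omega>)" for u
    by (intro has_wiener_integral_sum has_wiener_integral_scale wZ')
  have kL: "Kp H (g i) \<in> L2" "Kp H' (g i) \<in> L2" for i using Kp_norm(1) H H' g0 by auto
  have sym: "ip (kB (g i)) (Kp H (g j)) + ip (kB (g j)) (Kp H (g i)) = q * ip (Kp H' (g i)) (Kp H' (g j))" for i j
  proof -
    have "x / (H + 1/2) = 2 / ((C H')\<^sup>2 * (H + 1/2)) * ((C H')\<^sup>2 / 2 * x)" for x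
    proof -
      have *: "x / p = 2 / (c * p) * (c / 2 * x)" if "c \<noteq> 0" for c p :: real using that by simp
      show ?thesis by (rule *) (use C_pos[OF H'(1,2)] in simp)
    qed
    then show ?thesis
      unfolding kB_Kp_sym[OF H g0 g0] Kp_covariance[OF H'(1,2) g0 g0] H'(3) q_def by blast
  qed
  have cross: "2 * ip (?b u) (?k u) = q * ip (?k' u) (?k' u)" for u
  proof -
    have "2 * ip (?b u) (?k u) = (\<Sum>i<?n. \<Sum>j<?n. u i * u j * (q * ip (Kp H' (g i)) (Kp H' (g j))))"
      by (subst cross_symmetrize) (simp_all only: kB_L2 kL sym)
    also have "\<dots> = q * (\<Sum>i<?n. \<Sum>j<?n. u i * u j * ip (Kp H' (g i)) (Kp H' (g j)))"
      by (simp only: sum_distrib_left mult.left_commute)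
    also have "(\<Sum>i<?n. \<Sum>j<?n. u i * u j * ip (Kp H' (g i)) (Kp H' (g j))) = ip (?k' u) (?k' u)"
      by (rule ip_sum_sum[symmetric]) (rule kL)
    finally show ?thesis .
  qed
  let ?v = "\<lambda>u. ip (?b u) (?b u) + (\<alpha>\<^sup>2 * ip (?k' u) (?k' u) + \<epsilon>\<^sup>2 * ip (?k u) (?k u))"
  have plus1: "gauss M (\<lambda>\<omega>. \<Sum>i<?n. u i * (B (g i) \<omega> + \<epsilon> * Z (g i) \<omega>)) (?v u)" for u
  proof -
    have "gauss M (\<lambda>\<omega>. (\<Sum>i<?n. u i * B (g i) \<omega>) + \<epsilon> * (\<Sum>i<?n. u i * Z (g i) \<omega>))
        (ip (\<lambda>s. ?b u s + \<epsilon> * ?k u s) (\<lambda>s. ?b u s + \<epsilon> * ?k u s))"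
      by (rule has_wiener_integral_gauss(2)[OF has_wiener_integral_add[OF WB has_wiener_integral_scale[OF WZ]]])
    moreover have "ip (\<lambda>s. ?b u s + \<epsilon> * ?k u s) (\<lambda>s. ?b u s + \<epsilon> * ?k u s) = ?v u"
      unfolding ip_perturbed[OF has_wiener_integral_gauss(1)[OF WB] has_wiener_integral_gauss(1)[OF WZ]] cross \<alpha> by simp
    moreover have "(\<Sum>i<?n. u i * B (g i) \<omega>) + \<epsilon> * (\<Sum>i<?n. u i * Z (g i) \<omega>) = (\<Sum>i<?n. u i * (B (g i) \<omega> + \<epsilon> * Z (g i) \<omega>))" for \<omega>
      by (simp only: sum_distrib_left sum.distrib distrib_left mult.left_commute)
    ultimately show ?thesis by (simp only:)
  qed
  interpret P2: pair_prob_space M M ..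
  interpret P3: pair_prob_space M "M \<Otimes>\<^sub>M M" ..
  \<comment> \<open>Three independent copies of the space carry \<open>B\<close>, the comparison
    process \<open>Z'\<close> and \<open>Z\<close>, in this order. The factor c in \<open>G3\<close>
    is then 1, -1 or 0 for noise added, subtracted or absent.\<close>
  let ?M3 = "M \<Otimes>\<^sub>M (M \<Otimes>\<^sub>M M)"
  let ?N = "\<lambda>i p. \<alpha> * Z' i (fst (snd p)) + \<epsilon> * Z (g i) (snd (snd p))"
  have G3: "gauss ?M3 (\<lambda>p. (\<Sum>i<?n. u i * B (g i) (fst p)) + (c * \<alpha> * (\<Sum>i<?n. u i * Z' i (fst (snd p))) + c * \<epsilon> * (\<Sum>i<?n. u i * Z (g i) (snd (snd p)))))
      (ip (?b u) (?b u) + ((c * \<alpha>)\<^sup>2 * ip (?k' u) (?k' u) + (c * \<epsilon>)\<^sup>2 * ip (?k u) (?k u)))" for u c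
  proof -
    have "gauss (M \<Otimes>\<^sub>M M) (\<lambda>p. c * \<alpha> * (\<Sum>i<?n. u i * Z' i (fst p)) + c * \<epsilon> * (\<Sum>i<?n. u i * Z (g i) (snd p)))
        ((c * \<alpha>)\<^sup>2 * ip (?k' u) (?k' u) + (c * \<epsilon>)\<^sup>2 * ip (?k u) (?k u))"
      by (rule gauss_pair[OF prob_space_axioms prob_space_axioms
          gauss_scale[OF has_wiener_integral_gauss(2)[OF WZ']] gauss_scale[OF has_wiener_integral_gauss(2)[OF WZ]]])
    from gauss_pair[OF prob_space_axioms P2.prob_space_axioms has_wiener_integral_gauss(2)[OF WB[of u]] this]
    show ?thesis .
  qed
  have e3: "(\<Sum>i<?n. u i * B (g i) (fst p)) + (c * \<alpha> * (\<Sum>i<?n. u i * Z' i (fst (snd p))) + c * \<epsilon> * (\<Sum>i<?n. u i * Z (g i) (snd (snd p))))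
      = (\<Sum>i<?n. u i * (B (g i) (fst p) + c * ?N i p))" for u c p
    by (simp only: sum_distrib_left sum.distrib[symmetric]) (intro sum.cong refl, simp add: algebra_simps)
  have plus3: "gauss ?M3 (\<lambda>p. \<Sum>i<?n. u i * (B (g i) (fst p) + ?N i p)) (?v u)" for u
    using G3[of u 1] unfolding e3 by simp
  have minus3: "gauss ?M3 (\<lambda>p. \<Sum>i<?n. u i * (B (g i) (fst p) - ?N i p)) (?v u)" for u
    using G3[of u "-1"] unfolding e3 by (simp only: mult_minus1 power2_minus add_uminus_conv_diff)
  have base3: "gauss ?M3 (\<lambda>p. \<Sum>i<?n. u i * B (g i) (fst p)) (ip (?b u) (?b u))" for u
    using G3[of u 0] by simp
  have "(\<integral>\<omega>. Max ((\<lambda>i. B (g i) \<omega> - a * g i) ` {..<?n}) \<partial>M)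
      \<le> (\<integral>\<omega>. Max ((\<lambda>i. B (g i) \<omega> + \<epsilon> * Z (g i) \<omega> - a * g i) ` {..<?n}) \<partial>M)"
  proof (rule expected_Max_mono[where F = "\<lambda>i p. B (g i) (fst p)" and N = ?N and ?M2.0 = ?M3])
    show "prob_space M" by (rule prob_space_axioms)
    show "prob_space ?M3" by (rule P3.prob_space_axioms)
    show "integrable M (B (g i))" "integrable M (\<lambda>\<omega>. \<epsilon> * Z (g i) \<omega>)" for i
      by (auto intro!: wiener_integrable[OF wB] wiener_integrable[OF wZ])
    show "\<exists>v. gauss M (\<lambda>\<omega>. \<Sum>i<?n. u i * B (g i) \<omega>) v \<and> gauss ?M3 (\<lambda>p. \<Sum>i<?n. u i * B (g i) (fst p)) v" for u
      using has_wiener_integral_gauss(2)[OF WB[of u]] base3[of u] by blast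
    show "\<exists>v. gauss M (\<lambda>\<omega>. \<Sum>i<?n. u i * (B (g i) \<omega> + \<epsilon> * Z (g i) \<omega>)) v \<and>
        gauss ?M3 (\<lambda>p. \<Sum>i<?n. u i * (B (g i) (fst p) + ?N i p)) v" for u
      using plus1[of u] plus3[of u] by blast
    show "\<exists>v. gauss M (\<lambda>\<omega>. \<Sum>i<?n. u i * (B (g i) \<omega> + \<epsilon> * Z (g i) \<omega>)) v \<and>
        gauss ?M3 (\<lambda>p. \<Sum>i<?n. u i * (B (g i) (fst p) - ?N i p)) v" for u
      using plus1[of u] minus3[of u] by blast
    \<comment> \<open>Unit coefficient vectors turn the Gaussian statements on linear combinations
      into integrability of single coordinates.\<close>
    have sel: "(\<Sum>j<?n. (if j = i then 1 else 0) * h j) = h i" if "i < ?n" for i and h :: "nat \<Rightarrow> real"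
      using that by (simp add: if_distrib[of "\<lambda>c. c * _"] cong: if_cong)
    show F: "integrable ?M3 (\<lambda>p. B (g i) (fst p))" if "i < ?n" for i
      using P3.gauss_mean(1)[OF base3[of "\<lambda>j. if j = i then 1 else 0"] ip_self_nonneg] unfolding sel[OF that] .
    show "integrable ?M3 (?N i)" if "i < ?n" for i
    proof -
      let ?u = "\<lambda>j. if j = i then 1 else 0"
      have "0 \<le> ?v ?u" by (intro add_nonneg_nonneg mult_nonneg_nonneg ip_self_nonneg) auto
      from P3.gauss_mean(1)[OF plus3[of ?u] this] have "integrable ?M3 (\<lambda>p. B (g i) (fst p) + ?N i p)"
        unfolding sel[OF that] .
      from Bochner_Integration.integrable_diff[OF this F[OF that]] show ?thesis by simp
    qed
  qed simp
  then show ?thesis by (simp add: gridmax_def g_def lessThan_Suc_atMost algebra_simps)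
qed

end

subsection \<open>Infinite horizon\<close>

lemma csup_nonneg: "continuous_on {0..T} y \<Longrightarrow> 0 \<le> T \<Longrightarrow> 0 \<le> csup (\<lambda>t. \<bar>y t\<bar>) 0 T"
  using csup_ge[OF continuous_on_rabs, of 0 T y 0] by force

lemma dyadic_interval:
  assumes "1 \<le> (t :: real)"
  shows "\<exists>k. 2 ^ k \<le> t \<and> t < 2 ^ Suc k"
proof -
  have ex: "\<exists>n. t < 2 ^ n" using real_arch_pow[of 2 t] by simp
  define n where "n = (LEAST n. t < 2 ^ n)"
  have n: "t < 2 ^ n" unfolding n_def using ex by (rule LeastI_ex)
  then have "n \<noteq> 0" using assms by (cases n) auto
  then obtain k where k: "n = Suc k" by (cases n) auto
  have "\<not> t < 2 ^ k" using not_less_Least[of k "\<lambda>n. t < 2 ^ n"] unfolding n_def[symmetric] k by simp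
  then show ?thesis using n k by (intro exI[of _ k]) auto
qed

text \<open>The drifted path is 0 at time 0 and negative from R on, so both horizons have the same
  set of maximizers, and the leftmost one agrees.\<close>

lemma \<tau>_infinite_eq:
  assumes 0: "B 0 \<omega> = (0 :: real)" and neg: "\<And>t. R \<le> t \<Longrightarrow> B t \<omega> - a * t < 0" and N: "0 \<le> R" "R \<le> N"
  shows "\<tau> B \<infinity> a \<omega> = \<tau> B (ereal N) a \<omega>"
proof -
  let ?f = "\<lambda>t. B t \<omega> - a * t"
  have "{t \<in> horizon \<infinity>. \<forall>s\<in>horizon \<infinity>. ?f s \<le> ?f t} = {t \<in> horizon (ereal N). \<forall>s\<in>horizon (ereal N). ?f s \<le> ?f t}"
    unfolding horizon_finite horizon_infinite
  proof (intro set_eqI iffI)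
    fix t assume t: "t \<in> {t \<in> {0..}. \<forall>s\<in>{0..}. ?f s \<le> ?f t}"
    moreover have "(0 :: real) \<in> {0..}" by simp
    ultimately have "?f 0 \<le> ?f t" by blast
    then have "\<not> R \<le> t" using neg[of t] 0 by auto
    then show "t \<in> {t \<in> {0..N}. \<forall>s\<in>{0..N}. ?f s \<le> ?f t}" using t N by auto
  next
    fix t assume t: "t \<in> {t \<in> {0..N}. \<forall>s\<in>{0..N}. ?f s \<le> ?f t}"
    then have f0: "0 \<le> ?f t" using 0 N by force
    have "?f s \<le> ?f t" if "0 \<le> s" for s
    proof (cases "s \<le> N")
      case True
      then show ?thesis using t that by auto
    next
      case False
      then show ?thesis using neg[of s] f0 N by simp
    qed
    then show "t \<in> {t \<in> {0..}. \<forall>s\<in>{0..}. ?f s \<le> ?f t}" using t by auto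
  qed
  then show ?thesis by (simp only: \<tau>_def)
qed

lemma \<tau>_nonneg: "0 \<le> \<tau> B T a \<omega>"
proof -
  let ?A = "{t \<in> horizon T. \<forall>s\<in>horizon T. B s \<omega> - a * s \<le> B t \<omega> - a * t}"
  show ?thesis
  proof (cases "?A = {}")
    case True
    then have "\<tau> B T a \<omega> = 0" by (simp only: \<tau>_def Let_def simp_thms if_True)
    then show ?thesis by simp
  next
    case False
    then have "\<tau> B T a \<omega> = Inf ?A" by (simp only: \<tau>_def Let_def if_False)
    moreover have "0 \<le> Inf ?A" using False by (intro cInf_greatest) (auto simp: horizon_def)
    ultimately show ?thesis by simp
  qed
qed

section \<open>Measurability on the half-line and growth of suprema\<close>

context two_sided_brownian_motion
begin

text \<open>\<open>?P \<omega> x\<close> says that the supremum over the half-line, tested on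
  integer horizons, is already reached on {0..x}. A maximizer exists iff this holds for some integer
  x; if none exists, \<tau> is 0, which is at most s. Otherwise the leftmost maximizer is at most s
  iff it holds for s.\<close>

lemma \<tau>_infinite_measurable: "\<tau> B \<infinity> a \<in> borel_measurable M"
proof (rule borel_measurableI_le)
  fix s :: real
  let ?f = "\<lambda>\<omega> t. B t \<omega> - a * t"
  let ?P = "\<lambda>\<omega> x. \<forall>k :: nat. csup (?f \<omega>) 0 (real k) \<le> csup (?f \<omega>) 0 x"
  show "{\<omega> \<in> space M. \<tau> B \<infinity> a \<omega> \<le> s} \<in> sets M"
  proof (cases "0 \<le> s")
    case False
    then have "\<not> \<tau> B \<infinity> a \<omega> \<le> s" for \<omega> using \<tau>_nonneg[of B \<infinity> a \<omega>] by linarith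
    then have "{\<omega> \<in> space M. \<tau> B \<infinity> a \<omega> \<le> s} = {}" by blast
    then show ?thesis by (simp only: sets.empty_sets)
  next
    case True
    have "\<tau> B \<infinity> a \<omega> \<le> s \<longleftrightarrow> \<not> (\<exists>n :: nat. ?P \<omega> (real n)) \<or> ?P \<omega> s" if \<omega>: "\<omega> \<in> space M" for \<omega>
    proof -
      have c: "continuous_on S (?f \<omega>)" for S using \<omega> by (rule B_drift_continuous)
      let ?A = "{t \<in> {0..}. \<forall>u\<in>{0..}. ?f \<omega> u \<le> ?f \<omega> t}"
      have t: "\<tau> B \<infinity> a \<omega> = (if ?A = {} then 0 else Inf ?A)"
        by (simp only: \<tau>_def Let_def horizon_infinite)
      have P: "\<exists>m\<in>?A. m \<le> x" if x: "0 \<le> x" and p: "?P \<omega> x" for x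
      proof -
        obtain m where m: "m \<in> {0..x}" "csup (?f \<omega>) 0 x = ?f \<omega> m" using csup_attained[OF c x] by blast
        have "?f \<omega> u \<le> ?f \<omega> m" if "0 \<le> u" for u
        proof -
          obtain k :: nat where k: "u \<le> real k" using real_arch_simple by blast
          have "?f \<omega> u \<le> csup (?f \<omega>) 0 (real k)" using that k by (intro csup_ge c) auto
          also have "\<dots> \<le> csup (?f \<omega>) 0 x" using p by blast
          also have "\<dots> = ?f \<omega> m" by (rule m(2))
          finally show ?thesis .
        qed
        then show ?thesis using m by auto
      qed
      have Q: "?P \<omega> x" if m: "m \<in> ?A" "m \<le> x" for m x
      proof
        fix k :: nat
        have "csup (?f \<omega>) 0 (real k) \<le> ?f \<omega> m" using m by (intro csup_le c) auto
        also have "\<dots> \<le> csup (?f \<omega>) 0 x" using m by (intro csup_ge c) auto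
        finally show "csup (?f \<omega>) 0 (real k) \<le> csup (?f \<omega>) 0 x" .
      qed
      show ?thesis
      proof (cases "?A = {}")
        case e: True
        have "\<not> ?P \<omega> (real n)" for n :: nat
        proof
          assume "?P \<omega> (real n)"
          then obtain m where "m \<in> ?A" using P[OF of_nat_0_le_iff] by blast
          then show False using e by blast
        qed
        then have "\<not> (\<exists>n :: nat. ?P \<omega> (real n))" by blast
        moreover have "\<tau> B \<infinity> a \<omega> \<le> s" using True unfolding t e by simp
        ultimately show ?thesis by simp
      next
        case ne: False
        then obtain m where m: "m \<in> ?A" by blast
        obtain n :: nat where n: "m \<le> real n" using real_arch_simple by blast
        have ex: "\<exists>n :: nat. ?P \<omega> (real n)" using Q[OF m n] by blast
        have A: "?A = {t \<in> {0..}. ?f \<omega> t = ?f \<omega> m}" using m by (auto intro: antisym)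
        have "closed ?A" unfolding A by (rule continuous_closed_preimage_constant[OF c]) auto
        moreover have b: "bdd_below ?A" by (rule bdd_belowI[of _ 0]) auto
        ultimately have I: "Inf ?A \<in> ?A" using ne by (intro closed_contains_Inf)
        have t': "\<tau> B \<infinity> a \<omega> = Inf ?A" unfolding t using ne by (simp only: if_False)
        have "Inf ?A \<le> s \<longleftrightarrow> ?P \<omega> s"
        proof
          show "Inf ?A \<le> s \<Longrightarrow> ?P \<omega> s" using Q[OF I] by blast
          assume "?P \<omega> s"
          then obtain m' where "m' \<in> ?A" "m' \<le> s" using P[OF True] by blast
          then show "Inf ?A \<le> s" using cInf_lower[OF _ b] order_trans by blast
        qed
        then show ?thesis using ex t' by simp
      qed
    qed
    then have "{\<omega> \<in> space M. \<tau> B \<infinity> a \<omega> \<le> s} = {\<omega> \<in> space M. \<not> (\<exists>n :: nat. ?P \<omega> (real n)) \<or> ?P \<omega> s}" by auto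
    moreover have [measurable]: "(\<lambda>\<omega>. csup (?f \<omega>) 0 (real k)) \<in> borel_measurable M" "(\<lambda>\<omega>. csup (?f \<omega>) 0 s) \<in> borel_measurable M" for k
      using True by (auto intro!: csup_B_drift_measurable)
    moreover have "{\<omega> \<in> space M. \<not> (\<exists>n :: nat. ?P \<omega> (real n)) \<or> ?P \<omega> s} \<in> sets M" by measurable
    ultimately show ?thesis by simp
  qed
qed

lemma sup_moment:
  assumes m: "\<And>t. 0 \<le> t \<Longrightarrow> Z t \<in> borel_measurable M"
    and cont: "\<And>\<omega>. \<omega> \<in> space M \<Longrightarrow> continuous_on {0..} (\<lambda>t. Z t \<omega>)"
    and Z: "\<And>t. 0 \<le> t \<Longrightarrow> has_wiener_integral M B (k t) (Z t)"
    and k0: "k 0 = (\<lambda>s. 0)"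
    and inc: "\<And>s t. 0 \<le> s \<Longrightarrow> s \<le> t \<Longrightarrow> ip (\<lambda>x. k t x - k s x) (\<lambda>x. k t x - k s x) = c * (t - s) powr (2 * H)"
    and c: "0 \<le> c" and H: "0 < H" and r: "2 \<le> real r * H"
  obtains K where "0 \<le> K"
    "\<And>T. 0 < T \<Longrightarrow> (\<integral>\<^sup>+ \<omega>. ennreal ((csup (\<lambda>t. \<bar>Z t \<omega>\<bar>) 0 T) ^ (2 * r)) \<partial>M) \<le> ennreal (K * T powr (2 * H * real r))"
proof (rule chaining[where Y = Z and c = c and H = H and r = r])
  have "gauss M (Z 0) 0" using has_wiener_integral_gauss(2)[OF Z[of 0]] by (simp add: k0 ip_def)
  then show "AE \<omega> in M. Z 0 \<omega> = 0" by (rule gauss_zero)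
  show "gauss M (\<lambda>\<omega>. Z t \<omega> - Z s \<omega>) (c * (t - s) powr (2 * H))" if "0 \<le> s" "s \<le> t" for s t
  proof -
    have "has_wiener_integral M B (\<lambda>x. 1 * k t x + (-1) * k s x) (\<lambda>\<omega>. 1 * Z t \<omega> + (-1) * Z s \<omega>)"
      using that by (intro has_wiener_integral_comb Z) auto
    then show ?thesis using has_wiener_integral_gauss(2) inc[OF that] by fastforce
  qed
qed (use that m cont c H r in auto)

text \<open>Polynomial growth of the second moment of the running supremum. The degree
  \<open>s\<close> is free, since \<open>escape_prob\<close> offers geometric decay of any
  prescribed order to offset it.\<close>

definition sup_bounded :: "(real \<Rightarrow> 'w \<Rightarrow> real) \<Rightarrow> nat \<Rightarrow> real \<Rightarrow> bool" where
  "sup_bounded Z s K \<longleftrightarrow> 0 \<le> K \<and>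
     (\<forall>T>0. (\<integral>\<^sup>+ \<omega>. ennreal ((csup (\<lambda>t. \<bar>Z t \<omega>\<bar>) 0 T)\<^sup>2) \<partial>M) \<le> ennreal (K * (1 + T) ^ s))"

text \<open>Chaining requires r H >= 2 and hence high moments for small H. The inequality x <= 1 +
  x^r descends to the second moment, and T^(2 H r) <= (1 + T)^(2 r) because H < 1.\<close>

lemma sup_bounded_exists:
  assumes m: "\<And>t. 0 \<le> t \<Longrightarrow> Z t \<in> borel_measurable M"
    and cont: "\<And>\<omega>. \<omega> \<in> space M \<Longrightarrow> continuous_on {0..} (\<lambda>t. Z t \<omega>)"
    and Z: "\<And>t. 0 \<le> t \<Longrightarrow> has_wiener_integral M B (k t) (Z t)"
    and k0: "k 0 = (\<lambda>s. 0)"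
    and inc: "\<And>s t. 0 \<le> s \<Longrightarrow> s \<le> t \<Longrightarrow> ip (\<lambda>x. k t x - k s x) (\<lambda>x. k t x - k s x) = c * (t - s) powr (2 * H)"
    and c: "0 \<le> c" and H: "0 < H" "H < 1"
  shows "\<exists>s K. sup_bounded Z s K"
proof -
  obtain r :: nat where "2 / H \<le> real r" using real_arch_simple by blast
  then have r: "2 \<le> real r * H" using H by (simp add: field_simps)
  then have r1: "1 \<le> r" using H by (cases r) auto
  obtain K where K: "0 \<le> K" "\<And>T. 0 < T \<Longrightarrow>
      (\<integral>\<^sup>+ \<omega>. ennreal ((csup (\<lambda>t. \<bar>Z t \<omega>\<bar>) 0 T) ^ (2 * r)) \<partial>M) \<le> ennreal (K * T powr (2 * H * real r))"
    using sup_moment[where Z = Z and k = k, OF m cont Z k0 inc c H(1) r] by blast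
  have "sup_bounded Z (2 * r) (1 + K)"
    unfolding sup_bounded_def
  proof (intro conjI allI impI)
    fix T :: real assume T: "0 < T"
    let ?z = "\<lambda>\<omega>. csup (\<lambda>t. \<bar>Z t \<omega>\<bar>) 0 T"
    have zm: "?z \<in> borel_measurable M"
      by (rule csup_measurable) (use m T in \<open>auto intro!: continuous_on_rabs continuous_on_subset[OF cont]\<close>)
    have "(\<integral>\<^sup>+ \<omega>. ennreal ((?z \<omega>)\<^sup>2) \<partial>M) \<le> (\<integral>\<^sup>+ \<omega>. 1 + ennreal ((?z \<omega>) ^ (2 * r)) \<partial>M)"
    proof (rule nn_integral_mono)
      fix \<omega>
      have "x \<le> 1 + x ^ r" if "0 \<le> x" for x :: real
      proof (cases "x \<le> 1")
        case True
        then show ?thesis using that by (simp add: add_increasing2)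
      next
        case False
        then have "x ^ 1 \<le> x ^ r" using r1 by (intro power_increasing) auto
        then show ?thesis by simp
      qed
      from this[of "(?z \<omega>)\<^sup>2"] have "(?z \<omega>)\<^sup>2 \<le> 1 + (?z \<omega>) ^ (2 * r)" by (simp add: power_mult)
      then have "ennreal ((?z \<omega>)\<^sup>2) \<le> ennreal (1 + (?z \<omega>) ^ (2 * r))" by (rule ennreal_leI)
      also have "\<dots> = 1 + ennreal ((?z \<omega>) ^ (2 * r))" by (subst ennreal_plus) (auto simp: zero_le_even_power)
      finally show "ennreal ((?z \<omega>)\<^sup>2) \<le> 1 + ennreal ((?z \<omega>) ^ (2 * r))" .
    qed
    also have "\<dots> = 1 + (\<integral>\<^sup>+ \<omega>. ennreal ((?z \<omega>) ^ (2 * r)) \<partial>M)"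
      using zm by (subst nn_integral_add) (auto simp: emeasure_space_1)
    also have "\<dots> \<le> 1 + ennreal (K * T powr (2 * H * real r))" by (intro add_left_mono K T)
    also have "\<dots> = ennreal (1 + K * T powr (2 * H * real r))"
      using K by (subst ennreal_plus) auto
    also have "\<dots> \<le> ennreal ((1 + K) * (1 + T) ^ (2 * r))"
    proof (rule ennreal_leI)
      have "T powr (2 * H * real r) \<le> (1 + T) powr (2 * H * real r)" using T H by (intro powr_mono2) auto
      also have "\<dots> \<le> (1 + T) powr (real (2 * r))"
        using T H by (intro powr_mono) (auto simp: mult_left_le_one_le mult.commute[of 2] mult.assoc)
      also have "\<dots> = (1 + T) ^ (2 * r)" using T by (subst powr_realpow) auto
      finally have "K * T powr (2 * H * real r) \<le> K * (1 + T) ^ (2 * r)" using K by (intro mult_left_mono)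
      moreover have "1 \<le> (1 + T) ^ (2 * r)" using T by (intro one_le_power) auto
      ultimately show "1 + K * T powr (2 * H * real r) \<le> (1 + K) * (1 + T) ^ (2 * r)" by (simp add: distrib_right)
    qed
    finally show "(\<integral>\<^sup>+ \<omega>. ennreal ((?z \<omega>)\<^sup>2) \<partial>M) \<le> ennreal ((1 + K) * (1 + T) ^ (2 * r))" .
  qed (use K in auto)
  then show ?thesis by blast
qed

text \<open>With time itself as the process, facts on a process at the maximizer specialise to the
  integrability of \<tau>.\<close>

lemma sup_bounded_time: "sup_bounded (\<lambda>t \<omega>. t) 2 1"
  unfolding sup_bounded_def
proof (intro conjI allI impI)
  fix T :: real assume T: "0 < T"
  have c: "continuous_on {0..T} (\<lambda>t :: real. \<bar>t\<bar>)" by (intro continuous_intros)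
  have "csup (\<lambda>t. \<bar>t\<bar>) 0 T = T"
    using csup_le[OF c, of T] csup_ge[OF c, of T] T by (intro antisym) auto
  moreover have "T\<^sup>2 \<le> (1 + T)\<^sup>2" using T by (intro power_mono) auto
  ultimately show "(\<integral>\<^sup>+ \<omega>. ennreal ((csup (\<lambda>t. \<bar>t\<bar>) 0 T)\<^sup>2) \<partial>M) \<le> ennreal (1 * (1 + T)\<^sup>2)"
    by (simp add: emeasure_space_1 ennreal_leI)
qed simp

lemma sup_bounded_integrable:
  assumes "sup_bounded Z s K" and T: "0 < T"
    and m: "\<And>t. 0 \<le> t \<Longrightarrow> Z t \<in> borel_measurable M"
    and cont: "\<And>\<omega>. \<omega> \<in> space M \<Longrightarrow> continuous_on {0..} (\<lambda>t. Z t \<omega>)"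
  shows "integrable M (\<lambda>\<omega>. csup (\<lambda>t. \<bar>Z t \<omega>\<bar>) 0 T)"
proof -
  let ?z = "\<lambda>\<omega>. csup (\<lambda>t. \<bar>Z t \<omega>\<bar>) 0 T"
  have zm [measurable]: "?z \<in> borel_measurable M"
    by (rule csup_measurable) (use m T in \<open>auto intro!: continuous_on_rabs continuous_on_subset[OF cont]\<close>)
  have "(\<integral>\<^sup>+ \<omega>. ennreal ((?z \<omega>)\<^sup>2) \<partial>M) \<le> ennreal (K * (1 + T) ^ s)"
    using assms(1) T unfolding sup_bounded_def by blast
  then have fin: "(\<integral>\<^sup>+ \<omega>. ennreal ((?z \<omega>)\<^sup>2) \<partial>M) < \<infinity>" by (rule le_less_trans) simp
  have i: "integrable M (\<lambda>\<omega>. (?z \<omega>)\<^sup>2)" by (rule integrableI_bounded) (use fin in auto)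
  show ?thesis
  proof (rule Bochner_Integration.integrable_bound[where f = "\<lambda>\<omega>. 1 + (?z \<omega>)\<^sup>2"])
    show "integrable M (\<lambda>\<omega>. 1 + (?z \<omega>)\<^sup>2)" using i by simp
    show "AE \<omega> in M. norm (?z \<omega>) \<le> norm (1 + (?z \<omega>)\<^sup>2)"
    proof (rule AE_I2)
      fix \<omega>
      have "\<bar>x\<bar> \<le> 1 + x\<^sup>2" for x :: real
        using zero_le_power2[of "\<bar>x\<bar> - 1"] zero_le_power2[of x] unfolding power2_diff by simp
      then show "norm (?z \<omega>) \<le> norm (1 + (?z \<omega>)\<^sup>2)" by simp
    qed
  qed simp
qed

lemma \<tau>_finite_integrable:
  assumes "sup_bounded Z s K" and T: "0 < T"
    and m: "\<And>t. 0 \<le> t \<Longrightarrow> Z t \<in> borel_measurable M"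
    and cont: "\<And>\<omega>. \<omega> \<in> space M \<Longrightarrow> continuous_on {0..} (\<lambda>t. Z t \<omega>)"
  shows "integrable M (\<lambda>\<omega>. Z (\<tau> B (ereal T) a \<omega>) \<omega>)"
proof (rule Bochner_Integration.integrable_bound[where f = "\<lambda>\<omega>. csup (\<lambda>t. \<bar>Z t \<omega>\<bar>) 0 T"])
  show "integrable M (\<lambda>\<omega>. csup (\<lambda>t. \<bar>Z t \<omega>\<bar>) 0 T)"
    by (rule sup_bounded_integrable[where Z = Z, OF assms(1) T]) (use m cont in auto)
  show "(\<lambda>\<omega>. Z (\<tau> B (ereal T) a \<omega>) \<omega>) \<in> borel_measurable M"
    by (rule process_at_measurable[where Z = Z and s = "\<tau> B (ereal T) a"])
      (use m cont \<tau>_finite_measurable T \<tau>_nonneg in auto)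
  show "AE \<omega> in M. norm (Z (\<tau> B (ereal T) a \<omega>) \<omega>) \<le> norm (csup (\<lambda>t. \<bar>Z t \<omega>\<bar>) 0 T)"
  proof (rule AE_I2)
    fix \<omega> assume \<omega>: "\<omega> \<in> space M"
    have c: "continuous_on {0..T} (\<lambda>t. \<bar>Z t \<omega>\<bar>)" by (intro continuous_on_rabs continuous_on_subset[OF cont[OF \<omega>]]) auto
    have "\<bar>Z (\<tau> B (ereal T) a \<omega>) \<omega>\<bar> \<le> csup (\<lambda>t. \<bar>Z t \<omega>\<bar>) 0 T"
      using csup_ge[OF c \<tau>_finite(1)[where B = B and a = a and T = T and \<omega> = \<omega>, OF B_drift_continuous[OF \<omega>]]] T by simp
    then show "norm (Z (\<tau> B (ereal T) a \<omega>) \<omega>) \<le> norm (csup (\<lambda>t. \<bar>Z t \<omega>\<bar>) 0 T)" by simp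
  qed
qed

end

section \<open>Late maximizers on the infinite horizon\<close>

context two_sided_brownian_motion
begin

text \<open>Chaining with H = 1/2, for which its condition on the exponent reads
  \<open>4 \<le> q\<close>.\<close>

lemma B_sup_moment:
  assumes q: "4 \<le> q"
  obtains K where "0 \<le> K"
    "\<And>T. 0 < T \<Longrightarrow> (\<integral>\<^sup>+ \<omega>. ennreal ((csup (\<lambda>t. \<bar>B t \<omega>\<bar>) 0 T) ^ (2 * q)) \<partial>M) \<le> ennreal (K * T ^ q)"
proof -
  obtain K where K: "0 \<le> K" "\<And>T. 0 < T \<Longrightarrow>
      (\<integral>\<^sup>+ \<omega>. ennreal ((csup (\<lambda>t. \<bar>B t \<omega>\<bar>) 0 T) ^ (2 * q)) \<partial>M) \<le> ennreal (K * T powr (2 * (1/2) * real q))"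
  proof (rule sup_moment[where Z = B and k = kB and c = 1 and H = "1/2" and r = q])
    show "continuous_on {0..} (\<lambda>t. B t \<omega>)" if "\<omega> \<in> space M" for \<omega>
      by (rule continuous_on_subset[OF B_continuous[OF that]]) simp
    show "kB 0 = (\<lambda>s. 0)" by (auto simp: kB_def)
    show "ip (\<lambda>x. kB t x - kB s x) (\<lambda>x. kB t x - kB s x) = 1 * (t - s) powr (2 * (1/2))" if "0 \<le> s" "s \<le> t" for s t
      using kB_increment[OF that] that by simp
    show "2 \<le> real q * (1/2)" using q by simp
  qed (auto intro: B_wiener)
  show ?thesis
  proof (rule that[of K])
    show "(\<integral>\<^sup>+ \<omega>. ennreal ((csup (\<lambda>t. \<bar>B t \<omega>\<bar>) 0 T) ^ (2 * q)) \<partial>M) \<le> ennreal (K * T ^ q)" if "0 < T" for T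
      using K(2)[OF that] that by (simp add: powr_realpow)
  qed (rule K)
qed

lemma B_sup_measurable [measurable]: "0 \<le> T \<Longrightarrow> (\<lambda>\<omega>. csup (\<lambda>t. \<bar>B t \<omega>\<bar>) 0 T) \<in> borel_measurable M"
  by (rule csup_measurable) (auto intro!: continuous_on_rabs continuous_on_subset[OF B_continuous])

text \<open>Contains the event that \<open>B(t) \<ge> a t\<close> for some \<open>t\<close> between \<open>2\<^sup>k\<close> and \<open>2\<^sup>k\<^sup>+\<^sup>1\<close>.\<close>

definition escape :: "real \<Rightarrow> nat \<Rightarrow> 'w set" where
  "escape a k = {\<omega> \<in> space M. a * 2 ^ k \<le> csup (\<lambda>t. \<bar>B t \<omega>\<bar>) 0 (2 ^ Suc k)}"

lemma escape_sets [measurable]: "escape a k \<in> sets M"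
  unfolding escape_def by measurable

lemma escapeI:
  assumes "\<omega> \<in> space M" "0 < a" "2 ^ k \<le> t" "t < 2 ^ Suc k" "0 \<le> B t \<omega> - a * t"
  shows "\<omega> \<in> escape a k"
proof -
  have c: "continuous_on {0..2 ^ Suc k} (\<lambda>t. \<bar>B t \<omega>\<bar>)"
    by (intro continuous_on_rabs continuous_on_subset[OF B_continuous[OF assms(1)]]) simp
  have "0 \<le> t" using assms(3) order_trans[of 0 "2 ^ k" t] by simp
  then have "\<bar>B t \<omega>\<bar> \<le> csup (\<lambda>t. \<bar>B t \<omega>\<bar>) 0 (2 ^ Suc k)" using csup_ge[OF c, of t] assms by simp
  moreover have "a * 2 ^ k \<le> a * t" using assms by (intro mult_left_mono) auto
  ultimately have "a * 2 ^ k \<le> csup (\<lambda>t. \<bar>B t \<omega>\<bar>) 0 (2 ^ Suc k)" using assms(5) by linarith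
  then show ?thesis using assms(1) by (simp add: escape_def)
qed

text \<open>Markov's inequality for the 2q-th power: the moment is of order 2^(k q), the threshold
  to the same power of order 2^(2 k q). The order q of the decay is free.\<close>

lemma escape_prob:
  assumes a: "0 < a" and q: "4 \<le> q"
  obtains D where "0 \<le> D" "\<And>k. emeasure M (escape a k) \<le> ennreal (D * (1/2) ^ (q * k))"
proof -
  obtain K where K: "0 \<le> K"
    "\<And>T. 0 < T \<Longrightarrow> (\<integral>\<^sup>+ \<omega>. ennreal ((csup (\<lambda>t. \<bar>B t \<omega>\<bar>) 0 T) ^ (2 * q)) \<partial>M) \<le> ennreal (K * T ^ q)"
    using B_sup_moment[OF q] by blast
  have "emeasure M (escape a k) \<le> ennreal (K * 2 ^ q / a ^ (2 * q) * (1/2) ^ (q * k))" for k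
  proof -
    let ?w = "\<lambda>\<omega>. csup (\<lambda>t. \<bar>B t \<omega>\<bar>) 0 (2 ^ Suc k)"
    let ?c = "1 / (a * 2 ^ k) ^ (2 * q)"
    have c: "0 \<le> ?c" using a by simp
    have [measurable]: "?w \<in> borel_measurable M" by measurable
    have "emeasure M (escape a k) = (\<integral>\<^sup>+ \<omega>. indicator (escape a k) \<omega> \<partial>M)" by simp
    also have "\<dots> \<le> (\<integral>\<^sup>+ \<omega>. ennreal ?c * ennreal ((?w \<omega>) ^ (2 * q)) \<partial>M)"
    proof (rule nn_integral_mono)
      fix \<omega>
      show "indicator (escape a k) \<omega> \<le> ennreal ?c * ennreal ((?w \<omega>) ^ (2 * q))"
      proof (cases "\<omega> \<in> escape a k")
        case True
        then have "(a * 2 ^ k) ^ (2 * q) \<le> (?w \<omega>) ^ (2 * q)" using a by (intro power_mono) (auto simp: escape_def)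
        then have "1 \<le> ?c * (?w \<omega>) ^ (2 * q)" using a by (simp add: field_simps)
        then have "ennreal 1 \<le> ennreal (?c * (?w \<omega>) ^ (2 * q))" by (rule ennreal_leI)
        also have "\<dots> = ennreal ?c * ennreal ((?w \<omega>) ^ (2 * q))" using c by (intro ennreal_mult) (auto simp: zero_le_even_power)
        finally show ?thesis using True by simp
      qed simp
    qed
    also have "\<dots> = ennreal ?c * (\<integral>\<^sup>+ \<omega>. ennreal ((?w \<omega>) ^ (2 * q)) \<partial>M)"
      by (rule nn_integral_cmult) measurable
    also have "\<dots> \<le> ennreal ?c * ennreal (K * (2 ^ Suc k) ^ q)" by (intro mult_left_mono K) auto
    also have "\<dots> = ennreal (?c * (K * (2 ^ Suc k) ^ q))" using c K by (intro ennreal_mult[symmetric]) auto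
    also have "?c * (K * (2 ^ Suc k) ^ q) = K * 2 ^ q / a ^ (2 * q) * (1/2) ^ (q * k)"
    proof -
      define y :: real where "y = 2 ^ (q * k)"
      have "(2 ^ k :: real) ^ (2 * q) = y * y" "(2 ^ Suc k :: real) ^ q = 2 ^ q * y" "(1/2 :: real) ^ (q * k) = 1 / y"
        unfolding y_def by (simp_all add: power_mult[symmetric] power_add[symmetric] power_mult_distrib power_divide mult.commute mult_2_right distrib_left)
      moreover have "y \<noteq> 0" by (simp add: y_def)
      ultimately show ?thesis using a by (simp add: power_mult_distrib field_simps)
    qed
    finally show ?thesis .
  qed
  then show ?thesis using K a by (intro that[of "K * 2 ^ q / a ^ (2 * q)"]) auto
qed

text \<open>Borel-Cantelli: almost surely only finitely many escape events occur, and a late time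
  with B(t) >= a t would lie in a dyadic block whose escape event occurs.\<close>

lemma eventually_negative:
  assumes a: "0 < a"
  shows "AE \<omega> in M. \<exists>R>0. \<forall>t\<ge>R. B t \<omega> - a * t < 0"
proof -
  obtain D where D: "0 \<le> D" "\<And>k. emeasure M (escape a k) \<le> ennreal (D * (1/2) ^ (4 * k))"
    using escape_prob[OF a order_refl] by blast
  have "summable (\<lambda>k. measure M (escape a k))"
  proof (rule summable_comparison_test)
    have "measure M (escape a k) \<le> D * (1/2) ^ k" for k
    proof -
      have "(1/2 :: real) ^ (4 * k) \<le> (1/2) ^ k" by (intro power_decreasing) auto
      then have "D * (1/2) ^ (4 * k) \<le> D * (1/2) ^ k" using D by (intro mult_left_mono)
      moreover have "measure M (escape a k) \<le> D * (1/2) ^ (4 * k)"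
        using D(2)[of k] D(1) by (simp add: emeasure_eq_measure)
      ultimately show ?thesis by simp
    qed
    then show "\<exists>N. \<forall>k\<ge>N. norm (measure M (escape a k)) \<le> D * (1/2) ^ k" by simp
    show "summable (\<lambda>k. D * (1/2 :: real) ^ k)" by (intro summable_mult summable_geometric) simp
  qed
  then have "AE \<omega> in M. eventually (\<lambda>k. \<omega> \<in> space M - escape a k) sequentially"
    by (intro borel_cantelli_AE1) (auto simp: emeasure_eq_measure)
  then show ?thesis
  proof (rule AE_mp, intro AE_I2 impI)
    fix \<omega> assume \<omega>: "\<omega> \<in> space M" and "eventually (\<lambda>k. \<omega> \<in> space M - escape a k) sequentially"
    then obtain k0 where k0: "\<And>k. k \<ge> k0 \<Longrightarrow> \<omega> \<notin> escape a k" by (auto simp: eventually_sequentially)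
    have "B t \<omega> - a * t < 0" if t: "2 ^ k0 \<le> t" for t
    proof (rule ccontr)
      assume "\<not> B t \<omega> - a * t < 0"
      moreover have "1 \<le> t" using t by (rule order_trans[OF one_le_power, rotated]) simp
      then obtain k where k: "2 ^ k \<le> t" "t < 2 ^ Suc k" using dyadic_interval by blast
      ultimately have "\<omega> \<in> escape a k" using \<omega> a by (intro escapeI) auto
      moreover have "k0 \<le> k"
      proof -
        have "(2 :: real) ^ k0 < 2 ^ Suc k" using t k by linarith
        then have "k0 < Suc k" by (rule power_less_imp_less_exp[rotated]) simp
        then show ?thesis by simp
      qed
      ultimately show False using k0 by blast
    qed
    then show "\<exists>R>0. \<forall>t\<ge>R. B t \<omega> - a * t < 0" by (intro exI[of _ "2 ^ k0"]) auto
  qed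
qed

text \<open>One integrable bound \<open>G\<close> serves all finite horizons: a maximizer in the
  dyadic block k forces the event \<open>escape a k\<close>, so the supremum of |Z| over blocks with
  escape events dominates. Pointwise, the maximizers are eventually constant in the horizon.\<close>

lemma \<tau>_infinite_limit:
  assumes a: "0 < a" and Z: "sup_bounded Z s K"
    and m: "\<And>t. 0 \<le> t \<Longrightarrow> Z t \<in> borel_measurable M"
    and cont: "\<And>\<omega>. \<omega> \<in> space M \<Longrightarrow> continuous_on {0..} (\<lambda>t. Z t \<omega>)"
  shows "integrable M (\<lambda>\<omega>. Z (\<tau> B \<infinity> a \<omega>) \<omega>)"
    "(\<lambda>N. \<integral>\<omega>. Z (\<tau> B (ereal (real (Suc N))) a \<omega>) \<omega> \<partial>M) \<longlonglongrightarrow> (\<integral>\<omega>. Z (\<tau> B \<infinity> a \<omega>) \<omega> \<partial>M)"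
proof -
  let ?z = "\<lambda>T \<omega>. csup (\<lambda>t. \<bar>Z t \<omega>\<bar>) 0 T"
  have K: "0 \<le> K" "\<And>T. 0 < T \<Longrightarrow> (\<integral>\<^sup>+ \<omega>. ennreal ((?z T \<omega>)\<^sup>2) \<partial>M) \<le> ennreal (K * (1 + T) ^ s)"
    using Z unfolding sup_bounded_def by auto
  have zc: "continuous_on {0..T} (\<lambda>t. \<bar>Z t \<omega>\<bar>)" if "\<omega> \<in> space M" for T \<omega>
    by (intro continuous_on_rabs continuous_on_subset[OF cont[OF that]]) auto
  have zm [measurable]: "?z T \<in> borel_measurable M" if "0 \<le> T" for T
    by (rule csup_measurable) (use m that zc in auto)
  have z0: "0 \<le> ?z T \<omega>" if "0 \<le> T" "\<omega> \<in> space M" for T \<omega>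
    by (rule csup_nonneg) (use that in \<open>auto intro!: continuous_on_subset[OF cont]\<close>)
  \<comment> \<open>The exponent s absorbs the growth of the second moment of the supremum of |Z|;
    adding 4 leaves a summable remainder and satisfies the condition of
    \<open>escape_prob\<close>.\<close>
  obtain D where D: "0 \<le> D" "\<And>k. emeasure M (escape a k) \<le> ennreal (D * (1/2) ^ ((s + 4) * k))"
    using escape_prob[OF a, of "s + 4"] by auto
  let ?E = "\<lambda>k. indicator (escape a k) :: 'w \<Rightarrow> real"
  let ?t = "\<lambda>k \<omega>. ennreal (?z (2 ^ Suc k) \<omega> * ?E k \<omega>)"
  have tm [measurable]: "?t k \<in> borel_measurable M" for k by measurable
  define G where "G \<omega> = ennreal (?z 1 \<omega>) + (\<Sum>k. ?t k \<omega>)" for \<omega>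
  have Gm [measurable]: "G \<in> borel_measurable M" unfolding G_def by measurable
  have tk: "(\<integral>\<^sup>+ \<omega>. ?t k \<omega> \<partial>M) \<le> ennreal ((K * 4 ^ s + D) * (1/2) ^ k)" for k
  proof -
    \<comment> \<open>Weight in x <= \<mu> x^2 + 1 / \<mu>, applied on the escape event. Up to
      constants the first term becomes \<mu> 2^(k s) = 2^-k, and the second, after multiplication
      with the probability, 2^(- 3 k).\<close>
    define \<mu> :: real where "\<mu> = (1/2) ^ ((s + 1) * k)"
    have \<mu>: "\<mu> > 0" by (simp add: \<mu>_def)
    have "(\<integral>\<^sup>+ \<omega>. ?t k \<omega> \<partial>M) \<le> (\<integral>\<^sup>+ \<omega>. ennreal \<mu> * ennreal ((?z (2 ^ Suc k) \<omega>)\<^sup>2) + ennreal (1 / \<mu>) * indicator (escape a k) \<omega> \<partial>M)"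
    proof (rule nn_integral_mono)
      fix \<omega>
      have "x \<le> \<mu> * x\<^sup>2 + 1 / \<mu>" for x :: real
      proof -
        have "\<mu> * x \<le> (\<mu> * x)\<^sup>2 + 1"
          using zero_le_power2[of "\<mu> * x - 1/2"] by (simp add: power2_eq_square algebra_simps)
        then have "(\<mu> * x) / \<mu> \<le> ((\<mu> * x)\<^sup>2 + 1) / \<mu>" using \<mu> by (intro divide_right_mono) auto
        moreover have "(\<mu> * x) / \<mu> = x" "((\<mu> * x)\<^sup>2 + 1) / \<mu> = \<mu> * x\<^sup>2 + 1 / \<mu>"
          using \<mu> by (simp_all add: field_simps power2_eq_square)
        ultimately show ?thesis by simp
      qed
      then have "?z (2 ^ Suc k) \<omega> * ?E k \<omega> \<le> \<mu> * (?z (2 ^ Suc k) \<omega>)\<^sup>2 + (1 / \<mu>) * ?E k \<omega>"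
        using \<mu> by (auto simp: indicator_def)
      then have "?t k \<omega> \<le> ennreal (\<mu> * (?z (2 ^ Suc k) \<omega>)\<^sup>2 + (1 / \<mu>) * ?E k \<omega>)" by (rule ennreal_leI)
      also have "\<dots> = ennreal (\<mu> * (?z (2 ^ Suc k) \<omega>)\<^sup>2) + ennreal ((1 / \<mu>) * ?E k \<omega>)"
        using \<mu> by (intro ennreal_plus) auto
      also have "\<dots> = ennreal \<mu> * ennreal ((?z (2 ^ Suc k) \<omega>)\<^sup>2) + ennreal (1 / \<mu>) * indicator (escape a k) \<omega>"
        using \<mu> by (simp add: ennreal_mult ennreal_indicator indicator_def)
      finally show "?t k \<omega> \<le> ennreal \<mu> * ennreal ((?z (2 ^ Suc k) \<omega>)\<^sup>2) + ennreal (1 / \<mu>) * indicator (escape a k) \<omega>" .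
    qed
    also have "\<dots> = ennreal \<mu> * (\<integral>\<^sup>+ \<omega>. ennreal ((?z (2 ^ Suc k) \<omega>)\<^sup>2) \<partial>M) + ennreal (1 / \<mu>) * emeasure M (escape a k)"
      by (subst nn_integral_add) (auto simp: nn_integral_cmult nn_integral_cmult_indicator)
    also have "\<dots> \<le> ennreal \<mu> * ennreal (K * (1 + 2 ^ Suc k) ^ s) + ennreal (1 / \<mu>) * ennreal (D * (1/2) ^ ((s + 4) * k))"
      by (intro add_mono mult_left_mono K D) auto
    also have "\<dots> = ennreal (\<mu> * (K * (1 + 2 ^ Suc k) ^ s) + (1 / \<mu>) * (D * (1/2) ^ ((s + 4) * k)))"
    proof -
      have "ennreal p * ennreal x + ennreal q * ennreal y = ennreal (p * x + q * y)"
        if "0 \<le> p" "0 \<le> x" "0 \<le> q" "0 \<le> y" for p x q y using that by (simp add: ennreal_mult ennreal_plus)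
      then show ?thesis using \<mu> K(1) D(1) by simp
    qed
    also have "\<dots> \<le> ennreal ((K * 4 ^ s + D) * (1/2) ^ k)"
    proof (rule ennreal_leI)
      have "(1 + 2 ^ Suc k :: real) ^ s \<le> (4 * 2 ^ k) ^ s"
      proof (rule power_mono)
        have "1 \<le> (2 :: real) ^ k" by simp
        then show "1 + 2 ^ Suc k \<le> (4 * 2 ^ k :: real)" unfolding power_Suc by linarith
      qed simp
      then have "\<mu> * (K * (1 + 2 ^ Suc k) ^ s) \<le> \<mu> * (K * (4 * 2 ^ k) ^ s)"
        using \<mu> K by (intro mult_left_mono) auto
      also have "\<dots> = K * 4 ^ s * (\<mu> * (2 ^ k) ^ s)" by (simp add: power_mult_distrib)
      also have "\<mu> * (2 ^ k) ^ s = (1/2) ^ k"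
      proof -
        have "(s + 1) * k = s * k + k" by simp
        then have "\<mu> = (1/2) ^ (s * k) * (1/2) ^ k" by (simp only: \<mu>_def power_add)
        moreover have "(1/2 :: real) ^ (s * k) * (2 ^ k) ^ s = 1"
          by (simp add: power_mult[symmetric] mult.commute[of k s] power_mult_distrib[symmetric])
        ultimately show ?thesis by simp
      qed
      finally have 1: "\<mu> * (K * (1 + 2 ^ Suc k) ^ s) \<le> K * 4 ^ s * (1/2) ^ k" .
      have "(s + 4) * k = (s + 1) * k + 3 * k" by (simp add: algebra_simps)
      then have "(1 / \<mu>) * (D * (1/2) ^ ((s + 4) * k)) = D * (1/2) ^ (3 * k)"
        using \<mu> by (simp only: power_add \<mu>_def[symmetric]) simp
      also have "\<dots> \<le> D * (1/2) ^ k" using D by (intro mult_left_mono power_decreasing) auto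
      finally have 2: "(1 / \<mu>) * (D * (1/2) ^ ((s + 4) * k)) \<le> D * (1/2) ^ k" .
      from add_mono[OF 1 2] show "\<mu> * (K * (1 + 2 ^ Suc k) ^ s) + (1 / \<mu>) * (D * (1/2) ^ ((s + 4) * k)) \<le> (K * 4 ^ s + D) * (1/2) ^ k"
        by (simp only: distrib_right)
    qed
    finally show ?thesis .
  qed
  have G: "(\<integral>\<^sup>+ \<omega>. G \<omega> \<partial>M) < \<infinity>"
  proof -
    have "(\<integral>\<^sup>+ \<omega>. G \<omega> \<partial>M) = (\<integral>\<^sup>+ \<omega>. ennreal (?z 1 \<omega>) \<partial>M) + (\<Sum>k. \<integral>\<^sup>+ \<omega>. ?t k \<omega> \<partial>M)"
      unfolding G_def by (subst nn_integral_add, measurable, subst nn_integral_suminf) auto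
    also have "\<dots> < \<infinity>"
    proof -
      have "integrable M (?z 1)" by (rule sup_bounded_integrable[where Z = Z, OF Z]) (use m cont in auto)
      then have "(\<integral>\<^sup>+ \<omega>. ennreal (?z 1 \<omega>) \<partial>M) < \<infinity>"
        by (subst nn_integral_eq_integral) (auto intro!: AE_I2 z0)
      moreover have "(\<Sum>k. \<integral>\<^sup>+ \<omega>. ?t k \<omega> \<partial>M) < \<infinity>"
      proof -
        have "(\<Sum>k. \<integral>\<^sup>+ \<omega>. ?t k \<omega> \<partial>M) \<le> (\<Sum>k. ennreal ((K * 4 ^ s + D) * (1/2) ^ k))"
          by (intro suminf_le tk) auto
        also have "\<dots> = ennreal (\<Sum>k. (K * 4 ^ s + D) * (1/2) ^ k)"
          using K D by (intro suminf_ennreal2 summable_mult summable_geometric) auto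
        finally show ?thesis by (rule le_less_trans) simp
      qed
      ultimately show ?thesis by simp
    qed
    finally show ?thesis .
  qed
  let ?g = "\<lambda>\<omega>. enn2real (G \<omega>)"
  have AEG: "AE \<omega> in M. G \<omega> < \<infinity>" using nn_integral_PInf_AE[OF Gm] G by (auto simp: less_top)
  have gi: "integrable M ?g"
  proof (rule integrableI_bounded)
    have "(\<integral>\<^sup>+ \<omega>. ennreal (norm (?g \<omega>)) \<partial>M) \<le> (\<integral>\<^sup>+ \<omega>. G \<omega> \<partial>M)"
      by (intro nn_integral_mono) (auto simp: ennreal_enn2real_if)
    then show "(\<integral>\<^sup>+ \<omega>. ennreal (norm (?g \<omega>)) \<partial>M) < \<infinity>" using G by (rule le_less_trans)
  qed measurable
  have dom: "\<bar>Z (\<tau> B (ereal N) a \<omega>) \<omega>\<bar> \<le> ?g \<omega>" if \<omega>: "\<omega> \<in> space M" and fin: "G \<omega> < \<infinity>" and N: "0 < N" for N \<omega>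
  proof -
    define t where "t = \<tau> B (ereal N) a \<omega>"
    have t0: "0 \<le> t" unfolding t_def by (rule \<tau>_nonneg)
    have "ennreal \<bar>Z t \<omega>\<bar> \<le> G \<omega>"
    proof (cases "1 \<le> t")
      case False
      then have "\<bar>Z t \<omega>\<bar> \<le> ?z 1 \<omega>" using csup_ge[OF zc[OF \<omega>], of t 1] t0 by simp
      then have "ennreal \<bar>Z t \<omega>\<bar> \<le> ennreal (?z 1 \<omega>)" by (rule ennreal_leI)
      also have "\<dots> \<le> G \<omega>" unfolding G_def by simp
      finally show ?thesis .
    next
      case True
      then obtain k where k: "2 ^ k \<le> t" "t < 2 ^ Suc k" using dyadic_interval by blast
      \<comment> \<open>Comparison with time 0: at a maximizer the drifted path is not negative,
        which is what the escape event detects.\<close>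
      have "B 0 \<omega> - a * 0 \<le> B t \<omega> - a * t"
        unfolding t_def
        using \<tau>_finite(2)[where B = B and a = a and T = N and \<omega> = \<omega> and s = 0, OF B_drift_continuous[OF \<omega>]] N by simp
      then have "\<omega> \<in> escape a k" using k \<omega> a by (intro escapeI) (auto simp: B_zero)
      moreover have "\<bar>Z t \<omega>\<bar> \<le> ?z (2 ^ Suc k) \<omega>" using csup_ge[OF zc[OF \<omega>], of t "2 ^ Suc k"] t0 k by simp
      ultimately have "ennreal \<bar>Z t \<omega>\<bar> \<le> ?t k \<omega>" by (intro ennreal_leI) simp
      also have "\<dots> \<le> (\<Sum>k. ?t k \<omega>)" using sum_le_suminf[of "\<lambda>k. ?t k \<omega>" "{k}"] by simp
      also have "\<dots> \<le> G \<omega>" unfolding G_def by simp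
      finally show ?thesis .
    qed
    also have "G \<omega> = ennreal (?g \<omega>)" using fin by simp
    finally show ?thesis unfolding t_def by simp
  qed
  have tm: "(\<lambda>\<omega>. Z (\<tau> B (ereal N) a \<omega>) \<omega>) \<in> borel_measurable M" if "0 < N" for N
    by (rule process_at_measurable[where Z = Z and s = "\<tau> B (ereal N) a"])
      (use m cont \<tau>_finite_measurable that \<tau>_nonneg in auto)
  have tmi: "(\<lambda>\<omega>. Z (\<tau> B \<infinity> a \<omega>) \<omega>) \<in> borel_measurable M"
    by (rule process_at_measurable[where Z = Z and s = "\<tau> B \<infinity> a"])
      (use m cont \<tau>_infinite_measurable \<tau>_nonneg in auto)
  have lim: "AE \<omega> in M. (\<lambda>N. Z (\<tau> B (ereal (real (Suc N))) a \<omega>) \<omega>) \<longlonglongrightarrow> Z (\<tau> B \<infinity> a \<omega>) \<omega>"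
    using eventually_negative[OF a] AE_space
  proof eventually_elim
    case (elim \<omega>)
    then obtain R where R: "R > 0" "\<And>t. t \<ge> R \<Longrightarrow> B t \<omega> - a * t < 0" by blast
    obtain n :: nat where n: "R \<le> real n" using real_arch_simple by blast
    have "\<tau> B \<infinity> a \<omega> = \<tau> B (ereal (real (Suc N))) a \<omega>" if "n \<le> N" for N
      by (rule \<tau>_infinite_eq[where R = R]) (use R n that elim B_zero in auto)
    then show ?case by (intro tendsto_eventually) (auto simp: eventually_sequentially intro!: exI[of _ n])
  qed
  have bd: "AE \<omega> in M. norm (Z (\<tau> B (ereal (real (Suc N))) a \<omega>) \<omega>) \<le> ?g \<omega>" for N
    using AEG AE_space by eventually_elim (use dom in auto)
  show "integrable M (\<lambda>\<omega>. Z (\<tau> B \<infinity> a \<omega>) \<omega>)"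
    by (rule integrable_dominated_convergence[where w = ?g and s = "\<lambda>N \<omega>. Z (\<tau> B (ereal (real (Suc N))) a \<omega>) \<omega>"])
      (use tm tmi gi lim bd in auto)
  show "(\<lambda>N. \<integral>\<omega>. Z (\<tau> B (ereal (real (Suc N))) a \<omega>) \<omega> \<partial>M) \<longlonglongrightarrow> (\<integral>\<omega>. Z (\<tau> B \<infinity> a \<omega>) \<omega> \<partial>M)"
    by (rule integral_dominated_convergence[where w = ?g]) (use tm tmi gi lim bd in auto)
qed

end

subsection \<open>Expectations at the maximizer\<close>

lemma continuous_modification_at:
  assumes "continuous_modification M X Y" "0 < H" "H < 1"
  shows "0 \<le> t \<Longrightarrow> Y H t \<in> borel_measurable M" "0 \<le> t \<Longrightarrow> AE \<omega> in M. X H t \<omega> = Y H t \<omega>"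
    "\<omega> \<in> space M \<Longrightarrow> continuous_on {0..} (\<lambda>t. Y H t \<omega>)"
proof -
  show "0 \<le> t \<Longrightarrow> Y H t \<in> borel_measurable M"
    using assms unfolding continuous_modification_def by simp
  show "AE \<omega> in M. X H t \<omega> = Y H t \<omega>" if "0 \<le> t"
  proof -
    have "AE \<omega> in M. Y H t \<omega> = X H t \<omega>" using assms that unfolding continuous_modification_def by simp
    then show ?thesis by eventually_elim simp
  qed
  assume "\<omega> \<in> space M"
  then have "continuous_on ({0<..<1} \<times> {0..}) (\<lambda>(H, t). Y H t \<omega>)"
    using assms unfolding continuous_modification_def by blast
  moreover have "continuous_on {0..} (\<lambda>t :: real. (H, t))" by (intro continuous_intros)
  moreover have "(\<lambda>t. (H, t)) ` {0..} \<subseteq> {0<..<1} \<times> {0..}" using assms by auto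
  ultimately have "continuous_on {0..} (\<lambda>t. (\<lambda>(H, t). Y H t \<omega>) (H, t))" by (rule continuous_on_compose2)
  then show "continuous_on {0..} (\<lambda>t. Y H t \<omega>)" by simp
qed

context two_sided_brownian_motion
begin

context
  fixes Xp Xm :: "real \<Rightarrow> real \<Rightarrow> 'w \<Rightarrow> real" and H :: real
  assumes mp: "continuous_modification M (X_plus M B) Xp" and mm: "continuous_modification M (X_minus M B) Xm"
    and H: "0 < H" "H < 1"
begin

lemmas Xp_at = continuous_modification_at[OF mp H]
lemmas Xm_at = continuous_modification_at[OF mm H]

lemma Xp_wiener: "0 \<le> t \<Longrightarrow> has_wiener_integral M B (Kp H t) (Xp H t)"
  by (rule has_wiener_integral_cong[OF X_plus_wiener[OF H]]) (auto intro: Xp_at)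

lemma Xm_wiener: "0 \<le> t \<Longrightarrow> has_wiener_integral M B (Km H t) (Xm H t)"
  by (rule has_wiener_integral_cong[OF X_minus_wiener[OF H]]) (auto intro: Xm_at)

lemma Xp_sup_bounded: "\<exists>s K. sup_bounded (Xp H) s K"
proof (rule sup_bounded_exists[where Z = "Xp H" and k = "Kp H" and c = "(C H)\<^sup>2" and H = H])
  show "Kp H 0 = (\<lambda>s. 0)" by (auto simp: Kp_def)
qed (use Xp_at Xp_wiener Kp_increment[OF H] H in auto)

lemma Xm_sup_bounded: "\<exists>s K. sup_bounded (Xm H) s K"
proof (rule sup_bounded_exists[where Z = "Xm H" and k = "Km H" and c = "(C H)\<^sup>2" and H = H])
  show "Km H 0 = (\<lambda>s. 0)" by (auto simp: Km_def)
qed (use Xm_at Xm_wiener Km_increment[OF H] H in auto)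

lemma B_sup_integrable: "0 < T \<Longrightarrow> integrable M (\<lambda>\<omega>. csup (\<lambda>t. \<bar>B t \<omega>\<bar>) 0 T)"
proof -
  assume T: "0 < T"
  have c: "continuous_on {0..} (\<lambda>t. B t \<omega>)" if "\<omega> \<in> space M" for \<omega>
    by (rule continuous_on_subset[OF B_continuous[OF that]]) simp
  have "\<exists>s K. sup_bounded B s K"
  proof (rule sup_bounded_exists[where Z = B and k = kB and c = 1 and H = "1/2"])
    show "kB 0 = (\<lambda>s. 0)" by (auto simp: kB_def)
    show "ip (\<lambda>x. kB t x - kB s x) (\<lambda>x. kB t x - kB s x) = 1 * (t - s) powr (2 * (1/2))" if "0 \<le> s" "s \<le> t" for s t
      using kB_increment[OF that] that by simp
  qed (auto intro: B_wiener c)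
  then obtain s K where "sup_bounded B s K" by blast
  then show ?thesis by (rule sup_bounded_integrable[where Z = B]) (use T c in auto)
qed

text \<open>\<open>grid_Kp\<close> compares positive perturbations only, so just an inequality
  results, in contrast to the sum of the two processes.\<close>

lemma expectation_plus_nonneg:
  assumes T: "0 < T"
  shows "0 \<le> (\<integral>\<omega>. Xp H (\<tau> B (ereal T) a \<omega>) \<omega> \<partial>M)"
proof (rule perturbation_nonneg[where Z = "Xp H", OF T])
  obtain s K where "sup_bounded (Xp H) s K" using Xp_sup_bounded by blast
  then show "integrable M (\<lambda>\<omega>. csup (\<lambda>t. \<bar>Xp H t \<omega>\<bar>) 0 T)"
    by (rule sup_bounded_integrable[where Z = "Xp H"]) (use T Xp_at in auto)
  show "integrable M (\<lambda>\<omega>. csup (\<lambda>t. \<bar>B t \<omega>\<bar>) 0 T)" by (rule B_sup_integrable[OF T])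
  show "(\<integral>\<omega>. gridmax (\<lambda>t. B t \<omega> - a * t) 0 T n \<partial>M) \<le> (\<integral>\<omega>. gridmax (\<lambda>t. B t \<omega> - a * t + \<epsilon> * Xp H t \<omega>) 0 T n \<partial>M)"
    if "0 < \<epsilon>" for \<epsilon> n
    using T that by (intro grid_Kp[where Z = "Xp H" and H = H] H Xp_wiener) auto
qed (use Xp_at in auto)

text \<open>Antisymmetry survives multiplication by a constant, so
  \<open>perturbation_nonneg\<close> applies to the sum and to its negative; both expectations being
  nonnegative forces the value 0.\<close>

lemma expectation_sum_finite:
  assumes T: "0 < T"
  shows "(\<integral>\<omega>. Xp H (\<tau> B (ereal T) a \<omega>) \<omega> \<partial>M) + (\<integral>\<omega>. Xm H (\<tau> B (ereal T) a \<omega>) \<omega> \<partial>M) = 0"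
proof -
  obtain s K where p: "sup_bounded (Xp H) s K" using Xp_sup_bounded by blast
  obtain s' K' where m: "sup_bounded (Xm H) s' K'" using Xm_sup_bounded by blast
  let ?p = "\<lambda>\<omega>. csup (\<lambda>t. \<bar>Xp H t \<omega>\<bar>) 0 T" and ?m = "\<lambda>\<omega>. csup (\<lambda>t. \<bar>Xm H t \<omega>\<bar>) 0 T"
  have ip: "integrable M ?p" by (rule sup_bounded_integrable[where Z = "Xp H", OF p T]) (use Xp_at in auto)
  have im: "integrable M ?m" by (rule sup_bounded_integrable[where Z = "Xm H", OF m T]) (use Xm_at in auto)
  have nonneg: "0 \<le> (\<integral>\<omega>. c * (Xp H (\<tau> B (ereal T) a \<omega>) \<omega> + Xm H (\<tau> B (ereal T) a \<omega>) \<omega>) \<partial>M)" for c :: real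
  proof (rule perturbation_nonneg[where Z = "\<lambda>t \<omega>. c * (Xp H t \<omega> + Xm H t \<omega>)", OF T])
    show m: "(\<lambda>\<omega>. c * (Xp H t \<omega> + Xm H t \<omega>)) \<in> borel_measurable M" if "0 \<le> t" for t
      using Xp_at(1)[OF that] Xm_at(1)[OF that] by measurable
    show c: "continuous_on {0..} (\<lambda>t. c * (Xp H t \<omega> + Xm H t \<omega>))" if "\<omega> \<in> space M" for \<omega>
      using that by (intro continuous_intros Xp_at(3) Xm_at(3))
    show "integrable M (\<lambda>\<omega>. csup (\<lambda>t. \<bar>B t \<omega>\<bar>) 0 T)" by (rule B_sup_integrable[OF T])
    show "integrable M (\<lambda>\<omega>. csup (\<lambda>t. \<bar>c * (Xp H t \<omega> + Xm H t \<omega>)\<bar>) 0 T)"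
    proof (rule Bochner_Integration.integrable_bound[where f = "\<lambda>\<omega>. \<bar>c\<bar> * (?p \<omega> + ?m \<omega>)"])
      show "integrable M (\<lambda>\<omega>. \<bar>c\<bar> * (?p \<omega> + ?m \<omega>))" using ip im by simp
      show "(\<lambda>\<omega>. csup (\<lambda>t. \<bar>c * (Xp H t \<omega> + Xm H t \<omega>)\<bar>) 0 T) \<in> borel_measurable M"
        by (rule csup_measurable) (use m T in \<open>auto intro!: continuous_on_rabs continuous_on_subset[OF c]\<close>)
      show "AE \<omega> in M. norm (csup (\<lambda>t. \<bar>c * (Xp H t \<omega> + Xm H t \<omega>)\<bar>) 0 T) \<le> norm (\<bar>c\<bar> * (?p \<omega> + ?m \<omega>))"
      proof (rule AE_I2)
        fix \<omega> assume \<omega>: "\<omega> \<in> space M"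
        have cp: "continuous_on {0..T} (\<lambda>t. \<bar>Xp H t \<omega>\<bar>)" "continuous_on {0..T} (\<lambda>t. \<bar>Xm H t \<omega>\<bar>)"
          by (auto intro!: continuous_on_rabs continuous_on_subset[OF Xp_at(3)[OF \<omega>]] continuous_on_subset[OF Xm_at(3)[OF \<omega>]])
        have cc: "continuous_on {0..T} (\<lambda>t. c * (Xp H t \<omega> + Xm H t \<omega>))"
          by (rule continuous_on_subset[OF c[OF \<omega>]]) auto
        have "csup (\<lambda>t. \<bar>c * (Xp H t \<omega> + Xm H t \<omega>)\<bar>) 0 T \<le> \<bar>c\<bar> * (?p \<omega> + ?m \<omega>)"
        proof (rule csup_le[OF continuous_on_rabs[OF cc]])
          fix t assume t: "t \<in> {0..T}"
          have "\<bar>Xp H t \<omega> + Xm H t \<omega>\<bar> \<le> ?p \<omega> + ?m \<omega>"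
            using csup_ge[OF cp(1) t] csup_ge[OF cp(2) t] by linarith
          then show "\<bar>c * (Xp H t \<omega> + Xm H t \<omega>)\<bar> \<le> \<bar>c\<bar> * (?p \<omega> + ?m \<omega>)"
            unfolding abs_mult by (intro mult_left_mono) auto
        qed (use T in simp)
        moreover have "0 \<le> csup (\<lambda>t. \<bar>c * (Xp H t \<omega> + Xm H t \<omega>)\<bar>) 0 T"
          using T by (intro csup_nonneg cc) simp
        ultimately show "norm (csup (\<lambda>t. \<bar>c * (Xp H t \<omega> + Xm H t \<omega>)\<bar>) 0 T) \<le> norm (\<bar>c\<bar> * (?p \<omega> + ?m \<omega>))" by simp
      qed
    qed
    show "(\<integral>\<omega>. gridmax (\<lambda>t. B t \<omega> - a * t) 0 T n \<partial>M)
        \<le> (\<integral>\<omega>. gridmax (\<lambda>t. B t \<omega> - a * t + \<epsilon> * (c * (Xp H t \<omega> + Xm H t \<omega>))) 0 T n \<partial>M)" for \<epsilon> n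
    proof (rule grid_antisymmetric[where k = "\<lambda>t s. c * Ks H t s" and Z = "\<lambda>t \<omega>. c * (Xp H t \<omega> + Xm H t \<omega>)"])
      show "has_wiener_integral M B (\<lambda>s. c * Ks H t s) (\<lambda>\<omega>. c * (Xp H t \<omega> + Xm H t \<omega>))" if "0 \<le> t" for t
        unfolding Ks_def[abs_def] using that
        by (intro has_wiener_integral_scale has_wiener_integral_add Xp_wiener Xm_wiener)
      show "ip (kB s) (\<lambda>x. c * Ks H t x) + ip (kB t) (\<lambda>x. c * Ks H s x) = 0" if "0 \<le> s" "0 \<le> t" for s t
        using kB_Ks_antisym[OF H that] by (simp add: ip_scale_right flip: distrib_left)
    qed (use T in simp)
  qed
  have "integrable M (\<lambda>\<omega>. Xp H (\<tau> B (ereal T) a \<omega>) \<omega>)" "integrable M (\<lambda>\<omega>. Xm H (\<tau> B (ereal T) a \<omega>) \<omega>)"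
    by (rule \<tau>_finite_integrable[where Z = "Xp H", OF p T] \<tau>_finite_integrable[where Z = "Xm H", OF m T]; use Xp_at Xm_at in blast)+
  then show ?thesis using nonneg[of 1] nonneg[of "-1"] by simp
qed

lemma expectations:
  assumes T: "(0 < T \<and> T < \<infinity>) \<or> (0 < a \<and> T = \<infinity>)"
  shows "integrable M (\<lambda>\<omega>. Xp H (\<tau> B T a \<omega>) \<omega>)" "integrable M (\<lambda>\<omega>. Xm H (\<tau> B T a \<omega>) \<omega>)"
    "integrable M (\<tau> B T a)"
    "(\<integral>\<omega>. Xm H (\<tau> B T a \<omega>) \<omega> \<partial>M) = - (\<integral>\<omega>. Xp H (\<tau> B T a \<omega>) \<omega> \<partial>M)"
    "0 \<le> (\<integral>\<omega>. Xp H (\<tau> B T a \<omega>) \<omega> \<partial>M)"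
proof -
  obtain s K where p: "sup_bounded (Xp H) s K" using Xp_sup_bounded by blast
  obtain s' K' where m: "sup_bounded (Xm H) s' K'" using Xm_sup_bounded by blast
  have "integrable M (\<lambda>\<omega>. Xp H (\<tau> B T a \<omega>) \<omega>) \<and> integrable M (\<lambda>\<omega>. Xm H (\<tau> B T a \<omega>) \<omega>) \<and> integrable M (\<tau> B T a) \<and>
    (\<integral>\<omega>. Xp H (\<tau> B T a \<omega>) \<omega> \<partial>M) + (\<integral>\<omega>. Xm H (\<tau> B T a \<omega>) \<omega> \<partial>M) = 0 \<and> 0 \<le> (\<integral>\<omega>. Xp H (\<tau> B T a \<omega>) \<omega> \<partial>M)"
    using T
  proof (elim disjE conjE)
    assume "0 < T" "T < \<infinity>"
    then obtain T' where T': "T = ereal T'" "0 < T'" by (cases T) auto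
    show ?thesis unfolding T'(1)
    proof (intro conjI)
      show "integrable M (\<lambda>\<omega>. Xp H (\<tau> B (ereal T') a \<omega>) \<omega>)"
        by (rule \<tau>_finite_integrable[where Z = "Xp H", OF p T'(2)]) (use Xp_at in auto)
      show "integrable M (\<lambda>\<omega>. Xm H (\<tau> B (ereal T') a \<omega>) \<omega>)"
        by (rule \<tau>_finite_integrable[where Z = "Xm H", OF m T'(2)]) (use Xm_at in auto)
      show "integrable M (\<tau> B (ereal T') a)"
        by (rule \<tau>_finite_integrable[where Z = "\<lambda>t \<omega>. t", OF sup_bounded_time T'(2)]) auto
    qed (use expectation_sum_finite[OF T'(2)] expectation_plus_nonneg[OF T'(2)] in auto)
  next
    assume a: "0 < a" and "T = \<infinity>"
    have lp: "integrable M (\<lambda>\<omega>. Xp H (\<tau> B \<infinity> a \<omega>) \<omega>)"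
      "(\<lambda>N. \<integral>\<omega>. Xp H (\<tau> B (ereal (real (Suc N))) a \<omega>) \<omega> \<partial>M) \<longlonglongrightarrow> (\<integral>\<omega>. Xp H (\<tau> B \<infinity> a \<omega>) \<omega> \<partial>M)"
      by (rule \<tau>_infinite_limit[where Z = "Xp H", OF a p]; use Xp_at in blast)+
    have lm: "integrable M (\<lambda>\<omega>. Xm H (\<tau> B \<infinity> a \<omega>) \<omega>)"
      "(\<lambda>N. \<integral>\<omega>. Xm H (\<tau> B (ereal (real (Suc N))) a \<omega>) \<omega> \<partial>M) \<longlonglongrightarrow> (\<integral>\<omega>. Xm H (\<tau> B \<infinity> a \<omega>) \<omega> \<partial>M)"
      by (rule \<tau>_infinite_limit[where Z = "Xm H", OF a m]; use Xm_at in blast)+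
    have it: "integrable M (\<tau> B \<infinity> a)"
      by (rule \<tau>_infinite_limit(1)[where Z = "\<lambda>t \<omega>. t", OF a sup_bounded_time]) auto
    have "(\<integral>\<omega>. Xp H (\<tau> B \<infinity> a \<omega>) \<omega> \<partial>M) + (\<integral>\<omega>. Xm H (\<tau> B \<infinity> a \<omega>) \<omega> \<partial>M) = 0"
    proof (rule LIMSEQ_unique)
      show "(\<lambda>N. 0 :: real) \<longlonglongrightarrow> (\<integral>\<omega>. Xp H (\<tau> B \<infinity> a \<omega>) \<omega> \<partial>M) + (\<integral>\<omega>. Xm H (\<tau> B \<infinity> a \<omega>) \<omega> \<partial>M)"
        using tendsto_add[OF lp(2) lm(2)] by (simp only: expectation_sum_finite of_nat_0_less_iff zero_less_Suc)
    qed simp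
    moreover have "0 \<le> (\<integral>\<omega>. Xp H (\<tau> B \<infinity> a \<omega>) \<omega> \<partial>M)"
      by (rule LIMSEQ_le_const[OF lp(2)]) (use expectation_plus_nonneg in auto)
    ultimately show ?thesis unfolding \<open>T = \<infinity>\<close> using lp lm it by blast
  qed
  then show "integrable M (\<lambda>\<omega>. Xp H (\<tau> B T a \<omega>) \<omega>)" "integrable M (\<lambda>\<omega>. Xm H (\<tau> B T a \<omega>) \<omega>)"
    "integrable M (\<tau> B T a)"
    "(\<integral>\<omega>. Xm H (\<tau> B T a \<omega>) \<omega> \<partial>M) = - (\<integral>\<omega>. Xp H (\<tau> B T a \<omega>) \<omega> \<partial>M)"
    "0 \<le> (\<integral>\<omega>. Xp H (\<tau> B T a \<omega>) \<omega> \<partial>M)"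
    by auto
qed

text \<open>Linearity, with E X- replaced by - E X+. If the variance is 0, both quotients are 0 by x
  / 0 = 0, so the formula persists.\<close>

lemma m_eq:
  assumes T: "(0 < T \<and> T < \<infinity>) \<or> (0 < a \<and> T = \<infinity>)"
  shows "m M B Xp Xm c H T a = (fst c - snd c) / sqrt (V M B c H) * \<J> M B Xp H T a - a * \<E> M B T a"
proof -
  note E = expectations[OF T]
  have "m M B Xp Xm c H T a = (\<integral>\<omega>. (fst c * Xp H (\<tau> B T a \<omega>) \<omega> + snd c * Xm H (\<tau> B T a \<omega>) \<omega>) / sqrt (V M B c H) - a * \<tau> B T a \<omega> \<partial>M)"
    by (simp add: m_def fbm_def linear_comb_def)
  also have "\<dots> = (fst c * (\<integral>\<omega>. Xp H (\<tau> B T a \<omega>) \<omega> \<partial>M) + snd c * (\<integral>\<omega>. Xm H (\<tau> B T a \<omega>) \<omega> \<partial>M)) / sqrt (V M B c H)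
      - a * (\<integral>\<omega>. \<tau> B T a \<omega> \<partial>M)"
    using E(1-3) by simp
  also have "\<dots> = (fst c - snd c) / sqrt (V M B c H) * \<J> M B Xp H T a - a * \<E> M B T a"
    unfolding E(4) \<J>_def \<E>_def by (simp add: algebra_simps)
  finally show ?thesis .
qed

end

end

section \<open>Maximizing over the coefficients\<close>

lemma half_angle_sin:
  "2 * (sin (pi * (H + 1/2) / 2))\<^sup>2 = 1 + sin (pi * H)"
proof -
  have "cos (2 * (pi * (H + 1/2) / 2)) = 1 - 2 * (sin (pi * (H + 1/2) / 2))\<^sup>2" by (rule cos_double_sin)
  moreover have "2 * (pi * (H + 1/2) / 2) = pi * H + pi / 2" by (simp add: algebra_simps)
  moreover have "cos (pi * H + pi / 2) = - sin (pi * H)" by (simp add: cos_add)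
  ultimately show ?thesis by simp
qed

theorem proposition4:
  fixes M :: "'w measure" and B :: "real \<Rightarrow> 'w \<Rightarrow> real"
    and Xp Xm :: "real \<Rightarrow> real \<Rightarrow> 'w \<Rightarrow> real"
    and H a :: real and T :: ereal and c :: "real \<times> real"
  assumes "two_sided_brownian_motion M B"
    and "continuous_modification M (X_plus M B) Xp"
    and "continuous_modification M (X_minus M B) Xm"
    and "0 < H" and "H < 1"
    and "c \<noteq> (0, 0)"
    and "(0 < T \<and> T < \<infinity>) \<or> (0 < a \<and> T = \<infinity>)"
  shows "m M B Xp Xm c H T a
           = (fst c - snd c) / sqrt (V M B c H) * \<J> M B Xp H T a - a * \<E> M B T a
       \<and> m_sup M B Xp Xm H T a = ereal (m M B Xp Xm (1, -1) H T a)
       \<and> m M B Xp Xm (1, -1) H T a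
           = \<J> M B Xp H T a / (C H * sin (pi * (H + 1/2) / 2)) - a * \<E> M B T a"
proof -
  interpret two_sided_brownian_motion M B by fact
  note m = m_eq[OF assms(2-5,7)]
  have J: "0 \<le> \<J> M B Xp H T a" unfolding \<J>_def by (rule expectations(5)[OF assms(2-5,7)])
  let ?s = "sin (pi * (H + 1/2) / 2)"
  have C: "0 < C H" using assms(4,5) by (rule C_pos)
  have "0 < pi * (H + 1/2) / 2" "pi * (H + 1/2) / 2 < pi"
  proof -
    have "pi * (H + 1/2) < pi * 2" using assms(5) by (intro mult_strict_left_mono) auto
    then show "pi * (H + 1/2) / 2 < pi" by simp
  qed (use assms(4) in simp)
  then have s: "0 < ?s" by (rule sin_gt_zero)
  have ss: "2 * ?s\<^sup>2 = 1 + sin (pi * H)" by (rule half_angle_sin)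
  have V11: "sqrt (V M B (1, -1) H) = 2 * (C H * ?s)"
  proof -
    have "V M B (1, -1) H = (C H)\<^sup>2 * (2 * (1 + sin (pi * H)))"
      unfolding V_eq[OF assms(4,5)] by simp
    also have "\<dots> = (2 * (C H * ?s))\<^sup>2" unfolding ss[symmetric] by (simp add: power_mult_distrib)
    finally have V: "V M B (1, -1) H = (2 * (C H * ?s))\<^sup>2" .
    show ?thesis unfolding V real_sqrt_abs using C s by simp
  qed
  have m11: "m M B Xp Xm (1, -1) H T a = \<J> M B Xp H T a / (C H * ?s) - a * \<E> M B T a"
    unfolding m V11 by simp
  have le: "(fst c - snd c) / sqrt (V M B c H) \<le> 1 / (C H * ?s)" for c
  proof -
    \<comment> \<open>The decomposition of the variance into squares of the difference and the sum
      of the coefficients. The second square vanishes at c = (1, -1), which therefore attains the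
      bound.\<close>
    have "V M B c H = ((fst c - snd c) * (C H * ?s))\<^sup>2 + (C H)\<^sup>2 * ((fst c + snd c)\<^sup>2 * (1 - sin (pi * H)) / 2)"
    proof -
      have "((fst c - snd c) * (C H * ?s))\<^sup>2 = (C H)\<^sup>2 * ((fst c - snd c)\<^sup>2 * (2 * ?s\<^sup>2) / 2)"
        by (simp add: power_mult_distrib)
      then show ?thesis
        unfolding ss V_eq[OF assms(4,5)] by (simp add: power2_eq_square field_simps)
    qed
    moreover have "0 \<le> (C H)\<^sup>2 * ((fst c + snd c)\<^sup>2 * (1 - sin (pi * H)) / 2)"
      by (intro mult_nonneg_nonneg divide_nonneg_nonneg) auto
    ultimately have "((fst c - snd c) * (C H * ?s))\<^sup>2 \<le> V M B c H" by linarith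
    then have "(fst c - snd c) * (C H * ?s) \<le> sqrt (V M B c H)" by (rule real_le_rsqrt)
    moreover have "0 \<le> sqrt (V M B c H)"
      using order_trans[OF zero_le_power2 \<open>_ \<le> V M B c H\<close>] by simp
    \<comment> \<open>If the variance is 0, the left side is 0 by x / 0 = 0 and the positive right
      side still bounds it.\<close>
    ultimately show ?thesis
      using C s by (cases "sqrt (V M B c H) = 0") (auto simp: field_simps)
  qed
  have "m M B Xp Xm c H T a \<le> m M B Xp Xm (1, -1) H T a" for c
  proof -
    \<comment> \<open>Here the sign of \<open>\<J>\<close> is decisive: the bound on the coefficient
      may be multiplied by it.\<close>
    have "(fst c - snd c) / sqrt (V M B c H) * \<J> M B Xp H T a \<le> 1 / (C H * ?s) * \<J> M B Xp H T a"
      using J by (intro mult_right_mono le)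
    then show ?thesis unfolding m[of c] m11 by simp
  qed
  then have "m_sup M B Xp Xm H T a = ereal (m M B Xp Xm (1, -1) H T a)"
    unfolding m_sup_def by (intro antisym SUP_least SUP_upper2[of "(1, -1)"]) auto
  then show ?thesis using m m11 by blast
qed

end
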